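(* Let $Q^\star_{\mathcal T}\colon H^{-1}(\Omega)\to \mathcal P^0(\mathcal T)$ be a bounded linear projection (i.e. $Q^\star_{\mathcal T}\phi=\phi$ for $\phi\in\mathcal P^0(\mathcal T)$ and $\|Q^\star_{\mathcal T}\phi\|_{-1}\le C_Q\|\phi\|_{-1}$ for all $\phi\in H^{-1}(\Omega)$). Let $f\in H^{-1}(\Omega)$, let $u\in H^1_0(\Omega)$ be the weak solution of $-\Delta u=f$ and $\boldsymbol\sigma=\nabla u$. Then the modified mixed FEM has a unique solution $(u_{\mathcal T},\boldsymbol\sigma_{\mathcal T})\in W_{\mathcal T}\times\Sigma_{\mathcal T}$, and it satisfies $$\|u-u_{\mathcal T}\|+\|\boldsymbol\sigma-\boldsymbol\sigma_{\mathcal T}\|\lesssim \min_{(v,\boldsymbol\tau)\in W_{\mathcal T}\times\Sigma_{\mathcal T}}\big(\|u-v\|+\|\boldsymbol\sigma-\boldsymbol\tau\|\big).$$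
   Context: $\Omega\subset\mathbb R^n$, $n\in\{2,3\}$, is a bounded Lipschitz domain with polytopal boundary. $\mathcal T$ is a conforming shape-regular simplicial mesh of $\Omega$ with shape-regularity constant $\kappa_{\mathcal T}=\max_{T\in\mathcal T}\mathrm{diam}(T)^n/|T|$. $\mathcal P^p(\mathcal T)$ denotes $\mathcal T$-piecewise polynomials of degree $\le p$, $W_{\mathcal T}=\mathcal P^0(\mathcal T)$, $\Sigma_{\mathcal T}=\mathcal{RT}^0(\mathcal T)$ (lowest-order Raviart–Thomas space). $\|\cdot\|$ and $\langle\cdot,\cdot\rangle$ are the $L^2(\Omega)$ norm and inner product, $\|v\|_1=\|\nabla v\|$ on $H^1_0(\Omega)$, $\|\cdot\|_{-1}$ the dual norm on $H^{-1}(\Omega)$. The modified mixed FEM: find $(u_{\mathcal T},\boldsymbol\sigma_{\mathcal T})\in W_{\mathcal T}\times\Sigma_{\mathcal T}$ with $\langle\boldsymbol\sigma_{\mathcal T},\boldsymbol\tau\rangle+\langle u_{\mathcal T},\operatorname{div}\boldsymbol\tau\rangle=0$ and $\langle\operatorname{div}\boldsymbol\sigma_{\mathcal T},v\rangle=\langle -Q^\star_{\mathcal T}f,v\rangle$ for all $(v,\boldsymbol\tau)\in W_{\mathcal T}\times\Sigma_{\mathcal T}$. The notation $A\lesssim B$ means $A\le CB$ with $C$ depending only on $\kappa_{\mathcal T}$, $\Omega$ and $C_Q$. *)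

theory Defs
  imports "HOL-Analysis.Analysis"
begin

coinductive smooth_fun :: "('a::euclidean_space \<Rightarrow> real) \<Rightarrow> bool" where
  "(\<forall>x. f differentiable (at x)) \<Longrightarrow>
   (\<forall>i\<in>Basis. smooth_fun (\<lambda>x. frechet_derivative f (at x) i)) \<Longrightarrow> smooth_fun f"

definition grad :: "('a::euclidean_space \<Rightarrow> real) \<Rightarrow> 'a \<Rightarrow> 'a" where
  "grad \<phi> x = (\<Sum>i\<in>Basis. frechet_derivative \<phi> (at x) i *\<^sub>R i)"

definition test_fun :: "'a::euclidean_space set \<Rightarrow> ('a \<Rightarrow> real) \<Rightarrow> bool" where
  "test_fun \<Omega> \<phi> \<longleftrightarrow> smooth_fun \<phi> \<and> compact (closure {x. \<phi> x \<noteq> 0})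
      \<and> closure {x. \<phi> x \<noteq> 0} \<subseteq> \<Omega>"

definition L2 :: "'a::euclidean_space set \<Rightarrow> ('a \<Rightarrow> real) \<Rightarrow> bool" where
  "L2 \<Omega> v \<longleftrightarrow> set_borel_measurable lebesgue \<Omega> v \<and> set_integrable lebesgue \<Omega> (\<lambda>x. (v x)\<^sup>2)"

definition L2v :: "'a::euclidean_space set \<Rightarrow> ('a \<Rightarrow> 'a) \<Rightarrow> bool" where
  "L2v \<Omega> \<tau> \<longleftrightarrow> set_borel_measurable lebesgue \<Omega> \<tau> \<and> set_integrable lebesgue \<Omega> (\<lambda>x. (norm (\<tau> x))\<^sup>2)"

definition L2inner :: "'a::euclidean_space set \<Rightarrow> ('a \<Rightarrow> real) \<Rightarrow> ('a \<Rightarrow> real) \<Rightarrow> real" where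
  "L2inner \<Omega> v w = (LINT x:\<Omega>|lebesgue. v x * w x)"

definition L2innerv :: "'a::euclidean_space set \<Rightarrow> ('a \<Rightarrow> 'a) \<Rightarrow> ('a \<Rightarrow> 'a) \<Rightarrow> real" where
  "L2innerv \<Omega> \<sigma> \<tau> = (LINT x:\<Omega>|lebesgue. \<sigma> x \<bullet> \<tau> x)"

definition L2norm :: "'a::euclidean_space set \<Rightarrow> ('a \<Rightarrow> real) \<Rightarrow> real" where
  "L2norm \<Omega> v = sqrt (LINT x:\<Omega>|lebesgue. (v x)\<^sup>2)"

definition L2normv :: "'a::euclidean_space set \<Rightarrow> ('a \<Rightarrow> 'a) \<Rightarrow> real" where
  "L2normv \<Omega> \<tau> = sqrt (LINT x:\<Omega>|lebesgue. (norm (\<tau> x))\<^sup>2)"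

definition ae_eq :: "'a::euclidean_space set \<Rightarrow> ('a \<Rightarrow> 'b) \<Rightarrow> ('a \<Rightarrow> 'b) \<Rightarrow> bool" where
  "ae_eq \<Omega> f g \<longleftrightarrow> (AE x in lebesgue. x \<in> \<Omega> \<longrightarrow> f x = g x)"

definition has_weak_grad :: "'a::euclidean_space set \<Rightarrow> ('a \<Rightarrow> real) \<Rightarrow> ('a \<Rightarrow> 'a) \<Rightarrow> bool" where
  "has_weak_grad \<Omega> u g \<longleftrightarrow> L2 \<Omega> u \<and> L2v \<Omega> g \<and>
     (\<forall>\<phi>. test_fun \<Omega> \<phi> \<longrightarrow> (\<forall>i\<in>Basis.
        (LINT x:\<Omega>|lebesgue. u x * frechet_derivative \<phi> (at x) i) = - (LINT x:\<Omega>|lebesgue. (g x \<bullet> i) * \<phi> x)))"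

definition wgrad :: "'a::euclidean_space set \<Rightarrow> ('a \<Rightarrow> real) \<Rightarrow> 'a \<Rightarrow> 'a" where
  "wgrad \<Omega> u = (SOME g. has_weak_grad \<Omega> u g)"

definition H10 :: "'a::euclidean_space set \<Rightarrow> ('a \<Rightarrow> real) set" where
  "H10 \<Omega> = {u. \<exists>g. has_weak_grad \<Omega> u g \<and>
      (\<exists>\<phi>::nat \<Rightarrow> 'a \<Rightarrow> real. (\<forall>k. test_fun \<Omega> (\<phi> k)) \<and>
         (\<lambda>k. L2norm \<Omega> (\<lambda>x. \<phi> k x - u x) + L2normv \<Omega> (\<lambda>x. grad (\<phi> k) x - g x)) \<longlonglongrightarrow> 0)}"

definition H1norm :: "'a::euclidean_space set \<Rightarrow> ('a \<Rightarrow> real) \<Rightarrow> real" where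
  "H1norm \<Omega> v = L2normv \<Omega> (wgrad \<Omega> v)"

definition has_weak_div :: "'a::euclidean_space set \<Rightarrow> ('a \<Rightarrow> 'a) \<Rightarrow> ('a \<Rightarrow> real) \<Rightarrow> bool" where
  "has_weak_div \<Omega> \<tau> d \<longleftrightarrow> L2v \<Omega> \<tau> \<and> L2 \<Omega> d \<and>
     (\<forall>\<phi>. test_fun \<Omega> \<phi> \<longrightarrow>
        (LINT x:\<Omega>|lebesgue. \<tau> x \<bullet> grad \<phi> x) = - (LINT x:\<Omega>|lebesgue. d x * \<phi> x))"

definition wdiv :: "'a::euclidean_space set \<Rightarrow> ('a \<Rightarrow> 'a) \<Rightarrow> 'a \<Rightarrow> real" where
  "wdiv \<Omega> \<tau> = (SOME d. has_weak_div \<Omega> \<tau> d)"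

text \<open>\<open>H^{-1}(\<Omega>)\<close>: bounded linear functionals on \<open>H^1_0(\<Omega>)\<close> (only their values on
  \<open>H^1_0(\<Omega>)\<close> matter).\<close>
definition Hm1 :: "'a::euclidean_space set \<Rightarrow> (('a \<Rightarrow> real) \<Rightarrow> real) set" where
  "Hm1 \<Omega> = {F. (\<forall>v\<in>H10 \<Omega>. \<forall>w\<in>H10 \<Omega>. \<forall>a b. F (\<lambda>x. a * v x + b * w x) = a * F v + b * F w)
              \<and> (\<exists>M. \<forall>v\<in>H10 \<Omega>. \<bar>F v\<bar> \<le> M * H1norm \<Omega> v)}"

definition dual_norm :: "'a::euclidean_space set \<Rightarrow> (('a \<Rightarrow> real) \<Rightarrow> real) \<Rightarrow> real" where
  "dual_norm \<Omega> F = Sup {\<bar>F v\<bar> | v. v \<in> H10 \<Omega> \<and> H1norm \<Omega> v \<le> 1}"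

definition emb :: "'a::euclidean_space set \<Rightarrow> ('a \<Rightarrow> real) \<Rightarrow> ('a \<Rightarrow> real) \<Rightarrow> real" where
  "emb \<Omega> p = (\<lambda>v. LINT x:\<Omega>|lebesgue. p x * v x)"

definition weak_solution :: "'a::euclidean_space set \<Rightarrow> (('a \<Rightarrow> real) \<Rightarrow> real) \<Rightarrow> ('a \<Rightarrow> real) \<Rightarrow> bool" where
  "weak_solution \<Omega> f u \<longleftrightarrow> u \<in> H10 \<Omega> \<and>
     (\<forall>v\<in>H10 \<Omega>. L2innerv \<Omega> (wgrad \<Omega> u) (wgrad \<Omega> v) = f v)"

definition lipschitz_domain :: "'a::euclidean_space set \<Rightarrow> bool" where
  "lipschitz_domain \<Omega> \<longleftrightarrow> open \<Omega> \<and> bounded \<Omega> \<and> connected \<Omega> \<and> \<Omega> \<noteq> {} \<and>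
     (\<forall>x\<in>frontier \<Omega>. \<exists>r>0. \<exists>e h L. norm e = 1 \<and> L-lipschitz_on UNIV h \<and>
        (\<forall>y\<in>ball x r. y \<in> \<Omega> \<longleftrightarrow> y \<bullet> e < h (y - (y \<bullet> e) *\<^sub>R e)))"

definition polytopal :: "'a::euclidean_space set \<Rightarrow> bool" where
  "polytopal \<Omega> \<longleftrightarrow> (\<exists>P. finite P \<and> (\<forall>K\<in>P. polytope K) \<and> closure \<Omega> = \<Union>P)"

definition simplicial_mesh :: "'a::euclidean_space set \<Rightarrow> 'a set set \<Rightarrow> bool" where
  "simplicial_mesh \<Omega> \<T> \<longleftrightarrow> finite \<T> \<and> (\<forall>K\<in>\<T>. int DIM('a) simplex K) \<and> \<Union>\<T> = closure \<Omega> \<and>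
     (\<forall>K\<in>\<T>. \<forall>K'\<in>\<T>. (K \<inter> K') face_of K \<and> (K \<inter> K') face_of K')"

definition shape_const :: "'a::euclidean_space set set \<Rightarrow> real" where
  "shape_const \<T> = Max ((\<lambda>K. diameter K ^ DIM('a) / measure lebesgue K) ` \<T>)"

definition P0 :: "'a::euclidean_space set set \<Rightarrow> ('a \<Rightarrow> real) set" where
  "P0 \<T> = {v. \<forall>K\<in>\<T>. \<exists>c. \<forall>x\<in>interior K. v x = c}"

definition RT0 :: "'a::euclidean_space set \<Rightarrow> 'a set set \<Rightarrow> ('a \<Rightarrow> 'a) set" where
  "RT0 \<Omega> \<T> = {\<tau>. (\<forall>K\<in>\<T>. \<exists>a b. \<forall>x\<in>interior K. \<tau> x = a + b *\<^sub>R x) \<and> (\<exists>d. has_weak_div \<Omega> \<tau> d)}"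

definition bounded_projection ::
  "'a::euclidean_space set \<Rightarrow> 'a set set \<Rightarrow> real \<Rightarrow> ((('a \<Rightarrow> real) \<Rightarrow> real) \<Rightarrow> 'a \<Rightarrow> real) \<Rightarrow> bool" where
  "bounded_projection \<Omega> \<T> CQ Q \<longleftrightarrow>
     (\<forall>F\<in>Hm1 \<Omega>. Q F \<in> P0 \<T>) \<and>
     (\<forall>F\<in>Hm1 \<Omega>. \<forall>G\<in>Hm1 \<Omega>. \<forall>a b. ae_eq \<Omega> (Q (\<lambda>v. a * F v + b * G v)) (\<lambda>x. a * Q F x + b * Q G x)) \<and>
     (\<forall>p\<in>P0 \<T>. ae_eq \<Omega> (Q (emb \<Omega> p)) p) \<and>
     (\<forall>F\<in>Hm1 \<Omega>. dual_norm \<Omega> (emb \<Omega> (Q F)) \<le> CQ * dual_norm \<Omega> F)"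

definition mixed_fem_solution ::
  "'a::euclidean_space set \<Rightarrow> 'a set set \<Rightarrow> ((('a \<Rightarrow> real) \<Rightarrow> real) \<Rightarrow> 'a \<Rightarrow> real) \<Rightarrow> (('a \<Rightarrow> real) \<Rightarrow> real)
     \<Rightarrow> ('a \<Rightarrow> real) \<Rightarrow> ('a \<Rightarrow> 'a) \<Rightarrow> bool" where
  "mixed_fem_solution \<Omega> \<T> Q f uT \<sigma>T \<longleftrightarrow> uT \<in> P0 \<T> \<and> \<sigma>T \<in> RT0 \<Omega> \<T> \<and>
     (\<forall>\<tau>\<in>RT0 \<Omega> \<T>. L2innerv \<Omega> \<sigma>T \<tau> + L2inner \<Omega> uT (wdiv \<Omega> \<tau>) = 0) \<and>
     (\<forall>v\<in>P0 \<T>. L2inner \<Omega> (wdiv \<Omega> \<sigma>T) v = - L2inner \<Omega> (Q f) v)"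

end

theory Submission
  imports Defs "HOL-Analysis.Analysis"
begin

text \<open>The argument rests on an inf-sup bound in the norm of \<open>H\<^sup>-\<^sup>1\<close>: every piecewise constant \<open>p\<close> has a
  Raviart--Thomas lifting \<open>\<rho>\<close> with \<open>div \<rho> = p\<close> and \<open>\<parallel>\<rho>\<parallel> \<lesssim> \<parallel>p\<parallel>\<^sub>-\<^sub>1\<close>. By Marini's identity \<open>\<rho>\<close> is the
  broken gradient of a Crouzeix--Raviart solution plus a cellwise linear term. The former is bounded by
  testing \<open>p\<close> with a conforming companion that preserves all cell means, the latter by testing with
  cell bubbles. For \<open>\<tau>\<close> in the discrete space, let \<open>\<rho>\<close> lift \<open>- Q f - div \<tau>\<close>. The projection property turns
  this function into \<open>- Q (f + div \<tau>)\<close>, whose dual norm is at most \<open>C\<^sub>Q \<parallel>\<sigma> - \<tau>\<parallel>\<close> since \<open>f = - div \<sigma>\<close>.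
  Both \<open>\<sigma>\<close> and the discrete flux \<open>\<sigma>\<^sub>h\<close> are orthogonal to the discrete divergence-free field \<open>\<sigma>\<^sub>h - \<tau> - \<rho>\<close>,
  which bounds \<open>\<parallel>\<sigma> - \<sigma>\<^sub>h\<parallel>\<close>. The potential follows by lifting \<open>v - u\<^sub>h\<close> and Friedrichs' inequality.\<close>

section \<open>Square-integrable functions\<close>

text \<open>A lifting bound by the L2 norm of the divergence is of no use here: \<sigma> has a
  divergence only in the dual space, and \<open>Q\<close> is bounded only there. Nor can a lifting
  of the required size be interpolated from a continuous one, because an L2 norm does not control
  facet fluxes; hence the detour through a discrete Poisson problem. The delicate point is
  uniformity in the mesh. All geometric constants are obtained from \<kappa> by counting volumes
  (\<open>bgrad_bound_aux\<close>, \<open>card_vertex_patch\<close>), and the companion compares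
  values along chains of facet neighbours at one vertex. At a boundary vertex such chains need not
  join all simplices; but a chain component that is not the whole patch reaches a boundary facet
  through the vertex, and there the nodal value 0 is the right one. Surface integrals never occur: a
  facet mean is a volume integral over an adjacent simplex, and the divergence theorem is used only
  for radial fields from a vertex that vanish on the opposite facet.\<close>

definition sqi :: "'x measure \<Rightarrow> ('x \<Rightarrow> 'b::euclidean_space) \<Rightarrow> bool" where
  "sqi M f \<longleftrightarrow> f \<in> borel_measurable M \<and> integrable M (\<lambda>x. (norm (f x))\<^sup>2)"

text \<open>Scalar functions and vector fields share \<open>sqi\<close>, \<open>ip\<close> and
  \<open>nrm\<close>, because the inner product of \<open>real\<close> is multiplication and its
  norm the absolute value.\<close>

definition ip :: "'x measure \<Rightarrow> ('x \<Rightarrow> 'b::euclidean_space) \<Rightarrow> ('x \<Rightarrow> 'b) \<Rightarrow> real" where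
  "ip M f g = (\<integral>x. f x \<bullet> g x \<partial>M)"

definition nrm :: "'x measure \<Rightarrow> ('x \<Rightarrow> 'b::euclidean_space) \<Rightarrow> real" where
  "nrm M f = sqrt (\<integral>x. (norm (f x))\<^sup>2 \<partial>M)"

lemma sqi_measurable [measurable_dest]: "sqi M f \<Longrightarrow> f \<in> borel_measurable M"
  by (simp add: sqi_def)

lemma sqi_integrable_ip:
  assumes "sqi M f" "sqi M g"
  shows "integrable M (\<lambda>x. f x \<bullet> g x)"
proof (rule Bochner_Integration.integrable_bound)
  show "integrable M (\<lambda>x. (norm (f x))\<^sup>2 + (norm (g x))\<^sup>2)"
    using assms by (auto simp: sqi_def)
  show "(\<lambda>x. f x \<bullet> g x) \<in> borel_measurable M"
    using assms by (auto simp: sqi_def)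
  have "\<bar>a \<bullet> b\<bar> \<le> (norm a)\<^sup>2 + (norm b)\<^sup>2" for a b :: 'b
  proof -
    have "\<bar>a \<bullet> b\<bar> \<le> norm a * norm b" by (rule Cauchy_Schwarz_ineq2)
    moreover have "2 * (norm a * norm b) \<le> (norm a)\<^sup>2 + (norm b)\<^sup>2"
      using sum_squares_bound[of "norm a" "norm b"] by simp
    moreover have "0 \<le> norm a * norm b" by simp
    ultimately show ?thesis by linarith
  qed
  then show "AE x in M. norm (f x \<bullet> g x) \<le> norm ((norm (f x))\<^sup>2 + (norm (g x))\<^sup>2)"
    by (auto intro!: always_eventually order_trans[OF _ abs_ge_self])
qed

lemma sqi_scaleR: "sqi M f \<Longrightarrow> sqi M (\<lambda>x. c *\<^sub>R f x)"
  by (auto simp: sqi_def power_mult_distrib)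

lemma sqi_add:
  assumes "sqi M f" "sqi M g"
  shows "sqi M (\<lambda>x. f x + g x)"
proof -
  have "integrable M (\<lambda>x. (norm (f x))\<^sup>2 + 2 * (f x \<bullet> g x) + (norm (g x))\<^sup>2)"
    using assms sqi_integrable_ip[OF assms] by (auto simp: sqi_def)
  moreover have "(norm (f x))\<^sup>2 + 2 * (f x \<bullet> g x) + (norm (g x))\<^sup>2 = (norm (f x + g x))\<^sup>2" for x
    by (simp add: power2_norm_eq_inner inner_add inner_commute)
  ultimately show ?thesis
    using assms by (auto simp: sqi_def)
qed

lemma sqi_diff: "sqi M f \<Longrightarrow> sqi M g \<Longrightarrow> sqi M (\<lambda>x. f x - g x)"
  using sqi_add[of M f "\<lambda>x. (-1) *\<^sub>R g x"] sqi_scaleR[of M g "-1"] by simp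

lemma sqi_zero: "sqi M (\<lambda>x. 0)"
  by (simp add: sqi_def)

lemma sqi_sum: "(\<And>i. i \<in> I \<Longrightarrow> sqi M (f i)) \<Longrightarrow> sqi M (\<lambda>x. \<Sum>i\<in>I. f i x)"
  by (induction I rule: infinite_finite_induct) (auto simp: sqi_zero sqi_add)

lemma ip_commute: "ip M f g = ip M g f"
  by (simp add: ip_def inner_commute)

lemma ip_add_left: "sqi M f \<Longrightarrow> sqi M g \<Longrightarrow> sqi M h \<Longrightarrow> ip M (\<lambda>x. f x + g x) h = ip M f h + ip M g h"
  by (simp add: ip_def inner_add sqi_integrable_ip)

lemma ip_diff_left: "sqi M f \<Longrightarrow> sqi M g \<Longrightarrow> sqi M h \<Longrightarrow> ip M (\<lambda>x. f x - g x) h = ip M f h - ip M g h"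
  by (simp add: ip_def inner_diff sqi_integrable_ip)

lemma ip_scaleR_left: "ip M (\<lambda>x. c *\<^sub>R f x) h = c * ip M f h"
  by (simp add: ip_def)

lemma ip_add_right: "sqi M f \<Longrightarrow> sqi M g \<Longrightarrow> sqi M h \<Longrightarrow> ip M h (\<lambda>x. f x + g x) = ip M h f + ip M h g"
  by (simp add: ip_def inner_add sqi_integrable_ip)

lemma ip_diff_right: "sqi M f \<Longrightarrow> sqi M g \<Longrightarrow> sqi M h \<Longrightarrow> ip M h (\<lambda>x. f x - g x) = ip M h f - ip M h g"
  by (simp add: ip_def inner_diff sqi_integrable_ip)

lemma ip_scaleR_right: "ip M h (\<lambda>x. c *\<^sub>R f x) = c * ip M h f"
  by (simp add: ip_def)

lemma ip_sum_left:
  assumes "\<And>i. i \<in> I \<Longrightarrow> sqi M (f i)" "sqi M h"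
  shows "ip M (\<lambda>x. \<Sum>i\<in>I. f i x) h = (\<Sum>i\<in>I. ip M (f i) h)"
  using assms by (simp add: ip_def inner_sum_left sqi_integrable_ip)

lemma nrm_nonneg [simp]: "0 \<le> nrm M f"
  by (simp add: nrm_def)

lemma nrm_power2: "(nrm M f)\<^sup>2 = ip M f f"
  by (simp add: nrm_def ip_def power2_norm_eq_inner)

lemma nrm_scaleR: "nrm M (\<lambda>x. c *\<^sub>R f x) = \<bar>c\<bar> * nrm M f"
  by (simp add: nrm_def power_mult_distrib real_sqrt_mult)

text \<open>The squared norm of \<open>f + t g\<close> is a polynomial in t without negative values.
  Its minimiser yields the inequality; for \<open>nrm M g = 0\<close> it is affine, so its slope has
  to vanish.\<close>

lemma ip_cauchy_schwarz:
  assumes f: "sqi M f" and g: "sqi M g"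
  shows "\<bar>ip M f g\<bar> \<le> nrm M f * nrm M g"
proof -
  have pos: "0 \<le> (nrm M f)\<^sup>2 + 2 * t * ip M f g + t\<^sup>2 * (nrm M g)\<^sup>2" for t
  proof -
    have "0 \<le> (nrm M (\<lambda>x. f x + t *\<^sub>R g x))\<^sup>2" by simp
    also have "\<dots> = ip M f f + 2 * t * ip M f g + t\<^sup>2 * ip M g g"
      unfolding nrm_power2
      using f g by (simp add: ip_add_left ip_add_right ip_scaleR_left ip_scaleR_right sqi_add sqi_scaleR
          ip_commute[of M g f] algebra_simps power2_eq_square)
    finally show ?thesis by (simp add: nrm_power2)
  qed
  have "(ip M f g)\<^sup>2 \<le> (nrm M f)\<^sup>2 * (nrm M g)\<^sup>2"
  proof (cases "nrm M g = 0")
    case True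
    have "ip M f g = 0"
    proof (rule ccontr)
      assume "ip M f g \<noteq> 0"
      \<comment> \<open>At this t the polynomial has the value -1.\<close>
      then show False
        using pos[of "- ((nrm M f)\<^sup>2 + 1) / (2 * ip M f g)"] True by (simp add: field_simps)
    qed
    then show ?thesis by simp
  next
    case False
    define b where "b = (nrm M g)\<^sup>2"
    have b: "b > 0" using False by (simp add: b_def)
    have "0 \<le> b * ((nrm M f)\<^sup>2 + 2 * (- ip M f g / b) * ip M f g + (- ip M f g / b)\<^sup>2 * b)"
      using pos[of "- ip M f g / b"] b by (simp add: b_def)
    also have "\<dots> = b * (nrm M f)\<^sup>2 - (ip M f g)\<^sup>2"
      using b by (simp add: field_simps power2_eq_square)
    finally show ?thesis by (simp add: b_def mult.commute)
  qed
  then have "(\<bar>ip M f g\<bar>)\<^sup>2 \<le> (nrm M f * nrm M g)\<^sup>2"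
    by (simp add: power_mult_distrib)
  then show ?thesis
    by (rule power2_le_imp_le) simp
qed

lemma nrm_triangle:
  assumes "sqi M f" "sqi M g"
  shows "nrm M (\<lambda>x. f x + g x) \<le> nrm M f + nrm M g"
proof (rule power2_le_imp_le)
  have "(nrm M (\<lambda>x. f x + g x))\<^sup>2 = (nrm M f)\<^sup>2 + 2 * ip M f g + (nrm M g)\<^sup>2"
    using assms by (simp add: nrm_power2 ip_add_left ip_add_right sqi_add ip_commute[of M g f])
  also have "\<dots> \<le> (nrm M f + nrm M g)\<^sup>2"
    using ip_cauchy_schwarz[OF assms] by (simp add: power2_sum)
  finally show "(nrm M (\<lambda>x. f x + g x))\<^sup>2 \<le> (nrm M f + nrm M g)\<^sup>2" .
qed simp

lemma nrm_minus: "nrm M (\<lambda>x. f x - g x) = nrm M (\<lambda>x. g x - f x)"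
  by (simp add: nrm_def norm_minus_commute)

lemma nrm_triangle_diff:
  assumes "sqi M f" "sqi M g" "sqi M h"
  shows "nrm M (\<lambda>x. f x - h x) \<le> nrm M (\<lambda>x. f x - g x) + nrm M (\<lambda>x. g x - h x)"
  using nrm_triangle[of M "\<lambda>x. f x - g x" "\<lambda>x. g x - h x"] assms by (simp add: sqi_diff)

lemma nrm_triangle_sub:
  assumes "sqi M f" "sqi M g"
  shows "nrm M f \<le> nrm M g + nrm M (\<lambda>x. f x - g x)"
  using nrm_triangle[of M g "\<lambda>x. f x - g x"] assms by (simp add: sqi_diff)

lemma nrm_eq_0_AE:
  assumes "sqi M f" "nrm M f = 0"
  shows "AE x in M. f x = 0"
  using assms integral_nonneg_eq_0_iff_AE[of M "\<lambda>x. (norm (f x))\<^sup>2"]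
  by (auto simp: sqi_def nrm_def)

lemma nrm_cong_AE:
  assumes "f \<in> borel_measurable M" "g \<in> borel_measurable M" "AE x in M. f x = g x"
  shows "nrm M f = nrm M g"
proof -
  have "(\<integral>x. (norm (f x))\<^sup>2 \<partial>M) = (\<integral>x. (norm (g x))\<^sup>2 \<partial>M)"
    by (rule integral_cong_AE) (use assms in auto)
  then show ?thesis by (simp add: nrm_def)
qed

lemma ip_cong_AE:
  assumes "f \<in> borel_measurable M" "g \<in> borel_measurable M" "f' \<in> borel_measurable M" "g' \<in> borel_measurable M"
    "AE x in M. f x = f' x" "AE x in M. g x = g' x"
  shows "ip M f g = ip M f' g'"
  unfolding ip_def by (rule integral_cong_AE) (use assms in auto)

text \<open>Lebesgue measure is complete, so preimages that differ by a null set are measurable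
  together. This is what allows weak derivatives to be exchanged for almost everywhere equal
  functions.\<close>

lemma borel_measurable_lebesgue_AE:
  fixes f g :: "'a::euclidean_space \<Rightarrow> 'b::euclidean_space"
  assumes "f \<in> borel_measurable lebesgue" "AE x in lebesgue. f x = g x"
  shows "g \<in> borel_measurable lebesgue"
proof (rule measurableI)
  fix A :: "'b set" assume A: "A \<in> sets borel"
  show "g -` A \<inter> space lebesgue \<in> sets lebesgue"
  proof (rule completion.in_sets_AE)
    show "AE x in lebesgue. x \<in> f -` A \<inter> space lebesgue \<longleftrightarrow> x \<in> g -` A \<inter> space lebesgue"
      using assms(2) by eventually_elim auto
    show "f -` A \<inter> space lebesgue \<in> sets lebesgue"
      using assms(1) A by (rule measurable_sets)
  qed auto
qed auto

lemma measurable_on_AE_eq: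
  fixes f g :: "'a::euclidean_space \<Rightarrow> 'b::euclidean_space"
  assumes "S \<in> sets lebesgue" "f \<in> borel_measurable (lebesgue_on S)" "AE x in lebesgue_on S. f x = g x"
  shows "g \<in> borel_measurable (lebesgue_on S)"
proof -
  have "AE x in lebesgue. (if x \<in> S then f x else 0) = (if x \<in> S then g x else 0)"
    using assms by (auto simp: AE_restrict_space_iff elim!: eventually_mono)
  moreover have "(\<lambda>x. if x \<in> S then f x else 0) \<in> borel_measurable lebesgue"
    using assms by (simp add: borel_measurable_if)
  ultimately have "(\<lambda>x. if x \<in> S then g x else 0) \<in> borel_measurable lebesgue"
    by (rule borel_measurable_lebesgue_AE[rotated])
  then show ?thesis
    using assms by (simp add: borel_measurable_if)
qed

lemma sqi_AE_eq:
  fixes f g :: "'a::euclidean_space \<Rightarrow> 'b::euclidean_space"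
  assumes "S \<in> sets lebesgue" "sqi (lebesgue_on S) f" "AE x in lebesgue_on S. f x = g x"
  shows "sqi (lebesgue_on S) g"
proof -
  have g: "g \<in> borel_measurable (lebesgue_on S)"
    using assms measurable_on_AE_eq by (auto simp: sqi_def)
  have "integrable (lebesgue_on S) (\<lambda>x. (norm (g x))\<^sup>2)"
    by (rule integrable_cong_AE_imp[where g="\<lambda>x. (norm (f x))\<^sup>2"]) (use assms g in \<open>auto simp: sqi_def\<close>)
  with g show ?thesis by (simp add: sqi_def)
qed

section \<open>Set integrals over a measurable set expressed by \<open>lebesgue_on\<close>\<close>

context
  fixes S :: "'a::euclidean_space set"
  assumes S: "S \<in> sets lebesgue"
begin

lemma set_borel_lebesgue_on:
  "set_borel_measurable lebesgue S f \<longleftrightarrow> f \<in> borel_measurable (lebesgue_on S)"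
  for f :: "'a \<Rightarrow> 'b::euclidean_space"
  using S by (simp add: set_borel_measurable_def borel_measurable_restrict_space_iff)

lemma set_integrable_lebesgue_on:
  "set_integrable lebesgue S f \<longleftrightarrow> integrable (lebesgue_on S) f"
  for f :: "'a \<Rightarrow> 'b::euclidean_space"
  using S by (simp add: set_integrable_def integrable_restrict_space)

lemma set_integral_lebesgue_on:
  "(LINT x:S|lebesgue. f x) = integral\<^sup>L (lebesgue_on S) f"
  for f :: "'a \<Rightarrow> 'b::euclidean_space"
  using S by (simp add: set_lebesgue_integral_def integral_restrict_space)

lemma L2_iff: "L2 S v \<longleftrightarrow> sqi (lebesgue_on S) v"
  by (simp add: L2_def sqi_def set_borel_lebesgue_on set_integrable_lebesgue_on)

lemma L2v_iff: "L2v S v \<longleftrightarrow> sqi (lebesgue_on S) v"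
  by (simp add: L2v_def sqi_def set_borel_lebesgue_on set_integrable_lebesgue_on)

lemma L2norm_eq: "L2norm S v = nrm (lebesgue_on S) v"
  by (simp add: L2norm_def nrm_def set_integral_lebesgue_on)

lemma L2normv_eq: "L2normv S v = nrm (lebesgue_on S) v"
  by (simp add: L2normv_def nrm_def set_integral_lebesgue_on)

lemma L2inner_eq: "L2inner S v w = ip (lebesgue_on S) v w"
  by (simp add: L2inner_def ip_def set_integral_lebesgue_on)

lemma L2innerv_eq: "L2innerv S v w = ip (lebesgue_on S) v w"
  by (simp add: L2innerv_def ip_def set_integral_lebesgue_on)

lemma emb_eq: "emb S p v = ip (lebesgue_on S) p v"
  by (simp add: emb_def ip_def set_integral_lebesgue_on)

lemma ae_eq_iff: "ae_eq S f g \<longleftrightarrow> (AE x in lebesgue_on S. f x = g x)"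
  using S by (simp add: ae_eq_def AE_restrict_space_iff)

end

section \<open>Bounded functions and convergence in mean square\<close>

lemma sqi_bounded:
  fixes f :: "'a::euclidean_space \<Rightarrow> 'b::euclidean_space"
  assumes "S \<in> lmeasurable" "f \<in> borel_measurable (lebesgue_on S)" "\<And>x. x \<in> S \<Longrightarrow> norm (f x) \<le> B"
  shows "sqi (lebesgue_on S) f"
proof -
  have "integrable (lebesgue_on S) (\<lambda>x. (norm (f x))\<^sup>2)"
  proof (rule Bochner_Integration.integrable_bound)
    show "integrable (lebesgue_on S) (\<lambda>x. B\<^sup>2)"
      using finite_measure_lebesgue_on[OF assms(1)] by (simp add: finite_measure.integrable_const)
    have "norm (f x) \<le> \<bar>B\<bar>" if "x \<in> S" for x using assms(3)[OF that] by linarith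
    then have "(norm (f x))\<^sup>2 \<le> B\<^sup>2" if "x \<in> S" for x
      using that by (metis abs_norm_cancel abs_le_square_iff)
    then show "AE x in lebesgue_on S. norm ((norm (f x))\<^sup>2) \<le> norm (B\<^sup>2)"
      using fmeasurableD[OF assms(1)] by (auto simp: AE_restrict_space_iff)
  qed (use assms in auto)
  with assms show ?thesis by (simp add: sqi_def)
qed

text \<open>Dominated convergence: the limit inherits the bound \<open>B\<close> almost everywhere,
  so the constant \<open>(2 * B)^2\<close> dominates on a set of finite measure.\<close>

lemma nrm_diff_tendsto_0:
  fixes f :: "'a::euclidean_space \<Rightarrow> 'b::euclidean_space"
  assumes S: "S \<in> lmeasurable" and f: "sqi (lebesgue_on S) f" and fk: "\<And>k::nat. sqi (lebesgue_on S) (\<phi> k)"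
    and bd: "\<And>k x. x \<in> S \<Longrightarrow> norm (\<phi> k x) \<le> B"
    and lim: "AE x in lebesgue_on S. (\<lambda>k. \<phi> k x) \<longlonglongrightarrow> f x"
  shows "(\<lambda>k. nrm (lebesgue_on S) (\<lambda>x. \<phi> k x - f x)) \<longlonglongrightarrow> 0"
proof -
  interpret finite_measure "lebesgue_on S" using finite_measure_lebesgue_on[OF S] .
  have bdf: "AE x in lebesgue_on S. norm (f x) \<le> B"
  proof -
    have "AE x in lebesgue_on S. x \<in> S" by (metis AE_space space_lebesgue_on)
    with lim show ?thesis
    proof eventually_elim
      case (elim x)
      from tendsto_norm[OF elim(1)] show ?case
        by (rule LIMSEQ_le_const2) (use bd elim in auto)
    qed
  qed
  have "(\<lambda>k. \<integral>x. (norm (\<phi> k x - f x))\<^sup>2 \<partial>lebesgue_on S) \<longlonglongrightarrow> (\<integral>x. 0 \<partial>lebesgue_on S)"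
  proof (rule integral_dominated_convergence[where w="\<lambda>x. (2 * B)\<^sup>2"])
    show "AE x in lebesgue_on S. (\<lambda>k. (norm (\<phi> k x - f x))\<^sup>2) \<longlonglongrightarrow> 0"
      using lim
    proof eventually_elim
      case (elim x)
      then have "(\<lambda>k. (norm (\<phi> k x - f x))\<^sup>2) \<longlonglongrightarrow> (norm (f x - f x))\<^sup>2"
        by (intro tendsto_intros)
      then show ?case by simp
    qed
    show "AE x in lebesgue_on S. norm ((norm (\<phi> k x - f x))\<^sup>2) \<le> (2 * B)\<^sup>2" for k
    proof -
      have "AE x in lebesgue_on S. x \<in> S" by (metis AE_space space_lebesgue_on)
      with bdf show ?thesis
      proof eventually_elim
        case (elim x)
        have "norm (\<phi> k x - f x) \<le> 2 * B"
          using norm_triangle_ineq4[of "\<phi> k x" "f x"] bd[OF elim(2), of k] elim(1) by linarith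
        then have "(norm (\<phi> k x - f x))\<^sup>2 \<le> (2 * B)\<^sup>2" by (intro power_mono) auto
        then show ?case by simp
      qed
    qed
  qed (use f fk sqi_diff[OF fk f] in \<open>auto simp: sqi_def\<close>)
  then have "(\<lambda>k. sqrt (\<integral>x. (norm (\<phi> k x - f x))\<^sup>2 \<partial>lebesgue_on S)) \<longlonglongrightarrow> sqrt 0"
    by (intro tendsto_real_sqrt) simp
  then show ?thesis by (simp add: nrm_def)
qed

lemma ip_tendsto:
  assumes "\<And>k::nat. sqi M (\<phi> k)" "sqi M f" "sqi M h" "(\<lambda>k. nrm M (\<lambda>x. \<phi> k x - f x)) \<longlonglongrightarrow> 0"
  shows "(\<lambda>k. ip M (\<phi> k) h) \<longlonglongrightarrow> ip M f h"
proof -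
  have "(\<lambda>k. ip M (\<phi> k) h - ip M f h) \<longlonglongrightarrow> 0"
  proof (rule Lim_null_comparison)
    show "(\<lambda>k. nrm M (\<lambda>x. \<phi> k x - f x) * nrm M h) \<longlonglongrightarrow> 0"
      using tendsto_mult[OF assms(4) tendsto_const[of "nrm M h"]] by simp
    show "\<forall>\<^sub>F k in sequentially. norm (ip M (\<phi> k) h - ip M f h) \<le> nrm M (\<lambda>x. \<phi> k x - f x) * nrm M h"
      using ip_cauchy_schwarz[OF sqi_diff[OF assms(1,2)] assms(3)] assms by (simp add: ip_diff_left)
  qed
  then show ?thesis by (simp add: LIM_zero_iff)
qed

lemma nrm_tendsto:
  assumes "\<And>k::nat. sqi M (\<phi> k)" "sqi M f" "(\<lambda>k. nrm M (\<lambda>x. \<phi> k x - f x)) \<longlonglongrightarrow> 0"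
  shows "(\<lambda>k. nrm M (\<phi> k)) \<longlonglongrightarrow> nrm M f"
proof -
  have "(\<lambda>k. nrm M (\<phi> k) - nrm M f) \<longlonglongrightarrow> 0"
  proof (rule Lim_null_comparison[OF _ assms(3)])
    have "\<bar>nrm M (\<phi> k) - nrm M f\<bar> \<le> nrm M (\<lambda>x. \<phi> k x - f x)" for k
      using nrm_triangle_sub[OF assms(1,2), of k] nrm_triangle_sub[OF assms(2,1), of k]
        nrm_minus[of M f "\<phi> k"] by linarith
    then show "\<forall>\<^sub>F k in sequentially. norm (nrm M (\<phi> k) - nrm M f) \<le> nrm M (\<lambda>x. \<phi> k x - f x)"
      by simp
  qed
  then show ?thesis by (simp add: LIM_zero_iff)
qed

section \<open>Smooth functions and mollification\<close>

lemma smooth_fun_differentiable: "smooth_fun f \<Longrightarrow> f differentiable (at x)"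
  by (erule smooth_fun.cases) auto

lemma smooth_fun_partial: "smooth_fun f \<Longrightarrow> i \<in> Basis \<Longrightarrow> smooth_fun (\<lambda>x. frechet_derivative f (at x) i)"
  by (erule smooth_fun.cases) auto

lemma grad_has_derivative:
  assumes "f differentiable (at x)"
  shows "(f has_derivative (\<lambda>h. grad f x \<bullet> h)) (at x)"
proof -
  have D: "(f has_derivative frechet_derivative f (at x)) (at x)"
    using assms frechet_derivative_works by blast
  then interpret bounded_linear "frechet_derivative f (at x)"
    by (rule has_derivative_bounded_linear)
  have "frechet_derivative f (at x) h = grad f x \<bullet> h" for h
  proof -
    have "frechet_derivative f (at x) h = frechet_derivative f (at x) (\<Sum>i\<in>Basis. (h \<bullet> i) *\<^sub>R i)"
      by (simp add: euclidean_representation)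
    also have "\<dots> = (\<Sum>i\<in>Basis. (h \<bullet> i) * frechet_derivative f (at x) i)"
      by (simp add: sum scaleR)
    also have "\<dots> = grad f x \<bullet> h"
      by (simp add: grad_def inner_sum_left inner_commute[of h] mult.commute)
    finally show ?thesis .
  qed
  then have "frechet_derivative f (at x) = (\<lambda>h. grad f x \<bullet> h)" by auto
  with D show ?thesis by simp
qed

lemma grad_eqI:
  assumes "(f has_derivative (\<lambda>h. g \<bullet> h)) (at x)"
  shows "grad f x = g"
proof -
  have "frechet_derivative f (at x) = (\<lambda>h. g \<bullet> h)"
    using assms frechet_derivative_at by metis
  then show ?thesis
    by (simp add: grad_def euclidean_representation)
qed

lemma grad_inner_Basis: "i \<in> Basis \<Longrightarrow> grad f x \<bullet> i = frechet_derivative f (at x) i"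
  by (simp add: grad_def)

lemma smooth_fun_continuous: "smooth_fun f \<Longrightarrow> continuous_on S f"
  by (meson continuous_at_imp_continuous_on differentiable_imp_continuous_within smooth_fun_differentiable)

lemma smooth_fun_grad_continuous: "smooth_fun f \<Longrightarrow> continuous_on S (grad f)"
  unfolding grad_def[abs_def]
  by (intro continuous_intros smooth_fun_continuous smooth_fun_partial)

lemmas smooth_fun_has_derivative = grad_has_derivative[OF smooth_fun_differentiable]

lemmas smooth_fun_has_frechet_derivative =
  frechet_derivative_works[THEN iffD1, OF smooth_fun_differentiable]

text \<open>The invariant of the coinduction is the set of all sums of two smooth functions, since a
  partial derivative of a sum is again one. Affine substitution and mollification follow the same
  pattern.\<close>

lemma smooth_fun_add:
  assumes "smooth_fun f" "smooth_fun g"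
  shows "smooth_fun (\<lambda>x. f x + g x)"
proof -
  have "\<exists>f g. h = (\<lambda>x. f x + g x) \<and> smooth_fun f \<and> smooth_fun g \<Longrightarrow> smooth_fun h" for h :: "'a \<Rightarrow> real"
  proof (coinduction arbitrary: h rule: smooth_fun.coinduct)
    case (smooth_fun h)
    then obtain f g where h: "h = (\<lambda>x. f x + g x)" and fg: "smooth_fun f" "smooth_fun g" by blast
    have D: "frechet_derivative h (at x) = (\<lambda>k. frechet_derivative f (at x) k + frechet_derivative g (at x) k)" for x
      unfolding h
      by (rule frechet_derivative_at[symmetric])
        (rule has_derivative_add[OF fg[THEN smooth_fun_has_frechet_derivative]])
    have "h differentiable (at x)" for x
      unfolding h by (intro differentiable_add smooth_fun_differentiable fg)
    moreover have "\<exists>f g. (\<lambda>x. frechet_derivative h (at x) i) = (\<lambda>x. f x + g x) \<and> smooth_fun f \<and> smooth_fun g"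
      if "i \<in> Basis" for i
      unfolding D
      by (rule exI[of _ "\<lambda>x. frechet_derivative f (at x) i"], rule exI[of _ "\<lambda>x. frechet_derivative g (at x) i"])
        (simp add: smooth_fun_partial fg that)
    ultimately show ?case by blast
  qed
  with assms show ?thesis by blast
qed

lemma smooth_fun_affine:
  assumes "smooth_fun f"
  shows "smooth_fun (\<lambda>x. a * f (c *\<^sub>R x + t))"
proof -
  have "\<exists>f a. h = (\<lambda>x. a * f (c *\<^sub>R x + t)) \<and> smooth_fun f \<Longrightarrow> smooth_fun h" for h :: "'a \<Rightarrow> real"
  proof (coinduction arbitrary: h rule: smooth_fun.coinduct)
    case (smooth_fun h)
    then obtain f a where h: "h = (\<lambda>x. a * f (c *\<^sub>R x + t))" and f: "smooth_fun f" by blast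
    have H: "(h has_derivative (\<lambda>k. a * (grad f (c *\<^sub>R x + t) \<bullet> (c *\<^sub>R k)))) (at x)" for x
      unfolding h
      by (rule has_derivative_mult_right, rule has_derivative_compose[OF _ smooth_fun_has_derivative[OF f]])
        (auto intro!: derivative_eq_intros)
    have D: "frechet_derivative h (at x) = (\<lambda>k. a * (grad f (c *\<^sub>R x + t) \<bullet> (c *\<^sub>R k)))" for x
      by (rule frechet_derivative_at[OF H, symmetric])
    have "\<exists>f a. (\<lambda>x. frechet_derivative h (at x) i) = (\<lambda>x. a * f (c *\<^sub>R x + t)) \<and> smooth_fun f"
      if "i \<in> Basis" for i
      by (rule exI[of _ "\<lambda>x. frechet_derivative f (at x) i"], rule exI[of _ "a * c"])
        (simp add: D grad_inner_Basis mult.assoc smooth_fun_partial f that)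
    moreover have "h differentiable (at x)" for x
      using H differentiable_def by blast
    ultimately show ?case by blast
  qed
  with assms show ?thesis by blast
qed

lemma smooth_fun_cmult: "smooth_fun f \<Longrightarrow> smooth_fun (\<lambda>x. a * f x)"
  using smooth_fun_affine[of f a 1 0] by simp

lemma smooth_fun_zero: "smooth_fun (\<lambda>x. 0)"
proof -
  have "h = (\<lambda>x. 0) \<Longrightarrow> smooth_fun h" for h :: "'a \<Rightarrow> real"
    by (coinduction rule: smooth_fun.coinduct) auto
  then show ?thesis by blast
qed

section \<open>A smooth bump function with compact support\<close>

definition flat_exp :: "nat \<Rightarrow> real \<Rightarrow> real" where
  "flat_exp k t = (if t \<le> 0 then 0 else exp (- 1 / t) / t ^ k)"

text \<open>The exponential series of \<open>1 / t\<close> dominates its term of index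
  \<open>k + 2\<close>; the two surplus powers of t make the difference quotient at 0 tend to
  0.\<close>

lemma flat_exp_bound: "\<bar>flat_exp k t\<bar> \<le> fact (k + 2) * t\<^sup>2"
proof (cases "t \<le> 0")
  case False
  then have t: "t > 0" by simp
  have "(1 / t) ^ (k + 2) /\<^sub>R fact (k + 2) \<le> (\<Sum>n. (1 / t) ^ n /\<^sub>R fact n)"
    using sum_le_suminf[of "\<lambda>n. (1 / t) ^ n /\<^sub>R fact n" "{k + 2}"] exp_converges[of "1 / t"] t
    by (auto simp: sums_iff)
  also have "\<dots> = exp (1 / t)"
    using exp_converges[of "1 / t"] by (simp add: sums_iff)
  finally have le: "(1 / t) ^ (k + 2) /\<^sub>R fact (k + 2) \<le> exp (1 / t)" .
  define A where "A = (fact (k + 2) :: real)"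
  have A: "A > 0" by (simp add: A_def)
  have "(1 / t) ^ (k + 2) / A \<le> exp (1 / t)"
    using le unfolding A_def[symmetric] by (simp add: divide_inverse mult.commute)
  then have "1 \<le> exp (1 / t) * (A * (t ^ k * t\<^sup>2))"
    using t A by (simp add: field_simps power_add power2_eq_square)
  then have "exp (- 1 / t) \<le> A * (t ^ k * t\<^sup>2)"
    using t by (simp add: exp_minus field_simps)
  then have "exp (- 1 / t) / t ^ k \<le> A * t\<^sup>2"
    using t by (simp add: field_simps)
  then show ?thesis
    using t by (simp add: flat_exp_def A_def)
qed (simp add: flat_exp_def)

text \<open>Differentiation only shifts the exponent \<open>k\<close>, so the family is closed under
  derivatives up to linear combinations; this is why \<open>k\<close> is a parameter.\<close>

lemma flat_exp_has_derivative:
  "(flat_exp k has_real_derivative (flat_exp (k + 2) t - real k * flat_exp (k + 1) t)) (at t)"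
proof -
  consider "t < 0" | "t = 0" | "t > 0" by linarith
  then show ?thesis
  proof cases
    case 1
    have "(flat_exp k has_real_derivative 0) (at t)"
    proof (rule has_field_derivative_transform_within_open[where S="{..<0}" and f="\<lambda>t. 0"])
    qed (use 1 in \<open>auto simp: flat_exp_def\<close>)
    then show ?thesis using 1 by (simp add: flat_exp_def)
  next
    case 2
    have "((\<lambda>h. flat_exp k h / h) \<longlongrightarrow> 0) (at 0)"
    proof (rule Lim_null_comparison)
      have "norm (flat_exp k h / h) \<le> fact (k + 2) * \<bar>h\<bar>" for h :: real
        using flat_exp_bound[of k h] by (cases "h = 0") (auto simp: divide_simps power2_eq_square abs_mult)
      then show "\<forall>\<^sub>F h in at 0. norm (flat_exp k h / h) \<le> fact (k + 2) * \<bar>h\<bar>" by simp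
      show "((\<lambda>h::real. fact (k + 2) * \<bar>h\<bar>) \<longlongrightarrow> 0) (at 0)"
        by (auto intro!: tendsto_eq_intros)
    qed
    then show ?thesis using 2 by (simp add: DERIV_def flat_exp_def)
  next
    case 3
    define u where "u = inverse t"
    have "((\<lambda>t. exp (- inverse t) * inverse t ^ k) has_real_derivative
        exp (- u) * u ^ 2 * u ^ k + exp (- u) * (real k * u ^ (k - 1) * (- (u ^ 2)))) (at t)"
      using 3 unfolding u_def
      by (auto intro!: derivative_eq_intros simp: power2_eq_square)
    moreover have "exp (- u) * u ^ 2 * u ^ k + exp (- u) * (real k * u ^ (k - 1) * (- (u ^ 2))) =
        exp (- u) * u ^ (k + 2) - real k * (exp (- u) * u ^ (k + 1))"
      by (cases k) (simp_all add: power2_eq_square)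
    ultimately have "((\<lambda>t. exp (- 1 / t) / t ^ k) has_real_derivative (flat_exp (k + 2) t - real k * flat_exp (k + 1) t)) (at t)"
      using 3 by (simp add: flat_exp_def u_def divide_inverse power_inverse)
    then show ?thesis
      by (rule has_field_derivative_transform_within_open[where S="{0<..}"]) (use 3 in \<open>auto simp: flat_exp_def\<close>)
  qed
qed

text \<open>The module over the polynomials generated by the bumps
  \<open>flat_exp k (1 - x \<bullet> x)\<close>. It is closed under partial derivatives and thus an
  invariant for the coinductive \<open>smooth_fun\<close>.\<close>

inductive bump_alg :: "('a::euclidean_space \<Rightarrow> real) \<Rightarrow> bool" where
  bump: "bump_alg (\<lambda>x. flat_exp k (1 - x \<bullet> x))"
| coord: "bump_alg g \<Longrightarrow> bump_alg (\<lambda>x. (x \<bullet> j) * g x)"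
| cmult: "bump_alg g \<Longrightarrow> bump_alg (\<lambda>x. c * g x)"
| add: "bump_alg g \<Longrightarrow> bump_alg h \<Longrightarrow> bump_alg (\<lambda>x. g x + h x)"

lemma bump_alg_derivative:
  "bump_alg g \<Longrightarrow> (\<forall>x. g differentiable (at x)) \<and> (\<forall>i. bump_alg (\<lambda>x. frechet_derivative g (at x) i))"
proof (induction rule: bump_alg.induct)
  case (bump k)
  have H: "((\<lambda>x::'a. flat_exp k (1 - x \<bullet> x)) has_derivative
      (\<lambda>h. (flat_exp (k + 2) (1 - x \<bullet> x) - real k * flat_exp (k + 1) (1 - x \<bullet> x)) * (- 2 * (x \<bullet> h)))) (at x)" for x
  proof -
    have "((\<lambda>x::'a. 1 - x \<bullet> x) has_derivative (\<lambda>h. - 2 * (x \<bullet> h))) (at x)"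
      by (auto intro!: derivative_eq_intros simp: inner_commute)
    from has_derivative_compose[OF this flat_exp_has_derivative[unfolded has_field_derivative_def]]
    show ?thesis by simp
  qed
  have D: "frechet_derivative (\<lambda>x::'a. flat_exp k (1 - x \<bullet> x)) (at x) =
      (\<lambda>h. (flat_exp (k + 2) (1 - x \<bullet> x) - real k * flat_exp (k + 1) (1 - x \<bullet> x)) * (- 2 * (x \<bullet> h)))" for x
    by (rule frechet_derivative_at[OF H, symmetric])
  have "bump_alg (\<lambda>x::'a. -2 * ((x \<bullet> i) * (flat_exp (k + 2) (1 - x \<bullet> x) + (- real k) * flat_exp (k + 1) (1 - x \<bullet> x))))" for i
    by (intro bump_alg.intros)
  moreover have "(\<lambda>x::'a. -2 * ((x \<bullet> i) * (flat_exp (k + 2) (1 - x \<bullet> x) + (- real k) * flat_exp (k + 1) (1 - x \<bullet> x))))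
     = (\<lambda>x. frechet_derivative (\<lambda>x. flat_exp k (1 - x \<bullet> x)) (at x) i)" for i
    by (simp add: D algebra_simps fun_eq_iff)
  ultimately have "bump_alg (\<lambda>x. frechet_derivative (\<lambda>x::'a. flat_exp k (1 - x \<bullet> x)) (at x) i)" for i
    by metis
  then show ?case using H differentiable_def by blast
next
  case (coord g j)
  then have d: "g differentiable at x" for x by blast
  have H: "((\<lambda>x. (x \<bullet> j) * g x) has_derivative (\<lambda>h. (x \<bullet> j) * frechet_derivative g (at x) h + (h \<bullet> j) * g x)) (at x)" for x
    by (rule has_derivative_eq_rhs, rule has_derivative_mult[OF _ frechet_derivative_works[THEN iffD1, OF d]])
      (auto intro!: derivative_eq_intros)
  have D: "frechet_derivative (\<lambda>x. (x \<bullet> j) * g x) (at x) = (\<lambda>h. (x \<bullet> j) * frechet_derivative g (at x) h + (h \<bullet> j) * g x)" for x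
    by (rule frechet_derivative_at[OF H, symmetric])
  have "bump_alg (\<lambda>x. frechet_derivative (\<lambda>x. (x \<bullet> j) * g x) (at x) i)" for i
    unfolding D using coord by (intro bump_alg.intros) auto
  then show ?case using H differentiable_def by blast
next
  case (cmult g c)
  then have d: "g differentiable at x" for x by blast
  have H: "((\<lambda>x. c * g x) has_derivative (\<lambda>h. c * frechet_derivative g (at x) h)) (at x)" for x
    by (rule has_derivative_mult_right[OF frechet_derivative_works[THEN iffD1, OF d]])
  have D: "frechet_derivative (\<lambda>x. c * g x) (at x) = (\<lambda>h. c * frechet_derivative g (at x) h)" for x
    by (rule frechet_derivative_at[OF H, symmetric])
  have "bump_alg (\<lambda>x. frechet_derivative (\<lambda>x. c * g x) (at x) i)" for i
    unfolding D using cmult by (intro bump_alg.intros) auto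
  then show ?case using H differentiable_def by blast
next
  case (add g h)
  then have d: "g differentiable at x" "h differentiable at x" for x by blast+
  have H: "((\<lambda>x. g x + h x) has_derivative (\<lambda>k. frechet_derivative g (at x) k + frechet_derivative h (at x) k)) (at x)" for x
    by (rule has_derivative_add[OF d[THEN frechet_derivative_works[THEN iffD1]]])
  have D: "frechet_derivative (\<lambda>x. g x + h x) (at x) = (\<lambda>k. frechet_derivative g (at x) k + frechet_derivative h (at x) k)" for x
    by (rule frechet_derivative_at[OF H, symmetric])
  have "bump_alg (\<lambda>x. frechet_derivative (\<lambda>x. g x + h x) (at x) i)" for i
    unfolding D using add by (intro bump_alg.intros) auto
  then show ?case using H differentiable_def by blast
qed

lemma bump_alg_smooth: "bump_alg g \<Longrightarrow> smooth_fun g"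
  by (coinduction arbitrary: g rule: smooth_fun.coinduct) (use bump_alg_derivative in blast)

lemma bump_exists:
  obtains \<psi> :: "'a::euclidean_space \<Rightarrow> real" where "smooth_fun \<psi>" "\<And>x. 0 \<le> \<psi> x"
    "\<And>x. norm x < 1 \<Longrightarrow> 0 < \<psi> x" "\<And>x. 1 \<le> norm x \<Longrightarrow> \<psi> x = 0"
proof
  let ?\<psi> = "\<lambda>x::'a. flat_exp 0 (1 - x \<bullet> x)"
  show "smooth_fun ?\<psi>" by (intro bump_alg_smooth bump_alg.bump)
  show "0 \<le> ?\<psi> x" for x by (simp add: flat_exp_def)
  show "0 < ?\<psi> x" if "norm x < 1" for x
    using that abs_square_less_1[of "norm x"] by (simp add: flat_exp_def power2_norm_eq_inner[symmetric] not_le)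
  show "?\<psi> x = 0" if "1 \<le> norm x" for x
    using that by (simp add: flat_exp_def power2_norm_eq_inner[symmetric])
qed

section \<open>Mollification and smooth approximation of Lipschitz functions\<close>

lemma integrable_continuous_compact_support:
  fixes f :: "'a::euclidean_space \<Rightarrow> 'b::{banach, second_countable_topology}"
  assumes "continuous_on UNIV f" "compact C" "\<And>x. x \<notin> C \<Longrightarrow> f x = 0"
  shows "integrable lborel f"
proof -
  have "integrable lborel (\<lambda>x. indicator C x *\<^sub>R f x)"
    by (rule borel_integrable_compact[OF assms(2) continuous_on_subset[OF assms(1)]]) auto
  moreover have "(\<lambda>x. indicator C x *\<^sub>R f x) = f"
    using assms(3) by (auto simp: indicator_def)
  ultimately show ?thesis by simp
qed

lemma mollifier_exists:
  assumes "\<epsilon> > 0"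
  obtains \<eta> :: "'a::euclidean_space \<Rightarrow> real" where "smooth_fun \<eta>" "\<And>x. 0 \<le> \<eta> x"
    "\<And>x. \<epsilon> \<le> norm x \<Longrightarrow> \<eta> x = 0" "integrable lborel \<eta>" "(\<integral>x. \<eta> x \<partial>lborel) = 1"
proof -
  obtain \<psi> :: "'a \<Rightarrow> real" where \<psi>: "smooth_fun \<psi>" "\<And>x. 0 \<le> \<psi> x"
    "\<And>x. norm x < 1 \<Longrightarrow> 0 < \<psi> x" "\<And>x. 1 \<le> norm x \<Longrightarrow> \<psi> x = 0"
    using bump_exists by blast
  define \<theta> where "\<theta> = (\<lambda>x. \<psi> ((1 / \<epsilon>) *\<^sub>R x))"
  have sm: "smooth_fun \<theta>"
    using smooth_fun_affine[OF \<psi>(1), of 1 "1 / \<epsilon>" 0] by (simp add: \<theta>_def)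
  have z: "\<theta> x = 0" if "\<epsilon> \<le> norm x" for x
    using that assms \<psi>(4) by (simp add: \<theta>_def)
  have pos: "0 < \<theta> x" if "norm x < \<epsilon>" for x
    using that assms \<psi>(3) by (simp add: \<theta>_def)
  have int: "integrable lborel \<theta>"
    by (rule integrable_continuous_compact_support[where C="cball 0 \<epsilon>"])
      (use z in \<open>auto intro: smooth_fun_continuous[OF sm]\<close>)
  have "(\<integral>x. \<theta> x \<partial>lborel) \<noteq> 0"
  proof
    assume "(\<integral>x. \<theta> x \<partial>lborel) = 0"
    then have "AE x in lborel. \<theta> x = 0"
      using integral_nonneg_eq_0_iff_AE[OF int] \<psi>(2) by (simp add: \<theta>_def)
    then have "AE x in lborel. x \<notin> ball (0::'a) \<epsilon>"
    proof eventually_elim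
      case (elim x)
      then show ?case using pos[of x] by auto
    qed
    then have "emeasure lborel (ball (0::'a) \<epsilon>) = 0"
      by (subst (asm) AE_iff_measurable[where N="ball 0 \<epsilon>"]) auto
    then show False
      using assms unit_ball_vol_pos[of "real DIM('a)"] zero_less_power[OF assms, of "DIM('a)"]
      by (auto simp: emeasure_ball ennreal_eq_0_iff mult_le_0_iff not_le[symmetric])
  qed
  moreover have "(\<integral>x. \<theta> x \<partial>lborel) \<ge> 0"
    by (rule Bochner_Integration.integral_nonneg) (simp add: \<theta>_def \<psi>)
  ultimately have c: "(\<integral>x. \<theta> x \<partial>lborel) > 0" by simp
  define d where "d = 1 / (\<integral>x. \<theta> x \<partial>lborel)"
  have "d > 0" "d * (\<integral>x. \<theta> x \<partial>lborel) = 1" using c by (simp_all add: d_def)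
  then show ?thesis
    using that[of "\<lambda>x. d * \<theta> x"] smooth_fun_cmult[OF sm, of d] z int \<psi>(2) by (simp add: \<theta>_def)
qed

lemma lborel_integral_reflect:
  fixes f :: "'a::euclidean_space \<Rightarrow> real"
  assumes [measurable]: "f \<in> borel_measurable borel"
  shows "(\<integral>y. f y \<partial>lborel) = (\<integral>s. f (x - s) \<partial>lborel)"
proof -
  have "(\<integral>y. f y \<partial>lborel) = (\<integral>y. f y \<partial>density (distr lborel borel (\<lambda>s. x + (-1) *\<^sub>R s)) (\<lambda>_. 1))"
    using lborel_affine[of "-1" x] by simp
  also have "\<dots> = (\<integral>s. f (x - s) \<partial>lborel)"
    by (simp only: density_1) (simp add: integral_distr)
  finally show ?thesis .
qed

text \<open>Differentiation under the integral over a box. The derivative falls on the kernel, so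
  continuity of \<open>w\<close> is enough.\<close>

lemma mollify_has_derivative:
  assumes w: "continuous_on UNIV w" and \<eta>: "smooth_fun \<eta>"
  shows "((\<lambda>x. integral (cbox a b) (\<lambda>y. w y * \<eta> (x - y))) has_derivative
     (\<lambda>h. integral (cbox a b) (\<lambda>y. w y * (grad \<eta> (x - y) \<bullet> h)))) (at x)"
proof -
  define F where "F x y = blinfun_inner_left (w y *\<^sub>R grad \<eta> (x - y))" for x y :: 'a
  have cg: "continuous_on S (\<lambda>z. grad \<eta> (f z))" if "continuous_on S f" for f :: "'c::topological_space \<Rightarrow> 'a" and S
    by (rule continuous_on_compose2[OF smooth_fun_grad_continuous[OF \<eta>, of UNIV] that]) auto
  have ce: "continuous_on S (\<lambda>z. \<eta> (f z))" if "continuous_on S f" for f :: "'c::topological_space \<Rightarrow> 'a" and S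
    by (rule continuous_on_compose2[OF smooth_fun_continuous[OF \<eta>, of UNIV] that]) auto
  have cw: "continuous_on S (\<lambda>z. w (f z))" if "continuous_on S f" for f :: "'c::topological_space \<Rightarrow> 'a" and S
    by (rule continuous_on_compose2[OF w that]) auto
  have "((\<lambda>x. integral (cbox a b) (\<lambda>y. w y * \<eta> (x - y))) has_derivative integral (cbox a b) (F x)) (at x within UNIV)"
  proof (rule leibniz_rule)
    show "((\<lambda>x. w y * \<eta> (x - y)) has_derivative blinfun_apply (F x y)) (at x within UNIV)" for x y
    proof -
      have "((\<lambda>x. w y * \<eta> (x - y)) has_derivative (\<lambda>h. w y * (grad \<eta> (x - y) \<bullet> h))) (at x)"
        by (rule has_derivative_mult_right, rule has_derivative_compose[OF _ smooth_fun_has_derivative[OF \<eta>]])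
          (auto intro!: derivative_eq_intros)
      then show ?thesis by (simp add: F_def inner_commute)
    qed
    show "(\<lambda>y. w y * \<eta> (x - y)) integrable_on cbox a b" for x
      by (intro integrable_continuous continuous_intros ce cw)
    show "continuous_on (UNIV \<times> cbox a b) (\<lambda>(x, t). F x t)"
      unfolding F_def split_beta
      by (intro continuous_intros cg cw)
  qed auto
  moreover have "blinfun_apply (integral (cbox a b) (F x)) h = integral (cbox a b) (\<lambda>y. w y * (grad \<eta> (x - y) \<bullet> h))" for h
  proof -
    have "F x integrable_on cbox a b"
      unfolding F_def by (intro integrable_continuous continuous_intros cg cw)
    from integral_linear[OF this blinfun.bounded_linear_left[of h]]
    show ?thesis by (simp add: o_def F_def inner_commute)
  qed
  then have "blinfun_apply (integral (cbox a b) (F x)) = (\<lambda>h. integral (cbox a b) (\<lambda>y. w y * (grad \<eta> (x - y) \<bullet> h)))"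
    by blast
  ultimately show ?thesis by simp
qed

lemma smooth_fun_mollify:
  assumes w: "continuous_on UNIV w" and "smooth_fun \<eta>"
  shows "smooth_fun (\<lambda>x. integral (cbox a b) (\<lambda>y. w y * \<eta> (x - y)))"
proof -
  have "\<exists>\<eta>. h = (\<lambda>x. integral (cbox a b) (\<lambda>y. w y * \<eta> (x - y))) \<and> smooth_fun \<eta> \<Longrightarrow> smooth_fun h"
    for h :: "'a \<Rightarrow> real"
  proof (coinduction arbitrary: h rule: smooth_fun.coinduct)
    case (smooth_fun h)
    then obtain \<eta> where h: "h = (\<lambda>x. integral (cbox a b) (\<lambda>y. w y * \<eta> (x - y)))" and \<eta>: "smooth_fun \<eta>" by blast
    note H = mollify_has_derivative[OF w \<eta>, of a b, folded h]
    have D: "frechet_derivative h (at x) = (\<lambda>k. integral (cbox a b) (\<lambda>y. w y * (grad \<eta> (x - y) \<bullet> k)))" for x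
      using frechet_derivative_at[OF H] by simp
    have "\<exists>\<eta>. (\<lambda>x. frechet_derivative h (at x) i) = (\<lambda>x. integral (cbox a b) (\<lambda>y. w y * \<eta> (x - y))) \<and> smooth_fun \<eta>"
      if "i \<in> Basis" for i
      unfolding D
      by (rule exI[of _ "\<lambda>x. frechet_derivative \<eta> (at x) i"])
        (use that \<eta> in \<open>auto simp: grad_inner_Basis intro: smooth_fun_partial\<close>)
    moreover have "h differentiable (at x)" for x
      using H differentiable_def by blast
    ultimately show ?case by blast
  qed
  with assms show ?thesis by blast
qed

text \<open>Of the kernel only this is exported: averaging reproduces a constant \<open>c\<close> up
  to the tolerance \<delta> with which \<open>u\<close> matches it on the \<epsilon>-ball. Used with
  various \<open>u\<close>, and also with \<delta> = 0, this gives error bound, Lipschitz bound,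
  support and exactness on affine pieces in \<open>smooth_approximation\<close>.\<close>

lemma mollify_exists:
  fixes w :: "'a::euclidean_space \<Rightarrow> real"
  assumes w: "continuous_on UNIV w" and C: "bounded C" "\<And>x. x \<notin> C \<Longrightarrow> w x = 0" and "\<epsilon> > 0"
  obtains \<phi> \<eta> where "smooth_fun \<phi>" "\<forall>x. \<phi> x = (\<integral>s. w (x - s) * \<eta> s \<partial>lborel)"
    "\<forall>u c \<delta>. continuous_on UNIV u \<longrightarrow> (\<forall>s. norm s < \<epsilon> \<longrightarrow> \<bar>u s - c\<bar> \<le> \<delta>) \<longrightarrow> \<bar>(\<integral>s. u s * \<eta> s \<partial>lborel) - c\<bar> \<le> \<delta>"
    "\<forall>u. continuous_on UNIV u \<longrightarrow> integrable lborel (\<lambda>s. u s * \<eta> s)"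
proof -
  obtain \<eta> :: "'a \<Rightarrow> real" where \<eta>: "smooth_fun \<eta>" "\<And>x. 0 \<le> \<eta> x"
    "\<And>x. \<epsilon> \<le> norm x \<Longrightarrow> \<eta> x = 0" "integrable lborel \<eta>" "(\<integral>x. \<eta> x \<partial>lborel) = 1"
    using mollifier_exists[OF \<open>\<epsilon> > 0\<close>] by metis
  obtain a where a: "C \<subseteq> cbox (-a) a"
    using bounded_subset_cbox_symmetric[OF C(1)] by metis
  have c\<eta>: "continuous_on UNIV \<eta>" using \<eta>(1) by (rule smooth_fun_continuous)
  have intu: "integrable lborel (\<lambda>s. u s * \<eta> s)" if "continuous_on UNIV u" for u
    by (rule integrable_continuous_compact_support[where C="cball 0 \<epsilon>"])
      (use that c\<eta> \<eta>(3) in \<open>auto intro!: continuous_intros\<close>)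
  let ?\<phi> = "\<lambda>x. integral (cbox (-a) a) (\<lambda>y. w y * \<eta> (x - y))"
  have "?\<phi> x = (\<integral>s. w (x - s) * \<eta> s \<partial>lborel)" for x
  proof -
    have cont: "continuous_on S (\<lambda>y. w y * \<eta> (x - y))" for S
      by (intro continuous_intros continuous_on_compose2[OF c\<eta>] continuous_on_subset[OF w]) auto
    have "integrable lborel (\<lambda>y. indicator (cbox (-a) a) y *\<^sub>R (w y * \<eta> (x - y)))"
      by (rule borel_integrable_compact) (auto intro: cont)
    then have "?\<phi> x = (LINT y:cbox (-a) a|lborel. w y * \<eta> (x - y))"
      by (subst set_borel_integral_eq_integral) (auto simp: set_integrable_def)
    also have "\<dots> = (\<integral>y. w y * \<eta> (x - y) \<partial>lborel)"
      unfolding set_lebesgue_integral_def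
      by (rule Bochner_Integration.integral_cong) (use a C in \<open>auto simp: indicator_def\<close>)
    also have "\<dots> = (\<integral>s. w (x - s) * \<eta> (x - (x - s)) \<partial>lborel)"
      by (rule lborel_integral_reflect) (simp add: borel_measurable_continuous_onI cont)
    finally show ?thesis by simp
  qed
  moreover have "\<bar>(\<integral>s. u s * \<eta> s \<partial>lborel) - c\<bar> \<le> \<delta>"
    if u: "continuous_on UNIV u" and b: "\<And>s. norm s < \<epsilon> \<Longrightarrow> \<bar>u s - c\<bar> \<le> \<delta>" for u c \<delta>
  proof -
    have "(\<integral>s. u s * \<eta> s \<partial>lborel) - c = (\<integral>s. u s * \<eta> s \<partial>lborel) - (\<integral>s. c * \<eta> s \<partial>lborel)"
      by (simp add: \<eta>)
    also have "\<dots> = (\<integral>s. (u s - c) * \<eta> s \<partial>lborel)"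
      by (subst Bochner_Integration.integral_diff[symmetric]) (use intu[OF u] \<eta>(4) in \<open>auto simp: algebra_simps\<close>)
    finally have eq: "(\<integral>s. u s * \<eta> s \<partial>lborel) - c = (\<integral>s. (u s - c) * \<eta> s \<partial>lborel)" .
    have "norm (\<integral>s. (u s - c) * \<eta> s \<partial>lborel) \<le> (\<integral>s. \<delta> * \<eta> s \<partial>lborel)"
    proof (rule Bochner_Integration.integral_norm_bound_integral)
      show "integrable lborel (\<lambda>s. (u s - c) * \<eta> s)"
        by (rule intu) (intro continuous_intros u)
      show "norm ((u s - c) * \<eta> s) \<le> \<delta> * \<eta> s" for s
        using b[of s] \<eta>(2,3)[of s] by (cases "norm s < \<epsilon>") (auto simp: abs_mult mult_right_mono)
    qed (use \<eta> in auto)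
    then show ?thesis by (simp add: eq \<eta>)
  qed
  ultimately show ?thesis
    using that[of ?\<phi> \<eta>] smooth_fun_mollify[OF w \<eta>(1), of "-a" a] intu by blast
qed

text \<open>Soft thresholding by \<delta> removes the values of \<open>w\<close> near the boundary,
  where \<open>w\<close> is small, and mollifying at radius \<open>\<delta> / (2 * L)\<close> then
  keeps the support inside \<Omega>. Both operations preserve the Lipschitz constant. Where
  \<open>w\<close> is affine and stays on one branch of the threshold, or vanishes, averaging
  reproduces the slope exactly; gradients thus converge by becoming stationary.\<close>

lemma smooth_approximation:
  fixes w :: "'a::euclidean_space \<Rightarrow> real"
  assumes \<Omega>: "open \<Omega>" "bounded \<Omega>" and w: "L-lipschitz_on UNIV w" and w0: "\<And>x. x \<notin> \<Omega> \<Longrightarrow> w x = 0"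
    and "0 < L" "0 < \<delta>"
  obtains \<phi> where "test_fun \<Omega> \<phi>" "\<And>x. \<bar>\<phi> x - w x\<bar> \<le> 2 * \<delta>" "L-lipschitz_on UNIV \<phi>"
    "\<And>x r g. (\<And>y. y \<in> ball x r \<Longrightarrow> w y = w x + g \<bullet> (y - x)) \<Longrightarrow> \<delta> / (2 * L) < r \<Longrightarrow>
        (\<forall>y\<in>ball x r. w y > \<delta>) \<or> (\<forall>y\<in>ball x r. w y < - \<delta>) \<or> (g = 0 \<and> w x = 0) \<Longrightarrow>
        grad \<phi> x = g"
proof -
  \<comment> \<open>Soft thresholding: every value moves towards 0 by at most \<delta>, and values
    of size at most \<delta> become 0.\<close>
  define st where "st t = max (t - \<delta>) 0 + min (t + \<delta>) 0" for t :: real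
  have st1: "\<bar>st s - st t\<bar> \<le> \<bar>s - t\<bar>" for s t
    using \<open>0 < \<delta>\<close> unfolding st_def by (simp add: max_def min_def abs_if split: if_splits)
  have st2: "\<bar>st t - t\<bar> \<le> \<delta>" for t
    using \<open>0 < \<delta>\<close> unfolding st_def by (simp add: max_def min_def abs_if split: if_splits)
  have st3: "st t = 0" if "\<bar>t\<bar> \<le> \<delta>" for t
    using that unfolding st_def by (simp add: max_def min_def abs_if split: if_splits)
  define v where "v x = st (w x)" for x
  \<comment> \<open>Over this distance \<open>w\<close> varies by at most
    \<open>\<delta> / 2\<close>.\<close>
  define \<epsilon> where "\<epsilon> = \<delta> / (2 * L)"
  have \<epsilon>: "\<epsilon> > 0" "L * \<epsilon> = \<delta> / 2" using \<open>0 < L\<close> \<open>0 < \<delta>\<close> by (simp_all add: \<epsilon>_def)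
  have wl: "\<bar>w x - w y\<bar> \<le> L * norm (x - y)" for x y
    using lipschitz_onD[OF w] by (simp add: dist_norm dist_real_def)
  have vl: "\<bar>v x - v y\<bar> \<le> L * norm (x - y)" for x y
    using st1[of "w x" "w y"] wl[of x y] by (simp add: v_def)
  have "L-lipschitz_on UNIV v"
    using vl \<open>0 < L\<close> by (auto intro!: lipschitz_onI simp: dist_norm)
  then have vc: "continuous_on UNIV v" by (rule lipschitz_on_continuous_on)
  have vcs: "continuous_on UNIV (\<lambda>s. v (x - s))" for x
    by (rule continuous_on_compose2[OF vc]) (auto intro!: continuous_intros)
  have v0: "v x = 0" if "x \<notin> \<Omega>" for x
    using w0[OF that] \<open>0 < \<delta>\<close> by (simp add: v_def st3)
  obtain \<phi> \<eta> where \<phi>0: "smooth_fun \<phi>" "\<forall>x. \<phi> x = (\<integral>s. v (x - s) * \<eta> s \<partial>lborel)"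
    and av0: "\<forall>u c \<delta>. continuous_on UNIV u \<longrightarrow> (\<forall>s. norm s < \<epsilon> \<longrightarrow> \<bar>u s - c\<bar> \<le> \<delta>) \<longrightarrow> \<bar>(\<integral>s. u s * \<eta> s \<partial>lborel) - c\<bar> \<le> \<delta>"
    and intu0: "\<forall>u. continuous_on UNIV u \<longrightarrow> integrable lborel (\<lambda>s. u s * \<eta> s)"
    by (rule mollify_exists[OF vc \<Omega>(2) _ \<epsilon>(1)]) (rule v0, assumption, rule that)
  note \<phi> = \<phi>0(1) \<phi>0(2)[rule_format]
  have av: "\<bar>(\<integral>s. u s * \<eta> s \<partial>lborel) - c\<bar> \<le> \<delta>"
    if "continuous_on UNIV u" "\<And>s. norm s < \<epsilon> \<Longrightarrow> \<bar>u s - c\<bar> \<le> \<delta>" for u c \<delta>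
    using av0 that by blast
  have intu: "integrable lborel (\<lambda>s. u s * \<eta> s)" if "continuous_on UNIV u" for u
    using intu0 that by blast
  have diff: "\<phi> y - \<phi> x = (\<integral>s. (v (y - s) - v (x - s)) * \<eta> s \<partial>lborel)" for x y
    unfolding \<phi>(2) left_diff_distrib
    by (rule Bochner_Integration.integral_diff[symmetric]) (intro intu vcs)+
  have cdiff: "continuous_on UNIV (\<lambda>s. v (y - s) - v (x - s))" for x y
    by (intro continuous_intros vcs)
  have near: "\<bar>\<phi> x - v x\<bar> \<le> \<delta> / 2" for x
  proof -
    have "\<bar>v (x - s) - v x\<bar> \<le> \<delta> / 2" if "norm s < \<epsilon>" for s
      using vl[of "x - s" x] mult_left_mono[of "norm s" \<epsilon> L] that \<open>0 < L\<close> \<epsilon>(2) by simp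
    then show ?thesis unfolding \<phi>(2) by (rule av[OF vcs])
  qed
  have lip: "L-lipschitz_on UNIV \<phi>"
  proof (rule lipschitz_onI)
    show "dist (\<phi> x) (\<phi> y) \<le> L * dist x y" for x y
    proof -
      have "\<bar>v (x - s) - v (y - s) - 0\<bar> \<le> L * norm (x - y)" for s
        using vl[of "x - s" "y - s"] by simp
      then have "\<bar>(\<phi> x - \<phi> y) - 0\<bar> \<le> L * norm (x - y)"
        unfolding diff by (intro av cdiff)
      then show ?thesis by (simp add: dist_norm)
    qed
  qed (use \<open>0 < L\<close> in simp)
  have supp: "\<delta> / 2 \<le> \<bar>w x\<bar>" if "\<phi> x \<noteq> 0" for x
  proof (rule ccontr)
    assume a: "\<not> \<delta> / 2 \<le> \<bar>w x\<bar>"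
    \<comment> \<open>Within distance \<epsilon> of such a point \<open>w\<close> stays at most
      \<delta> in size, so all averaged values are 0.\<close>
    have "\<bar>v (x - s) - 0\<bar> \<le> 0" if "norm s < \<epsilon>" for s
    proof -
      have "\<bar>w (x - s) - w x\<bar> \<le> \<delta> / 2"
        using wl[of "x - s" x] mult_left_mono[of "norm s" \<epsilon> L] that \<open>0 < L\<close> \<epsilon>(2) by simp
      then have "\<bar>w (x - s)\<bar> \<le> \<delta>" using a by linarith
      then show ?thesis by (simp add: v_def st3)
    qed
    then have "\<bar>\<phi> x - 0\<bar> \<le> 0" unfolding \<phi>(2) by (rule av[OF vcs])
    with that show False by simp
  qed
  have cl: "closed {x. \<delta> / 2 \<le> \<bar>w x\<bar>}"
    by (intro closed_Collect_le continuous_intros lipschitz_on_continuous_on[OF w])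
  have sub: "closure {x. \<phi> x \<noteq> 0} \<subseteq> {x. \<delta> / 2 \<le> \<bar>w x\<bar>}"
    by (rule closure_minimal[OF _ cl]) (use supp in auto)
  also have sub2: "{x. \<delta> / 2 \<le> \<bar>w x\<bar>} \<subseteq> \<Omega>"
    using w0 \<open>0 < \<delta>\<close> by force
  finally have test: "test_fun \<Omega> \<phi>"
    using \<phi>(1) bounded_subset[OF \<Omega>(2)] by (auto simp: test_fun_def compact_eq_bounded_closed)
  have app: "\<bar>\<phi> x - w x\<bar> \<le> 2 * \<delta>" for x
    using near[of x] st2[of "w x"] \<open>0 < \<delta>\<close> unfolding v_def by linarith
  have gr: "grad \<phi> x = g"
    if aff: "\<And>y. y \<in> ball x r \<Longrightarrow> w y = w x + g \<bullet> (y - x)" and r: "\<delta> / (2 * L) < r"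
      and c: "(\<forall>y\<in>ball x r. w y > \<delta>) \<or> (\<forall>y\<in>ball x r. w y < - \<delta>) \<or> (g = 0 \<and> w x = 0)" for x r g
  proof -
    have vaff: "v y - v z = g \<bullet> (y - z)" if "y \<in> ball x r" "z \<in> ball x r" for y z
    proof -
      note yz = that
      have wy: "w y = w x + g \<bullet> (y - x)" "w z = w x + g \<bullet> (z - x)" using aff that by blast+
      from c consider "w y > \<delta>" "w z > \<delta>" | "w y < - \<delta>" "w z < - \<delta>" | "g = 0" "w x = 0"
        using yz by blast
      then show ?thesis
        using wy \<open>0 < \<delta>\<close> by cases (auto simp: v_def st_def inner_diff_right)
    qed
    \<comment> \<open>The tolerance 0 turns the averaging bound into an identity.\<close>
    have loc: "\<phi> y = \<phi> x + g \<bullet> (y - x)" if "y \<in> ball x (r - \<epsilon>)" for y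
    proof -
      have "\<bar>v (y - s) - v (x - s) - g \<bullet> (y - x)\<bar> \<le> 0" if "norm s < \<epsilon>" for s
      proof -
        have "norm (x - (y - s)) \<le> norm (x - y) + norm s"
          using norm_triangle_ineq[of "x - y" s] by (simp add: algebra_simps)
        then have "y - s \<in> ball x r"
          using \<open>y \<in> ball x (r - \<epsilon>)\<close> that by (simp add: dist_norm)
        moreover have "x - s \<in> ball x r" using that r by (simp add: dist_norm \<epsilon>_def)
        ultimately show ?thesis using vaff[of "y - s" "x - s"] by simp
      qed
      then have "\<bar>(\<phi> y - \<phi> x) - g \<bullet> (y - x)\<bar> \<le> 0"
        unfolding diff by (intro av cdiff)
      then show ?thesis by simp
    qed
    have "(\<phi> has_derivative (\<lambda>h. g \<bullet> h)) (at x)"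
    proof (rule has_derivative_transform_within_open[where s="ball x (r - \<epsilon>)" and f="\<lambda>y. \<phi> x + g \<bullet> (y - x)"])
      show "((\<lambda>y. \<phi> x + g \<bullet> (y - x)) has_derivative (\<lambda>h. g \<bullet> h)) (at x)"
        by (auto intro!: derivative_eq_intros)
      show "\<phi> x + g \<bullet> (y - x) = \<phi> y" if "y \<in> ball x (r - \<epsilon>)" for y
        using loc[OF that] by simp
    qed (use r in \<open>auto simp: \<epsilon>_def\<close>)
    then show ?thesis by (rule grad_eqI)
  qed
  show ?thesis by (rule that[OF test app lip gr])
qed

section \<open>Sobolev functions\<close>

lemma lborel_integral_translate:
  fixes f :: "'a::euclidean_space \<Rightarrow> real"
  assumes [measurable]: "f \<in> borel_measurable borel"
  shows "(\<integral>x. f (c + x) \<partial>lborel) = (\<integral>x. f x \<partial>lborel)"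
proof -
  have "(\<integral>x. f x \<partial>lborel) = (\<integral>x. f x \<partial>distr lborel borel ((+) c))"
    by (simp add: lborel_distr_plus)
  then show ?thesis by (simp add: integral_distr)
qed

lemma grad_zero_outside:
  fixes f :: "'a::euclidean_space \<Rightarrow> real"
  assumes D: "(f has_derivative (\<lambda>h. g \<bullet> h)) (at x)" and C: "closed C" "\<And>y. y \<notin> C \<Longrightarrow> f y = 0" "x \<notin> C"
  shows "g = 0"
proof -
  have "(f has_derivative (\<lambda>h. 0)) (at x)"
  proof (rule has_derivative_transform_within_open[where s="- C" and f="\<lambda>y. 0"])
  qed (use C in auto)
  from has_derivative_unique[OF D this] show ?thesis
    by (metis inner_eq_zero_iff)
qed

lemma has_derivative_lipschitz:
  fixes f :: "'a::euclidean_space \<Rightarrow> real"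
  assumes D: "\<And>x. (f has_derivative (\<lambda>h. G x \<bullet> h)) (at x)" and "\<And>x. norm (G x) \<le> B"
  shows "\<bar>f y - f x\<bar> \<le> B * norm (y - x)"
proof -
  have "norm (f y - f x) \<le> B * norm (y - x)"
  proof (rule differentiable_bound)
    show "(f has_derivative (\<lambda>h. G x \<bullet> h)) (at x within UNIV)" for x using D by simp
    show "onorm ((\<bullet>) (G x)) \<le> B" for x
    proof (rule onorm_le)
      show "norm (G x \<bullet> h) \<le> B * norm h" for h
        using Cauchy_Schwarz_ineq2[of "G x" h] mult_right_mono[OF assms(2)[of x], of "norm h"] by simp
    qed
  qed auto
  then show ?thesis by simp
qed

text \<open>Difference quotients in the direction \<open>g\<close> itself are at most
  \<open>L * norm g\<close> and tend to \<open>g \<bullet> g\<close>.\<close>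

lemma grad_norm_le_lipschitz:
  fixes f :: "'a::euclidean_space \<Rightarrow> real"
  assumes L: "L-lipschitz_on UNIV f" and D: "(f has_derivative (\<lambda>h. g \<bullet> h)) (at x)"
  shows "norm g \<le> L"
proof -
  have "((\<lambda>t. f (x + t *\<^sub>R g)) has_derivative (\<lambda>t. g \<bullet> (t *\<^sub>R g))) (at 0)"
    by (rule has_derivative_compose[of "\<lambda>t. x + t *\<^sub>R g" "\<lambda>t. t *\<^sub>R g"]) (use D in \<open>auto intro!: derivative_eq_intros\<close>)
  then have "((\<lambda>t. f (x + t *\<^sub>R g)) has_real_derivative (g \<bullet> g)) (at 0)"
    by (simp add: has_field_derivative_def mult_commute_abs)
  then have "((\<lambda>t. (f (x + t *\<^sub>R g) - f x) / t) \<longlongrightarrow> g \<bullet> g) (at 0)"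
    by (simp add: DERIV_def)
  moreover have "(f (x + t *\<^sub>R g) - f x) / t \<le> L * norm g" if "t \<noteq> 0" for t
  proof -
    have "\<bar>f (x + t *\<^sub>R g) - f x\<bar> \<le> L * (\<bar>t\<bar> * norm g)"
      using lipschitz_onD[OF L, of "x + t *\<^sub>R g" x] by (simp add: dist_norm)
    then have "\<bar>(f (x + t *\<^sub>R g) - f x) / t\<bar> \<le> L * norm g"
      using that by (simp add: abs_divide field_simps)
    then show ?thesis by linarith
  qed
  then have "\<forall>\<^sub>F t in at 0. (f (x + t *\<^sub>R g) - f x) / t \<le> L * norm g"
    by (simp add: eventually_at_filter)
  ultimately have "g \<bullet> g \<le> L * norm g"
    by (rule tendsto_upperbound) auto
  then show ?thesis
    by (cases "g = 0") (use lipschitz_on_nonneg[OF L] in \<open>auto simp: power2_norm_eq_inner[symmetric] power2_eq_square\<close>)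
qed

text \<open>By translation invariance every difference quotient has integral 0. The quotients
  converge boundedly to the derivative, with supports in one ball because the step sizes are at most
  1.\<close>

lemma integral_partial_derivative_zero:
  fixes f :: "'a::euclidean_space \<Rightarrow> real"
  assumes D: "\<And>x. (f has_derivative (\<lambda>h. G x \<bullet> h)) (at x)" and G: "continuous_on UNIV G"
    and C: "compact C" "\<And>x. x \<notin> C \<Longrightarrow> f x = 0"
  shows "(\<integral>x. G x \<bullet> e \<partial>lborel) = 0"
proof -
  have G0: "G x = 0" if "x \<notin> C" for x
    using grad_zero_outside[OF D compact_imp_closed[OF C(1)] C(2) that] .
  have "bounded (G ` C)"
    by (intro compact_imp_bounded compact_continuous_image C continuous_on_subset[OF G]) auto
  then obtain B0 where B0: "\<And>x. x \<in> C \<Longrightarrow> norm (G x) \<le> B0" by (auto simp: bounded_iff)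
  define B where "B = max B0 0"
  have B: "norm (G x) \<le> B" for x
    using B0[of x] G0[of x] by (cases "x \<in> C") (auto simp: B_def)
  have B_nn: "B \<ge> 0" by (simp add: B_def)
  obtain R where R: "\<And>x. x \<in> C \<Longrightarrow> norm x \<le> R" using compact_imp_bounded[OF C(1)] by (auto simp: bounded_iff)
  have cf: "continuous_on UNIV f"
    by (meson D continuous_at_imp_continuous_on has_derivative_continuous)
  then have [measurable]: "f \<in> borel_measurable borel" by (rule borel_measurable_continuous_onI)
  have cG: "(\<lambda>x. G x \<bullet> e) \<in> borel_measurable borel"
    by (intro borel_measurable_continuous_onI continuous_intros G)
  have intf: "integrable lborel f" by (rule integrable_continuous_compact_support[OF cf C])
  define h where "h k = inverse (real (Suc k))" for k
  have h: "h k > 0" "h k \<le> 1" for k by (auto simp: h_def field_simps)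
  define q where "q k x = (f (h k *\<^sub>R e + x) - f x) / h k" for k x
  have "integrable lborel (\<lambda>x. f (c + x))" for c
  proof -
    have "integrable (distr lborel borel ((+) c)) f" using intf by (simp add: lborel_distr_plus)
    then show ?thesis by (simp add: integrable_distr_eq)
  qed
  then have q0: "(\<integral>x. q k x \<partial>lborel) = 0" for k
    using intf by (simp add: q_def lborel_integral_translate)
  have "(\<lambda>k. \<integral>x. q k x \<partial>lborel) \<longlonglongrightarrow> (\<integral>x. G x \<bullet> e \<partial>lborel)"
  proof (rule integral_dominated_convergence[where w="\<lambda>x. indicator (cball 0 (R + norm e)) x * (B * norm e)"])
    show "integrable lborel (\<lambda>x. indicator (cball (0::'a) (R + norm e)) x * (B * norm e))"
      by (rule integrable_mult_left)
        (use emeasure_lborel_cball_finite[of "0::'a" "R + norm e"] in \<open>simp add: integrable_indicator_iff\<close>)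
    show "AE x in lborel. (\<lambda>k. q k x) \<longlonglongrightarrow> G x \<bullet> e"
    proof (rule AE_I2)
      fix x
      have "((\<lambda>t. f (x + t *\<^sub>R e)) has_derivative (\<lambda>t. G x \<bullet> (t *\<^sub>R e))) (at 0)"
        by (rule has_derivative_compose[of "\<lambda>t. x + t *\<^sub>R e" "\<lambda>t. t *\<^sub>R e"]) (use D in \<open>auto intro!: derivative_eq_intros\<close>)
      then have "((\<lambda>t. f (x + t *\<^sub>R e)) has_real_derivative (G x \<bullet> e)) (at 0)"
        by (simp add: has_field_derivative_def mult_commute_abs)
      then have "((\<lambda>t. (f (x + t *\<^sub>R e) - f x) / t) \<longlongrightarrow> G x \<bullet> e) (at 0)"
        by (simp add: DERIV_def)
      moreover have "filterlim h (at 0) sequentially"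
        unfolding h_def filterlim_at using LIMSEQ_inverse_real_of_nat by (auto simp del: of_nat_Suc)
      ultimately have "((\<lambda>k. (f (x + h k *\<^sub>R e) - f x) / h k) \<longlongrightarrow> G x \<bullet> e) sequentially"
        by (rule filterlim_compose)
      then show "(\<lambda>k. q k x) \<longlonglongrightarrow> G x \<bullet> e" by (simp add: q_def add.commute)
    qed
    show "AE x in lborel. norm (q k x) \<le> indicator (cball 0 (R + norm e)) x * (B * norm e)" for k
    proof (rule AE_I2)
      fix x :: 'a
      show "norm (q k x) \<le> indicator (cball 0 (R + norm e)) x * (B * norm e)"
      proof (cases "x \<in> cball 0 (R + norm e)")
        case True
        have "\<bar>f (h k *\<^sub>R e + x) - f x\<bar> \<le> B * norm (h k *\<^sub>R e + x - x)"
          by (rule has_derivative_lipschitz[OF D B])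
        then show ?thesis using True h[of k] by (simp add: q_def field_simps)
      next
        case False
        then have n: "norm x > R + norm e" by simp
        have "x \<notin> C" using R[of x] n norm_ge_zero[of e] by linarith
        moreover have "h k *\<^sub>R e + x \<notin> C"
        proof
          assume "h k *\<^sub>R e + x \<in> C"
          then have "norm (h k *\<^sub>R e + x) \<le> R" by (rule R)
          moreover have "norm x \<le> norm (h k *\<^sub>R e + x) + norm (h k *\<^sub>R e)"
            using norm_triangle_ineq4[of "h k *\<^sub>R e + x" "h k *\<^sub>R e"] by simp
          moreover have "norm (h k *\<^sub>R e) \<le> norm e"
            using h[of k] mult_right_mono[of "h k" 1 "norm e"] by simp
          ultimately show False using n by linarith
        qed
        ultimately show ?thesis using C(2) B_nn by (simp add: q_def)
      qed
    qed
    show "(\<lambda>x. q k x) \<in> borel_measurable lborel" for k unfolding q_def by measurable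
  qed (use cG in simp)
  then have "(\<lambda>k. 0) \<longlonglongrightarrow> (\<integral>x. G x \<bullet> e \<partial>lborel)" by (simp add: q0)
  then show ?thesis using LIMSEQ_unique tendsto_const by metis
qed

section \<open>Test functions and integration by parts\<close>

lemma test_fun_smooth: "test_fun \<Omega> \<phi> \<Longrightarrow> smooth_fun \<phi>"
  by (simp add: test_fun_def)

lemma test_fun_support:
  assumes "test_fun \<Omega> \<phi>"
  obtains C where "compact C" "C \<subseteq> \<Omega>" "\<And>x. x \<notin> C \<Longrightarrow> \<phi> x = 0" "\<And>x. x \<notin> C \<Longrightarrow> grad \<phi> x = 0"
proof
  let ?C = "closure {x. \<phi> x \<noteq> 0}"
  show "compact ?C" "?C \<subseteq> \<Omega>" using assms by (auto simp: test_fun_def)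
  show z: "\<phi> x = 0" if "x \<notin> ?C" for x
    using that closure_subset[of "{x. \<phi> x \<noteq> 0}"] by auto
  show "grad \<phi> x = 0" if "x \<notin> ?C" for x
    by (rule grad_zero_outside[OF smooth_fun_has_derivative[OF test_fun_smooth[OF assms]] closed_closure z that])
qed

lemma test_fun_zero: "test_fun \<Omega> (\<lambda>x. 0)"
  by (simp add: test_fun_def smooth_fun_zero)

lemma test_fun_mono: "test_fun U \<phi> \<Longrightarrow> U \<subseteq> \<Omega> \<Longrightarrow> test_fun \<Omega> \<phi>"
  by (auto simp: test_fun_def)

lemma test_fun_cmult:
  assumes "test_fun \<Omega> \<phi>" shows "test_fun \<Omega> (\<lambda>x. a * \<phi> x)"
proof -
  have sub: "closure {x. a * \<phi> x \<noteq> 0} \<subseteq> closure {x. \<phi> x \<noteq> 0}" by (intro closure_mono) auto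
  have "bounded (closure {x. a * \<phi> x \<noteq> 0})"
    by (rule bounded_subset[OF compact_imp_bounded sub]) (use assms in \<open>simp add: test_fun_def\<close>)
  then have "compact (closure {x. a * \<phi> x \<noteq> 0})"
    by (simp only: compact_eq_bounded_closed closed_closure)
  with assms sub show ?thesis
    by (auto simp: test_fun_def smooth_fun_cmult)
qed

lemma test_fun_add:
  assumes "test_fun \<Omega> \<phi>" "test_fun \<Omega> \<psi>" shows "test_fun \<Omega> (\<lambda>x. \<phi> x + \<psi> x)"
proof -
  have sub: "closure {x. \<phi> x + \<psi> x \<noteq> 0} \<subseteq> closure {x. \<phi> x \<noteq> 0} \<union> closure {x. \<psi> x \<noteq> 0}"
    unfolding closure_Un[symmetric] by (intro closure_mono) auto
  have "compact (closure {x. \<phi> x \<noteq> 0} \<union> closure {x. \<psi> x \<noteq> 0})"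
    using assms by (auto simp: test_fun_def)
  then have "bounded (closure {x. \<phi> x + \<psi> x \<noteq> 0})"
    using bounded_subset[OF compact_imp_bounded sub] by blast
  then have "compact (closure {x. \<phi> x + \<psi> x \<noteq> 0})"
    by (simp only: compact_eq_bounded_closed closed_closure)
  with sub assms show ?thesis
    by (auto simp: test_fun_def smooth_fun_add)
qed

lemma grad_add: "smooth_fun f \<Longrightarrow> smooth_fun g \<Longrightarrow> grad (\<lambda>x. f x + g x) x = grad f x + grad g x"
  by (rule grad_eqI)
    (use has_derivative_add[OF smooth_fun_has_derivative[of f x] smooth_fun_has_derivative[of g x]] in \<open>simp add: inner_add_left\<close>)

lemma grad_cmult: "smooth_fun f \<Longrightarrow> grad (\<lambda>x. a * f x) x = a *\<^sub>R grad f x"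
  by (rule grad_eqI)
    (use has_derivative_mult_right[OF smooth_fun_has_derivative[of f x], of a] in simp)

lemma integrable_continuous_compact_support_on:
  fixes f :: "'a::euclidean_space \<Rightarrow> 'b::euclidean_space"
  assumes "S \<in> sets lebesgue" "continuous_on UNIV f" "compact C" "\<And>x. x \<notin> C \<Longrightarrow> f x = 0"
  shows "integrable (lebesgue_on S) f"
    and "C \<subseteq> S \<Longrightarrow> integral\<^sup>L (lebesgue_on S) f = (\<integral>x. f x \<partial>lborel)"
proof -
  have i: "integrable lborel f" by (rule integrable_continuous_compact_support[OF assms(2-4)])
  then have il: "integrable lebesgue f" and f: "f \<in> borel_measurable lborel"
    by (auto simp: integrable_completion)
  have "integrable lebesgue (\<lambda>x. indicator S x *\<^sub>R f x)"
    by (rule integrable_mult_indicator[OF assms(1) il])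
  then show "integrable (lebesgue_on S) f"
    using assms(1) by (simp add: integrable_restrict_space)
  assume "C \<subseteq> S"
  have "indicator S x *\<^sub>R f x = f x" for x
    using assms(4)[of x] \<open>C \<subseteq> S\<close> by (cases "x \<in> S") auto
  then have "(\<lambda>x. indicator S x *\<^sub>R f x) = f" by blast
  then show "integral\<^sup>L (lebesgue_on S) f = (\<integral>x. f x \<partial>lborel)"
    using assms(1) f by (simp add: integral_restrict_space integral_completion)
qed

lemma sqi_continuous_compact_support:
  fixes f :: "'a::euclidean_space \<Rightarrow> 'b::euclidean_space"
  assumes "S \<in> sets lebesgue" "continuous_on UNIV f" "compact C" "\<And>x. x \<notin> C \<Longrightarrow> f x = 0"
  shows "sqi (lebesgue_on S) f"
proof -
  have "integrable (lebesgue_on S) (\<lambda>x. (norm (f x))\<^sup>2)"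
    by (rule integrable_continuous_compact_support_on[where C=C]) (use assms in \<open>auto intro!: continuous_intros\<close>)
  moreover have "f \<in> borel_measurable (lebesgue_on S)"
    using integrable_continuous_compact_support_on(1)[OF assms] by auto
  ultimately show ?thesis by (simp add: sqi_def)
qed

lemma test_fun_sqi:
  assumes "S \<in> sets lebesgue" "test_fun \<Omega> \<phi>"
  shows "sqi (lebesgue_on S) \<phi>" "sqi (lebesgue_on S) (grad \<phi>)"
proof -
  obtain C where C: "compact C" "\<And>x. x \<notin> C \<Longrightarrow> \<phi> x = 0" "\<And>x. x \<notin> C \<Longrightarrow> grad \<phi> x = 0"
    using test_fun_support[OF assms(2)] by metis
  show "sqi (lebesgue_on S) \<phi>"
    by (rule sqi_continuous_compact_support[OF assms(1) smooth_fun_continuous[OF test_fun_smooth[OF assms(2)]] C(1,2)])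
  show "sqi (lebesgue_on S) (grad \<phi>)"
    by (rule sqi_continuous_compact_support[OF assms(1) smooth_fun_grad_continuous[OF test_fun_smooth[OF assms(2)]] C(1,3)])
qed

text \<open>The product of \<open>u\<close> and \<phi> has compact support, so its directional
  derivative has integral 0.\<close>

lemma integration_by_parts_test:
  fixes u :: "'a::euclidean_space \<Rightarrow> real"
  assumes S: "S \<in> sets lebesgue" and \<phi>: "test_fun S \<phi>"
    and u: "\<And>x. (u has_derivative (\<lambda>h. G x \<bullet> h)) (at x)" "continuous_on UNIV G"
  shows "(\<integral>x. u x * (grad \<phi> x \<bullet> e) \<partial>lebesgue_on S) = - (\<integral>x. (G x \<bullet> e) * \<phi> x \<partial>lebesgue_on S)"
proof -
  obtain C where C: "compact C" "C \<subseteq> S" "\<And>x. x \<notin> C \<Longrightarrow> \<phi> x = 0" "\<And>x. x \<notin> C \<Longrightarrow> grad \<phi> x = 0"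
    using test_fun_support[OF \<phi>] by metis
  note sm = test_fun_smooth[OF \<phi>]
  have cu: "continuous_on UNIV u" by (meson u(1) continuous_at_imp_continuous_on has_derivative_continuous)
  have c: "continuous_on UNIV (\<lambda>x. u x * (grad \<phi> x \<bullet> e))" "continuous_on UNIV (\<lambda>x. (G x \<bullet> e) * \<phi> x)"
    by (intro continuous_intros cu u smooth_fun_grad_continuous smooth_fun_continuous sm)+
  note i1 = integrable_continuous_compact_support_on[OF S c(1) C(1)]
  note i2 = integrable_continuous_compact_support_on[OF S c(2) C(1)]
  have "((\<lambda>x. u x * \<phi> x) has_derivative (\<lambda>h. (u x *\<^sub>R grad \<phi> x + \<phi> x *\<^sub>R G x) \<bullet> h)) (at x)" for x
    by (rule has_derivative_eq_rhs, rule has_derivative_mult[OF u(1) smooth_fun_has_derivative[OF sm]])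
      (simp add: inner_add_left mult.commute)
  then have "(\<integral>x. (u x *\<^sub>R grad \<phi> x + \<phi> x *\<^sub>R G x) \<bullet> e \<partial>lborel) = 0"
    by (rule integral_partial_derivative_zero[where C=C])
      (use C in \<open>auto intro!: continuous_intros cu u smooth_fun_grad_continuous smooth_fun_continuous sm\<close>)
  moreover have "(\<integral>x. (u x *\<^sub>R grad \<phi> x + \<phi> x *\<^sub>R G x) \<bullet> e \<partial>lborel) =
      (\<integral>x. u x * (grad \<phi> x \<bullet> e) + (G x \<bullet> e) * \<phi> x \<partial>lborel)"
    by (simp add: inner_add_left mult.commute)
  moreover have "\<dots> = (\<integral>x. u x * (grad \<phi> x \<bullet> e) \<partial>lborel) + (\<integral>x. (G x \<bullet> e) * \<phi> x \<partial>lborel)"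
    by (intro Bochner_Integration.integral_add integrable_continuous_compact_support[where C=C] c C) (use C in auto)
  ultimately show ?thesis
    using i1(2) i2(2) C by simp
qed

text \<open>Membership in \<open>H10\<close> together with a witness for the weak gradient. An
  explicit \<open>g\<close> avoids the choice in \<open>wgrad\<close> and makes the relation linear
  in the pair.\<close>

definition H10g :: "'a::euclidean_space set \<Rightarrow> ('a \<Rightarrow> real) \<Rightarrow> ('a \<Rightarrow> 'a) \<Rightarrow> bool" where
  "H10g \<Omega> u g \<longleftrightarrow> has_weak_grad \<Omega> u g \<and>
      (\<exists>\<phi>::nat \<Rightarrow> 'a \<Rightarrow> real. (\<forall>k. test_fun \<Omega> (\<phi> k)) \<and>
         (\<lambda>k. L2norm \<Omega> (\<lambda>x. \<phi> k x - u x) + L2normv \<Omega> (\<lambda>x. grad (\<phi> k) x - g x)) \<longlonglongrightarrow> 0)"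

lemma H10_iff: "u \<in> H10 \<Omega> \<longleftrightarrow> (\<exists>g. H10g \<Omega> u g)"
  by (simp add: H10_def H10g_def)

section \<open>Functions in \<open>H10\<close> with explicit weak gradients\<close>

context
  fixes \<Omega> :: "'a::euclidean_space set"
  assumes op: "open \<Omega>" and bd: "bounded \<Omega>"
begin

private abbreviation "M \<equiv> lebesgue_on \<Omega>"

lemma domain_sets: "\<Omega> \<in> sets lebesgue" using op by auto
lemma domain_lmeasurable: "\<Omega> \<in> lmeasurable" using op bd by (rule lmeasurable_open[rotated])

lemma has_weak_grad_iff:
  "has_weak_grad \<Omega> u g \<longleftrightarrow> sqi M u \<and> sqi M g \<and>
    (\<forall>\<phi>. test_fun \<Omega> \<phi> \<longrightarrow> (\<forall>i\<in>Basis. ip M u (\<lambda>x. grad \<phi> x \<bullet> i) = - ip M (\<lambda>x. g x \<bullet> i) \<phi>))"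
  unfolding has_weak_grad_def L2_iff[OF domain_sets] L2v_iff[OF domain_sets]
    set_integral_lebesgue_on[OF domain_sets] ip_def
  by (simp add: grad_inner_Basis cong: conj_cong ball_cong)

lemma has_weak_div_iff:
  "has_weak_div \<Omega> \<tau> d \<longleftrightarrow> sqi M \<tau> \<and> sqi M d \<and>
    (\<forall>\<phi>. test_fun \<Omega> \<phi> \<longrightarrow> ip M \<tau> (grad \<phi>) = - ip M d \<phi>)"
  unfolding has_weak_div_def L2_iff[OF domain_sets] L2v_iff[OF domain_sets]
    set_integral_lebesgue_on[OF domain_sets] ip_def by simp

lemma test_sqi: "test_fun \<Omega> \<phi> \<Longrightarrow> sqi M \<phi>" "test_fun \<Omega> \<phi> \<Longrightarrow> sqi M (grad \<phi>)"
  using test_fun_sqi domain_sets by blast+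

lemma sqi_inner: "sqi M (f :: 'a \<Rightarrow> 'a) \<Longrightarrow> sqi M (\<lambda>x. f x \<bullet> e)"
proof -
  assume f: "sqi M f"
  have "integrable M (\<lambda>x. (norm (f x \<bullet> e))\<^sup>2)"
  proof (rule Bochner_Integration.integrable_bound)
    show "integrable M (\<lambda>x. (norm e)\<^sup>2 * (norm (f x))\<^sup>2)" using f by (auto simp: sqi_def)
    have "(norm (f x \<bullet> e))\<^sup>2 \<le> (norm e)\<^sup>2 * (norm (f x))\<^sup>2" for x
      using Cauchy_Schwarz_ineq2[of "f x" e] power_mono[of "\<bar>f x \<bullet> e\<bar>" "norm (f x) * norm e" 2]
      by (simp add: power_mult_distrib mult.commute)
    then show "AE x in M. norm ((norm (f x \<bullet> e))\<^sup>2) \<le> norm ((norm e)\<^sup>2 * (norm (f x))\<^sup>2)" by simp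
  qed (use f in \<open>auto simp: sqi_def\<close>)
  then show ?thesis using f by (auto simp: sqi_def)
qed

lemma test_fun_weak_grad:
  assumes \<phi>: "test_fun \<Omega> \<phi>" shows "has_weak_grad \<Omega> \<phi> (grad \<phi>)"
  unfolding has_weak_grad_iff ip_def
  using test_sqi[OF \<phi>] integration_by_parts_test[OF domain_sets _ smooth_fun_has_derivative[OF test_fun_smooth[OF \<phi>]]
      smooth_fun_grad_continuous[OF test_fun_smooth[OF \<phi>]]] by simp

lemma test_fun_H10g: assumes \<phi>: "test_fun \<Omega> \<phi>" shows "H10g \<Omega> \<phi> (grad \<phi>)"
  unfolding H10g_def
  by (intro conjI test_fun_weak_grad[OF \<phi>] exI[of _ "\<lambda>k. \<phi>"]) (use \<phi> in \<open>auto simp: L2norm_def L2normv_def\<close>)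

lemma H10g_sqi: "H10g \<Omega> u g \<Longrightarrow> sqi M u" "H10g \<Omega> u g \<Longrightarrow> sqi M g"
  by (simp_all add: H10g_def has_weak_grad_iff)

lemma H10g_approx:
  assumes "H10g \<Omega> u g"
  obtains \<phi> :: "nat \<Rightarrow> 'a \<Rightarrow> real" where "\<forall>k. test_fun \<Omega> (\<phi> k)"
    "(\<lambda>k. nrm M (\<lambda>x. \<phi> k x - u x)) \<longlonglongrightarrow> 0" "(\<lambda>k. nrm M (\<lambda>x. grad (\<phi> k) x - g x)) \<longlonglongrightarrow> 0"
proof -
  obtain \<phi> :: "nat \<Rightarrow> 'a \<Rightarrow> real" where \<phi>: "\<And>k. test_fun \<Omega> (\<phi> k)"
    and l: "(\<lambda>k. nrm M (\<lambda>x. \<phi> k x - u x) + nrm M (\<lambda>x. grad (\<phi> k) x - g x)) \<longlonglongrightarrow> 0"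
    using assms by (auto simp: H10g_def L2norm_eq[OF domain_sets] L2normv_eq[OF domain_sets])
  have "(\<lambda>k. nrm M (\<lambda>x. \<phi> k x - u x)) \<longlonglongrightarrow> 0"
    by (rule Lim_null_comparison[OF _ l]) simp
  moreover have "(\<lambda>k. nrm M (\<lambda>x. grad (\<phi> k) x - g x)) \<longlonglongrightarrow> 0"
    by (rule Lim_null_comparison[OF _ l]) simp
  ultimately show ?thesis using \<phi> that[of \<phi>] by simp
qed

text \<open>The weak gradient comes for free from the approximating sequence.\<close>

lemma H10gI:
  fixes \<phi> :: "nat \<Rightarrow> 'a \<Rightarrow> real"
  assumes u: "sqi M u" and g: "sqi M g" and \<phi>: "\<And>k. test_fun \<Omega> (\<phi> k)"
    and l: "(\<lambda>k. nrm M (\<lambda>x. \<phi> k x - u x)) \<longlonglongrightarrow> 0" "(\<lambda>k. nrm M (\<lambda>x. grad (\<phi> k) x - g x)) \<longlonglongrightarrow> 0"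
  shows "H10g \<Omega> u g"
proof -
  have "ip M u (\<lambda>x. grad \<psi> x \<bullet> i) = - ip M (\<lambda>x. g x \<bullet> i) \<psi>" if \<psi>: "test_fun \<Omega> \<psi>" and i: "i \<in> Basis" for \<psi> i
  proof -
    have sw: "ip M (\<lambda>x. f x \<bullet> i) \<psi> = ip M f (\<lambda>x. \<psi> x *\<^sub>R i)" for f
      by (simp add: ip_def mult.commute)
    have sqi2: "sqi M (\<lambda>x. \<psi> x *\<^sub>R i)"
      using test_sqi(1)[OF \<psi>] i by (auto simp: sqi_def power_mult_distrib)
    have "(\<lambda>k. ip M (\<phi> k) (\<lambda>x. grad \<psi> x \<bullet> i)) \<longlonglongrightarrow> ip M u (\<lambda>x. grad \<psi> x \<bullet> i)"
      by (rule ip_tendsto[OF test_sqi(1)[OF \<phi>] u sqi_inner[OF test_sqi(2)[OF \<psi>]] l(1)])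
    moreover have "ip M (\<phi> k) (\<lambda>x. grad \<psi> x \<bullet> i) = - ip M (grad (\<phi> k)) (\<lambda>x. \<psi> x *\<^sub>R i)" for k
      using test_fun_weak_grad[OF \<phi>[of k]] \<psi> i sw[of "grad (\<phi> k)"] by (simp add: has_weak_grad_iff)
    then have "(\<lambda>k. ip M (\<phi> k) (\<lambda>x. grad \<psi> x \<bullet> i)) = (\<lambda>k. - ip M (grad (\<phi> k)) (\<lambda>x. \<psi> x *\<^sub>R i))"
      by simp
    moreover have "(\<lambda>k. - ip M (grad (\<phi> k)) (\<lambda>x. \<psi> x *\<^sub>R i)) \<longlonglongrightarrow> - ip M g (\<lambda>x. \<psi> x *\<^sub>R i)"
      by (intro tendsto_minus ip_tendsto test_sqi \<phi> g sqi2 l)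
    ultimately show ?thesis unfolding sw[of g] using LIMSEQ_unique by metis
  qed
  then have "has_weak_grad \<Omega> u g" using u g by (simp add: has_weak_grad_iff)
  moreover have "(\<lambda>k. nrm M (\<lambda>x. \<phi> k x - u x) + nrm M (\<lambda>x. grad (\<phi> k) x - g x)) \<longlonglongrightarrow> 0"
    using tendsto_add[OF l] by simp
  ultimately show ?thesis
    using \<phi> by (auto simp: H10g_def L2norm_eq[OF domain_sets] L2normv_eq[OF domain_sets])
qed

lemma H10g_lincomb:
  assumes "H10g \<Omega> u g" "H10g \<Omega> v h"
  shows "H10g \<Omega> (\<lambda>x. a * u x + b * v x) (\<lambda>x. a *\<^sub>R g x + b *\<^sub>R h x)"
proof -
  obtain \<phi> where \<phi>0: "\<forall>k. test_fun \<Omega> (\<phi> k)"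
    "(\<lambda>k. nrm M (\<lambda>x. \<phi> k x - u x)) \<longlonglongrightarrow> 0" "(\<lambda>k. nrm M (\<lambda>x. grad (\<phi> k) x - g x)) \<longlonglongrightarrow> 0"
    by (rule H10g_approx[OF assms(1)]) (rule that)
  note \<phi> = \<phi>0(1)[rule_format] \<phi>0(2,3)
  obtain \<psi> where \<psi>0: "\<forall>k. test_fun \<Omega> (\<psi> k)"
    "(\<lambda>k. nrm M (\<lambda>x. \<psi> k x - v x)) \<longlonglongrightarrow> 0" "(\<lambda>k. nrm M (\<lambda>x. grad (\<psi> k) x - h x)) \<longlonglongrightarrow> 0"
    by (rule H10g_approx[OF assms(2)]) (rule that)
  note \<psi> = \<psi>0(1)[rule_format] \<psi>0(2,3)
  note s = H10g_sqi[OF assms(1)] H10g_sqi[OF assms(2)]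
  have lim: "(\<lambda>k. nrm M (\<lambda>x. (a *\<^sub>R f k x + b *\<^sub>R f' k x) - (a *\<^sub>R w x + b *\<^sub>R w' x))) \<longlonglongrightarrow> 0"
    if sq: "\<And>k. sqi M (f k)" "\<And>k. sqi M (f' k)" "sqi M w" "sqi M w'"
      and l: "(\<lambda>k. nrm M (\<lambda>x. f k x - w x)) \<longlonglongrightarrow> 0" "(\<lambda>k. nrm M (\<lambda>x. f' k x - w' x)) \<longlonglongrightarrow> 0"
    for f f' :: "nat \<Rightarrow> 'a \<Rightarrow> 'b::euclidean_space" and w w'
  proof (rule Lim_null_comparison)
    show "(\<lambda>k. \<bar>a\<bar> * nrm M (\<lambda>x. f k x - w x) + \<bar>b\<bar> * nrm M (\<lambda>x. f' k x - w' x)) \<longlonglongrightarrow> 0"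
      using tendsto_add[OF tendsto_mult_left[OF l(1), of "\<bar>a\<bar>"] tendsto_mult_left[OF l(2), of "\<bar>b\<bar>"]] by simp
    have "(\<lambda>x. (a *\<^sub>R f k x + b *\<^sub>R f' k x) - (a *\<^sub>R w x + b *\<^sub>R w' x)) =
        (\<lambda>x. a *\<^sub>R (f k x - w x) + b *\<^sub>R (f' k x - w' x))" for k
      by (simp add: algebra_simps)
    then have "nrm M (\<lambda>x. (a *\<^sub>R f k x + b *\<^sub>R f' k x) - (a *\<^sub>R w x + b *\<^sub>R w' x)) \<le>
      \<bar>a\<bar> * nrm M (\<lambda>x. f k x - w x) + \<bar>b\<bar> * nrm M (\<lambda>x. f' k x - w' x)" for k
      using nrm_triangle[OF sqi_scaleR[OF sqi_diff[OF sq(1,3)]] sqi_scaleR[OF sqi_diff[OF sq(2,4)]], of a k b k]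
      by (simp add: nrm_scaleR)
    then show "\<forall>\<^sub>F k in sequentially. norm (nrm M (\<lambda>x. (a *\<^sub>R f k x + b *\<^sub>R f' k x) - (a *\<^sub>R w x + b *\<^sub>R w' x))) \<le>
      \<bar>a\<bar> * nrm M (\<lambda>x. f k x - w x) + \<bar>b\<bar> * nrm M (\<lambda>x. f' k x - w' x)" by simp
  qed
  have g: "grad (\<lambda>x. a * \<phi> k x + b * \<psi> k x) x = a *\<^sub>R grad (\<phi> k) x + b *\<^sub>R grad (\<psi> k) x" for k x
    using \<phi>(1)[of k] \<psi>(1)[of k] by (simp add: grad_add grad_cmult smooth_fun_cmult test_fun_smooth)
  show ?thesis
  proof (rule H10gI[where \<phi>="\<lambda>k x. a * \<phi> k x + b * \<psi> k x"])
    show "sqi M (\<lambda>x. a * u x + b * v x)" using sqi_add[OF sqi_scaleR[OF s(1), of a] sqi_scaleR[OF s(3), of b]] by simp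
    show "sqi M (\<lambda>x. a *\<^sub>R g x + b *\<^sub>R h x)" by (intro sqi_add sqi_scaleR s)
    show "test_fun \<Omega> (\<lambda>x. a * \<phi> k x + b * \<psi> k x)" for k by (intro test_fun_add test_fun_cmult \<phi> \<psi>)
    show "(\<lambda>k. nrm M (\<lambda>x. a * \<phi> k x + b * \<psi> k x - (a * u x + b * v x))) \<longlonglongrightarrow> 0"
      using lim[of \<phi> \<psi> u v] \<phi> \<psi> s test_sqi by simp
    show "(\<lambda>k. nrm M (\<lambda>x. grad (\<lambda>x. a * \<phi> k x + b * \<psi> k x) x - (a *\<^sub>R g x + b *\<^sub>R h x))) \<longlonglongrightarrow> 0"
      unfolding g using lim[of "\<lambda>k. grad (\<phi> k)" "\<lambda>k. grad (\<psi> k)" g h] \<phi> \<psi> s test_sqi by simp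
  qed
qed

lemma H10g_weak_div:
  assumes v: "H10g \<Omega> v g" and \<tau>: "has_weak_div \<Omega> \<tau> d"
  shows "ip M \<tau> g = - ip M d v"
proof -
  obtain \<phi> where \<phi>0: "\<forall>k. test_fun \<Omega> (\<phi> k)"
    "(\<lambda>k. nrm M (\<lambda>x. \<phi> k x - v x)) \<longlonglongrightarrow> 0" "(\<lambda>k. nrm M (\<lambda>x. grad (\<phi> k) x - g x)) \<longlonglongrightarrow> 0"
    by (rule H10g_approx[OF v]) (rule that)
  note \<phi> = \<phi>0(1)[rule_format] \<phi>0(2,3)
  have s: "sqi M \<tau>" "sqi M d" using \<tau> by (auto simp: has_weak_div_iff)
  have "(\<lambda>k. ip M (grad (\<phi> k)) \<tau>) \<longlonglongrightarrow> ip M g \<tau>"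
    by (rule ip_tendsto[OF test_sqi(2)[OF \<phi>(1)] H10g_sqi(2)[OF v] s(1) \<phi>(3)])
  moreover have "(\<lambda>k. - ip M (\<phi> k) d) \<longlonglongrightarrow> - ip M v d"
    by (intro tendsto_minus ip_tendsto test_sqi \<phi> H10g_sqi[OF v] s)
  moreover have "ip M (grad (\<phi> k)) \<tau> = - ip M (\<phi> k) d" for k
    using \<tau> \<phi>(1)[of k] by (simp add: has_weak_div_iff ip_commute)
  ultimately have "ip M g \<tau> = - ip M v d" using LIMSEQ_unique by fastforce
  then show ?thesis by (simp add: ip_commute)
qed

text \<open>The smooth approximations have gradients bounded by \<open>L\<close> that are eventually
  equal to \<open>g\<close> at almost every point, so dominated convergence yields convergence in
  the H1 norm. Through this lemma conforming piecewise affine functions enter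
  \<open>H10\<close>.\<close>

lemma lipschitz_H10g:
  assumes w: "L-lipschitz_on UNIV w" and L: "0 < L" and w0: "\<And>x. x \<notin> \<Omega> \<Longrightarrow> w x = 0"
    and N: "negligible N" and g: "g \<in> borel_measurable M"
    and aff: "\<And>x. x \<in> \<Omega> - N \<Longrightarrow> \<exists>r>0. \<forall>y\<in>ball x r. w y = w x + g x \<bullet> (y - x)"
  shows "H10g \<Omega> w g"
proof -
  \<comment> \<open>At points of \<open>Z\<close> thresholding destroys the gradient for every
    \<delta>. Locally they lie on one level hyperplane of \<open>w\<close>, so \<open>Z\<close> is
    null.\<close>
  define Z where "Z = {x \<in> \<Omega> - N. w x = 0 \<and> g x \<noteq> 0}"
  have Z: "negligible Z"
  proof (rule locally_negligible_alt[THEN iffD2], rule ballI)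
    fix x assume x: "x \<in> Z"
    then obtain r where r: "r > 0" "\<And>y. y \<in> ball x r \<Longrightarrow> w y = w x + g x \<bullet> (y - x)"
      using aff[of x] by (auto simp: Z_def)
    have "Z \<inter> ball x r \<subseteq> {y. g x \<bullet> y = g x \<bullet> x}"
    proof
      fix y assume y: "y \<in> Z \<inter> ball x r"
      then have "w y = 0" "w x = 0" using x by (auto simp: Z_def)
      then show "y \<in> {y. g x \<bullet> y = g x \<bullet> x}" using r(2)[of y] y by (simp add: inner_diff_right)
    qed
    moreover have "negligible {y. g x \<bullet> y = g x \<bullet> x}"
      using x by (intro negligible_hyperplane) (simp add: Z_def)
    ultimately have "negligible (Z \<inter> ball x r)" using negligible_subset by blast
    then show "\<exists>U. openin (top_of_set Z) U \<and> x \<in> U \<and> negligible U"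
      using x r(1) by (intro exI[of _ "Z \<inter> ball x r"]) (auto intro: openin_open_Int)
  qed
  define \<delta> where "\<delta> k = inverse (real (Suc k))" for k
  have \<delta>: "\<delta> k > 0" for k by (simp add: \<delta>_def)
  have \<delta>0: "\<delta> \<longlonglongrightarrow> 0" unfolding \<delta>_def by (rule LIMSEQ_inverse_real_of_nat)
  have "\<exists>\<phi>. test_fun \<Omega> \<phi> \<and> (\<forall>x. \<bar>\<phi> x - w x\<bar> \<le> 2 * \<delta> k) \<and> L-lipschitz_on UNIV \<phi> \<and>
     (\<forall>x r g. (\<forall>y\<in>ball x r. w y = w x + g \<bullet> (y - x)) \<longrightarrow> \<delta> k / (2 * L) < r \<longrightarrow>
        (\<forall>y\<in>ball x r. w y > \<delta> k) \<or> (\<forall>y\<in>ball x r. w y < - \<delta> k) \<or> (g = 0 \<and> w x = 0) \<longrightarrow> grad \<phi> x = g)" for k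
    by (rule smooth_approximation[OF op bd w w0 L \<delta>[of k]]) blast+
  then obtain \<phi> where \<phi>: "\<And>k. test_fun \<Omega> (\<phi> k)" "\<And>k x. \<bar>\<phi> k x - w x\<bar> \<le> 2 * \<delta> k" "\<And>k. L-lipschitz_on UNIV (\<phi> k)"
    and gr: "\<And>k x r g. (\<forall>y\<in>ball x r. w y = w x + g \<bullet> (y - x)) \<Longrightarrow> \<delta> k / (2 * L) < r \<Longrightarrow>
        (\<forall>y\<in>ball x r. w y > \<delta> k) \<or> (\<forall>y\<in>ball x r. w y < - \<delta> k) \<or> (g = 0 \<and> w x = 0) \<Longrightarrow> grad (\<phi> k) x = g"
    by metis
  have lim: "(\<lambda>k. grad (\<phi> k) x) \<longlonglongrightarrow> g x" if x: "x \<in> \<Omega> - N - Z" for x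
  proof -
    obtain r where r: "r > 0" "\<forall>y\<in>ball x r. w y = w x + g x \<bullet> (y - x)"
      using aff[of x] x by auto
    have cw: "continuous (at x) w"
      using lipschitz_on_continuous_on[OF w] by (simp add: continuous_on_eq_continuous_at)
    \<comment> \<open>Either \<open>w\<close> keeps one sign and a positive distance from 0 near x,
      and \<open>\<delta> k\<close> drops below that distance, or both \<open>w x\<close> and
      \<open>g x\<close> are 0.\<close>
    have "\<exists>r'>0. r' \<le> r \<and> (\<forall>\<^sub>F k in sequentially.
        (\<forall>y\<in>ball x r'. w y > \<delta> k) \<or> (\<forall>y\<in>ball x r'. w y < - \<delta> k) \<or> (g x = 0 \<and> w x = 0))"
    proof (cases "w x = 0")
      case True
      then have "g x = 0" using x by (auto simp: Z_def)
      with True r(1) show ?thesis by auto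
    next
      case False
      define a where "a = \<bar>w x\<bar> / 2"
      have a: "a > 0" using False by (simp add: a_def)
      obtain s where s: "s > 0" "\<And>y. dist y x < s \<Longrightarrow> \<bar>w y - w x\<bar> < a"
        using cw a unfolding continuous_at_eps_delta dist_real_def by blast
      have ev: "\<forall>\<^sub>F k in sequentially. \<delta> k < a" using order_tendstoD(2)[OF \<delta>0 a] .
      have "\<forall>\<^sub>F k in sequentially. (\<forall>y\<in>ball x (min r s). w y > \<delta> k) \<or> (\<forall>y\<in>ball x (min r s). w y < - \<delta> k)"
        using ev
      proof eventually_elim
        case (elim k)
        have b: "\<bar>w y - w x\<bar> < a" if "y \<in> ball x (min r s)" for y
          using s(2)[of y] that by (simp add: dist_commute)
        show ?case
        proof (cases "w x > 0")
          case True
          have "w y > \<delta> k" if "y \<in> ball x (min r s)" for y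
            using b[OF that] elim True unfolding a_def by linarith
          then show ?thesis by blast
        next
          case False
          have "w y < - \<delta> k" if "y \<in> ball x (min r s)" for y
            using b[OF that] elim False unfolding a_def by linarith
          then show ?thesis by blast
        qed
      qed
      then show ?thesis using r(1) s(1)
        by (intro exI[of _ "min r s"]) (auto elim: eventually_mono)
    qed
    then obtain r' where r': "r' > 0" "r' \<le> r" and ev: "\<forall>\<^sub>F k in sequentially.
        (\<forall>y\<in>ball x r'. w y > \<delta> k) \<or> (\<forall>y\<in>ball x r'. w y < - \<delta> k) \<or> (g x = 0 \<and> w x = 0)" by blast
    have "\<forall>\<^sub>F k in sequentially. \<delta> k < r' * (2 * L)"
      by (rule order_tendstoD(2)[OF \<delta>0]) (use r'(1) L in simp)
    with ev have "\<forall>\<^sub>F k in sequentially. grad (\<phi> k) x = g x"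
    proof eventually_elim
      case (elim k)
      have "\<forall>y\<in>ball x r'. w y = w x + g x \<bullet> (y - x)" using r(2) r'(2) by (meson mem_ball order_less_le_trans)
      moreover have "\<delta> k / (2 * L) < r'" using elim(2) L by (simp add: divide_less_eq)
      ultimately show ?case using elim(1) by (rule gr)
    qed
    then show ?thesis by (rule tendsto_eventually)
  qed
  have NZ: "AE x in M. x \<in> \<Omega> - N - Z"
  proof -
    have "AE x in lebesgue. x \<notin> N \<union> Z"
      using N Z by (intro AE_not_in) (simp add: negligible_iff_null_sets[symmetric] negligible_Un)
    then show ?thesis
      using domain_sets by (simp add: AE_restrict_space_iff) (auto elim: eventually_mono)
  qed
  then have glim: "AE x in M. (\<lambda>k. grad (\<phi> k) x) \<longlonglongrightarrow> g x"
    by eventually_elim (rule lim)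
  have gL: "norm (grad (\<phi> k) x) \<le> L" for k x
    by (rule grad_norm_le_lipschitz[OF \<phi>(3) smooth_fun_has_derivative[OF test_fun_smooth[OF \<phi>(1)]]])
  have sw: "sqi M w"
  proof -
    have "compact (closure \<Omega>)" using bd by simp
    moreover have "w x = 0" if "x \<notin> closure \<Omega>" for x using w0 that closure_subset by blast
    ultimately show ?thesis
      by (intro sqi_continuous_compact_support[OF domain_sets lipschitz_on_continuous_on[OF w]])
  qed
  have sg: "sqi M g"
  proof -
    have "AE x in M. norm (g x) \<le> L"
      using glim
    proof eventually_elim
      case (elim x)
      show ?case by (rule LIMSEQ_le_const2[OF tendsto_norm[OF elim]]) (use gL in auto)
    qed
    then have "AE x in M. (if norm (g x) \<le> L then g x else 0) = g x"
      by eventually_elim auto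
    moreover have "sqi M (\<lambda>x. if norm (g x) \<le> L then g x else 0)"
      by (rule sqi_bounded[OF domain_lmeasurable, where B=L]) (use g L in auto)
    ultimately show ?thesis
      using sqi_AE_eq[OF domain_sets] by blast
  qed
  show ?thesis
  proof (rule H10gI[where \<phi>=\<phi>])
    have "compact (closure \<Omega>)" using bd by simp
    obtain K where K: "\<And>x. \<bar>w x\<bar> \<le> K"
    proof -
      have "bounded (w ` closure \<Omega>)"
        by (intro compact_imp_bounded compact_continuous_image continuous_on_subset[OF lipschitz_on_continuous_on[OF w]])
          (use bd in auto)
      then obtain K where "\<And>x. x \<in> closure \<Omega> \<Longrightarrow> \<bar>w x\<bar> \<le> K" by (auto simp: bounded_iff)
      then have "\<bar>w x\<bar> \<le> max K 0" for x
        using w0[of x] closure_subset[of \<Omega>] by (cases "x \<in> \<Omega>") (auto simp: le_max_iff_disj)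
      then show ?thesis using that by blast
    qed
    have wl: "(\<lambda>k. \<phi> k x) \<longlonglongrightarrow> w x" for x
    proof -
      have "(\<lambda>k. \<phi> k x - w x) \<longlonglongrightarrow> 0"
        by (rule Lim_null_comparison[where g="\<lambda>k. 2 * \<delta> k"])
          (use \<phi>(2) tendsto_mult_left[OF \<delta>0, of 2] in auto)
      then show ?thesis by (simp add: LIM_zero_iff)
    qed
    show "(\<lambda>k. nrm M (\<lambda>x. \<phi> k x - w x)) \<longlonglongrightarrow> 0"
    proof (rule nrm_diff_tendsto_0[OF domain_lmeasurable sw test_sqi(1)[OF \<phi>(1)], where B="K + 2"])
      show "norm (\<phi> k x) \<le> K + 2" for k x
      proof -
        have "\<delta> k \<le> 1" by (simp add: \<delta>_def field_simps)
        then show ?thesis using K[of x] \<phi>(2)[of k x] by simp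
      qed
    qed (use wl in simp)
    show "(\<lambda>k. nrm M (\<lambda>x. grad (\<phi> k) x - g x)) \<longlonglongrightarrow> 0"
      by (rule nrm_diff_tendsto_0[OF domain_lmeasurable sg test_sqi(2)[OF \<phi>(1)] gL glim])
  qed (use sw sg \<phi> in auto)
qed

end

section \<open>Uniqueness of weak derivatives, Friedrichs' inequality and the dual norm\<close>

context
  fixes \<Omega> :: "'a::euclidean_space set"
  assumes op: "open \<Omega>" and bd: "bounded \<Omega>"
begin

private abbreviation "N \<equiv> lebesgue_on \<Omega>"

private lemmas dsets = domain_sets[OF op bd]
private lemmas dlm = domain_lmeasurable[OF op bd]

text \<open>The indicator of a compact set is the pointwise limit of Lipschitz cutoffs of its
  distance function, and each cutoff vanishing outside \<Omega> is a uniform limit of test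
  functions.\<close>

lemma integral_compact_zero:
  assumes d: "sqi N d" and z: "\<And>\<phi>. test_fun \<Omega> \<phi> \<Longrightarrow> ip N d \<phi> = 0"
    and C: "compact C" "C \<subseteq> \<Omega>"
  shows "ip N d (indicator C) = 0"
proof (cases "C = {}")
  case False
  define w where "w k x = max 0 (1 - real (Suc k) * infdist x C)" for k x
  obtain e where e: "e > 0" "\<And>x y. x \<in> C \<Longrightarrow> y \<in> - \<Omega> \<Longrightarrow> e \<le> dist x y"
  proof -
    have "C \<inter> - \<Omega> = {}" using C by auto
    from separate_compact_closed[OF C(1) _ this] op show ?thesis
      using that by (auto simp: closed_Compl)
  qed
  have wlip: "(real (Suc k))-lipschitz_on UNIV (w k)" for k
  proof (rule lipschitz_onI)
    show "dist (w k x) (w k y) \<le> real (Suc k) * dist x y" for x y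
    proof -
      have "\<bar>infdist x C - infdist y C\<bar> \<le> dist x y"
        by (metis abs_le_iff diff_le_eq dist_commute infdist_triangle le_diff_eq minus_diff_eq add.commute)
      then have B: "real (Suc k) * \<bar>infdist x C - infdist y C\<bar> \<le> real (Suc k) * dist x y"
        by (intro mult_left_mono) auto
      have "\<bar>w k x - w k y\<bar> \<le> \<bar>real (Suc k) * infdist x C - real (Suc k) * infdist y C\<bar>"
      proof -
        have "\<bar>max 0 (1 - a) - max 0 (1 - b)\<bar> \<le> \<bar>a - b\<bar>" for a b :: real by (simp add: max_def abs_if)
        then show ?thesis unfolding w_def .
      qed
      also have "\<dots> = real (Suc k) * \<bar>infdist x C - infdist y C\<bar>"
        by (simp only: right_diff_distrib[symmetric] abs_mult abs_of_nat)
      finally show ?thesis using B by (simp only: dist_real_def)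
    qed
  qed simp
  have wmeas: "w k \<in> borel_measurable N" for k
    by (rule continuous_imp_measurable_on_sets_lebesgue[OF _ dsets])
      (rule continuous_on_subset[OF lipschitz_on_continuous_on[OF wlip]], simp)
  have w01: "0 \<le> w k x" "w k x \<le> 1" for k x
    by (simp_all add: w_def infdist_nonneg)
  \<comment> \<open>From index \<open>K\<close> on the cutoff vanishes outside \<Omega>, whose
    complement keeps distance at least \<open>e\<close> from \<open>C\<close>.\<close>
  obtain K where K: "real (Suc K) * e > 1" using ex_less_of_nat_mult[OF e(1), of 1]
    by (metis e(1) less_trans mult_less_cancel_right_pos of_nat_less_iff lessI)
  have w0: "w k x = 0" if "K \<le> k" "x \<notin> \<Omega>" for k x
  proof -
    have "e \<le> infdist x C"
      unfolding infdist_notempty[OF False]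
      by (rule cINF_greatest[OF False]) (use e(2) that in \<open>simp add: dist_commute\<close>)
    then have "real (Suc K) * e \<le> real (Suc k) * infdist x C"
      using that e(1) by (intro mult_mono) auto
    then show ?thesis using K by (simp add: w_def)
  qed
  have wt: "ip N d (w k) = 0" if k: "K \<le> k" for k
  proof -
    have "\<exists>\<phi>. test_fun \<Omega> \<phi> \<and> (\<forall>x. \<bar>\<phi> x - w k x\<bar> \<le> 2 * inverse (real (Suc j)))" for j
      by (rule smooth_approximation[OF op bd wlip w0[OF k], of "inverse (real (Suc j))"]) auto
    then obtain \<phi> where \<phi>: "\<And>j. test_fun \<Omega> (\<phi> j)" "\<And>j x. \<bar>\<phi> j x - w k x\<bar> \<le> 2 * inverse (real (Suc j))"
      by metis
    have lim: "(\<lambda>j. 2 * inverse (real (Suc j))) \<longlonglongrightarrow> 0"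
      using tendsto_mult_left[OF LIMSEQ_inverse_real_of_nat, of 2] by simp
    have sw: "sqi N (w k)"
      by (rule sqi_bounded[OF dlm, where B=1])
        (use w01 wmeas in auto)
    have "(\<lambda>j. nrm N (\<lambda>x. \<phi> j x - w k x)) \<longlonglongrightarrow> 0"
    proof (rule nrm_diff_tendsto_0[OF dlm sw test_sqi(1)[OF op bd \<phi>(1)], where B=3])
      show "norm (\<phi> j x) \<le> 3" for j x
      proof -
        have "inverse (real (Suc j)) \<le> 1" by (simp add: field_simps)
        then show ?thesis using \<phi>(2)[of j x] w01[of k x] by simp
      qed
      have "(\<lambda>j. \<phi> j x - w k x) \<longlonglongrightarrow> 0" for x
        by (rule Lim_null_comparison[OF _ lim]) (use \<phi>(2) in simp)
      then show "AE x in N. (\<lambda>j. \<phi> j x) \<longlonglongrightarrow> w k x" by (simp add: LIM_zero_iff)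
    qed
    then have "(\<lambda>j. ip N (\<phi> j) d) \<longlonglongrightarrow> ip N (w k) d"
      by (rule ip_tendsto[OF test_sqi(1)[OF op bd \<phi>(1)] sw d])
    moreover have "ip N (\<phi> j) d = 0" for j using z[OF \<phi>(1)] by (simp add: ip_commute)
    ultimately have "ip N (w k) d = 0" using LIMSEQ_unique[OF _ tendsto_const] by simp
    then show ?thesis by (simp add: ip_commute)
  qed
  have lim: "(\<lambda>k. w (k + K) x) \<longlonglongrightarrow> indicator C x" for x
  proof (cases "x \<in> C")
    case True
    then show ?thesis by (simp add: w_def)
  next
    case False
    then have "infdist x C > 0"
      using C \<open>C \<noteq> {}\<close> by (metis compact_imp_closed in_closed_iff_infdist_zero infdist_nonneg less_eq_real_def)
    then obtain k0 where k0: "real k0 * infdist x C > 1" using ex_less_of_nat_mult by blast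
    have "\<forall>\<^sub>F k in sequentially. w (k + K) x = 0"
      using eventually_ge_at_top[of k0]
    proof eventually_elim
      case (elim k)
      have "real k0 * infdist x C \<le> real (Suc (k + K)) * infdist x C"
        using elim by (intro mult_right_mono) (auto simp: infdist_nonneg)
      then show ?case using k0 by (simp add: w_def)
    qed
    then show ?thesis using False by (simp add: tendsto_eventually)
  qed
  have "(\<lambda>k. \<integral>x. w (k + K) x * d x \<partial>N) \<longlonglongrightarrow> (\<integral>x. indicator C x * d x \<partial>N)"
  proof (rule integral_dominated_convergence[where w="\<lambda>x. norm (d x)"])
    have cst: "sqi N (\<lambda>x. 1::real)"
      by (rule sqi_bounded[OF dlm, where B=1]) auto
    show "integrable N (\<lambda>x. norm (d x))"
      using sqi_integrable_ip[OF cst d] by (simp add: integrable_norm_iff[symmetric])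
    show "AE x in N. norm (w (k + K) x * d x) \<le> norm (d x)" for k
      using w01 by (auto simp: abs_mult intro!: mult_left_le_one_le)
    show "AE x in N. (\<lambda>k. w (k + K) x * d x) \<longlonglongrightarrow> indicator C x * d x"
      by (intro AE_I2 tendsto_intros lim)
    have "C \<in> sets N"
      using lmeasurable_compact[OF C(1)] C(2) dsets by (simp add: sets_restrict_space_iff fmeasurableD)
    then have ic: "(indicator C :: 'a \<Rightarrow> real) \<in> borel_measurable N" by (rule borel_measurable_indicator)
    have dm: "d \<in> borel_measurable N" using d by (simp add: sqi_def)
    show "(\<lambda>x. indicator C x * d x) \<in> borel_measurable N"
      by (rule borel_measurable_times[OF ic dm])
    show "(\<lambda>x. w (k + K) x * d x) \<in> borel_measurable N" for k
      by (rule borel_measurable_times[OF wmeas dm])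
  qed
  moreover have "(\<integral>x. w (k + K) x * d x \<partial>N) = 0" for k
    using wt[of "k + K"] by (simp add: ip_def mult.commute)
  ultimately have "(\<integral>x. indicator C x * d x \<partial>N) = 0"
    using LIMSEQ_unique[OF _ tendsto_const] by simp
  then show ?thesis by (simp add: ip_def mult.commute)
qed (simp add: ip_def)

text \<open>If \<open>d\<close> were positive on a set of positive measure, inner regularity would
  give a compact subset of positive measure, over which the integral of \<open>d\<close> is both
  positive and 0.\<close>

lemma fundamental_lemma_nonpos:
  assumes d: "sqi N d" and z: "\<And>\<phi>. test_fun \<Omega> \<phi> \<Longrightarrow> ip N d \<phi> = 0"
  shows "AE x in N. d x \<le> 0"
proof (rule ccontr)
  assume n: "\<not> (AE x in N. d x \<le> 0)"
  define P where "P = {x \<in> \<Omega>. d x > 0}"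
  have Ps: "P \<in> sets lebesgue"
  proof -
    have [measurable]: "d \<in> borel_measurable N" using d by (simp add: sqi_def)
    have "{x \<in> space N. d x > 0} \<in> sets N" by measurable
    then show ?thesis using dsets by (simp add: P_def sets_restrict_space_iff)
  qed
  have "P \<subseteq> \<Omega>" by (auto simp: P_def)
  then have Plm: "P \<in> lmeasurable" using Ps dlm fmeasurable_Int_fmeasurable by (metis Int_absorb1 inf_commute)
  have "measure lebesgue P \<noteq> 0"
  proof
    assume "measure lebesgue P = 0"
    then have "P \<in> null_sets lebesgue" using Plm Ps by (simp add: null_sets_def emeasure_eq_measure2)
    then have "AE x in lebesgue. x \<notin> P" by (rule AE_not_in)
    then have "AE x in N. d x \<le> 0"
      using dsets by (simp add: AE_restrict_space_iff P_def) (auto elim: eventually_mono)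
    with n show False ..
  qed
  then have pos: "measure lebesgue P > 0" by (simp add: zero_less_measure_iff)
  obtain C where C: "closed C" "C \<subseteq> P" "P - C \<in> lmeasurable" "emeasure lebesgue (P - C) < ennreal (measure lebesgue P)"
    using sets_lebesgue_inner_closed[OF Ps pos] by metis
  have Cc: "compact C" using C bd \<open>P \<subseteq> \<Omega>\<close> by (meson bounded_subset compact_eq_bounded_closed order_trans)
  then have Clm: "C \<in> lmeasurable" by (simp add: lmeasurable_compact)
  have "measure lebesgue (P - C) < measure lebesgue P"
    using C(3,4) by (simp add: emeasure_eq_measure2 ennreal_less_iff)
  then have Cpos: "measure lebesgue C > 0"
    using measurable_measure_Diff[OF Plm _ C(2)] Clm by (simp add: fmeasurableD)
  have "(\<integral>x. indicator C x * d x \<partial>N) = 0"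
    using integral_compact_zero[OF d z Cc] C(2) \<open>P \<subseteq> \<Omega>\<close> by (simp add: ip_def mult.commute)
  moreover have "integrable N (\<lambda>x. indicator C x * d x)"
  proof -
    have "C \<in> sets N" using Clm C(2) \<open>P \<subseteq> \<Omega>\<close> dsets by (auto simp: sets_restrict_space_iff fmeasurableD)
    then have "sqi N (indicator C :: 'a \<Rightarrow> real)"
      by (intro sqi_bounded[OF dlm, where B=1]) (auto simp: indicator_def[abs_def])
    from sqi_integrable_ip[OF this d] show ?thesis by simp
  qed
  moreover have "AE x in N. 0 \<le> indicator C x * d x"
    by (rule AE_I2) (use C(2) in \<open>auto simp: indicator_def P_def less_imp_le\<close>)
  ultimately have "AE x in N. indicator C x * d x = 0"
    using integral_nonneg_eq_0_iff_AE by blast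
  then have "AE x in N. x \<notin> C"
    by (rule eventually_mono) (use C(2) in \<open>auto simp: P_def indicator_def split: if_splits\<close>)
  then have "AE x in lebesgue. x \<notin> C"
    using dsets C(2) \<open>P \<subseteq> \<Omega>\<close> by (simp add: AE_restrict_space_iff) (auto elim: eventually_mono)
  then have "C \<in> null_sets lebesgue"
    using Clm by (simp add: AE_iff_null_sets fmeasurableD)
  then show False using Cpos by (simp add: measure_eq_0_null_sets)
qed

lemma fundamental_lemma:
  assumes d: "sqi N d" and z: "\<And>\<phi>. test_fun \<Omega> \<phi> \<Longrightarrow> ip N d \<phi> = 0"
  shows "AE x in N. d x = 0"
proof -
  have "AE x in N. d x \<le> 0" by (rule fundamental_lemma_nonpos[OF d z])
  moreover have "AE x in N. (-1) *\<^sub>R d x \<le> 0"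
    by (rule fundamental_lemma_nonpos[OF sqi_scaleR[OF d]]) (use z ip_scaleR_left[of N "-1" d] in simp)
  ultimately show ?thesis by eventually_elim simp
qed

lemma weak_grad_unique:
  assumes "has_weak_grad \<Omega> u g" "has_weak_grad \<Omega> u h"
  shows "AE x in N. g x = h x"
proof -
  have s: "sqi N g" "sqi N h" using assms by (auto simp: has_weak_grad_iff[OF op bd])
  have "AE x in N. (g x - h x) \<bullet> i = 0" if i: "i \<in> Basis" for i
  proof (rule fundamental_lemma)
    show "sqi N (\<lambda>x. (g x - h x) \<bullet> i)" by (intro sqi_inner[OF op bd] sqi_diff s)
    show "ip N (\<lambda>x. (g x - h x) \<bullet> i) \<phi> = 0" if \<phi>: "test_fun \<Omega> \<phi>" for \<phi>
    proof -
      have "ip N (\<lambda>x. g x \<bullet> i) \<phi> = ip N (\<lambda>x. h x \<bullet> i) \<phi>"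
        using assms \<phi> i unfolding has_weak_grad_iff[OF op bd] by (metis neg_equal_iff_equal)
      then show ?thesis
        using ip_diff_left[OF sqi_inner[OF op bd s(1), of i] sqi_inner[OF op bd s(2), of i] test_sqi(1)[OF op bd \<phi>]]
        by (simp add: inner_diff_left)
    qed
  qed
  then have "AE x in N. \<forall>i\<in>Basis. (g x - h x) \<bullet> i = 0"
    by (subst AE_ball_countable) (auto intro: countable_finite)
  then show ?thesis
    by eventually_elim (auto simp: euclidean_eq_iff[where 'a='a] inner_diff_left)
qed

lemma weak_div_unique:
  assumes "has_weak_div \<Omega> \<tau> d" "has_weak_div \<Omega> \<tau> e"
  shows "AE x in N. d x = e x"
proof -
  have s: "sqi N d" "sqi N e" using assms by (auto simp: has_weak_div_iff[OF op bd])
  have "AE x in N. d x - e x = 0"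
  proof (rule fundamental_lemma[OF sqi_diff[OF s]])
    show "ip N (\<lambda>x. d x - e x) \<phi> = 0" if \<phi>: "test_fun \<Omega> \<phi>" for \<phi>
      using assms \<phi> unfolding ip_diff_left[OF s test_sqi(1)[OF op bd \<phi>]] has_weak_div_iff[OF op bd] by fastforce
  qed
  then show ?thesis by simp
qed

lemma wdiv_eq:
  assumes "has_weak_div \<Omega> \<tau> d"
  shows "has_weak_div \<Omega> \<tau> (wdiv \<Omega> \<tau>)" "AE x in N. wdiv \<Omega> \<tau> x = d x"
proof -
  show "has_weak_div \<Omega> \<tau> (wdiv \<Omega> \<tau>)"
    unfolding wdiv_def by (rule someI[of "has_weak_div \<Omega> \<tau>", OF assms])
  then show "AE x in N. wdiv \<Omega> \<tau> x = d x" using assms by (rule weak_div_unique)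
qed

lemma wgrad_eq:
  assumes "has_weak_grad \<Omega> u g"
  shows "has_weak_grad \<Omega> u (wgrad \<Omega> u)" "AE x in N. wgrad \<Omega> u x = g x"
proof -
  show "has_weak_grad \<Omega> u (wgrad \<Omega> u)"
    unfolding wgrad_def by (rule someI[of "has_weak_grad \<Omega> u", OF assms])
  then show "AE x in N. wgrad \<Omega> u x = g x" using assms by (rule weak_grad_unique)
qed

lemma H1norm_eq: assumes "has_weak_grad \<Omega> u g" shows "H1norm \<Omega> u = nrm N g"
  unfolding H1norm_def L2normv_eq[OF dsets]
  by (rule nrm_cong_AE) (use wgrad_eq[OF assms] assms in \<open>auto simp: has_weak_grad_iff[OF op bd] sqi_def\<close>)

lemma H10g_weak_grad: "H10g \<Omega> u g \<Longrightarrow> has_weak_grad \<Omega> u g"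
  by (simp add: H10g_def)

text \<open>One coordinate suffices: integration by parts against
  \<open>(x \<bullet> i) * \<phi> x\<close> gives the squared norm of \<phi> as -2 times the pairing
  of that product with the i-th partial derivative. The factor \<open>2 * R\<close> arises from
  \<open>\<bar>x \<bullet> i\<bar> \<le> R\<close>.\<close>

lemma test_fun_friedrichs:
  assumes \<phi>: "test_fun \<Omega> \<phi>" and R: "\<Omega> \<subseteq> cball 0 R"
  shows "nrm N \<phi> \<le> 2 * R * nrm N (grad \<phi>)"
proof (cases "nrm N \<phi> = 0 \<or> \<Omega> = {}")
  case False
  then obtain x0 where "x0 \<in> \<Omega>" by blast
  then have "norm x0 \<le> R" using R by auto
  then have Rnn: "R \<ge> 0" using norm_ge_zero[of x0] by linarith
  obtain i :: 'a where i: "i \<in> Basis" using nonempty_Basis by blast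
  note sm = test_fun_smooth[OF \<phi>]
  have D: "((\<lambda>x. (x \<bullet> i) * \<phi> x) has_derivative (\<lambda>h. (\<phi> x *\<^sub>R i + (x \<bullet> i) *\<^sub>R grad \<phi> x) \<bullet> h)) (at x)" for x
    by (rule has_derivative_eq_rhs, rule has_derivative_mult[OF _ smooth_fun_has_derivative[OF sm]])
      (auto intro!: derivative_eq_intros simp: inner_add_left inner_add_right inner_commute algebra_simps)
  have "continuous_on UNIV (\<lambda>x. \<phi> x *\<^sub>R i + (x \<bullet> i) *\<^sub>R grad \<phi> x)"
    by (intro continuous_intros smooth_fun_continuous smooth_fun_grad_continuous sm)
  from integration_by_parts_test[OF dsets \<phi> D this, of i]
  have eq: "(\<integral>x. (x \<bullet> i) * \<phi> x * (grad \<phi> x \<bullet> i) \<partial>N) = - (\<integral>x. (\<phi> x + (x \<bullet> i) * (grad \<phi> x \<bullet> i)) * \<phi> x \<partial>N)"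
    using i by (simp add: inner_add_left inner_Basis)
  define b where "b = (\<lambda>x. (x \<bullet> i) * \<phi> x)"
  have bb: "\<bar>x \<bullet> i\<bar> \<le> R" if "x \<in> \<Omega>" for x
  proof -
    have "norm x \<le> R" using R that by auto
    then show ?thesis using Basis_le_norm[OF i, of x] by linarith
  qed
  obtain C where C: "compact C" "\<And>x. x \<notin> C \<Longrightarrow> \<phi> x = 0"
    by (rule test_fun_support[OF \<phi>]) (rule that; assumption)
  have sb: "sqi N b" unfolding b_def
    by (rule sqi_continuous_compact_support[OF dsets _ C(1)])
      (use C in \<open>auto intro!: continuous_intros smooth_fun_continuous[OF sm]\<close>)
  note s\<phi> = test_sqi[OF op bd \<phi>]
  note sg = sqi_inner[OF op bd s\<phi>(2), of i]
  have "ip N b (\<lambda>x. grad \<phi> x \<bullet> i) = - (ip N \<phi> \<phi> + ip N b (\<lambda>x. grad \<phi> x \<bullet> i))"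
  proof -
    have "(\<integral>x. (\<phi> x + (x \<bullet> i) * (grad \<phi> x \<bullet> i)) * \<phi> x \<partial>N) = (\<integral>x. \<phi> x \<bullet> \<phi> x + b x \<bullet> (grad \<phi> x \<bullet> i) \<partial>N)"
      by (rule Bochner_Integration.integral_cong) (simp_all add: b_def algebra_simps)
    also have "\<dots> = ip N \<phi> \<phi> + ip N b (\<lambda>x. grad \<phi> x \<bullet> i)"
      unfolding ip_def by (intro Bochner_Integration.integral_add sqi_integrable_ip s\<phi> sb sg)
    finally show ?thesis using eq by (simp add: ip_def b_def)
  qed
  then have "(nrm N \<phi>)\<^sup>2 = - 2 * ip N b (\<lambda>x. grad \<phi> x \<bullet> i)" by (simp add: nrm_power2)
  also have "\<dots> \<le> 2 * (nrm N b * nrm N (\<lambda>x. grad \<phi> x \<bullet> i))"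
    using ip_cauchy_schwarz[OF sb sg] by linarith
  also have "\<dots> \<le> 2 * ((R * nrm N \<phi>) * nrm N (grad \<phi>))"
  proof -
    have "nrm N b \<le> nrm N (\<lambda>x. R *\<^sub>R \<phi> x)"
      unfolding nrm_def
    proof (rule real_sqrt_le_mono, rule integral_mono_AE)
      have "AE x in N. x \<in> \<Omega>" by (metis AE_space space_lebesgue_on)
      then show "AE x in N. (norm (b x))\<^sup>2 \<le> (norm (R *\<^sub>R \<phi> x))\<^sup>2"
      proof eventually_elim
        case (elim x)
        then show ?case using bb[OF elim] by (intro power_mono) (auto simp: b_def abs_mult mult_right_mono)
      qed
    qed (use sb sqi_scaleR[OF s\<phi>(1), of R] in \<open>auto simp: sqi_def\<close>)
    then have 1: "nrm N b \<le> R * nrm N \<phi>" using Rnn by (simp only: nrm_scaleR abs_of_nonneg)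
    have 2: "nrm N (\<lambda>x. grad \<phi> x \<bullet> i) \<le> nrm N (grad \<phi>)"
      unfolding nrm_def
    proof (rule real_sqrt_le_mono, rule integral_mono_AE)
      show "AE x in N. (norm (grad \<phi> x \<bullet> i))\<^sup>2 \<le> (norm (grad \<phi> x))\<^sup>2"
        using Basis_le_norm[OF i] by (intro AE_I2 power_mono) auto
    qed (use sg s\<phi> in \<open>auto simp: sqi_def\<close>)
    show ?thesis using 1 2 Rnn by (intro mult_left_mono mult_mono) auto
  qed
  finally have "nrm N \<phi> * nrm N \<phi> \<le> nrm N \<phi> * (2 * R * nrm N (grad \<phi>))"
    by (simp add: power2_eq_square algebra_simps)
  then show ?thesis using False by (simp add: mult_le_cancel_left less_le)
next
  case True
  then show ?thesis
  proof
    assume z: "nrm N \<phi> = 0"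
    show ?thesis
    proof (cases "\<Omega> = {}")
      case True then show ?thesis by (simp add: nrm_def)
    next
      case False
      then obtain x0 where "x0 \<in> \<Omega>" by blast
      then have "norm x0 \<le> R" using R by auto
      then have "R \<ge> 0" using norm_ge_zero[of x0] by linarith
      then show ?thesis using z by simp
    qed
  qed (simp add: nrm_def)
qed

lemma H10g_friedrichs:
  assumes u: "H10g \<Omega> u g" and R: "\<Omega> \<subseteq> cball 0 R"
  shows "nrm N u \<le> 2 * R * nrm N g"
proof -
  obtain \<phi> where \<phi>0: "\<forall>k. test_fun \<Omega> (\<phi> k)"
    "(\<lambda>k. nrm N (\<lambda>x. \<phi> k x - u x)) \<longlonglongrightarrow> 0" "(\<lambda>k. nrm N (\<lambda>x. grad (\<phi> k) x - g x)) \<longlonglongrightarrow> 0"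
    by (rule H10g_approx[OF op bd u]) (rule that)
  note \<phi> = \<phi>0(1)[rule_format] \<phi>0(2,3)
  have "(\<lambda>k. nrm N (\<phi> k)) \<longlonglongrightarrow> nrm N u"
    by (rule nrm_tendsto[OF test_sqi(1)[OF op bd \<phi>(1)] H10g_sqi(1)[OF op bd u] \<phi>(2)])
  moreover have "(\<lambda>k. 2 * R * nrm N (grad (\<phi> k))) \<longlonglongrightarrow> 2 * R * nrm N g"
    by (intro tendsto_intros nrm_tendsto[OF test_sqi(2)[OF op bd \<phi>(1)] H10g_sqi(2)[OF op bd u] \<phi>(3)])
  ultimately show ?thesis
    by (rule LIMSEQ_le) (use test_fun_friedrichs[OF \<phi>(1) R] in auto)
qed

lemma emb_Hm1:
  assumes p: "sqi N p" shows "emb \<Omega> p \<in> Hm1 \<Omega>"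
proof -
  obtain R where R: "\<Omega> \<subseteq> cball 0 R" using bounded_subset_ballD[OF bd, of 0] ball_subset_cball by (meson order_trans)
  have "\<bar>emb \<Omega> p v\<bar> \<le> (nrm N p * (2 * R)) * H1norm \<Omega> v" if "v \<in> H10 \<Omega>" for v
  proof -
    obtain g where g: "H10g \<Omega> v g" using \<open>v \<in> H10 \<Omega>\<close> by (auto simp: H10_iff)
    have "\<bar>emb \<Omega> p v\<bar> \<le> nrm N p * nrm N v"
      unfolding emb_eq[OF dsets] by (rule ip_cauchy_schwarz[OF p H10g_sqi(1)[OF op bd g]])
    also have "\<dots> \<le> nrm N p * (2 * R * nrm N g)"
      by (intro mult_left_mono H10g_friedrichs[OF g R]) simp
    finally show ?thesis by (simp add: H1norm_eq[OF H10g_weak_grad[OF g]] algebra_simps)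
  qed
  moreover have "emb \<Omega> p (\<lambda>x. a * v x + b * w x) = a * emb \<Omega> p v + b * emb \<Omega> p w"
    if "v \<in> H10 \<Omega>" "w \<in> H10 \<Omega>" for v w a b
  proof -
    have s: "sqi N v" "sqi N w" using that H10g_sqi[OF op bd] by (auto simp: H10_iff)
    show ?thesis
      using ip_add_right[OF sqi_scaleR[OF s(1), of a] sqi_scaleR[OF s(2), of b] p]
        ip_scaleR_right[of N p a v] ip_scaleR_right[of N p b w]
      by (simp add: emb_eq[OF dsets])
  qed
  ultimately show ?thesis by (auto simp: Hm1_def)
qed

lemma zero_H10: "(\<lambda>x. 0) \<in> H10 \<Omega>" "H1norm \<Omega> (\<lambda>x. 0) = 0"
proof -
  have "grad (\<lambda>x::'a. 0::real) = (\<lambda>x. 0)" by (rule ext) (rule grad_eqI, simp)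
  then have g: "H10g \<Omega> (\<lambda>x. 0) (\<lambda>x. 0)" using test_fun_H10g[OF op bd test_fun_zero] by simp
  then show "(\<lambda>x. 0) \<in> H10 \<Omega>" by (auto simp: H10_iff)
  show "H1norm \<Omega> (\<lambda>x. 0) = 0" using H1norm_eq[OF H10g_weak_grad[OF g]] by (simp add: nrm_def)
qed

lemma dual_norm_le:
  assumes "\<And>v. v \<in> H10 \<Omega> \<Longrightarrow> \<bar>F v\<bar> \<le> B * H1norm \<Omega> v" "0 \<le> B"
  shows "dual_norm \<Omega> F \<le> B"
  unfolding dual_norm_def
proof (rule cSup_least)
  show "{\<bar>F v\<bar> |v. v \<in> H10 \<Omega> \<and> H1norm \<Omega> v \<le> 1} \<noteq> {}" using zero_H10 by fastforce
  show "x \<le> B" if "x \<in> {\<bar>F v\<bar> |v. v \<in> H10 \<Omega> \<and> H1norm \<Omega> v \<le> 1}" for x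
  proof -
    note xin = that
    obtain v where v: "x = \<bar>F v\<bar>" "v \<in> H10 \<Omega>" "H1norm \<Omega> v \<le> 1" using xin by blast
    show ?thesis using assms(1)[OF v(2)] mult_left_mono[OF v(3) assms(2)] v(1) by simp
  qed
qed

text \<open>A real supremum says something only about bounded sets; membership in \<open>Hm1\<close>
  provides the bound.\<close>

lemma dual_norm_upper:
  assumes F: "F \<in> Hm1 \<Omega>" and v: "v \<in> H10 \<Omega>" "H1norm \<Omega> v \<le> 1"
  shows "\<bar>F v\<bar> \<le> dual_norm \<Omega> F"
proof -
  obtain B where B: "\<And>v. v \<in> H10 \<Omega> \<Longrightarrow> \<bar>F v\<bar> \<le> B * H1norm \<Omega> v" using F unfolding Hm1_def by blast
  have "bdd_above {\<bar>F v\<bar> |v. v \<in> H10 \<Omega> \<and> H1norm \<Omega> v \<le> 1}"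
  proof (rule bdd_aboveI[of _ "\<bar>B\<bar>"])
    fix x assume "x \<in> {\<bar>F v\<bar> |v. v \<in> H10 \<Omega> \<and> H1norm \<Omega> v \<le> 1}"
    then obtain v where v: "x = \<bar>F v\<bar>" "v \<in> H10 \<Omega>" "H1norm \<Omega> v \<le> 1" by blast
    have "0 \<le> H1norm \<Omega> v" by (simp add: H1norm_def L2normv_eq[OF dsets])
    then have "B * H1norm \<Omega> v \<le> \<bar>B\<bar> * 1" using v(3) by (intro mult_mono) auto
    then show "x \<le> \<bar>B\<bar>" using B[OF v(2)] v(1) by simp
  qed
  then show ?thesis
    unfolding dual_norm_def by (rule cSup_upper[rotated]) (use v in auto)
qed

lemma dual_norm_nonneg: assumes "F \<in> Hm1 \<Omega>" shows "0 \<le> dual_norm \<Omega> F"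
  using dual_norm_upper[OF assms zero_H10(1)] zero_H10(2) abs_ge_zero[of "F (\<lambda>x. 0)"] by linarith

text \<open>Scaling to unit norm. If \<open>nrm N g = 0\<close>, the bound in \<open>Hm1\<close>
  forces \<open>F v = 0\<close>.\<close>

lemma dual_norm_bound:
  assumes F: "F \<in> Hm1 \<Omega>" and v: "H10g \<Omega> v g"
  shows "\<bar>F v\<bar> \<le> dual_norm \<Omega> F * nrm N g"
proof -
  obtain B where B: "\<And>v. v \<in> H10 \<Omega> \<Longrightarrow> \<bar>F v\<bar> \<le> B * H1norm \<Omega> v" using F unfolding Hm1_def by blast
  have vH: "v \<in> H10 \<Omega>" using v by (auto simp: H10_iff)
  have n: "H1norm \<Omega> v = nrm N g" by (rule H1norm_eq[OF H10g_weak_grad[OF v]])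
  show ?thesis
  proof (cases "nrm N g = 0")
    case True
    then show ?thesis using B[OF vH] n by simp
  next
    case False
    then have pos: "nrm N g > 0" using nrm_nonneg[of N g] by linarith
    define c where "c = 1 / nrm N g"
    \<comment> \<open>The summand with factor 0 brings the scaled function into the form in which
      \<open>Hm1\<close> states linearity.\<close>
    have w: "H10g \<Omega> (\<lambda>x. c * v x + 0 * v x) (\<lambda>x. c *\<^sub>R g x + 0 *\<^sub>R g x)"
      by (rule H10g_lincomb[OF op bd v v])
    have wn: "H1norm \<Omega> (\<lambda>x. c * v x + 0 * v x) \<le> 1"
      using H1norm_eq[OF H10g_weak_grad[OF w]] pos by (simp add: nrm_scaleR c_def)
    have "\<bar>F (\<lambda>x. c * v x + 0 * v x)\<bar> \<le> dual_norm \<Omega> F"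
      by (rule dual_norm_upper[OF F _ wn]) (use w in \<open>auto simp: H10_iff\<close>)
    moreover have "F (\<lambda>x. c * v x + 0 * v x) = c * F v + 0 * F v"
      using F vH unfolding Hm1_def by blast
    ultimately have "\<bar>c * F v + 0 * F v\<bar> \<le> dual_norm \<Omega> F" by (simp only:)
    then show ?thesis using pos by (simp add: c_def abs_mult field_simps)
  qed
qed

end

section \<open>Simplices\<close>

lemma lborel_integral_affine:
  fixes f :: "'a::euclidean_space \<Rightarrow> real"
  assumes [measurable]: "f \<in> borel_measurable borel" and c: "c \<noteq> 0"
  shows "(\<integral>x. f x \<partial>lborel) = \<bar>c\<bar> ^ DIM('a) * (\<integral>x. f (t + c *\<^sub>R x) \<partial>lborel)"
proof -
  have "(\<integral>x. f x \<partial>lborel) =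
      (\<integral>x. f x \<partial>density (distr lborel borel (\<lambda>x. t + c *\<^sub>R x)) (\<lambda>_. ennreal (\<bar>c\<bar> ^ DIM('a))))"
    using lborel_affine[OF c, of t] by (simp add: ennreal_power)
  also have "\<dots> = \<bar>c\<bar> ^ DIM('a) * (\<integral>x. f (t + c *\<^sub>R x) \<partial>lborel)"
    by (subst integral_density) (auto simp: integral_distr)
  finally show ?thesis .
qed

text \<open>Uniqueness of Haar measure: both sides of the symmetric identity compute the same double integral.\<close>

lemma affine_preimage_measure:
  fixes L J :: "'a::euclidean_space \<Rightarrow> 'a" and b :: 'a
  assumes L: "linear L" and J: "\<And>y. L (J y) = y"
  defines "A \<equiv> \<lambda>x. L x + b"
  shows "\<exists>c. \<forall>X\<in>sets borel. emeasure lborel (A -` X) = c * emeasure lborel X"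
proof -
  let ?B = "cball (0::'a) 1"
  have [measurable]: "?B \<in> sets borel" by simp
  have [measurable]: "A \<in> borel_measurable borel"
    unfolding A_def using L by (intro borel_measurable_continuous_onI continuous_intros linear_continuous_on) (simp add: linear_conv_bounded_linear)
  have trans: "(\<integral>\<^sup>+x. f (t + x) \<partial>lborel) = (\<integral>\<^sup>+x. f x \<partial>lborel)" if [measurable]: "f \<in> borel_measurable borel"
    for f :: "'a \<Rightarrow> ennreal" and t
  proof -
    have "(\<integral>\<^sup>+x. f x \<partial>lborel) = (\<integral>\<^sup>+x. f x \<partial>distr lborel borel ((+) t))"
      by (simp add: lborel_distr_plus)
    then show ?thesis by (simp add: nn_integral_distr)
  qed
  define v where "v = emeasure lborel ?B"
  have v: "v \<noteq> 0" "v \<noteq> \<infinity>"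
  proof -
    have "0 < unit_ball_vol (real DIM('a))" by simp
    then have "\<not> unit_ball_vol (real DIM('a)) \<le> 0" by linarith
    then show "v \<noteq> 0" "v \<noteq> \<infinity>" by (simp_all add: v_def emeasure_cball ennreal_eq_0_iff)
  qed
  \<comment> \<open>\<open>v\<close> is the volume of the unit ball and \<open>c\<close> that of the
    preimage of the reflected ball; the factor of the lemma will be \<open>c / v\<close>.\<close>
  define c where "c = (\<integral>\<^sup>+s. indicator ?B (- A s) \<partial>lborel)"
  have "emeasure lborel (A -` X) * v = c * emeasure lborel X" if [measurable]: "X \<in> sets borel" for X
  proof -
    have "emeasure lborel (A -` X) * v = (\<integral>\<^sup>+s. indicator X (A s) * v \<partial>lborel)"
    proof -
      have "A -` X \<in> sets borel" using measurable_sets[of A borel borel X] by simp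
      then have "emeasure lborel (A -` X) * v = (\<integral>\<^sup>+s. indicator (A -` X) s * v \<partial>lborel)"
        by (simp add: nn_integral_multc)
      then show ?thesis by (simp add: indicator_vimage[symmetric] indicator_def)
    qed
    also have "\<dots> = (\<integral>\<^sup>+s. (\<integral>\<^sup>+y. indicator X (A s) * indicator ?B (- A s + y) \<partial>lborel) \<partial>lborel)"
    proof (rule nn_integral_cong)
      fix s
      have "(\<integral>\<^sup>+y. indicator X (A s) * indicator ?B (- A s + y) \<partial>lborel) =
          indicator X (A s) * (\<integral>\<^sup>+y. indicator ?B (- A s + y) \<partial>lborel)"
        by (rule nn_integral_cmult) measurable
      also have "(\<integral>\<^sup>+y. indicator ?B (- A s + y) \<partial>lborel) = v"
        using trans[of "indicator ?B" "- A s"] by (simp add: v_def)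
      finally show "indicator X (A s) * v = (\<integral>\<^sup>+y. indicator X (A s) * indicator ?B (- A s + y) \<partial>lborel)" ..
    qed
    also have "\<dots> = (\<integral>\<^sup>+y. (\<integral>\<^sup>+s. indicator X (A s) * indicator ?B (- A s + y) \<partial>lborel) \<partial>lborel)"
      by (rule lborel_pair.Fubini') measurable
    also have "\<dots> = (\<integral>\<^sup>+y. (\<integral>\<^sup>+s. indicator X (A s + y) * indicator ?B (- A s) \<partial>lborel) \<partial>lborel)"
    proof (rule nn_integral_cong)
      fix y
      \<comment> \<open>Translating s by \<open>J y\<close> adds y to \<open>A s\<close>, which
        moves the translation from the ball to \<open>X\<close>.\<close>
      have "A (J y + s) = A s + y" for s
        using linear_add[OF L] J by (simp add: A_def algebra_simps)
      then show "(\<integral>\<^sup>+s. indicator X (A s) * indicator ?B (- A s + y) \<partial>lborel) =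
          (\<integral>\<^sup>+s. indicator X (A s + y) * indicator ?B (- A s) \<partial>lborel)"
        using trans[of "\<lambda>s. indicator X (A s) * indicator ?B (- A s + y)" "J y"] by simp
    qed
    also have "\<dots> = (\<integral>\<^sup>+s. (\<integral>\<^sup>+y. indicator X (A s + y) * indicator ?B (- A s) \<partial>lborel) \<partial>lborel)"
      by (rule lborel_pair.Fubini') measurable
    also have "\<dots> = (\<integral>\<^sup>+s. emeasure lborel X * indicator ?B (- A s) \<partial>lborel)"
    proof (rule nn_integral_cong)
      fix s
      have "(\<integral>\<^sup>+y. indicator X (A s + y) * indicator ?B (- A s) \<partial>lborel) =
          (\<integral>\<^sup>+y. indicator X (A s + y) \<partial>lborel) * indicator ?B (- A s)"
        by (rule nn_integral_multc) measurable
      also have "(\<integral>\<^sup>+y. indicator X (A s + y) \<partial>lborel) = emeasure lborel X"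
        by (subst trans) auto
      finally show "(\<integral>\<^sup>+y. indicator X (A s + y) * indicator ?B (- A s) \<partial>lborel) = emeasure lborel X * indicator ?B (- A s)" .
    qed
    also have "\<dots> = emeasure lborel X * c"
      unfolding c_def by (rule nn_integral_cmult) measurable
    finally show ?thesis by (simp add: mult.commute)
  qed
  then have mv: "emeasure lborel (A -` X) * v = c * emeasure lborel X" if "X \<in> sets borel" for X
    using that by blast
  have "emeasure lborel (A -` X) = (c / v) * emeasure lborel X" if "X \<in> sets borel" for X
  proof -
    have "emeasure lborel (A -` X) = emeasure lborel (A -` X) * v / v"
      using v by (simp add: ennreal_mult_divide_eq)
    also have "\<dots> = (c / v) * emeasure lborel X"
      unfolding mv[OF that] by (simp add: divide_ennreal_def ac_simps)
    finally show ?thesis .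
  qed
  then show ?thesis by blast
qed

text \<open>Mean values are invariant under an invertible affine map. No determinant is computed:
  the Jacobian factor is the ratio \<open>r\<close> of the two volumes.\<close>

lemma affine_integral:
  fixes L J :: "'a::euclidean_space \<Rightarrow> 'a" and b :: 'a
  assumes L: "linear L" and J: "\<And>y. L (J y) = y"
  defines "A \<equiv> \<lambda>x. L x + b"
  assumes K: "compact K'" "A -` K' = K" "measure lborel K' > 0" "compact K"
    and f: "continuous_on UNIV f"
  shows "(LINT x:K|lborel. f (A x)) / measure lborel K = (LINT x:K'|lborel. f x) / measure lborel K'"
proof -
  obtain c where c: "\<And>X. X \<in> sets borel \<Longrightarrow> emeasure lborel (A -` X) = c * emeasure lborel X"
    using affine_preimage_measure[OF L J, of b] unfolding A_def by blast
  have cA: "continuous_on UNIV A"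
    unfolding A_def using L by (intro continuous_intros linear_continuous_on) (simp add: linear_conv_bounded_linear)
  then have [measurable]: "A \<in> borel_measurable borel" by (rule borel_measurable_continuous_onI)
  have bK [measurable]: "K' \<in> sets borel" "K \<in> sets borel" using K by (auto simp: compact_imp_closed)
  have e: "emeasure lborel K' = ennreal (measure lborel K')" "emeasure lborel K = ennreal (measure lborel K)"
    using emeasure_compact_finite[OF K(1)] emeasure_compact_finite[OF K(4)]
    by (simp_all add: emeasure_eq_ennreal_measure less_top[symmetric])
  have eq: "ennreal (measure lborel K) = c * ennreal (measure lborel K')"
    using c[OF bK(1)] K(2) e by simp
  define r where "r = measure lborel K / measure lborel K'"
  have cr: "c = ennreal r"
  proof -
    have "c \<noteq> top"
      using eq K(3) by (auto simp: ennreal_top_mult split: if_splits)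
    then obtain c' where c': "c = ennreal c'" "0 \<le> c'" by (cases c) auto
    then have "measure lborel K = c' * measure lborel K'" using eq by (simp add: ennreal_mult[symmetric])
    then show ?thesis using c' K(3) by (simp add: r_def)
  qed
  have r0: "r \<ge> 0" by (simp add: r_def)
  have d: "distr lborel borel A = density lborel (\<lambda>_. ennreal r)"
  proof (rule measure_eqI)
    fix X assume "X \<in> sets (distr lborel borel A)"
    then have X: "X \<in> sets borel" by simp
    then show "emeasure (distr lborel borel A) X = emeasure (density lborel (\<lambda>_. ennreal r)) X"
      using c[OF X] by (simp add: emeasure_distr emeasure_density cr nn_integral_cmult_indicator)
  qed simp
  define F where "F x = indicator K' x *\<^sub>R f x" for x
  have [measurable]: "F \<in> borel_measurable borel"
    unfolding F_def using borel_measurable_continuous_onI[OF f] by measurable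
  have "(\<integral>x. F (A x) \<partial>lborel) = (\<integral>x. F x \<partial>distr lborel borel A)"
    by (simp add: integral_distr)
  also have "\<dots> = r * (\<integral>x. F x \<partial>lborel)"
    unfolding d using r0 by (subst integral_density) auto
  finally have fin: "(LINT x:K|lborel. f (A x)) = r * (LINT x:K'|lborel. f x)"
    using K(2) unfolding set_lebesgue_integral_def F_def
    by (metis (no_types, lifting) Bochner_Integration.integral_cong indicator_vimage)
  show ?thesis
  proof (cases "measure lborel K = 0")
    case True
    \<comment> \<open>Volume 0 would give c = 0 and a null preimage of the whole space, which is the
      whole space.\<close>
    then have "c * emeasure lborel UNIV = 0" using eq K(3) cr r_def by simp
    then have "emeasure lborel (A -` (UNIV::'a set)) = 0" using c[of UNIV] by simp
    then show ?thesis by simp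
  next
    case False
    then show ?thesis using K(3) fin by (simp add: r_def field_simps)
  qed
qed

text \<open>The gradient of the barycentric coordinate of the vertex \<open>z\<close> in the simplex
  with vertex set \<open>C\<close>. The coordinate is 1 at \<open>z\<close> and 0 at the other
  vertices, so it falls by 1 along every edge from \<open>z\<close>.\<close>

definition bgrad :: "'a::euclidean_space set \<Rightarrow> 'a \<Rightarrow> 'a" where
  "bgrad C z = (SOME g. \<forall>z'\<in>C - {z}. g \<bullet> (z' - z) = -1)"

definition bary :: "'a::euclidean_space set \<Rightarrow> 'a \<Rightarrow> 'a \<Rightarrow> real" where
  "bary C z x = 1 + bgrad C z \<bullet> (x - z)"

text \<open>Via the divergence theorem this is the mean of \<open>\<phi>\<close> over the facet opposite to \<open>z\<close>:
  \<open>n \<phi> + \<nabla>\<phi> \<cdot> (x - z)\<close> is the divergence of \<open>\<phi> (x - z)\<close>, whose flux only crosses that facet.\<close>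

definition facet_mean :: "'a::euclidean_space set \<Rightarrow> 'a \<Rightarrow> ('a \<Rightarrow> real) \<Rightarrow> real" where
  "facet_mean C z \<phi> = (LINT x:convex hull C|lborel. real DIM('a) * \<phi> x + grad \<phi> x \<bullet> (x - z))
     / (real DIM('a) * measure lborel (convex hull C))"

section \<open>Barycentric coordinates and volume bounds\<close>

locale nsimplex =
  fixes C :: "'a::euclidean_space set"
  assumes indep: "\<not> affine_dependent C" and card_C: "card C = DIM('a) + 1"
begin

lemma finite_C: "finite C"
  using card_C by (metis card.infinite add_is_0 one_neq_zero)

lemma C_nonempty: "C \<noteq> {}"
  using card_C by auto

lemma affine_hull_UNIV: "affine hull C = UNIV"
proof -
  have "aff_dim C = int DIM('a)"
    using aff_dim_affine_independent[OF indep] card_C by simp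
  then show ?thesis by (simp add: aff_dim_eq_full)
qed

lemma affine_repr:
  obtains u where "sum u C = 1" "(\<Sum>z\<in>C. u z *\<^sub>R z) = x"
proof -
  have "x \<in> affine hull C" by (simp add: affine_hull_UNIV)
  then show ?thesis using that unfolding affine_hull_finite[OF finite_C] by blast
qed

text \<open>The edge vectors at \<open>z\<close> are independent, so some linear functional has the
  value -1 on all of them; its representing vector justifies the choice in
  \<open>bgrad\<close>.\<close>

lemma bgrad_eq:
  assumes z: "z \<in> C" "z' \<in> C" "z' \<noteq> z"
  shows "bgrad C z \<bullet> (z' - z) = -1"
proof -
  have "independent ((\<lambda>x. x - z) ` (C - {z}))"
    using indep affine_dependent_iff_dependent2[OF z(1)] by (simp add: image_def Setcompr_eq_image)
  then obtain f :: "'a \<Rightarrow> real" where f: "linear f" "\<And>x. x \<in> (\<lambda>x. x - z) ` (C - {z}) \<Longrightarrow> f x = -1"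
    using linear_independent_extend[of "(\<lambda>x. x - z) ` (C - {z})" "\<lambda>_. -1::real"] by blast
  define g where "g = (\<Sum>i\<in>Basis. f i *\<^sub>R i)"
  have "f h = g \<bullet> h" for h
  proof -
    have "f h = f (\<Sum>i\<in>Basis. (h \<bullet> i) *\<^sub>R i)" by (simp add: euclidean_representation)
    also have "\<dots> = g \<bullet> h"
      using f(1) by (simp add: linear_sum linear_cmul g_def inner_sum_left inner_commute[of h] mult.commute)
    finally show ?thesis .
  qed
  then have "\<forall>z'\<in>C - {z}. g \<bullet> (z' - z) = -1" using f(2) by force
  then have "\<forall>z'\<in>C - {z}. bgrad C z \<bullet> (z' - z) = -1"
    unfolding bgrad_def by (rule someI[of "\<lambda>g. \<forall>z'\<in>C - {z}. g \<bullet> (z' - z) = -1"])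
  then show ?thesis using z by auto
qed

lemma bary_vertex: "z \<in> C \<Longrightarrow> z' \<in> C \<Longrightarrow> bary C z z' = (if z' = z then 1 else 0)"
  using bgrad_eq by (auto simp: bary_def)

lemma bary_diff: "bary C z x - bary C z y = bgrad C z \<bullet> (x - y)"
  by (simp add: bary_def inner_diff_right)

lemma bary_convex: "bary C z ((1 - t) *\<^sub>R x + t *\<^sub>R y) = (1 - t) * bary C z x + t * bary C z y"
  by (simp add: bary_def inner_diff_right inner_add_right algebra_simps)

lemma bary_affine_sum:
  assumes "sum u S = 1"
  shows "bary C w (\<Sum>z\<in>S. u z *\<^sub>R f z) = (\<Sum>z\<in>S. u z * bary C w (f z))"
proof -
  have "(\<Sum>z\<in>S. u z * bary C w (f z)) = (\<Sum>z\<in>S. u z * (1 - bgrad C w \<bullet> w) + u z * (bgrad C w \<bullet> f z))"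
    by (simp add: bary_def inner_diff_right algebra_simps)
  also have "\<dots> = (1 - bgrad C w \<bullet> w) + (\<Sum>z\<in>S. u z * (bgrad C w \<bullet> f z))"
    using assms by (simp add: sum.distrib sum_distrib_right[symmetric])
  also have "\<dots> = bary C w (\<Sum>z\<in>S. u z *\<^sub>R f z)"
    by (simp add: bary_def inner_diff_right inner_sum_right)
  finally show ?thesis ..
qed

lemma bary_unique:
  assumes "sum u C = 1" "w \<in> C"
  shows "bary C w (\<Sum>z\<in>C. u z *\<^sub>R z) = u w"
proof -
  have "bary C w (\<Sum>z\<in>C. u z *\<^sub>R z) = (\<Sum>z\<in>C. u z * (if z = w then 1 else 0))"
    using bary_affine_sum[OF assms(1), of w "\<lambda>z. z"] assms(2) by (simp add: bary_vertex cong: sum.cong)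
  also have "\<dots> = u w" using finite_C assms(2) by (simp add: if_distrib cong: if_cong)
  finally show ?thesis .
qed

lemma bary_sum: "(\<Sum>z\<in>C. bary C z x) = 1" and bary_repr: "(\<Sum>z\<in>C. bary C z x *\<^sub>R z) = x"
proof -
  obtain u where u: "sum u C = 1" "(\<Sum>z\<in>C. u z *\<^sub>R z) = x" by (rule affine_repr)
  have "bary C w x = u w" if "w \<in> C" for w using bary_unique[OF u(1) that] u(2) by simp
  then show "(\<Sum>z\<in>C. bary C z x) = 1" "(\<Sum>z\<in>C. bary C z x *\<^sub>R z) = x"
    using u by (simp_all cong: sum.cong)
qed

lemma bgrad_sum: "(\<Sum>z\<in>C. bgrad C z) = 0"
proof -
  have "(\<Sum>z\<in>C. bgrad C z) \<bullet> h = 0" for h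
  proof -
    have "(\<Sum>z\<in>C. bgrad C z) \<bullet> h = (\<Sum>z\<in>C. bary C z h - bary C z 0)"
      by (simp add: bary_diff inner_sum_left)
    then show ?thesis by (simp add: sum_subtractf bary_sum)
  qed
  then show ?thesis by (metis inner_eq_zero_iff)
qed

lemma bgrad_repr: "(\<Sum>z\<in>C. (bgrad C z \<bullet> h) *\<^sub>R z) = h"
proof -
  have "(\<Sum>z\<in>C. (bgrad C z \<bullet> h) *\<^sub>R z) = (\<Sum>z\<in>C. (bary C z h - bary C z 0) *\<^sub>R z)"
    by (simp add: bary_diff)
  then show ?thesis by (simp add: scaleR_diff_left sum_subtractf bary_repr)
qed

lemma hull_eq: "convex hull C = {x. \<forall>z\<in>C. 0 \<le> bary C z x}"
proof
  show "convex hull C \<subseteq> {x. \<forall>z\<in>C. 0 \<le> bary C z x}"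
    using bary_unique by (auto simp: convex_hull_finite[OF finite_C])
  show "{x. \<forall>z\<in>C. 0 \<le> bary C z x} \<subseteq> convex hull C"
  proof safe
    fix x assume "\<forall>z\<in>C. 0 \<le> bary C z x"
    then show "x \<in> convex hull C"
      unfolding convex_hull_finite[OF finite_C]
      by (intro CollectI exI[of _ "\<lambda>z. bary C z x"]) (simp add: bary_sum bary_repr)
  qed
qed

lemma bary_le_1: assumes "x \<in> convex hull C" "z \<in> C" shows "bary C z x \<le> 1"
proof -
  have "bary C z x \<le> (\<Sum>z\<in>C. bary C z x)"
    by (rule member_le_sum) (use assms finite_C hull_eq in auto)
  then show ?thesis by (simp add: bary_sum)
qed

lemma bary_continuous: "continuous_on S (bary C z)"
  unfolding bary_def[abs_def] by (intro continuous_intros)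

lemma interior_eq: "interior (convex hull C) = {x. \<forall>z\<in>C. 0 < bary C z x}"
proof
  have "open (\<Inter>z\<in>C. {x. 0 < bary C z x})"
    using finite_C by (intro open_INT ballI open_Collect_less bary_continuous continuous_intros)
  moreover have "(\<Inter>z\<in>C. {x. 0 < bary C z x}) = {x. \<forall>z\<in>C. 0 < bary C z x}" by auto
  ultimately have "open {x. \<forall>z\<in>C. 0 < bary C z x}" by simp
  then show "{x. \<forall>z\<in>C. 0 < bary C z x} \<subseteq> interior (convex hull C)"
    by (intro interior_maximal) (auto simp: hull_eq less_imp_le)
  show "interior (convex hull C) \<subseteq> {x. \<forall>z\<in>C. 0 < bary C z x}"
  proof safe
    fix x z assume x: "x \<in> interior (convex hull C)" and z: "z \<in> C"
    then obtain e where e: "e > 0" "ball x e \<subseteq> convex hull C" by (auto simp: mem_interior)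
    show "0 < bary C z x"
    proof (cases "bgrad C z = 0")
      case True
      then show ?thesis by (simp add: bary_def)
    next
      case False
      define y where "y = x - (e / (2 * norm (bgrad C z))) *\<^sub>R bgrad C z"
      have "y \<in> ball x e" using e False by (simp add: y_def dist_norm)
      then have "0 \<le> bary C z y" using e(2) z by (auto simp: hull_eq)
      moreover have "bary C z x - bary C z y = (e / (2 * norm (bgrad C z))) * (bgrad C z \<bullet> bgrad C z)"
        by (simp add: bary_diff y_def)
      moreover have "\<dots> > 0" using e False by simp
      ultimately show ?thesis by linarith
    qed
  qed
qed

lemma sub_hull_eq:
  assumes "S \<subseteq> C"
  shows "convex hull S = {x \<in> convex hull C. \<forall>z\<in>C - S. bary C z x = 0}"
proof
  have fS: "finite S" using assms finite_C finite_subset by blast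
  show "convex hull S \<subseteq> {x \<in> convex hull C. \<forall>z\<in>C - S. bary C z x = 0}"
  proof
    fix x assume x: "x \<in> convex hull S"
    then obtain u where u: "sum u S = 1" "(\<Sum>z\<in>S. u z *\<^sub>R z) = x" by (auto simp: convex_hull_finite[OF fS])
    have "bary C z x = 0" if "z \<in> C - S" for z
      using bary_affine_sum[OF u(1), of z "\<lambda>z. z"] u(2) that assms
      by (auto simp: bary_vertex subset_iff intro!: sum.neutral)
    moreover have "x \<in> convex hull C" using hull_mono[OF assms] x by blast
    ultimately show "x \<in> {x \<in> convex hull C. \<forall>z\<in>C - S. bary C z x = 0}" by blast
  qed
  show "{x \<in> convex hull C. \<forall>z\<in>C - S. bary C z x = 0} \<subseteq> convex hull S"
  proof safe
    fix x assume x: "x \<in> convex hull C" "\<forall>z\<in>C - S. bary C z x = 0"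
    have "(\<Sum>z\<in>S. bary C z x) = 1" "(\<Sum>z\<in>S. bary C z x *\<^sub>R z) = x"
      using sum.mono_neutral_left[OF finite_C assms, of "\<lambda>z. bary C z x"] bary_sum
        sum.mono_neutral_left[OF finite_C assms, of "\<lambda>z. bary C z x *\<^sub>R z"] bary_repr x(2) by auto
    moreover have "\<forall>z\<in>S. 0 \<le> bary C z x" using x(1) assms by (auto simp: hull_eq)
    ultimately show "x \<in> convex hull S"
      unfolding convex_hull_finite[OF fS] by (intro CollectI exI[of _ "\<lambda>z. bary C z x"]) simp
  qed
qed

definition center :: 'a where "center = (\<Sum>z\<in>C. (1 / real (DIM('a) + 1)) *\<^sub>R z)"

lemma bary_center: "w \<in> C \<Longrightarrow> bary C w center = 1 / real (DIM('a) + 1)"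
  unfolding center_def by (rule bary_unique) (simp_all add: card_C)

lemma center_interior: "center \<in> interior (convex hull C)"
  unfolding interior_eq by (simp add: bary_center)

lemma compact_hull: "compact (convex hull C)"
  by (simp add: compact_convex_hull finite_imp_compact finite_C)

lemma hull_borel: "convex hull C \<in> sets borel"
  by (rule borel_closed[OF compact_imp_closed[OF compact_hull]])

lemma hull_lmeasurable: "convex hull C \<in> lmeasurable"
  by (rule lmeasurable_compact[OF compact_hull])

lemma measure_lborel_hull: "measure lborel (convex hull C) = measure lebesgue (convex hull C)"
  using hull_borel by simp

lemma measure_hull_pos: "measure lebesgue (convex hull C) > 0"
proof -
  obtain e where e: "e > 0" "ball center e \<subseteq> convex hull C"
    using center_interior by (auto simp: mem_interior)
  have "0 < measure lebesgue (ball center e)"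
    using content_ball_pos[OF e(1)] by simp
  also have "\<dots> \<le> measure lebesgue (convex hull C)"
    by (rule measure_mono_fmeasurable[OF e(2) _ hull_lmeasurable]) simp
  finally show ?thesis .
qed

lemma dist_le_diameter: "x \<in> convex hull C \<Longrightarrow> y \<in> convex hull C \<Longrightarrow> norm (x - y) \<le> diameter (convex hull C)"
  using diameter_bounded_bound[OF compact_imp_bounded[OF compact_hull]] by (simp add: dist_norm)

lemma vertex_in_hull: "z \<in> C \<Longrightarrow> z \<in> convex hull C"
  by (rule hull_inc)

lemma bgrad_nonzero: assumes "z \<in> C" shows "bgrad C z \<noteq> 0"
proof -
  have "C - {z} \<noteq> {}" using card_C finite_C assms by (metis card_Diff_singleton card.empty add_diff_cancel_right' DIM_positive less_irrefl)
  then obtain z' where "z' \<in> C" "z' \<noteq> z" by blast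
  then show ?thesis using bgrad_eq[OF assms] by force
qed

lemma diameter_pos: "diameter (convex hull C) > 0"
proof -
  obtain z where z: "z \<in> C" using C_nonempty by blast
  have "C - {z} \<noteq> {}" using card_C finite_C z by (metis card_Diff_singleton card.empty add_diff_cancel_right' DIM_positive less_irrefl)
  then obtain z' where z': "z' \<in> C" "z' \<noteq> z" by blast
  then have "0 < norm (z - z')" by simp
  also have "\<dots> \<le> diameter (convex hull C)" by (intro dist_le_diameter vertex_in_hull z z')
  finally show ?thesis .
qed

text \<open>The gradient bound comes from packing. Translates of the simplex by multiples of
  \<open>w\<close> occupy disjoint slabs, since the coordinate of \<open>z\<close> ranges over
  \<open>[2 k, 2 k + 1]\<close> on the k-th one. About \<open>norm g * h / 2\<close> of them fit
  into the ball of radius \<open>2 h\<close> around \<open>z\<close>, whose volume is at most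
  \<open>(4 h)^n\<close>.\<close>

lemma measure_hull_le: "measure lebesgue (convex hull C) \<le> (2 * diameter (convex hull C)) ^ DIM('a)"
  and bgrad_bound_aux: "z \<in> C \<Longrightarrow> norm (bgrad C z) * diameter (convex hull C) * measure lebesgue (convex hull C)
     \<le> 2 * (4 * diameter (convex hull C)) ^ DIM('a)"
proof -
  let ?K = "convex hull C" and ?h = "diameter (convex hull C)"
  have cb: "measure lebesgue (cball z r) \<le> (2 * r) ^ DIM('a)" if "r \<ge> 0" for z :: 'a and r
  proof -
    have "cball z r \<subseteq> cbox (z - r *\<^sub>R One) (z + r *\<^sub>R One)"
    proof
      fix x assume "x \<in> cball z r"
      then have "norm (x - z) \<le> r" by (simp add: dist_norm norm_minus_commute)
      then have "\<bar>(x - z) \<bullet> i\<bar> \<le> r" if "i \<in> Basis" for i using Basis_le_norm[OF that, of "x - z"] by linarith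
      then show "x \<in> cbox (z - r *\<^sub>R One) (z + r *\<^sub>R One)"
        by (fastforce simp: mem_box inner_diff_left inner_add_left abs_le_iff)
    qed
    then have "measure lebesgue (cball z r) \<le> measure lebesgue (cbox (z - r *\<^sub>R One) (z + r *\<^sub>R One))"
      by (intro measure_mono_fmeasurable) auto
    also have "\<dots> = (2 * r) ^ DIM('a)"
      using that by (simp add: content_cbox_if inner_diff_left inner_add_left box_eq_empty not_less)
    finally show ?thesis .
  qed
  obtain z0 where z0: "z0 \<in> C" using C_nonempty by blast
  have "measure lebesgue ?K \<le> measure lebesgue (cball z0 ?h)"
    by (intro measure_mono_fmeasurable)
      (use hull_lmeasurable dist_le_diameter[OF vertex_in_hull[OF z0]] in \<open>auto simp: dist_norm fmeasurableD\<close>)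
  also have "\<dots> \<le> (2 * ?h) ^ DIM('a)" using cb diameter_pos by simp
  finally show "measure lebesgue ?K \<le> (2 * ?h) ^ DIM('a)" .
  assume z: "z \<in> C"
  define g where "g = bgrad C z"
  have g: "norm g > 0" using bgrad_nonzero[OF z] by (simp add: g_def)
  \<comment> \<open>Chosen with \<open>g \<bullet> w = 2\<close>: consecutive slabs of width 1 are
    separated by gaps of width 1.\<close>
  define w where "w = (2 / (norm g)\<^sup>2) *\<^sub>R g"
  have gw: "g \<bullet> w = 2" using g by (simp add: w_def power2_norm_eq_inner)
  have nw: "norm w = 2 / norm g" using g by (simp add: w_def power2_eq_square)
  \<comment> \<open>The largest number of translates whose last shift, by
    \<open>(m - 1) * norm w\<close>, does not exceed the diameter.\<close>
  define m where "m = nat \<lfloor>norm g * ?h / 2\<rfloor> + 1"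
  have m: "norm g * ?h / 2 \<le> real m" "real (m - 1) \<le> norm g * ?h / 2"
  proof -
    have a0: "0 \<le> norm g * ?h / 2" using g diameter_pos by simp
    have "real (m - 1) = of_int \<lfloor>norm g * ?h / 2\<rfloor>" "real m = of_int \<lfloor>norm g * ?h / 2\<rfloor> + 1"
      using a0 by (simp_all add: m_def)
    then show "norm g * ?h / 2 \<le> real m" "real (m - 1) \<le> norm g * ?h / 2" by linarith+
  qed
  define T where "T k = (+) (real k *\<^sub>R w) ` ?K" for k
  have Tlm: "T k \<in> lmeasurable" "measure lebesgue (T k) = measure lebesgue ?K" for k
    using hull_lmeasurable by (simp_all add: T_def measurable_translation measure_translation)
  have Tb: "2 * real k \<le> bary C z x \<and> bary C z x \<le> 2 * real k + 1" if "x \<in> T k" for k x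
  proof -
    obtain y where y: "y \<in> ?K" "x = real k *\<^sub>R w + y" using \<open>x \<in> T k\<close> by (auto simp: T_def)
    have "bary C z x - bary C z y = 2 * real k"
      using gw by (simp add: bary_diff y(2) g_def[symmetric] inner_add_right)
    moreover have "0 \<le> bary C z y" "bary C z y \<le> 1" using y(1) z bary_le_1 hull_eq by auto
    ultimately show ?thesis by linarith
  qed
  have disj: "disjoint_family_on T {..<m}"
  proof (unfold disjoint_family_on_def, intro ballI impI)
    fix i j assume "i \<in> {..<m}" "j \<in> {..<m}" "i \<noteq> j"
    show "T i \<inter> T j = {}"
    proof (rule ccontr)
      assume "T i \<inter> T j \<noteq> {}"
      then obtain x where "x \<in> T i" "x \<in> T j" by blast
      from Tb[OF this(1)] Tb[OF this(2)] have "2 * real i \<le> 2 * real j + 1" "2 * real j \<le> 2 * real i + 1" by auto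
      then show False using \<open>i \<noteq> j\<close> by linarith
    qed
  qed
  have "(\<Union>k<m. T k) \<subseteq> cball z (2 * ?h)"
  proof safe
    fix k x assume k: "k < m" and "x \<in> T k"
    then obtain y where y: "y \<in> ?K" "x = real k *\<^sub>R w + y" by (auto simp: T_def)
    have "real k \<le> real (m - 1)" using k by simp
    then have "real k \<le> norm g * ?h / 2" using m(2) by linarith
    then have "real k * norm w \<le> norm g * ?h / 2 * norm w" by (rule mult_right_mono) simp
    also have "\<dots> = ?h" using g nw by simp
    finally have "real k * norm w \<le> ?h" .
    moreover have "norm (x - z) \<le> real k * norm w + norm (y - z)"
      using norm_triangle_ineq[of "real k *\<^sub>R w" "y - z"] by (simp add: y(2) algebra_simps)
    moreover have "norm (y - z) \<le> ?h" by (rule dist_le_diameter[OF y(1) vertex_in_hull[OF z]])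
    ultimately show "x \<in> cball z (2 * ?h)" by (simp add: dist_norm norm_minus_commute)
  qed
  then have "measure lebesgue (\<Union>k<m. T k) \<le> measure lebesgue (cball z (2 * ?h))"
    by (intro measure_mono_fmeasurable) (use Tlm in \<open>auto intro!: sets.finite_UN simp: fmeasurableD\<close>)
  also have "\<dots> \<le> (4 * ?h) ^ DIM('a)" using cb[of "2 * ?h" z] diameter_pos by simp
  finally have "measure lebesgue (\<Union>k<m. T k) \<le> (4 * ?h) ^ DIM('a)" .
  moreover have "measure lebesgue (\<Union>k<m. T k) = (\<Sum>k<m. measure lebesgue (T k))"
  proof (rule measure_finite_Union)
    show "T ` {..<m} \<subseteq> sets lebesgue" using Tlm(1) by (auto simp: fmeasurableD)
    show "emeasure lebesgue (T k) \<noteq> \<infinity>" for k using fmeasurableD2[OF Tlm(1)[of k]] by (simp only: infinity_ennreal_def not_False_eq_True)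
  qed (use disj in auto)
  ultimately have "real m * measure lebesgue ?K \<le> (4 * ?h) ^ DIM('a)" using Tlm(2) by simp
  moreover have "norm g * ?h / 2 * measure lebesgue ?K \<le> real m * measure lebesgue ?K"
    by (intro mult_right_mono m) simp
  ultimately show "norm (bgrad C z) * ?h * measure lebesgue ?K \<le> 2 * (4 * ?h) ^ DIM('a)"
    by (simp add: g_def)
qed

end

section \<open>The divergence theorem on a simplex and facet means\<close>

lemma set_integrable_on_compact:
  fixes f :: "'a::euclidean_space \<Rightarrow> 'b::euclidean_space"
  assumes "compact K" "continuous_on UNIV f"
  shows "set_integrable lborel K f"
  unfolding set_integrable_def
  by (rule borel_integrable_compact[OF assms(1) continuous_on_subset[OF assms(2)]]) simp

lemma has_gradient_of_linear:
  fixes f :: "'a::euclidean_space \<Rightarrow> real"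
  assumes "(f has_derivative D) (at x)" "\<And>h. D h = g \<bullet> h"
  shows "(f has_derivative (\<lambda>h. g \<bullet> h)) (at x)"
  using assms by (simp add: has_derivative_eq_rhs fun_eq_iff)

context nsimplex
begin

text \<open>The integrand is the divergence of \<open>\<psi> x *\<^sub>R (x - z)\<close>, a field
  that is tangential to the facets through \<open>z\<close> and vanishes on the opposite one. The
  proof contracts the simplex towards \<open>z\<close> by a factor s. The difference quotient
  \<open>F k\<close> approximates the integrand as s tends to 1, while its integral is, up to the
  factor \<open>1 / (1 - s)\<close>, that of \<psi> over the slab \<open>?K - Q k\<close>. Both
  \<psi> on the slab and the volume of the slab are O(1 - s), so the limit is 0.\<close>

lemma facet_flux_zero:
  assumes z: "z \<in> C"
    and D: "\<And>x. (\<psi> has_derivative (\<lambda>h. G x \<bullet> h)) (at x)" and G: "continuous_on UNIV G"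
    and \<psi>0: "\<And>x. x \<in> convex hull (C - {z}) \<Longrightarrow> \<psi> x = 0"
  shows "(LINT x:convex hull C|lborel. real DIM('a) * \<psi> x + G x \<bullet> (x - z)) = 0"
proof -
  let ?K = "convex hull C" and ?h = "diameter (convex hull C)" and ?n = "DIM('a)"
  have c\<psi>: "continuous_on UNIV \<psi>" by (meson D continuous_at_imp_continuous_on has_derivative_continuous)
  have comp: "compact ?K" by (rule compact_hull)
  have conv: "convex ?K" by (rule convex_convex_hull)
  have zK: "z \<in> ?K" by (rule vertex_in_hull[OF z])
  have "bounded (G ` ?K)" "bounded (\<psi> ` ?K)"
    by (intro compact_imp_bounded compact_continuous_image comp continuous_on_subset[OF G] continuous_on_subset[OF c\<psi>]; simp)+
  then obtain B \<Psi> where B: "\<And>x. x \<in> ?K \<Longrightarrow> norm (G x) \<le> B" and \<Psi>: "\<And>x. x \<in> ?K \<Longrightarrow> \<bar>\<psi> x\<bar> \<le> \<Psi>"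
    by (auto simp: bounded_iff)
  have B0: "B \<ge> 0" "\<Psi> \<ge> 0" using B[OF zK] \<Psi>[OF zK] norm_ge_zero[of "G z"] abs_ge_zero[of "\<psi> z"] by linarith+
  have lip: "\<bar>\<psi> y - \<psi> x\<bar> \<le> B * norm (y - x)" if "x \<in> ?K" "y \<in> ?K" for x y
  proof -
    have "norm (\<psi> y - \<psi> x) \<le> B * norm (y - x)"
    proof (rule differentiable_bound[OF conv _ _ that(2,1)])
      show "(\<psi> has_derivative (\<lambda>h. G x \<bullet> h)) (at x within ?K)" for x
        by (rule has_derivative_at_withinI[OF D])
      show "onorm ((\<bullet>) (G x)) \<le> B" if "x \<in> ?K" for x
      proof (rule onorm_le)
        show "norm (G x \<bullet> h) \<le> B * norm h" for h
          using Cauchy_Schwarz_ineq2[of "G x" h] mult_right_mono[OF B[OF that], of "norm h"] by simp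
      qed
    qed
    then show ?thesis by simp
  qed
  define s where "s k = 1 - inverse (real (Suc (Suc k)))" for k
  have s: "0 < s k" "s k < 1" for k by (auto simp: s_def field_simps)
  have s1: "s \<longlonglongrightarrow> 1"
    using tendsto_diff[OF tendsto_const[of 1] LIMSEQ_Suc[OF LIMSEQ_inverse_real_of_nat]] by (simp add: s_def[abs_def] del: of_nat_Suc)
  define q where "q k x = z + s k *\<^sub>R (x - z)" for k x
  have qK: "q k x \<in> ?K" if "x \<in> ?K" for k x
  proof -
    have "q k x = (1 - s k) *\<^sub>R z + s k *\<^sub>R x" by (simp add: q_def algebra_simps)
    then show ?thesis using conv zK that s[of k] by (simp add: convex_alt less_imp_le)
  qed
  have bz: "bary C w (q k x) = (if w = z then 1 - s k * (1 - bary C z x) else s k * bary C w x)" if "w \<in> C" for w k x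
  proof -
    have e: "q k x = (1 - s k) *\<^sub>R z + s k *\<^sub>R x" by (simp add: q_def algebra_simps)
    show ?thesis unfolding e bary_convex using that z by (auto simp: bary_vertex algebra_simps)
  qed
  define Q where "Q k = {x. x \<in> ?K \<and> 1 - s k \<le> bary C z x}" for k
  have Qiff: "q k x \<in> Q k \<longleftrightarrow> x \<in> ?K" for k x
  proof
    assume "q k x \<in> Q k"
    then have a: "\<forall>w\<in>C. 0 \<le> bary C w (q k x)" "1 - s k \<le> bary C z (q k x)" by (auto simp: Q_def hull_eq)
    have "0 \<le> bary C w x" if "w \<in> C" for w
    proof (cases "w = z")
      case True
      have "s k * (1 - bary C z x) \<le> s k * 1" using a(2) bz[OF z, of k x] by simp
      then have "1 - bary C z x \<le> 1" by (rule mult_left_le_imp_le) (rule s)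
      then show ?thesis using True by simp
    next
      case False
      then show ?thesis using a(1) bz[OF that, of k x] that s[of k] by (auto simp: zero_le_mult_iff)
    qed
    then show "x \<in> ?K" by (simp add: hull_eq)
  next
    assume x: "x \<in> ?K"
    then have "0 \<le> bary C z x" using z by (simp add: hull_eq)
    then have "s k * (1 - bary C z x) \<le> s k * 1" using s[of k] by (intro mult_left_mono) auto
    then show "q k x \<in> Q k" using qK[OF x] bz[OF z, of k x] by (simp add: Q_def)
  qed
  have Qc: "compact (Q k)" for k
  proof -
    have "closed {x. 1 - s k \<le> bary C z x}"
      by (intro closed_Collect_le continuous_intros bary_continuous)
    then have "compact (?K \<inter> {x. 1 - s k \<le> bary C z x})" by (rule compact_Int_closed[OF comp])
    moreover have "?K \<inter> {x. 1 - s k \<le> bary C z x} = Q k" by (auto simp: Q_def)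
    ultimately show ?thesis by simp
  qed
  have QK: "Q k \<subseteq> ?K" for k by (auto simp: Q_def)
  have Qb[measurable]: "Q k \<in> sets borel" "?K \<in> sets borel" for k
    by (rule borel_closed[OF compact_imp_closed[OF Qc]] hull_borel)+
  have m\<psi>[measurable]: "\<psi> \<in> borel_measurable borel" using c\<psi> by (rule borel_measurable_continuous_onI)
  have scale: "(LINT x:Q k|lborel. f x) = s k ^ ?n * (LINT x:?K|lborel. f (q k x))"
    if [measurable]: "f \<in> borel_measurable borel" for f :: "'a \<Rightarrow> real" and k
  proof -
    have "(LINT x:Q k|lborel. f x) = (\<integral>x. indicator (Q k) x * f x \<partial>lborel)"
      by (simp add: set_lebesgue_integral_def)
    also have "\<dots> = \<bar>s k\<bar> ^ ?n * (\<integral>x. indicator (Q k) ((z - s k *\<^sub>R z) + s k *\<^sub>R x) * f ((z - s k *\<^sub>R z) + s k *\<^sub>R x) \<partial>lborel)"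
      by (rule lborel_integral_affine) (use s[of k] in auto)
    also have "(\<lambda>x. (z - s k *\<^sub>R z) + s k *\<^sub>R x) = q k"
      by (simp add: q_def fun_eq_iff algebra_simps)
    then have "(z - s k *\<^sub>R z) + s k *\<^sub>R x = q k x" for x by metis
    then have "(\<integral>x. indicator (Q k) ((z - s k *\<^sub>R z) + s k *\<^sub>R x) * f ((z - s k *\<^sub>R z) + s k *\<^sub>R x) \<partial>lborel) =
        (LINT x:?K|lborel. f (q k x))"
      unfolding set_lebesgue_integral_def by (intro Bochner_Integration.integral_cong) (auto simp: indicator_def Qiff)
    finally show ?thesis using s[of k] by simp
  qed
  define F where "F k x = (\<psi> x - s k ^ ?n * \<psi> (q k x)) / (1 - s k)" for k x
  have cq: "continuous_on UNIV (\<lambda>x. \<psi> (q k x))" for k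
    unfolding q_def by (rule continuous_on_compose2[OF c\<psi>]) (auto intro!: continuous_intros)
  have intF: "(LINT x:?K|lborel. F k x) = ((LINT x:?K|lborel. \<psi> x) - (LINT x:Q k|lborel. \<psi> x)) / (1 - s k)" for k
    unfolding F_def scale[OF m\<psi>]
    using set_integrable_on_compact[OF comp c\<psi>] set_integrable_on_compact[OF comp cq[of k]] by simp
  have bern: "1 - s k ^ ?n \<le> real ?n * (1 - s k)" for k
    using Bernoulli_inequality[of "- (1 - s k)" ?n] s[of k] by (simp add: algebra_simps)
  have upper: "\<bar>LINT x:?K|lborel. F k x\<bar> \<le> B * ?h * (1 - s k ^ ?n) * measure lborel ?K" for k
  proof -
    have "(LINT x:?K|lborel. \<psi> x) - (LINT x:Q k|lborel. \<psi> x) = (LINT x:?K - Q k|lborel. \<psi> x)"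
    proof -
      have "(LINT x:?K|lborel. \<psi> x) = (LINT x:(?K - Q k) \<union> Q k|lborel. \<psi> x)"
        using QK[of k] by (simp add: Un_absorb2)
      also have "\<dots> = (LINT x:?K - Q k|lborel. \<psi> x) + (LINT x:Q k|lborel. \<psi> x)"
        by (rule set_integral_Un)
          (use set_integrable_on_compact[OF comp c\<psi>] set_integrable_on_compact[OF Qc c\<psi>] in
            \<open>auto intro: set_integrable_subset\<close>)
      finally show ?thesis by simp
    qed
    also have "\<bar>\<dots>\<bar> \<le> (LINT x:?K - Q k|lborel. B * ?h * (1 - s k))"
    proof -
      have bnd: "\<bar>\<psi> x\<bar> \<le> B * ?h * (1 - s k)" if x: "x \<in> ?K - Q k" for x
      proof -
        define l where "l = bary C z x"
        have l: "0 \<le> l" "l < 1 - s k" using x z by (auto simp: l_def Q_def hull_eq)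
        then have l1: "1 - l > 0" using s[of k] by linarith
        \<comment> \<open>The point where the ray from \<open>z\<close> through x meets the opposite
          facet.\<close>
        define p where "p = z + (1 / (1 - l)) *\<^sub>R (x - z)"
        have pe: "p = (1 - 1 / (1 - l)) *\<^sub>R z + (1 / (1 - l)) *\<^sub>R x" by (simp add: p_def algebra_simps)
        have bp: "bary C w p = (if w = z then 0 else (1 / (1 - l)) * bary C w x)" if "w \<in> C" for w
        proof (cases "w = z")
          case True
          then show ?thesis unfolding pe bary_convex using z l1 by (simp add: bary_vertex l_def[symmetric] field_simps)
        next
          case False
          then show ?thesis unfolding pe bary_convex using that z by (simp add: bary_vertex)
        qed
        have "0 \<le> bary C w p" if "w \<in> C" for w
          unfolding bp[OF that] using l1 x that by (simp add: hull_eq)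
        then have "p \<in> ?K" by (simp add: hull_eq)
        moreover have "bary C z p = 0" using bp[OF z] by simp
        moreover have "C - (C - {z}) = {z}" using z by auto
        ultimately have pF: "p \<in> convex hull (C - {z})"
          using sub_hull_eq[of "C - {z}"] by auto
        have "x - p = (- l) *\<^sub>R (p - z)"
        proof -
          have "(1 - l) *\<^sub>R (p - z) = x - z" using l1 by (simp add: p_def)
          then show ?thesis by (simp add: algebra_simps)
        qed
        then have "norm (x - p) = l * norm (p - z)" using l(1) by simp
        also have "\<dots> \<le> (1 - s k) * ?h"
          by (intro mult_mono dist_le_diameter[OF \<open>p \<in> ?K\<close> zK]) (use l in auto)
        finally have np: "norm (x - p) \<le> (1 - s k) * ?h" .
        have "\<bar>\<psi> x\<bar> = \<bar>\<psi> x - \<psi> p\<bar>" using \<psi>0[OF pF] by simp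
        also have "\<dots> \<le> B * norm (x - p)" using lip \<open>p \<in> ?K\<close> x by blast
        also have "\<dots> \<le> B * ((1 - s k) * ?h)" by (rule mult_left_mono[OF np B0(1)])
        finally show ?thesis by (simp add: algebra_simps)
      qed
      have i1: "set_integrable lborel (?K - Q k) \<psi>"
        by (rule set_integrable_subset[OF set_integrable_on_compact[OF comp c\<psi>]]) auto
      have i2: "set_integrable lborel (?K - Q k) (\<lambda>x. B * ?h * (1 - s k))"
        by (rule set_integrable_subset[OF set_integrable_on_compact[OF comp]]) auto
      show ?thesis
        unfolding set_lebesgue_integral_def real_norm_def[symmetric]
        by (rule Bochner_Integration.integral_norm_bound_integral)
          (use i1 i2 bnd in \<open>auto simp: set_integrable_def indicator_def\<close>)
    qed
    also have "\<dots> = B * ?h * (1 - s k) * measure lborel (?K - Q k)"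
    proof -
      have "emeasure lborel (?K - Q k) \<le> emeasure lborel ?K" by (rule emeasure_mono) auto
      then have "emeasure lborel (?K - Q k) < \<infinity>" using emeasure_compact_finite[OF comp] by (rule le_less_trans)
      then show ?thesis by (subst set_integral_const) auto
    qed
    also have "measure lborel (?K - Q k) = (1 - s k ^ ?n) * measure lborel ?K"
    proof -
      have "measure lborel (Q k) = s k ^ ?n * measure lborel ?K"
        using scale[of "\<lambda>x. 1" k] by (simp add: set_lebesgue_integral_def)
      moreover have "measure lborel (?K - Q k) = measure lborel ?K - measure lborel (Q k)"
        by (rule measure_Diff) (use emeasure_compact_finite[OF comp] QK in auto)
      ultimately show ?thesis by (simp add: algebra_simps)
    qed
    finally have "\<bar>(LINT x:?K|lborel. \<psi> x) - (LINT x:Q k|lborel. \<psi> x)\<bar> \<le>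
        B * ?h * (1 - s k) * ((1 - s k ^ ?n) * measure lborel ?K)" .
    then show ?thesis using s[of k] unfolding intF by (simp add: abs_divide field_simps)
  qed
  have "(\<lambda>k. B * ?h * (1 - s k ^ ?n) * measure lborel ?K) \<longlonglongrightarrow> B * ?h * (1 - 1 ^ ?n) * measure lborel ?K"
    by (intro tendsto_intros s1)
  then have "(\<lambda>k. B * ?h * (1 - s k ^ ?n) * measure lborel ?K) \<longlonglongrightarrow> 0" by simp
  moreover have "\<forall>k. norm (LINT x:?K|lborel. F k x) \<le> B * ?h * (1 - s k ^ ?n) * measure lborel ?K"
    using upper by (simp only: real_norm_def) blast
  ultimately have lim0: "(\<lambda>k. LINT x:?K|lborel. F k x) \<longlonglongrightarrow> 0"
    by (rule Lim_null_comparison[OF always_eventually, rotated])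
  have "(\<lambda>k. LINT x:?K|lborel. F k x) \<longlonglongrightarrow> (LINT x:?K|lborel. real ?n * \<psi> x + G x \<bullet> (x - z))"
    unfolding set_lebesgue_integral_def
  proof (rule integral_dominated_convergence[where w="\<lambda>x. indicator ?K x * (real ?n * \<Psi> + B * ?h)"])
    have "set_integrable lborel ?K (\<lambda>x. real ?n * \<Psi> + B * ?h)"
      by (rule set_integrable_on_compact[OF comp]) auto
    then show "integrable lborel (\<lambda>x. indicator ?K x * (real ?n * \<Psi> + B * ?h))"
      by (simp add: set_integrable_def)
    show "(\<lambda>x. indicator ?K x *\<^sub>R (real ?n * \<psi> x + G x \<bullet> (x - z))) \<in> borel_measurable lborel"
    proof -
      have "continuous_on UNIV (\<lambda>x. real ?n * \<psi> x + G x \<bullet> (x - z))"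
        by (intro continuous_intros c\<psi> G)
      from set_integrable_on_compact[OF comp this] show ?thesis by (auto simp: set_integrable_def)
    qed
    show "(\<lambda>x. indicator ?K x *\<^sub>R F k x) \<in> borel_measurable lborel" for k
    proof -
      have "continuous_on UNIV (F k)"
        unfolding F_def by (intro continuous_intros c\<psi> cq) (use s[of k] in auto)
      from set_integrable_on_compact[OF comp this] show ?thesis by (auto simp: set_integrable_def)
    qed
    show "AE x in lborel. norm (indicator ?K x *\<^sub>R F k x) \<le> indicator ?K x * (real ?n * \<Psi> + B * ?h)" for k
    proof (rule AE_I2)
      fix x
      show "norm (indicator ?K x *\<^sub>R F k x) \<le> indicator ?K x * (real ?n * \<Psi> + B * ?h)"
      proof (cases "x \<in> ?K")
        case True
        have "\<bar>\<psi> x - s k ^ ?n * \<psi> (q k x)\<bar> = \<bar>(\<psi> x - \<psi> (q k x)) + (1 - s k ^ ?n) * \<psi> (q k x)\<bar>"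
          by (simp add: algebra_simps)
        also have "\<dots> \<le> \<bar>\<psi> x - \<psi> (q k x)\<bar> + \<bar>(1 - s k ^ ?n) * \<psi> (q k x)\<bar>" by (rule abs_triangle_ineq)
        also have "\<dots> \<le> B * ((1 - s k) * ?h) + (real ?n * (1 - s k)) * \<Psi>"
        proof (rule add_mono)
          have "x - q k x = (1 - s k) *\<^sub>R (x - z)" by (simp add: q_def algebra_simps)
          then have "norm (x - q k x) \<le> (1 - s k) * ?h"
            using s[of k] dist_le_diameter[OF True zK] by (simp add: mult_left_mono)
          then have "B * norm (x - q k x) \<le> B * ((1 - s k) * ?h)" by (rule mult_left_mono[OF _ B0(1)])
          then show "\<bar>\<psi> x - \<psi> (q k x)\<bar> \<le> B * ((1 - s k) * ?h)"
            using lip[OF qK[OF True] True, of k] by linarith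
          have "0 \<le> 1 - s k ^ ?n" using s[of k] by (simp add: power_le_one)
          then show "\<bar>(1 - s k ^ ?n) * \<psi> (q k x)\<bar> \<le> (real ?n * (1 - s k)) * \<Psi>"
            unfolding abs_mult using bern[of k] \<Psi>[OF qK[OF True], of k] s[of k] by (intro mult_mono) auto
        qed
        finally have "\<bar>\<psi> x - s k ^ ?n * \<psi> (q k x)\<bar> \<le> (real ?n * \<Psi> + B * ?h) * (1 - s k)"
          by (simp add: algebra_simps)
        then have "\<bar>F k x\<bar> \<le> real ?n * \<Psi> + B * ?h"
          using s[of k] by (simp add: F_def abs_divide divide_le_eq)
        then show ?thesis using True by simp
      qed simp
    qed
    show "AE x in lborel. (\<lambda>k. indicator ?K x *\<^sub>R F k x) \<longlonglongrightarrow> indicator ?K x *\<^sub>R (real ?n * \<psi> x + G x \<bullet> (x - z))"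
    proof (intro AE_I2 tendsto_scaleR tendsto_const)
      fix x
      have D1: "((\<lambda>t. \<psi> (z + t *\<^sub>R (x - z))) has_real_derivative (G x \<bullet> (x - z))) (at 1)"
      proof -
        have "((\<lambda>t. \<psi> (z + t *\<^sub>R (x - z))) has_derivative (\<lambda>t. G x \<bullet> (t *\<^sub>R (x - z)))) (at 1)"
          by (rule has_derivative_compose[of "\<lambda>t. z + t *\<^sub>R (x - z)" "\<lambda>t. t *\<^sub>R (x - z)"])
            (use D in \<open>auto intro!: derivative_eq_intros\<close>)
        then show ?thesis by (simp add: has_field_derivative_def mult_commute_abs)
      qed
      \<comment> \<open>The pointwise limit of \<open>F k x\<close> is this derivative at t =
        1.\<close>
      have "((\<lambda>t. t ^ ?n * \<psi> (z + t *\<^sub>R (x - z))) has_real_derivative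
          (real ?n * \<psi> x + G x \<bullet> (x - z))) (at 1)"
        by (rule DERIV_cong[OF DERIV_mult[OF DERIV_pow D1]]) simp
      then have "((\<lambda>t. (t ^ ?n * \<psi> (z + t *\<^sub>R (x - z)) - \<psi> x) / (t - 1)) \<longlongrightarrow> real ?n * \<psi> x + G x \<bullet> (x - z)) (at 1)"
        by (simp add: has_field_derivative_iff)
      moreover have "filterlim s (at 1) sequentially"
        unfolding filterlim_at using s1 s by (auto simp: less_imp_neq)
      ultimately have "(\<lambda>k. (s k ^ ?n * \<psi> (z + s k *\<^sub>R (x - z)) - \<psi> x) / (s k - 1)) \<longlonglongrightarrow> real ?n * \<psi> x + G x \<bullet> (x - z)"
        by (rule filterlim_compose)
      moreover have "(s k ^ ?n * \<psi> (z + s k *\<^sub>R (x - z)) - \<psi> x) / (s k - 1) = F k x" for k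
        using s[of k] by (simp add: F_def q_def field_simps)
      ultimately show "(\<lambda>k. F k x) \<longlonglongrightarrow> real ?n * \<psi> x + G x \<bullet> (x - z)" by simp
    qed
  qed
  from LIMSEQ_unique[OF this lim0] show ?thesis .
qed

lemma facet_mean_zero:
  assumes z: "z \<in> C" and \<phi>: "smooth_fun \<phi>" "\<And>x. x \<in> convex hull (C - {z}) \<Longrightarrow> \<phi> x = 0"
  shows "facet_mean C z \<phi> = 0"
  unfolding facet_mean_def
  using facet_flux_zero[OF z smooth_fun_has_derivative[OF \<phi>(1)] smooth_fun_grad_continuous[OF \<phi>(1)] \<phi>(2)] by simp

text \<open>The affine map \<open>A\<close> that fixes the common facet and sends \<open>z\<close>
  to \<open>z'\<close> maps one simplex onto the other. The difference
  \<open>\<phi> o A - \<phi>\<close> vanishes on the facet, so its flux integral is 0, and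
  \<open>affine_integral\<close> moves the composed function to the other simplex.\<close>

lemma facet_mean_opposite:
  assumes z: "z \<in> C" and C': "nsimplex C'" "z' \<in> C'" "C' - {z'} = C - {z}" and \<phi>: "smooth_fun \<phi>"
  shows "facet_mean C' z' \<phi> = facet_mean C z \<phi>"
proof -
  interpret C': nsimplex C' by (rule C'(1))
  let ?S = "C - {z}" and ?n = "real DIM('a)"
  have CS: "C = insert z ?S" "C' = insert z' ?S" using z C' by auto
  have z'S: "z' \<notin> ?S" using C'(3) by auto
  \<comment> \<open>\<open>L\<close> is the linear part of \<open>A\<close>; \<open>J\<close>, built
    with the two simplices exchanged, is its right inverse.\<close>
  define L where "L h = (\<Sum>w\<in>?S. (bgrad C w \<bullet> h) *\<^sub>R w) + (bgrad C z \<bullet> h) *\<^sub>R z'" for h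
  define A where "A x = (\<Sum>w\<in>?S. bary C w x *\<^sub>R w) + bary C z x *\<^sub>R z'" for x
  define J where "J h = (\<Sum>w\<in>?S. (bgrad C' w \<bullet> h) *\<^sub>R w) + (bgrad C' z' \<bullet> h) *\<^sub>R z" for h
  have linL: "linear L"
    unfolding L_def
    by (intro linearI) (simp_all add: inner_add_right scaleR_left_distrib sum.distrib scaleR_sum_right algebra_simps)
  have sumS: "(\<Sum>w\<in>?S. f w) + f z = (\<Sum>w\<in>C. f w)" for f :: "'a \<Rightarrow> 'b::comm_monoid_add"
    using finite_C z by (subst sum.remove[of C z]) (auto simp: add.commute)
  have sumS': "(\<Sum>w\<in>?S. f w) + f z' = (\<Sum>w\<in>C'. f w)" for f :: "'a \<Rightarrow> 'b::comm_monoid_add"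
    using C'.finite_C C' by (subst sum.remove[of C' z']) (auto simp: add.commute)
  have Adiff: "A x - A y = L (x - y)" for x y
    by (simp add: A_def L_def bary_diff[symmetric] scaleR_diff_left sum_subtractf)
  have A0: "A x = L x + A 0" for x using Adiff[of x 0] by (simp add: algebra_simps)
  have bA: "bary C' z' (A x) = bary C z x" "w \<in> ?S \<Longrightarrow> bary C' w (A x) = bary C w x" for w x
  proof -
    define u where "u w = (if w = z' then bary C z x else bary C w x)" for w
    have "u w = bary C w x" if "w \<in> ?S" for w using z'S that by (metis u_def)
    then have uS: "(\<Sum>w\<in>?S. u w) = (\<Sum>w\<in>?S. bary C w x)" "(\<Sum>w\<in>?S. u w *\<^sub>R w) = (\<Sum>w\<in>?S. bary C w x *\<^sub>R w)"
      by (auto intro!: sum.cong)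
    have "sum u C' = 1"
      using sumS'[of u] uS(1) sumS[of "\<lambda>w. bary C w x"] bary_sum[of x] by (simp add: u_def)
    moreover have "(\<Sum>w\<in>C'. u w *\<^sub>R w) = A x"
      using sumS'[of "\<lambda>w. u w *\<^sub>R w"] uS(2) by (simp add: u_def A_def)
    ultimately have *: "bary C' w (A x) = u w" if "w \<in> C'" for w using C'.bary_unique that by metis
    show "bary C' z' (A x) = bary C z x" using *[OF C'(2)] by (simp add: u_def)
    show "bary C' w (A x) = bary C w x" if "w \<in> ?S" for w
      using *[of w] that CS(2) z'S by (auto simp: u_def)
  qed
  have LJ: "L (J h) = h" for h
  proof -
    have bgA: "bgrad C z \<bullet> J h = bgrad C' z' \<bullet> h" "w \<in> ?S \<Longrightarrow> bgrad C w \<bullet> J h = bgrad C' w \<bullet> h" for w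
    proof -
      define u where "u w = (if w = z then bgrad C' z' \<bullet> h else bgrad C' w \<bullet> h)" for w
      have uS: "(\<Sum>w\<in>?S. u w) = (\<Sum>w\<in>?S. bgrad C' w \<bullet> h)" "(\<Sum>w\<in>?S. u w *\<^sub>R w) = (\<Sum>w\<in>?S. (bgrad C' w \<bullet> h) *\<^sub>R w)"
        by (auto intro!: sum.cong simp: u_def)
      have u0: "sum u C = 0"
      proof -
        have "sum u C = (\<Sum>w\<in>C'. bgrad C' w \<bullet> h)"
          using sumS[of u] uS(1) sumS'[of "\<lambda>w. bgrad C' w \<bullet> h"] by (simp add: u_def)
        also have "\<dots> = (\<Sum>w\<in>C'. bgrad C' w) \<bullet> h" by (simp add: inner_sum_left)
        finally show ?thesis by (simp add: C'.bgrad_sum)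
      qed
      have Ju: "J h = (\<Sum>w\<in>C. u w *\<^sub>R w)"
        using sumS[of "\<lambda>w. u w *\<^sub>R w"] uS(2) by (simp add: u_def J_def)
      have g: "bgrad C v \<bullet> J h = u v" if v: "v \<in> C" for v
      proof -
        have "bgrad C v \<bullet> J h = (\<Sum>w\<in>C. u w * (bgrad C v \<bullet> w))" by (simp add: Ju inner_sum_right)
        also have "\<dots> = (\<Sum>w\<in>C. u w * (bary C v w - 1 + bgrad C v \<bullet> v))"
          by (simp add: bary_def inner_diff_right)
        also have "\<dots> = (\<Sum>w\<in>C. u w * bary C v w) + (\<Sum>w\<in>C. u w * (bgrad C v \<bullet> v - 1))"
          by (simp add: sum.distrib[symmetric] algebra_simps)
        also have "(\<Sum>w\<in>C. u w * (bgrad C v \<bullet> v - 1)) = sum u C * (bgrad C v \<bullet> v - 1)"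
          by (simp add: sum_distrib_right)
        also have "\<dots> = 0" by (simp add: u0)
        also have "(\<Sum>w\<in>C. u w * bary C v w) = (\<Sum>w\<in>C. if w = v then u w else 0)"
          by (rule sum.cong) (use v in \<open>auto simp: bary_vertex\<close>)
        also have "\<dots> = u v" using finite_C v by simp
        finally show ?thesis by simp
      qed
      show "bgrad C z \<bullet> J h = bgrad C' z' \<bullet> h" using g[OF z] by (simp add: u_def)
      show "bgrad C w \<bullet> J h = bgrad C' w \<bullet> h" if "w \<in> ?S" for w using g[of w] that by (auto simp: u_def)
    qed
    have "L (J h) = (\<Sum>w\<in>?S. (bgrad C' w \<bullet> h) *\<^sub>R w) + (bgrad C' z' \<bullet> h) *\<^sub>R z'"
    proof -
      have "(\<Sum>w\<in>?S. (bgrad C w \<bullet> J h) *\<^sub>R w) = (\<Sum>w\<in>?S. (bgrad C' w \<bullet> h) *\<^sub>R w)"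
        by (rule sum.cong[OF refl]) (simp only: bgA(2))
      then show ?thesis unfolding L_def bgA(1) by simp
    qed
    also have "\<dots> = h" using sumS'[of "\<lambda>w. (bgrad C' w \<bullet> h) *\<^sub>R w"] C'.bgrad_repr[of h] by simp
    finally show ?thesis .
  qed
  have pre: "A -` (convex hull C') = convex hull C"
  proof -
    have "A x \<in> convex hull C' \<longleftrightarrow> x \<in> convex hull C" for x
    proof -
      have "(\<forall>w\<in>C'. 0 \<le> bary C' w (A x)) \<longleftrightarrow> (0 \<le> bary C' z' (A x) \<and> (\<forall>w\<in>?S. 0 \<le> bary C' w (A x)))"
        using CS(2) by (metis insert_iff)
      moreover have "(\<forall>w\<in>C. 0 \<le> bary C w x) \<longleftrightarrow> (0 \<le> bary C z x \<and> (\<forall>w\<in>?S. 0 \<le> bary C w x))"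
        using z by auto
      ultimately show ?thesis using bA by (simp add: hull_eq C'.hull_eq)
    qed
    then show ?thesis by auto
  qed
  have Az: "A z = z'"
  proof -
    have "(\<Sum>w\<in>?S. bary C w z *\<^sub>R w) = 0"
      by (rule sum.neutral) (use z in \<open>auto simp: bary_vertex\<close>)
    then show ?thesis using z by (simp add: A_def bary_vertex)
  qed
  have AS: "A x = x" if x: "x \<in> convex hull ?S" for x
  proof -
    have "bary C z x = 0" using x z sub_hull_eq[of "C - {z}"] by auto
    then show ?thesis using sumS[of "\<lambda>w. bary C w x *\<^sub>R w"] bary_repr[of x] by (simp add: A_def)
  qed
  \<comment> \<open>The transpose of \<open>L\<close>, which the chain rule requires for the
    gradient of \<open>\<phi> o A\<close>.\<close>
  define Lt where "Lt v = (\<Sum>w\<in>?S. (w \<bullet> v) *\<^sub>R bgrad C w) + (z' \<bullet> v) *\<^sub>R bgrad C z" for v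
  have Lt: "Lt v \<bullet> h = v \<bullet> L h" for v h
    by (simp add: Lt_def L_def inner_add_left inner_add_right inner_sum_left inner_sum_right inner_commute mult.commute)
  define \<psi> where "\<psi> x = \<phi> (A x) - \<phi> x" for x
  define G where "G x = Lt (grad \<phi> (A x)) - grad \<phi> x" for x
  have cA: "continuous_on UNIV A"
    unfolding A_def by (intro continuous_intros bary_continuous)
  have Ae: "A = (\<lambda>x. L x + A 0)" by (rule ext) (rule A0)
  have DA: "(A has_derivative L) (at x)" for x
  proof -
    have "(L has_derivative L) (at x)" by (rule linear_imp_has_derivative[OF linL])
    then have "((\<lambda>x. L x + A 0) has_derivative L) (at x)"
      using has_derivative_add_const by blast
    then show ?thesis by (subst Ae)
  qed
  have D\<psi>: "(\<psi> has_derivative (\<lambda>h. G x \<bullet> h)) (at x)" for x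
  proof (rule has_gradient_of_linear)
    show "(\<psi> has_derivative (\<lambda>h. grad \<phi> (A x) \<bullet> L h - grad \<phi> x \<bullet> h)) (at x)"
      unfolding \<psi>_def
      by (rule has_derivative_diff[OF has_derivative_compose[OF DA smooth_fun_has_derivative[OF \<phi>]] smooth_fun_has_derivative[OF \<phi>]])
    show "grad \<phi> (A x) \<bullet> L h - grad \<phi> x \<bullet> h = G x \<bullet> h" for h
      by (simp add: G_def inner_diff_left Lt)
  qed
  have cg: "continuous_on UNIV (grad \<phi>)" "continuous_on UNIV \<phi>"
    by (rule smooth_fun_grad_continuous[OF \<phi>] smooth_fun_continuous[OF \<phi>])+
  have cgA: "continuous_on UNIV (\<lambda>x. grad \<phi> (A x))" "continuous_on UNIV (\<lambda>x. \<phi> (A x))"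
    by (rule continuous_on_compose2[OF cg(1) cA] continuous_on_compose2[OF cg(2) cA]; simp)+
  have cG: "continuous_on UNIV G"
    unfolding G_def Lt_def by (intro continuous_intros cgA cg)
  have "(LINT x:convex hull C|lborel. ?n * \<psi> x + G x \<bullet> (x - z)) = 0"
    by (rule facet_flux_zero[OF z D\<psi> cG]) (simp add: \<psi>_def AS)
  moreover define f where "f y = ?n * \<phi> y + grad \<phi> y \<bullet> (y - z')" for y
  have "?n * \<psi> x + G x \<bullet> (x - z) = f (A x) - (?n * \<phi> x + grad \<phi> x \<bullet> (x - z))" for x
  proof -
    have "A x - z' = L (x - z)" using Adiff[of x z] Az by simp
    then have "grad \<phi> (A x) \<bullet> (A x - z') = Lt (grad \<phi> (A x)) \<bullet> (x - z)" by (simp add: Lt)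
    then show ?thesis by (simp add: \<psi>_def G_def f_def inner_diff_left algebra_simps)
  qed
  ultimately have "(LINT x:convex hull C|lborel. f (A x) - (?n * \<phi> x + grad \<phi> x \<bullet> (x - z))) = 0"
    by simp
  moreover have "set_integrable lborel (convex hull C) (\<lambda>x. f (A x))"
    unfolding f_def
    by (intro set_integrable_on_compact compact_hull continuous_intros cgA cA)
  moreover have "set_integrable lborel (convex hull C) (\<lambda>x. ?n * \<phi> x + grad \<phi> x \<bullet> (x - z))"
    by (intro set_integrable_on_compact compact_hull continuous_intros cg)
  ultimately have eq: "(LINT x:convex hull C|lborel. f (A x)) = (LINT x:convex hull C|lborel. ?n * \<phi> x + grad \<phi> x \<bullet> (x - z))"
    by (simp add: set_integral_diff)
  have cf: "continuous_on UNIV f" unfolding f_def by (intro continuous_intros cg)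
  have "(LINT x:convex hull C|lborel. f (L x + A 0)) / measure lborel (convex hull C) =
      (LINT x:convex hull C'|lborel. f x) / measure lborel (convex hull C')"
  proof (rule affine_integral[OF linL LJ C'.compact_hull _ _ compact_hull cf])
    show "(\<lambda>x. L x + A 0) -` (convex hull C') = convex hull C"
      using pre by (subst (asm) Ae)
    show "measure lborel (convex hull C') > 0"
      using C'.measure_hull_pos C'.measure_lborel_hull by simp
  qed
  then have "(LINT x:convex hull C|lborel. f (A x)) / measure lborel (convex hull C) =
      (LINT x:convex hull C'|lborel. f x) / measure lborel (convex hull C')"
    by (simp only: A0[symmetric])
  then show ?thesis
    unfolding facet_mean_def f_def[symmetric] eq[symmetric] by (metis divide_divide_eq_left mult.commute)
qed

lemma set_integral_lborel_sum:
  fixes f :: "'i \<Rightarrow> 'a \<Rightarrow> real"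
  assumes "finite I" "\<And>i. i \<in> I \<Longrightarrow> set_integrable lborel K (f i)"
  shows "(LINT x:K|lborel. \<Sum>i\<in>I. f i x) = (\<Sum>i\<in>I. LINT x:K|lborel. f i x)"
  using assms unfolding set_lebesgue_integral_def set_integrable_def
  by (simp only: scaleR_sum_right) (rule Bochner_Integration.integral_sum, simp)

lemma facet_mean_integrable:
  assumes \<phi>: "smooth_fun \<phi>"
  shows "set_integrable lborel (convex hull C) (\<lambda>x. real DIM('a) * \<phi> x + grad \<phi> x \<bullet> (x - z))"
  by (intro set_integrable_on_compact compact_hull continuous_intros
      smooth_fun_continuous[OF \<phi>] smooth_fun_grad_continuous[OF \<phi>])

text \<open>Weighting the flux integrals with \<open>- (bgrad C z \<bullet> e)\<close> leaves only
  the wanted term, because the gradients sum to 0 and \<open>bgrad_repr\<close> recovers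
  \<open>e\<close>. It says that the Crouzeix--Raviart interpolant by facet means has the mean
  gradient of \<phi>.\<close>

lemma facet_mean_gradient:
  assumes \<phi>: "smooth_fun \<phi>"
  shows "(LINT x:convex hull C|lborel. grad \<phi> x \<bullet> e) =
    measure lborel (convex hull C) * ((\<Sum>z\<in>C. (- real DIM('a) * facet_mean C z \<phi>) *\<^sub>R bgrad C z) \<bullet> e)"
proof -
  let ?K = "convex hull C" and ?n = "real DIM('a)"
  have pos: "measure lborel ?K > 0" using measure_hull_pos measure_lborel_hull by simp
  define c where "c z = - (bgrad C z \<bullet> e)" for z
  have "measure lborel ?K * ((\<Sum>z\<in>C. (- ?n * facet_mean C z \<phi>) *\<^sub>R bgrad C z) \<bullet> e) =
      (\<Sum>z\<in>C. c z * (LINT x:?K|lborel. ?n * \<phi> x + grad \<phi> x \<bullet> (x - z)))"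
    using pos by (simp add: facet_mean_def c_def inner_sum_left sum_distrib_left mult.commute)
  also have "\<dots> = (LINT x:?K|lborel. (\<Sum>z\<in>C. c z * (?n * \<phi> x + grad \<phi> x \<bullet> (x - z))))"
    by (subst set_integral_lborel_sum[OF finite_C]) (simp_all add: facet_mean_integrable \<phi>)
  also have "\<dots> = (LINT x:?K|lborel. grad \<phi> x \<bullet> e)"
  proof -
    have "(\<Sum>z\<in>C. c z * (?n * \<phi> x + grad \<phi> x \<bullet> (x - z))) = grad \<phi> x \<bullet> e" for x
    proof -
      have "(\<Sum>z\<in>C. c z * (?n * \<phi> x + grad \<phi> x \<bullet> (x - z))) =
          (\<Sum>z\<in>C. - (bgrad C z \<bullet> e) * (?n * \<phi> x + grad \<phi> x \<bullet> x) + (bgrad C z \<bullet> e) * (grad \<phi> x \<bullet> z))"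
        by (rule sum.cong) (simp_all add: c_def inner_diff_right algebra_simps)
      also have "\<dots> = - (\<Sum>z\<in>C. bgrad C z \<bullet> e) * (?n * \<phi> x + grad \<phi> x \<bullet> x) + (\<Sum>z\<in>C. (bgrad C z \<bullet> e) * (grad \<phi> x \<bullet> z))"
        by (simp only: sum.distrib sum_distrib_right[symmetric] sum_negf)
      also have "(\<Sum>z\<in>C. bgrad C z \<bullet> e) = 0" using bgrad_sum by (simp add: inner_sum_left[symmetric])
      also have "(\<Sum>z\<in>C. (bgrad C z \<bullet> e) * (grad \<phi> x \<bullet> z)) = grad \<phi> x \<bullet> (\<Sum>z\<in>C. (bgrad C z \<bullet> e) *\<^sub>R z)"
        by (simp add: inner_sum_right)
      finally show ?thesis by (simp add: bgrad_repr)
    qed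
    then show ?thesis by simp
  qed
  finally show ?thesis ..
qed

text \<open>Averaging the flux integrals over the vertices replaces \<open>z\<close> by the
  barycentre. With \<open>facet_mean_gradient\<close> this evaluates the pairing of a cellwise
  Raviart--Thomas field with a gradient.\<close>

lemma facet_mean_center:
  assumes \<phi>: "smooth_fun \<phi>"
  shows "(LINT x:convex hull C|lborel. grad \<phi> x \<bullet> (x - center)) =
    real DIM('a) * (measure lborel (convex hull C) * ((\<Sum>z\<in>C. facet_mean C z \<phi>) / real (DIM('a) + 1))
      - (LINT x:convex hull C|lborel. \<phi> x))"
proof -
  let ?K = "convex hull C" and ?n = "real DIM('a)"
  have pos: "measure lborel ?K > 0" using measure_hull_pos measure_lborel_hull by simp
  have i: "set_integrable lborel ?K (\<lambda>x. grad \<phi> x \<bullet> (x - center))" "set_integrable lborel ?K \<phi>"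
    by (intro set_integrable_on_compact compact_hull continuous_intros
      smooth_fun_continuous[OF \<phi>] smooth_fun_grad_continuous[OF \<phi>])+
  have "?n * (measure lborel ?K * ((\<Sum>z\<in>C. facet_mean C z \<phi>) / real (DIM('a) + 1))) =
     (\<Sum>z\<in>C. (LINT x:?K|lborel. ?n * \<phi> x + grad \<phi> x \<bullet> (x - z))) / real (DIM('a) + 1)"
    using pos by (simp add: facet_mean_def sum_divide_distrib[symmetric])
  also have "\<dots> = (LINT x:?K|lborel. (\<Sum>z\<in>C. ?n * \<phi> x + grad \<phi> x \<bullet> (x - z))) / real (DIM('a) + 1)"
    by (subst set_integral_lborel_sum) (auto intro!: facet_mean_integrable \<phi> finite_C)
  also have "\<dots> = (LINT x:?K|lborel. (\<Sum>z\<in>C. ?n * \<phi> x + grad \<phi> x \<bullet> (x - z)) / real (DIM('a) + 1))"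
    by simp
  also have "\<dots> = (LINT x:?K|lborel. ?n * \<phi> x + grad \<phi> x \<bullet> (x - center))"
  proof -
    have "(\<Sum>z\<in>C. ?n * \<phi> x + grad \<phi> x \<bullet> (x - z)) / real (DIM('a) + 1) = ?n * \<phi> x + grad \<phi> x \<bullet> (x - center)" for x
    proof -
      have c: "(\<Sum>z\<in>C. grad \<phi> x \<bullet> z) = real (DIM('a) + 1) * (grad \<phi> x \<bullet> center)"
        by (simp add: center_def scaleR_sum_right[symmetric] inner_sum_right[symmetric] del: of_nat_add)
      have "(\<Sum>z\<in>C. ?n * \<phi> x + grad \<phi> x \<bullet> (x - z)) = real (DIM('a) + 1) * (?n * \<phi> x + grad \<phi> x \<bullet> x) - (\<Sum>z\<in>C. grad \<phi> x \<bullet> z)"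
        by (simp add: inner_diff_right sum.distrib sum_subtractf card_C algebra_simps del: of_nat_add of_nat_Suc)
      also have "\<dots> = real (DIM('a) + 1) * (?n * \<phi> x + grad \<phi> x \<bullet> (x - center))"
        unfolding c by (simp add: inner_diff_right algebra_simps)
      finally show ?thesis by (simp del: of_nat_add)
    qed
    then show ?thesis by simp
  qed
  also have "\<dots> = ?n * (LINT x:?K|lborel. \<phi> x) + (LINT x:?K|lborel. grad \<phi> x \<bullet> (x - center))"
    using i by simp
  finally show ?thesis by (simp add: algebra_simps)
qed

end

section \<open>Simplicial meshes\<close>

lemma ball_avoids_finite:
  fixes x :: "'a::metric_space"
  assumes "finite \<F>" "\<And>A. A \<in> \<F> \<Longrightarrow> closed A"
  shows "\<exists>r>0. \<forall>A\<in>\<F>. A \<inter> ball x r \<noteq> {} \<longrightarrow> x \<in> A"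
  using assms
proof (induction \<F> rule: finite_induct)
  case empty
  show ?case by (intro exI[of _ 1]) simp
next
  case (insert A \<F>)
  then obtain r where r: "r > 0" "\<forall>A\<in>\<F>. A \<inter> ball x r \<noteq> {} \<longrightarrow> x \<in> A" by auto
  show ?case
  proof (cases "x \<in> A")
    case True
    then show ?thesis using r by blast
  next
    case False
    have "open (- A)" using insert.prems by auto
    then obtain s where s: "s > 0" "ball x s \<subseteq> - A" using False by (meson ComplI open_contains_ball)
    have "\<forall>B\<in>insert A \<F>. B \<inter> ball x (min r s) \<noteq> {} \<longrightarrow> x \<in> B"
    proof (intro ballI impI)
      fix B assume B: "B \<in> insert A \<F>" "B \<inter> ball x (min r s) \<noteq> {}"
      then obtain y where y: "y \<in> B" "y \<in> ball x r" "y \<in> ball x s" by auto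
      show "x \<in> B"
      proof (cases "B = A")
        case True
        then show ?thesis using y s by auto
      next
        case False
        then show ?thesis using B(1) y r(2) by blast
      qed
    qed
    then show ?thesis using r(1) s(1) by (intro exI[of _ "min r s"]) simp
  qed
qed

context nsimplex
begin

lemma sub_hull_negligible:
  assumes "S \<subseteq> C" "S \<noteq> C"
  shows "negligible (convex hull S)"
proof -
  obtain z where z: "z \<in> C" "z \<notin> S" using assms by blast
  have "convex hull S \<subseteq> {x. bgrad C z \<bullet> x = bgrad C z \<bullet> z - 1}"
  proof
    fix x assume "x \<in> convex hull S"
    then have "bary C z x = 0" using sub_hull_eq[OF assms(1)] z by blast
    then show "x \<in> {x. bgrad C z \<bullet> x = bgrad C z \<bullet> z - 1}" by (simp add: bary_def inner_diff_right)
  qed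
  moreover have "negligible {x. bgrad C z \<bullet> x = bgrad C z \<bullet> z - 1}"
    by (rule negligible_hyperplane) (use bgrad_nonzero[OF z(1)] in simp)
  ultimately show ?thesis by (rule negligible_subset[rotated])
qed

lemma bary_pos_subset:
  assumes "x \<in> convex hull (C \<inter> C')" "w \<in> C" "0 < bary C w x"
  shows "w \<in> C'"
proof (rule ccontr)
  assume "w \<notin> C'"
  then have "bary C w x = 0" using sub_hull_eq[of "C \<inter> C'"] assms(1,2) by blast
  with assms(3) show False by simp
qed

lemma interior_hull_avoid:
  assumes "x \<in> interior (convex hull C)" "S \<subseteq> C" "S \<noteq> C"
  shows "x \<notin> convex hull S"
proof
  assume x: "x \<in> convex hull S"
  obtain z where z: "z \<in> C" "z \<notin> S" using assms by blast
  then have "bary C z x = 0" using sub_hull_eq[OF assms(2)] x by blast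
  moreover have "0 < bary C z x" using assms(1) z(1) by (simp add: interior_eq)
  ultimately show False by simp
qed

lemma facet_nonempty: assumes "z \<in> C" shows "C - {z} \<noteq> {}"
proof
  assume "C - {z} = {}"
  then have "C = {z}" using assms by blast
  then have "card C = 1" by simp
  then show False using card_C by simp
qed

lemma facet_card: "z \<in> C \<Longrightarrow> card (C - {z}) = DIM('a)"
  using card_C finite_C by (simp add: card_Diff_singleton)

end

text \<open>A mesh is given by the vertex sets of its simplices, so that faces are subsets and
  conformity is an intersection of vertex sets. \<open>regular_domain\<close> excludes slits: a
  point surrounded by the mesh lies in \<Omega>.\<close>

locale mesh =
  fixes \<Omega> :: "'a::euclidean_space set" and \<V> :: "'a set set"
  assumes finite_mesh: "finite \<V>"
    and simplices: "C \<in> \<V> \<Longrightarrow> nsimplex C"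
    and conforming: "C \<in> \<V> \<Longrightarrow> C' \<in> \<V> \<Longrightarrow> convex hull C \<inter> convex hull C' = convex hull (C \<inter> C')"
    and cover: "(\<Union>C\<in>\<V>. convex hull C) = closure \<Omega>"
    and open_domain: "open \<Omega>" and bounded_domain: "bounded \<Omega>"
    and regular_domain: "interior (closure \<Omega>) = \<Omega>"
begin

lemmas domain = open_domain bounded_domain

lemma finite_vertices: "C \<in> \<V> \<Longrightarrow> finite C"
  by (rule nsimplex.finite_C[OF simplices])

lemma interior_point_unique:
  assumes "C \<in> \<V>" "C' \<in> \<V>" "x \<in> interior (convex hull C)" "x \<in> convex hull C'"
  shows "C' = C"
proof -
  interpret C: nsimplex C using simplices assms by blast
  interpret C': nsimplex C' using simplices assms by blast
  have "x \<in> convex hull (C \<inter> C')"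
    using conforming[OF assms(1,2)] assms(3,4) interior_subset by blast
  then have "C \<inter> C' = C" using C.interior_hull_avoid[OF assms(3), of "C \<inter> C'"] by blast
  then have "C \<subseteq> C'" by blast
  then show ?thesis using C.card_C C'.card_C C'.finite_C by (metis card_subset_eq)
qed

lemma interior_subset_domain: assumes "C \<in> \<V>" shows "interior (convex hull C) \<subseteq> \<Omega>"
proof -
  have "convex hull C \<subseteq> closure \<Omega>" using cover assms by blast
  then have "interior (convex hull C) \<subseteq> interior (closure \<Omega>)" by (rule interior_mono)
  then show ?thesis by (simp add: regular_domain)
qed

lemma negligible_skeleton: "negligible (\<Omega> - (\<Union>C\<in>\<V>. interior (convex hull C)))"
proof -
  have "negligible (\<Union>C\<in>\<V>. frontier (convex hull C))"
    using finite_mesh by (intro negligible_Union) (auto intro: negligible_convex_frontier convex_convex_hull)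
  moreover have "\<Omega> - (\<Union>C\<in>\<V>. interior (convex hull C)) \<subseteq> (\<Union>C\<in>\<V>. frontier (convex hull C))"
  proof
    fix x assume x: "x \<in> \<Omega> - (\<Union>C\<in>\<V>. interior (convex hull C))"
    then have "x \<in> closure \<Omega>" using closure_subset by blast
    then obtain C where C: "C \<in> \<V>" "x \<in> convex hull C" using cover by blast
    then have "x \<in> frontier (convex hull C)" using x closure_subset[of "convex hull C"] by (auto simp: frontier_def)
    with C(1) show "x \<in> (\<Union>C\<in>\<V>. frontier (convex hull C))" by blast
  qed
  ultimately show ?thesis by (rule negligible_subset)
qed

text \<open>Decided by vertex sets alone. A set contained in no simplex satisfies it vacuously, so a
  function that vanishes on all boundary facets vanishes on such sets as well.\<close>

definition boundary_facet :: "'a set \<Rightarrow> bool" where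
  "boundary_facet S \<longleftrightarrow> (\<forall>C\<in>\<V>. \<forall>C'\<in>\<V>. S \<subseteq> C \<longrightarrow> S \<subseteq> C' \<longrightarrow> C = C')"

lemma neighbour_eq:
  assumes "C \<in> \<V>" "C' \<in> \<V>" "z \<in> C" "C - {z} \<subseteq> C'" "C' \<noteq> C"
  obtains z' where "z' \<in> C'" "C' - {z'} = C - {z}" "z' \<notin> C"
proof -
  interpret C: nsimplex C using simplices assms by blast
  interpret C': nsimplex C' using simplices assms by blast
  have "card (C' - (C - {z})) = 1"
    using C.facet_card[OF assms(3)] C'.card_C C'.finite_C assms(4) C.finite_C by (simp add: card_Diff_subset)
  then obtain z' where z': "C' - (C - {z}) = {z'}" by (auto simp: card_1_singleton_iff)
  have eq: "C' - {z'} = C - {z}" using z' assms(4) by blast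
  moreover have "z' \<in> C'" using z' by blast
  moreover have "z' \<notin> C"
  proof
    assume "z' \<in> C"
    then have "z' = z" using z' by blast
    then have "C' = C" using eq \<open>z' \<in> C'\<close> assms(3) by blast
    with assms(5) show False by blast
  qed
  ultimately show ?thesis using that by blast
qed

text \<open>The coordinate of \<open>z\<close> is a multiple \<open>a\<close> of the coordinate that
  the neighbour attaches to its own opposite vertex \<open>z'\<close>. The factor is negative, since
  otherwise moving from p towards \<open>z'\<close> would lead into the interior of \<open>C\<close>
  within the other simplex. Near p the remaining coordinates stay positive, and the sign of this one
  decides between the two simplices.\<close>

lemma neighbourhood_of_shared_facet:
  assumes C: "C \<in> \<V>" "C' \<in> \<V>" "z \<in> C" "C - {z} \<subseteq> C'" "C' \<noteq> C"
    and p: "bary C z p = 0" "\<And>w. w \<in> C - {z} \<Longrightarrow> 0 < bary C w p"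
  shows "\<exists>r>0. ball p r \<subseteq> convex hull C \<union> convex hull C'"
proof -
  interpret C: nsimplex C using simplices C by blast
  interpret C': nsimplex C' using simplices C by blast
  obtain z' where z': "z' \<in> C'" "C' - {z'} = C - {z}" "z' \<notin> C"
    using neighbour_eq[OF C] by blast
  define a where "a = bary C z z'"
  have scal: "bary C z x = a * bary C' z' x" for x
  proof -
    have "bary C z x = bary C z (\<Sum>w\<in>C'. bary C' w x *\<^sub>R w)" by (simp add: C'.bary_repr)
    also have "\<dots> = (\<Sum>w\<in>C'. bary C' w x * bary C z w)"
      by (rule C.bary_affine_sum) (rule C'.bary_sum)
    also have "\<dots> = bary C' z' x * bary C z z' + (\<Sum>w\<in>C - {z}. bary C' w x * bary C z w)"
      using sum.remove[OF C'.finite_C z'(1), of "\<lambda>w. bary C' w x * bary C z w"] z'(2) by simp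
    also have "(\<Sum>w\<in>C - {z}. bary C' w x * bary C z w) = 0"
      by (rule sum.neutral) (use C(3) in \<open>auto simp: C.bary_vertex\<close>)
    finally show ?thesis by (simp add: a_def)
  qed
  have pK: "p \<in> convex hull C"
  proof -
    have "0 \<le> bary C w p" if "w \<in> C" for w using p that by (cases "w = z") (auto simp: less_imp_le)
    then show ?thesis by (simp add: C.hull_eq)
  qed
  have "p \<in> convex hull (C - {z})"
    using pK p(1) C(3) C.sub_hull_eq[of "C - {z}"] by auto
  then have pK': "p \<in> convex hull C'" using hull_mono[OF C(4)] by blast
  have p': "0 < bary C' w p" if w: "w \<in> C - {z}" for w
  proof -
    have "p = (\<Sum>v\<in>C. bary C v p *\<^sub>R v)" by (simp add: C.bary_repr)
    also have "\<dots> = (\<Sum>v\<in>C - {z}. bary C v p *\<^sub>R v)"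
      using sum.remove[OF C.finite_C C(3), of "\<lambda>v. bary C v p *\<^sub>R v"] p(1) by simp
    finally have pe: "p = (\<Sum>v\<in>C - {z}. bary C v p *\<^sub>R v)" .
    have s1: "(\<Sum>v\<in>C - {z}. bary C v p) = 1"
      using sum.remove[OF C.finite_C C(3), of "\<lambda>v. bary C v p"] p(1) C.bary_sum by simp
    have "bary C' w p = (\<Sum>v\<in>C - {z}. bary C v p * bary C' w v)"
      by (subst pe) (rule C'.bary_affine_sum[OF s1])
    also have "\<dots> = (\<Sum>v\<in>C - {z}. if v = w then bary C v p else 0)"
      by (rule sum.cong) (use w C(4) in \<open>auto simp: C'.bary_vertex subset_iff\<close>)
    also have "\<dots> = bary C w p" using w C.finite_C by simp
    finally show ?thesis using p(2)[OF w] by simp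
  qed
  have a: "a < 0"
  proof (rule ccontr)
    assume "\<not> a < 0"
    moreover have "a \<noteq> 0"
    proof
      assume "a = 0"
      then have "bary C z z = 0" using scal by simp
      then show False using C(3) by (simp add: C.bary_vertex)
    qed
    ultimately have a0: "a > 0" by simp
    have "\<forall>\<^sub>F t in at_right 0. \<forall>w\<in>C - {z}. 0 < bary C w (p + t *\<^sub>R (z' - p))"
    proof (rule eventually_ball_finite)
      show "\<forall>w\<in>C - {z}. \<forall>\<^sub>F t in at_right 0. 0 < bary C w (p + t *\<^sub>R (z' - p))"
      proof
        fix w assume w: "w \<in> C - {z}"
        have "((\<lambda>t. bary C w (p + t *\<^sub>R (z' - p))) \<longlongrightarrow> bary C w (p + 0 *\<^sub>R (z' - p))) (at_right 0)"
          unfolding bary_def by (intro tendsto_intros)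
        then show "\<forall>\<^sub>F t in at_right 0. 0 < bary C w (p + t *\<^sub>R (z' - p))"
          by (rule order_tendstoD(1)) (use p(2)[OF w] in simp)
      qed
    qed (use C.finite_C in simp)
    moreover have "\<forall>\<^sub>F t::real in at_right 0. 0 < t \<and> t < 1"
      by (simp add: eventually_at_right_less eventually_conj_iff eventually_at_right_field) (auto intro: exI[of _ 1])
    ultimately have "\<forall>\<^sub>F t in at_right 0. (\<forall>w\<in>C - {z}. 0 < bary C w (p + t *\<^sub>R (z' - p))) \<and> 0 < t \<and> t < 1"
      by (rule eventually_conj)
    then obtain t where t: "\<And>w. w \<in> C - {z} \<Longrightarrow> 0 < bary C w (p + t *\<^sub>R (z' - p))" "0 < t" "t < 1"
      using eventually_happens[of _ "at_right (0::real)"] by (metis (no_types, lifting) trivial_limit_at_right_real)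
    define q where "q = p + t *\<^sub>R (z' - p)"
    have qe: "q = (1 - t) *\<^sub>R p + t *\<^sub>R z'" by (simp add: q_def algebra_simps)
    have bq: "bary C z q = t * a" unfolding qe C.bary_convex using p(1) by (simp add: a_def)
    then have bqp: "bary C z q > 0" using t(2) a0 by simp
    have "0 < bary C w q" if "w \<in> C" for w
      using t(1)[of w] that bqp by (cases "w = z") (auto simp: q_def[symmetric])
    then have qi: "q \<in> interior (convex hull C)" by (simp add: C.interior_eq)
    have "q \<in> convex hull C'"
      unfolding qe using pK' C'.vertex_in_hull[OF z'(1)] t convex_convex_hull[of C'] by (simp add: convex_alt)
    then show False using interior_point_unique[OF C(1,2) qi] C(5) by blast
  qed
  define U where "U = (\<Inter>w\<in>C - {z}. {x. 0 < bary C w x}) \<inter> (\<Inter>w\<in>C - {z}. {x. 0 < bary C' w x})"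
  have "open U"
    unfolding U_def using C.finite_C
    by (intro open_Int open_INT ballI open_Collect_less C.bary_continuous C'.bary_continuous continuous_intros) auto
  moreover have "p \<in> U" using p(2) p' by (auto simp: U_def)
  ultimately obtain r where r: "r > 0" "ball p r \<subseteq> U" by (meson open_contains_ball)
  have "U \<subseteq> convex hull C \<union> convex hull C'"
  proof
    fix q assume q: "q \<in> U"
    show "q \<in> convex hull C \<union> convex hull C'"
    proof (cases "0 \<le> bary C z q")
      case True
      have "0 \<le> bary C w q" if "w \<in> C" for w
        using True q that by (cases "w = z") (auto simp: U_def less_imp_le)
      then show ?thesis by (simp add: C.hull_eq)
    next
      case False
      then have "0 \<le> bary C' z' q" using scal[of q] a by (simp add: mult_less_0_iff not_le)
      then have "0 \<le> bary C' w q" if "w \<in> C'" for w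
      proof (cases "w = z'")
        case False
        then have "w \<in> C - {z}" using that z'(2) by blast
        then show ?thesis using q by (auto simp: U_def less_imp_le)
      qed simp
      then show ?thesis by (simp add: C'.hull_eq)
    qed
  qed
  with r show ?thesis by blast
qed

lemma ball_avoids_faces:
  "\<exists>r>0. \<forall>C\<in>\<V>. \<forall>S. S \<subseteq> C \<longrightarrow> convex hull S \<inter> ball x r \<noteq> {} \<longrightarrow> x \<in> convex hull S"
proof -
  let ?F = "(\<lambda>S. convex hull S) ` (\<Union>C\<in>\<V>. Pow C)"
  note fC = finite_vertices
  have "finite ?F" using finite_mesh fC by auto
  moreover have "closed A" if A: "A \<in> ?F" for A
  proof -
    obtain S C where "A = convex hull S" "S \<subseteq> C" "C \<in> \<V>" using A by blast
    then have "compact A" using fC finite_subset by (metis compact_convex_hull finite_imp_compact)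
    then show ?thesis by (rule compact_imp_closed)
  qed
  ultimately obtain r where r: "r > 0" "\<forall>A\<in>?F. A \<inter> ball x r \<noteq> {} \<longrightarrow> x \<in> A"
    using ball_avoids_finite[of ?F x] by blast
  then show ?thesis by (intro exI[of _ r]) blast
qed

text \<open>Were a relative interior point of the facet in \<Omega>, a small step away from
  \<open>z\<close> would leave \<open>C\<close> but not \<Omega> and reach another simplex, which by
  conformity contains the whole facet.\<close>

lemma boundary_facet_outside:
  assumes C: "C \<in> \<V>" "z \<in> C" "boundary_facet (C - {z})" and p: "p \<in> convex hull (C - {z})"
  shows "p \<notin> \<Omega>"
proof -
  interpret C: nsimplex C using simplices C by blast
  have rel: "p \<notin> \<Omega>" if p: "bary C z p = 0" "\<And>w. w \<in> C - {z} \<Longrightarrow> 0 < bary C w p" for p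
  proof
    assume pO: "p \<in> \<Omega>"
    obtain r where r: "r > 0" "\<forall>C\<in>\<V>. \<forall>S. S \<subseteq> C \<longrightarrow> convex hull S \<inter> ball p r \<noteq> {} \<longrightarrow> p \<in> convex hull S"
      by (rule ball_avoids_faces[of p, THEN exE]) (erule conjE, rule that)
    obtain s where s: "s > 0" "ball p s \<subseteq> \<Omega>" using pO open_domain by (meson open_contains_ball)
    have zp: "z \<noteq> p" using p(1) C(2) by (auto simp: C.bary_vertex)
    define t where "t = min r s / (2 * norm (z - p))"
    have t: "t > 0" "t * norm (z - p) < min r s" using r(1) s(1) zp by (auto simp: t_def)
    define q where "q = p - t *\<^sub>R (z - p)"
    have qb: "q \<in> ball p r" "q \<in> ball p s" using t by (auto simp: q_def dist_norm)
    then have "q \<in> closure \<Omega>" using s closure_subset by blast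
    then obtain C' where C': "C' \<in> \<V>" "q \<in> convex hull C'" using cover by blast
    then have pC': "p \<in> convex hull C'" using r(2) qb by blast
    have "bary C z q = - t"
    proof -
      have "q = (1 - (- t)) *\<^sub>R p + (- t) *\<^sub>R z" by (simp add: q_def algebra_simps)
      then show ?thesis using C.bary_convex[of z "- t" p z] p(1) C(2) by (simp add: C.bary_vertex)
    qed
    then have "\<not> 0 \<le> bary C z q" using t(1) by simp
    then have "q \<notin> convex hull C" using C(2) by (auto simp: C.hull_eq)
    then have ne: "C' \<noteq> C" using C' by blast
    have pC: "p \<in> convex hull C"
    proof -
      have "0 \<le> bary C w p" if "w \<in> C" for w using p that by (cases "w = z") (auto simp: less_imp_le)
      then show ?thesis by (simp add: C.hull_eq)
    qed
    have "p \<in> convex hull (C \<inter> C')" using conforming[OF C(1) C'(1)] pC pC' by blast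
    then have "C - {z} \<subseteq> C'" using C.bary_pos_subset p(2) by blast
    then show False using C(1,3) C'(1) ne unfolding boundary_facet_def by blast
  qed
  show ?thesis
  proof
    assume pO: "p \<in> \<Omega>"
    obtain s where s: "s > 0" "ball p s \<subseteq> \<Omega>" using pO open_domain by (meson open_contains_ball)
    \<comment> \<open>The weights of the facet's barycentre \<open>m\<close>. Any other point of the
      facet is moved slightly towards \<open>m\<close>; the result is a relative interior point that
      still lies in the open set \<Omega>.\<close>
    define u where "u w = (if w = z then 0 else 1 / real DIM('a))" for w
    have "sum u C = (\<Sum>w\<in>C - {z}. 1 / real DIM('a))"
      using sum.remove[OF C.finite_C C(2), of u] by (auto simp: u_def intro!: sum.cong)
    then have u1: "sum u C = 1" using C.facet_card[OF C(2)] by simp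
    define m where "m = (\<Sum>w\<in>C. u w *\<^sub>R w)"
    have bm: "bary C w m = u w" if "w \<in> C" for w unfolding m_def by (rule C.bary_unique[OF u1 that])
    define t where "t = min (1 / 2) (s / (2 * (norm (m - p) + 1)))"
    have np: "norm (m - p) + 1 > 0" using norm_ge_zero[of "m - p"] by linarith
    have t: "0 < t" "t < 1" "t * norm (m - p) < s"
    proof -
      show t0: "0 < t" "t < 1" using s(1) np by (auto simp: t_def)
      have "t * norm (m - p) \<le> s / (2 * (norm (m - p) + 1)) * norm (m - p)"
        by (rule mult_right_mono) (auto simp: t_def)
      also have "\<dots> < s" using s(1) np by (simp add: field_simps add_pos_nonneg)
      finally show "t * norm (m - p) < s" .
    qed
    define q where "q = (1 - t) *\<^sub>R p + t *\<^sub>R m"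
    have "p - q = (- t) *\<^sub>R (m - p)" by (simp add: q_def algebra_simps)
    then have "q \<in> ball p s" using t by (simp add: dist_norm)
    then have "q \<in> \<Omega>" using s by blast
    have bp: "bary C z p = 0" "\<And>w. w \<in> C \<Longrightarrow> 0 \<le> bary C w p"
      using p C(2) C.sub_hull_eq[of "C - {z}"] C.hull_eq by auto
    have "bary C z q = 0" unfolding q_def C.bary_convex using bp(1) bm[OF C(2)] by (simp add: u_def)
    moreover have "0 < bary C w q" if w: "w \<in> C - {z}" for w
    proof -
      have "0 < t * bary C w m" using bm[of w] w t by (auto simp: u_def)
      moreover have "0 \<le> (1 - t) * bary C w p" using bp(2)[of w] w t by auto
      ultimately show ?thesis unfolding q_def C.bary_convex by linarith
    qed
    ultimately show False using rel \<open>q \<in> \<Omega>\<close> by blast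
  qed
qed

text \<open>A generic segment starting in the union only meets the mesh outside the codimension two skeleton,
  so its last point in the union would have to lie in the interior of a boundary facet.\<close>

lemma facet_closed_patch_neighbourhood:
  assumes sub: "\<C> \<subseteq> {C \<in> \<V>. x \<in> convex hull C}" and ne: "\<C> \<noteq> {}"
    and clos: "\<And>C C' z. C \<in> \<C> \<Longrightarrow> z \<in> C \<Longrightarrow> x \<in> convex hull (C - {z}) \<Longrightarrow> C' \<in> \<V> \<Longrightarrow> C - {z} \<subseteq> C' \<Longrightarrow> C' \<in> \<C>"
    and nb: "\<And>C z. C \<in> \<C> \<Longrightarrow> z \<in> C \<Longrightarrow> x \<in> convex hull (C - {z}) \<Longrightarrow> \<not> boundary_facet (C - {z})"
  shows "\<exists>r>0. ball x r \<subseteq> (\<Union>C\<in>\<C>. convex hull C)"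
proof -
  define U where "U = (\<Union>C\<in>\<C>. convex hull C)"
  have fin: "finite \<C>" using sub finite_mesh finite_subset by (metis (no_types, lifting) mem_Collect_eq subsetI subset_iff)
  have "compact (convex hull C)" if "C \<in> \<C>" for C
    using nsimplex.compact_hull[OF simplices] sub that by blast
  then have "compact U" unfolding U_def using fin by blast
  then have clU: "closed U" by (rule compact_imp_closed)
  obtain r where r: "r > 0" "\<forall>C\<in>\<V>. \<forall>S. S \<subseteq> C \<longrightarrow> convex hull S \<inter> ball x r \<noteq> {} \<longrightarrow> x \<in> convex hull S"
    by (rule ball_avoids_faces[of x, THEN exE]) (erule conjE, rule that)
  obtain C0 where C0: "C0 \<in> \<C>" using ne by blast
  then have C0V: "C0 \<in> \<V>" "x \<in> convex hull C0" using sub by auto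
  interpret C0: nsimplex C0 using simplices C0V by blast
  have "x \<in> closure (interior (convex hull C0))"
    using C0V(2) convex_closure_interior[OF convex_convex_hull[of C0]] C0.center_interior closure_subset by blast
  then obtain p0 where p0: "p0 \<in> interior (convex hull C0)" "p0 \<in> ball x r"
    using r(1) by (metis closure_approachable dist_commute mem_ball)
  \<comment> \<open>Faces with at most n - 1 vertices have codimension at least two; their affine
    hulls with \<open>p0\<close> are still null sets.\<close>
  define \<S> where "\<S> = {S. \<exists>C\<in>\<V>. S \<subseteq> C \<and> card S \<le> DIM('a) - 1}"
  define N where "N = (\<Union>S\<in>\<S>. affine hull (insert p0 S))"
  note fC = finite_vertices
  have fS: "finite \<S>"
  proof (rule finite_subset)
    show "\<S> \<subseteq> (\<Union>C\<in>\<V>. Pow C)" by (auto simp: \<S>_def)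
    show "finite (\<Union>C\<in>\<V>. Pow C)" using finite_mesh fC by auto
  qed
  have negN: "negligible N"
    unfolding N_def
  proof (rule negligible_Union)
    fix A assume "A \<in> (\<lambda>S. affine hull (insert p0 S)) ` \<S>"
    then obtain S C where S: "A = affine hull (insert p0 S)" "C \<in> \<V>" "S \<subseteq> C" "card S \<le> DIM('a) - 1" by (auto simp: \<S>_def)
    have "finite S" using S fC finite_subset by blast
    have "aff_dim (insert p0 S) \<le> int (card (insert p0 S)) - 1" by (rule aff_dim_le_card) (use \<open>finite S\<close> in simp)
    also have "\<dots> \<le> int (card S)" using card_insert_le_m1 \<open>finite S\<close> by (simp add: card_insert_if)
    also have "\<dots> < int DIM('a)"
    proof -
      have "card S < DIM('a)" using S(4) DIM_positive[where 'a='a] by linarith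
      then show ?thesis by simp
    qed
    finally have "aff_dim A < int DIM('a)" by (simp add: S(1))
    then have "interior A = {}" using aff_dim_nonempty_interior[of A] by fastforce
    then show "negligible A" using S(1) by (simp add: negligible_convex_interior affine_imp_convex)
  qed (use fS in simp)
  have main: "y \<in> U" if y: "y \<in> ball x r" "y \<notin> N" for y
  proof (rule ccontr)
    assume yU: "y \<notin> U"
    define p where "p t = p0 + t *\<^sub>R (y - p0)" for t :: real
    have cp: "continuous_on S p" for S unfolding p_def by (intro continuous_intros)
    define D where "D = {0..1} \<inter> p -` U"
    have "closed (p -` U)" by (rule closed_vimage[OF clU cp])
    then have "compact D" unfolding D_def by (simp add: compact_Int_closed)
    moreover have "0 \<in> D" using p0(1) C0 interior_subset by (auto simp: D_def p_def U_def)
    \<comment> \<open>\<open>p t\<close> is the last point of the segment in the union, so by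
      \<open>no_ball\<close> the union contains no ball around it.\<close>
    ultimately obtain t where t: "t \<in> D" "\<And>s. s \<in> D \<Longrightarrow> s \<le> t" using compact_attains_sup[of D] by blast
    have t01: "0 \<le> t" "t \<le> 1" using t(1) by (auto simp: D_def)
    have "t \<noteq> 1" using yU t(1) by (auto simp: D_def p_def)
    then have t1: "t < 1" using t01 by simp
    have no_ball: False if e: "e > 0" "ball (p t) e \<subseteq> U" for e
    proof -
      define s where "s = min ((1 - t) / 2) (e / (2 * (norm (y - p0) + 1)))"
      have np: "norm (y - p0) + 1 > 0" using norm_ge_zero[of "y - p0"] by linarith
      have "s \<le> (1 - t) / 2" unfolding s_def by (rule min.cobounded1)
      moreover have "(1 - t) / 2 \<le> 1 - t" using t1 by simp
      ultimately have s2: "s \<le> 1 - t" by (rule order_trans)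
      have "0 < s" using t1 e(1) np by (simp add: s_def)
      note s = this s2
      have "s * norm (y - p0) \<le> e / (2 * (norm (y - p0) + 1)) * norm (y - p0)"
        by (rule mult_right_mono) (auto simp: s_def)
      also have "\<dots> < e" using e(1) np by (simp add: field_simps add_pos_nonneg)
      finally have "s * norm (y - p0) < e" .
      moreover have "p t - p (t + s) = (- s) *\<^sub>R (y - p0)" by (simp add: p_def algebra_simps)
      ultimately have "p (t + s) \<in> ball (p t) e" using s by (simp add: dist_norm)
      then have "t + s \<in> D" using e(2) s t01 by (auto simp: D_def)
      then show False using t(2)[of "t + s"] s by simp
    qed
    have "p t \<in> U" using t(1) by (simp add: D_def)
    then obtain C1 where C1: "C1 \<in> \<C>" "p t \<in> convex hull C1" by (auto simp: U_def)
    then have C1V: "C1 \<in> \<V>" using sub by blast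
    interpret C1: nsimplex C1 using simplices C1V by blast
    have no_int: "p t \<notin> interior (convex hull C)" if "C \<in> \<C>" for C
    proof
      assume "p t \<in> interior (convex hull C)"
      then obtain e where "e > 0" "ball (p t) e \<subseteq> convex hull C" by (auto simp: mem_interior)
      moreover have "convex hull C \<subseteq> U" using that by (auto simp: U_def)
      ultimately show False using no_ball by blast
    qed
    have tpos: "t > 0"
    proof (rule ccontr)
      assume "\<not> t > 0"
      then have "p t = p0" using t01 by (simp add: p_def)
      then show False using no_int[OF C0] p0(1) by simp
    qed
    have no_low: "p t \<notin> convex hull S" if S: "S \<subseteq> C1" "card S \<le> DIM('a) - 1" for S
    proof
      assume "p t \<in> convex hull S"
      then have "p t \<in> affine hull (insert p0 S)"
        using convex_hull_subset_affine_hull hull_mono[of S "insert p0 S" affine] by blast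
      moreover have "p0 \<in> affine hull (insert p0 S)" by (simp add: hull_inc)
      moreover have "y = (1 - 1 / t) *\<^sub>R p0 + (1 / t) *\<^sub>R p t" using tpos by (simp add: p_def algebra_simps)
      ultimately have "y \<in> affine hull (insert p0 S)"
        using mem_affine[OF affine_affine_hull, of p0 "insert p0 S" "p t" "1 - 1 / t" "1 / t"] by simp
      then have "y \<in> N" using S C1V unfolding N_def \<S>_def by blast
      with y(2) show False by blast
    qed
    have "p t \<in> ball x r"
    proof -
      have "p t = (1 - t) *\<^sub>R p0 + t *\<^sub>R y" by (simp add: p_def algebra_simps)
      then show ?thesis using convex_ball[of x r] p0(2) y(1) t01 by (simp add: convex_alt)
    qed
    obtain z where z: "z \<in> C1" "bary C1 z (p t) = 0"
    proof -
      have "\<not> (\<forall>w\<in>C1. 0 < bary C1 w (p t))" using no_int[OF C1(1)] by (simp add: C1.interior_eq)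
      moreover have "\<forall>w\<in>C1. 0 \<le> bary C1 w (p t)" using C1(2) by (simp add: C1.hull_eq)
      ultimately show ?thesis using that by force
    qed
    have pos: "0 < bary C1 w (p t)" if w: "w \<in> C1 - {z}" for w
    proof (rule ccontr)
      assume "\<not> 0 < bary C1 w (p t)"
      moreover have "0 \<le> bary C1 w (p t)" using C1(2) w by (simp add: C1.hull_eq)
      ultimately have w0: "bary C1 w (p t) = 0" by simp
      have "C1 - (C1 - {z, w}) = {z, w}" using z w by blast
      then have "p t \<in> convex hull (C1 - {z, w})"
        using C1.sub_hull_eq[of "C1 - {z, w}"] C1(2) z(2) w0 by auto
      moreover have "card (C1 - {z, w}) \<le> DIM('a) - 1"
      proof -
        have "card (C1 - {z, w}) = card C1 - card {z, w}"
          by (rule card_Diff_subset) (use z w in auto)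
        moreover have "card {z, w} = 2" using w by auto
        ultimately show ?thesis using C1.card_C by simp
      qed
      ultimately show False using no_low[of "C1 - {z, w}"] by blast
    qed
    have "C1 - (C1 - {z}) = {z}" using z by blast
    then have "p t \<in> convex hull (C1 - {z})"
      using C1.sub_hull_eq[of "C1 - {z}"] C1(2) z by auto
    then have xf: "x \<in> convex hull (C1 - {z})"
      using r(2)[rule_format, OF C1V, of "C1 - {z}"] \<open>p t \<in> ball x r\<close> by blast
    then have "\<not> boundary_facet (C1 - {z})" by (rule nb[OF C1(1) z(1)])
    then obtain Ca Cb where Cab: "Ca \<in> \<V>" "Cb \<in> \<V>" "C1 - {z} \<subseteq> Ca" "C1 - {z} \<subseteq> Cb" "Ca \<noteq> Cb"
      unfolding boundary_facet_def by auto
    obtain C2 where C2: "C2 \<in> \<V>" "C1 - {z} \<subseteq> C2" "C2 \<noteq> C1"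
    proof (cases "Ca = C1")
      case True
      then show ?thesis using Cab that[of Cb] by simp
    next
      case False
      then show ?thesis using Cab that[of Ca] by simp
    qed
    have C2C: "C2 \<in> \<C>" by (rule clos[OF C1(1) z(1) xf C2(1,2)])
    obtain e where e: "e > 0" "ball (p t) e \<subseteq> convex hull C1 \<union> convex hull C2"
      using neighbourhood_of_shared_facet[OF C1V C2(1) z(1) C2(2,3) z(2) pos] by blast
    have "convex hull C1 \<union> convex hull C2 \<subseteq> U" using C1(1) C2C by (auto simp: U_def)
    then show False using no_ball[OF e(1)] e(2) by blast
  qed
  have "ball x r \<subseteq> U"
  proof (rule ccontr)
    assume "\<not> ball x r \<subseteq> U"
    then have "ball x r - U \<noteq> {}" by blast
    moreover have "open (ball x r - U)" using clU by (simp add: open_Diff)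
    ultimately have "\<not> negligible (ball x r - U)" using open_not_negligible by blast
    moreover have "ball x r - U \<subseteq> N" using main by blast
    ultimately show False using negN negligible_subset by blast
  qed
  then show ?thesis using r(1) by (auto simp: U_def)
qed

text \<open>If all facets through x were shared, the simplices at x would fill a ball, which puts x
  into \<open>interior (closure \<Omega>)\<close>, that is, into \<Omega>.\<close>

lemma frontier_in_boundary_facet:
  assumes x: "x \<in> frontier \<Omega>"
  obtains C z where "C \<in> \<V>" "z \<in> C" "x \<in> convex hull (C - {z})" "boundary_facet (C - {z})"
proof (rule ccontr)
  assume "\<not> thesis"
  then have nb: "\<not> boundary_facet (C - {z})" if "C \<in> \<V>" "z \<in> C" "x \<in> convex hull (C - {z})" for C z
    using that(1-3) \<open>\<And>C z. \<lbrakk>C \<in> \<V>; z \<in> C; x \<in> convex hull (C - {z}); boundary_facet (C - {z})\<rbrakk> \<Longrightarrow> thesis\<close> by blast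
  have xc: "x \<in> closure \<Omega>" "x \<notin> \<Omega>" using x open_domain by (auto simp: frontier_def interior_open)
  let ?C = "{C \<in> \<V>. x \<in> convex hull C}"
  have "\<exists>r>0. ball x r \<subseteq> (\<Union>C\<in>?C. convex hull C)"
  proof (rule facet_closed_patch_neighbourhood)
    show "?C \<noteq> {}" using xc(1) cover by blast
    show "C' \<in> ?C" if "C \<in> ?C" "z \<in> C" "x \<in> convex hull (C - {z})" "C' \<in> \<V>" "C - {z} \<subseteq> C'" for C C' z
      using that hull_mono[of "C - {z}" C' convex] by blast
  qed (use nb in auto)
  then obtain r where r: "r > 0" "ball x r \<subseteq> (\<Union>C\<in>?C. convex hull C)" by blast
  have "(\<Union>C\<in>?C. convex hull C) \<subseteq> closure \<Omega>" using cover by blast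
  then have "x \<in> interior (closure \<Omega>)" using r by (meson mem_interior order_trans)
  then show False using xc(2) regular_domain by simp
qed

section \<open>Facet-connectedness of vertex patches\<close>

definition vertex_adj :: "'a \<Rightarrow> ('a set \<times> 'a set) set" where
  "vertex_adj z = {(C, C'). C \<in> \<V> \<and> C' \<in> \<V> \<and> z \<in> C \<and> z \<in> C' \<and> (\<exists>w\<in>C. w \<noteq> z \<and> C - {w} \<subseteq> C')}"

text \<open>\<open>vertex_adj z\<close> relates neighbours across a facet that contains
  \<open>z\<close>. A component that meets no boundary facet through \<open>z\<close> fills a ball
  around \<open>z\<close>, hence meets the interior of every simplex with vertex \<open>z\<close>,
  and only that simplex itself contains such points.\<close>

lemma vertex_patch_connected:
  assumes C0: "C0 \<in> \<V>" "z \<in> C0"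
    and nb: "\<And>C w. (C0, C) \<in> (vertex_adj z)\<^sup>* \<Longrightarrow> w \<in> C \<Longrightarrow> w \<noteq> z \<Longrightarrow> \<not> boundary_facet (C - {w})"
    and C: "C \<in> \<V>" "z \<in> C"
  shows "(C0, C) \<in> (vertex_adj z)\<^sup>*"
proof -
  let ?R = "{C. (C0, C) \<in> (vertex_adj z)\<^sup>*}"
  have RV: "C \<in> \<V> \<and> z \<in> C" if "C \<in> ?R" for C
  proof -
    have "(C0, C) \<in> (vertex_adj z)\<^sup>*" using that by simp
    then show ?thesis by (induction rule: rtrancl_induct) (use C0 in \<open>auto simp: vertex_adj_def\<close>)
  qed
  have zw: "w \<noteq> z" if "C \<in> ?R" "w \<in> C" "z \<in> convex hull (C - {w})" for C w
  proof
    assume "w = z"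
    interpret C: nsimplex C using simplices RV[OF that(1)] by blast
    have "bary C z z = 0" using that C.sub_hull_eq[of "C - {w}"] \<open>w = z\<close> by auto
    then show False using that \<open>w = z\<close> by (simp add: C.bary_vertex)
  qed
  have "\<exists>r>0. ball z r \<subseteq> (\<Union>C\<in>?R. convex hull C)"
  proof (rule facet_closed_patch_neighbourhood)
    show "?R \<subseteq> {C \<in> \<V>. z \<in> convex hull C}" using RV hull_inc by fast
    show "?R \<noteq> {}" by blast
    show "C' \<in> ?R" if h: "C \<in> ?R" "w \<in> C" "z \<in> convex hull (C - {w})" "C' \<in> \<V>" "C - {w} \<subseteq> C'" for C C' w
    proof -
      have "w \<noteq> z" by (rule zw[OF h(1-3)])
      then have "(C, C') \<in> vertex_adj z" using h RV[OF h(1)] by (auto simp: vertex_adj_def)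
      then show ?thesis using h(1) by (auto intro: rtrancl_into_rtrancl)
    qed
    show "\<not> boundary_facet (C - {w})" if h: "C \<in> ?R" "w \<in> C" "z \<in> convex hull (C - {w})" for C w
      using nb[of C w] zw[OF h] h by blast
  qed
  then obtain r where r: "r > 0" "ball z r \<subseteq> (\<Union>C\<in>?R. convex hull C)" by blast
  interpret C: nsimplex C using simplices C by blast
  have "z \<in> closure (interior (convex hull C))"
    using C.vertex_in_hull[OF C(2)] convex_closure_interior[OF convex_convex_hull[of C]] C.center_interior closure_subset by blast
  then obtain p where p: "p \<in> interior (convex hull C)" "p \<in> ball z r"
    using r(1) by (metis closure_approachable dist_commute mem_ball)
  then obtain C' where C': "C' \<in> ?R" "p \<in> convex hull C'" using r(2) by blast
  have "C' = C" by (rule interior_point_unique[OF C(1) _ p(1) C'(2)]) (use RV[OF C'(1)] in blast)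
  then show ?thesis using C'(1) by simp
qed

end

section \<open>Crouzeix--Raviart functions\<close>

abbreviation cell :: "'a::euclidean_space set \<Rightarrow> 'a set" where
  "cell C \<equiv> interior (convex hull C)"

abbreviation diam :: "'a::euclidean_space set \<Rightarrow> real" where
  "diam C \<equiv> diameter (convex hull C)"

abbreviation vol :: "'a::euclidean_space set \<Rightarrow> real" where
  "vol C \<equiv> measure lebesgue (convex hull C)"

text \<open>The Crouzeix--Raviart function with the value \<open>d S\<close> at the midpoint of the facet \<open>S\<close>.\<close>

definition cr_val :: "('a::euclidean_space set \<Rightarrow> real) \<Rightarrow> 'a set \<Rightarrow> 'a \<Rightarrow> real" where
  "cr_val d C x = (\<Sum>z\<in>C. d (C - {z}) * (1 - real DIM('a) * bary C z x))"

definition cr_grad :: "('a::euclidean_space set \<Rightarrow> real) \<Rightarrow> 'a set \<Rightarrow> 'a" where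
  "cr_grad d C = (\<Sum>z\<in>C. (- real DIM('a) * d (C - {z})) *\<^sub>R bgrad C z)"

text \<open>The function is affine on a cell, so its mean is its value at the barycentre
  (\<open>cr_val_center\<close>), the average of the facet values.\<close>

definition cr_mean :: "('a::euclidean_space set \<Rightarrow> real) \<Rightarrow> 'a set \<Rightarrow> real" where
  "cr_mean d C = (\<Sum>z\<in>C. d (C - {z})) / real (DIM('a) + 1)"

definition shape_regular :: "real \<Rightarrow> 'a::euclidean_space set \<Rightarrow> bool" where
  "shape_regular \<kappa> C \<longleftrightarrow> diam C ^ DIM('a) \<le> \<kappa> * vol C"

section \<open>Crouzeix--Raviart functions and shape regularity on one simplex\<close>

context nsimplex
begin

lemma cell_lmeasurable: "cell C \<in> lmeasurable"
  by (rule lmeasurable_interior) (rule compact_imp_bounded[OF compact_hull])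

lemma cell_sets: "cell C \<in> sets lebesgue"
  by (rule fmeasurableD[OF cell_lmeasurable])

lemma bounded_cell: "bounded (cell C)"
  using bounded_interior[OF compact_imp_bounded[OF compact_hull]] .

lemma hull_minus_cell_negligible: "negligible (convex hull C - cell C)"
  using negligible_convex_frontier[OF convex_convex_hull[of C]]
  by (rule negligible_subset) (auto simp: frontier_def compact_imp_closed[OF compact_hull] closure_closed)

lemma measure_cell: "measure lebesgue (cell C) = vol C"
proof -
  have "measure lebesgue (convex hull C - (convex hull C - cell C)) = vol C"
    by (rule measure_Diff_null_set) (use hull_minus_cell_negligible hull_lmeasurable in \<open>auto simp: negligible_iff_null_sets fmeasurableD\<close>)
  moreover have "convex hull C - (convex hull C - cell C) = cell C"
    using interior_subset by blast
  ultimately show ?thesis by simp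
qed

text \<open>Reconciles two views of a cell: closed simplices under \<open>lborel\<close>, for which
  the flux identities hold, and open cells under \<open>lebesgue_on\<close>, on which piecewise data
  are given. The difference is the null boundary.\<close>

lemma integral_cell:
  fixes f :: "'a \<Rightarrow> 'b::euclidean_space"
  assumes f: "continuous_on UNIV f"
  shows "(LINT x:convex hull C|lborel. f x) = integral\<^sup>L (lebesgue_on (cell C)) f"
    and "integrable (lebesgue_on (cell C)) f"
proof -
  have i: "set_integrable lborel (convex hull C) f"
    by (rule set_integrable_on_compact[OF compact_hull f])
  then have m: "(\<lambda>x. indicator (convex hull C) x *\<^sub>R f x) \<in> borel_measurable lborel"
    by (auto simp: set_integrable_def)
  have il: "integrable lebesgue (\<lambda>x. indicator (convex hull C) x *\<^sub>R f x)"
    using i by (simp add: set_integrable_def integrable_completion[OF m])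
  have "integrable lebesgue (\<lambda>x. indicator (cell C) x *\<^sub>R (indicator (convex hull C) x *\<^sub>R f x))"
    by (rule integrable_mult_indicator[OF cell_sets il])
  moreover have "(\<lambda>x. indicator (cell C) x *\<^sub>R (indicator (convex hull C) x *\<^sub>R f x)) = (\<lambda>x. indicator (cell C) x *\<^sub>R f x)"
    using interior_subset[of "convex hull C"] by (auto simp: indicator_def fun_eq_iff)
  ultimately have ic: "integrable lebesgue (\<lambda>x. indicator (cell C) x *\<^sub>R f x)" by (simp only:)
  then show "integrable (lebesgue_on (cell C)) f"
    using cell_sets by (simp add: integrable_restrict_space)
  have "(LINT x:convex hull C|lborel. f x) = (\<integral>x. indicator (convex hull C) x *\<^sub>R f x \<partial>lebesgue)"
    by (simp add: set_lebesgue_integral_def integral_completion[OF m])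
  also have "\<dots> = (\<integral>x. indicator (cell C) x *\<^sub>R f x \<partial>lebesgue)"
  proof (rule integral_cong_AE)
    have "AE x in lebesgue. x \<notin> convex hull C - cell C"
      by (rule AE_not_in) (use hull_minus_cell_negligible in \<open>simp add: negligible_iff_null_sets\<close>)
    then show "AE x in lebesgue. indicator (convex hull C) x *\<^sub>R f x = indicator (cell C) x *\<^sub>R f x"
    proof eventually_elim
      case (elim x)
      then show ?case using interior_subset[of "convex hull C"] by (auto simp: indicator_def)
    qed
  qed (use il ic in auto)
  also have "\<dots> = integral\<^sup>L (lebesgue_on (cell C)) f"
    using cell_sets by (simp add: integral_restrict_space)
  finally show "(LINT x:convex hull C|lborel. f x) = integral\<^sup>L (lebesgue_on (cell C)) f" .
qed

lemma bary_sub: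
  assumes "S \<subseteq> C" "sum u S = 1" "z \<in> C"
  shows "bary C z (\<Sum>v\<in>S. u v *\<^sub>R v) = (if z \<in> S then u z else 0)"
proof -
  have fS: "finite S" using assms(1) finite_C finite_subset by blast
  have "bary C z (\<Sum>v\<in>S. u v *\<^sub>R v) = (\<Sum>v\<in>S. u v * bary C z v)"
    by (rule bary_affine_sum[OF assms(2)])
  also have "\<dots> = (\<Sum>v\<in>S. if v = z then u v else 0)"
    by (rule sum.cong) (use assms in \<open>auto simp: bary_vertex subset_iff\<close>)
  also have "\<dots> = (if z \<in> S then u z else 0)" using fS by simp
  finally show ?thesis .
qed

lemma cr_val_diff: "cr_val d C x - cr_val d C y = cr_grad d C \<bullet> (x - y)"
proof -
  have "cr_val d C x - cr_val d C y =
     (\<Sum>z\<in>C. (- real DIM('a) * d (C - {z})) * (bary C z x - bary C z y))"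
    unfolding cr_val_def sum_subtractf[symmetric] by (rule sum.cong) (simp_all add: algebra_simps)
  then show ?thesis by (simp add: bary_diff cr_grad_def inner_sum_left)
qed

lemma cr_val_lipschitz: "\<bar>cr_val d C x - cr_val d C y\<bar> \<le> norm (cr_grad d C) * norm (x - y)"
  unfolding cr_val_diff by (rule Cauchy_Schwarz_ineq2)

lemma cr_val_center: "cr_val d C center = cr_mean d C"
proof -
  have "cr_val d C center = (\<Sum>z\<in>C. d (C - {z}) * (1 / real (DIM('a) + 1)))"
    unfolding cr_val_def by (rule sum.cong) (simp_all add: bary_center field_simps)
  then show ?thesis by (simp add: cr_mean_def sum_divide_distrib)
qed

lemma cr_val_vertex: assumes "z \<in> C" shows "cr_val d C z = (\<Sum>w\<in>C. d (C - {w})) - real DIM('a) * d (C - {z})"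
proof -
  have "cr_val d C z = (\<Sum>w\<in>C. d (C - {w}) - (if w = z then real DIM('a) * d (C - {w}) else 0))"
    unfolding cr_val_def by (rule sum.cong) (use assms in \<open>auto simp: bary_vertex algebra_simps\<close>)
  then show ?thesis using finite_C assms by (simp add: sum_subtractf)
qed

lemma cr_grad_vertex_values: "cr_grad d C = (\<Sum>z\<in>C. cr_val d C z *\<^sub>R bgrad C z)"
proof -
  have "(\<Sum>z\<in>C. cr_val d C z *\<^sub>R bgrad C z) =
     (\<Sum>z\<in>C. (\<Sum>w\<in>C. d (C - {w})) *\<^sub>R bgrad C z + (- real DIM('a) * d (C - {z})) *\<^sub>R bgrad C z)"
    by (rule sum.cong) (simp_all add: cr_val_vertex scaleR_diff_left)
  also have "\<dots> = (\<Sum>w\<in>C. d (C - {w})) *\<^sub>R (\<Sum>z\<in>C. bgrad C z) + cr_grad d C"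
    by (simp only: sum.distrib scaleR_sum_right cr_grad_def)
  finally show ?thesis by (simp add: bgrad_sum)
qed

lemma cr_val_repr: "cr_val d C x = (\<Sum>z\<in>C. bary C z x * cr_val d C z)"
proof -
  have e: "cr_val d C x = cr_val d C 0 + cr_grad d C \<bullet> x" for x using cr_val_diff[of d x 0] by simp
  have "(\<Sum>z\<in>C. bary C z x * cr_val d C z) =
      (\<Sum>z\<in>C. bary C z x * cr_val d C 0 + cr_grad d C \<bullet> (bary C z x *\<^sub>R z))"
    by (rule sum.cong[OF refl], subst e) (simp add: algebra_simps)
  also have "\<dots> = cr_val d C 0 + cr_grad d C \<bullet> x"
    by (simp only: sum.distrib sum_distrib_right[symmetric] bary_sum inner_sum_right[symmetric] bary_repr mult_1)
  finally show ?thesis by (simp only: e[of x])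
qed

text \<open>\<open>d (C - {w})\<close> is the value at the barycentre \<open>m\<close> of that
  facet, and the distance of \<open>m\<close> from \<open>z\<close> is at most the diameter.\<close>

lemma cr_val_facet:
  assumes "z \<in> C" "w \<in> C" "w \<noteq> z"
  shows "\<bar>cr_val d C z - d (C - {w})\<bar> \<le> norm (cr_grad d C) * diam C"
proof -
  define u where "u v = 1 / real DIM('a)" for v :: 'a
  let ?S = "C - {w}"
  have u1: "sum u ?S = 1" using facet_card[OF assms(2)] by (simp add: u_def)
  define m where "m = (\<Sum>v\<in>?S. u v *\<^sub>R v)"
  have bm: "bary C v m = (if v \<noteq> w then u v else 0)" if "v \<in> C" for v
    unfolding m_def using bary_sub[OF _ u1 that] that by auto
  have mK: "m \<in> convex hull C" using bm by (simp add: hull_eq u_def)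
  have "cr_val d C m = (\<Sum>v\<in>C. if v = w then d (C - {v}) else 0)"
    unfolding cr_val_def by (rule sum.cong) (auto simp: bm u_def)
  also have "\<dots> = d (C - {w})" using finite_C assms(2) by simp
  finally have "d (C - {w}) = cr_val d C m" ..
  then have "\<bar>cr_val d C z - d (C - {w})\<bar> \<le> norm (cr_grad d C) * norm (z - m)"
    using cr_val_lipschitz by simp
  also have "\<dots> \<le> norm (cr_grad d C) * diam C"
    by (intro mult_left_mono dist_le_diameter vertex_in_hull assms mK) simp
  finally show ?thesis .
qed

context
  fixes \<kappa> :: real
  assumes shape: "shape_regular \<kappa> C"
begin

lemma bgrad_bound:
  assumes "z \<in> C" shows "norm (bgrad C z) * diam C \<le> 2 * 4 ^ DIM('a) * \<kappa>"
proof -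
  have "norm (bgrad C z) * diam C * vol C \<le> 2 * (4 * diam C) ^ DIM('a)"
    by (rule bgrad_bound_aux[OF assms])
  also have "\<dots> \<le> 2 * 4 ^ DIM('a) * \<kappa> * vol C"
    using shape by (simp add: shape_regular_def power_mult_distrib mult.assoc)
  finally show ?thesis using measure_hull_pos by (simp add: mult_le_cancel_right not_less)
qed

text \<open>Along an edge the coordinate of \<open>z\<close> falls from 1 to 0, so a bound on its
  gradient forces the edge to be long.\<close>

lemma vertex_distance:
  assumes "z \<in> C" "v \<in> C" "z \<noteq> v" shows "diam C \<le> 2 * 4 ^ DIM('a) * \<kappa> * norm (z - v)"
proof -
  have "1 = \<bar>bgrad C z \<bullet> (v - z)\<bar>" using bgrad_eq[OF assms(1,2)] assms(3) by simp
  also have "\<dots> \<le> norm (bgrad C z) * norm (z - v)"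
    using Cauchy_Schwarz_ineq2[of "bgrad C z" "v - z"] by (simp add: norm_minus_commute)
  finally have "diam C * 1 \<le> diam C * (norm (bgrad C z) * norm (z - v))"
    using diameter_pos by (intro mult_left_mono) auto
  also have "\<dots> = (norm (bgrad C z) * diam C) * norm (z - v)" by simp
  also have "\<dots> \<le> 2 * 4 ^ DIM('a) * \<kappa> * norm (z - v)"
    by (rule mult_right_mono[OF bgrad_bound[OF assms(1)]]) simp
  finally show ?thesis by simp
qed

lemma shape_const_ge_1: "1 \<le> 2 * 4 ^ DIM('a) * \<kappa>"
proof -
  obtain z where z: "z \<in> C" using C_nonempty by blast
  obtain v where v: "v \<in> C" "z \<noteq> v" using facet_nonempty[OF z] by blast
  have "norm (z - v) \<le> diam C" by (intro dist_le_diameter vertex_in_hull z v)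
  then have "norm (z - v) \<le> 2 * 4 ^ DIM('a) * \<kappa> * norm (z - v)" using vertex_distance[OF z v] by simp
  then show ?thesis using v by simp
qed

text \<open>At the barycentre all coordinates are \<open>1 / (n + 1)\<close>, and by
  \<open>bgrad_bound\<close> they cannot reach 0 within this radius.\<close>

lemma inner_ball: "ball center (diam C / (2 * 4 ^ DIM('a) * \<kappa> * real (DIM('a) + 1))) \<subseteq> cell C"
proof
  let ?c = "2 * 4 ^ DIM('a) * \<kappa>" and ?m = "real (DIM('a) + 1)"
  have c: "?c > 0" "?m > 0" using shape_const_ge_1 by (linarith, simp)
  fix x assume "x \<in> ball center (diam C / (?c * ?m))"
  then have "norm (center - x) < diam C / (?c * ?m)" by (simp add: dist_norm)
  then have n: "norm (center - x) * (?c * ?m) < diam C" using mult_pos_pos[OF c] by (simp add: pos_less_divide_eq)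
  have "0 < bary C z x" if z: "z \<in> C" for z
  proof -
    have "1 / ?m - bary C z x = bgrad C z \<bullet> (center - x)" using bary_center[OF z] by (simp add: bary_diff[symmetric])
    also have "\<dots> \<le> norm (bgrad C z) * norm (center - x)" by (rule norm_cauchy_schwarz)
    finally have "(1 / ?m - bary C z x) * (diam C * ?m) \<le> norm (bgrad C z) * norm (center - x) * (diam C * ?m)"
      using diameter_pos by (intro mult_right_mono) auto
    also have "\<dots> = (norm (bgrad C z) * diam C) * (norm (center - x) * ?m)" by simp
    also have "\<dots> \<le> ?c * (norm (center - x) * ?m)" by (rule mult_right_mono[OF bgrad_bound[OF z]]) simp
    also have "\<dots> < diam C" using n by (simp add: algebra_simps)
    finally have "(1 / ?m - bary C z x) * (diam C * ?m) < diam C" .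
    moreover have "(1 / ?m - bary C z x) * (diam C * ?m) = diam C - bary C z x * (diam C * ?m)"
      using c(2) by (simp add: left_diff_distrib del: of_nat_add)
    ultimately have "0 < bary C z x * (diam C * ?m)" by linarith
    then show ?thesis by (rule zero_less_mult_pos2[OF _ mult_pos_pos[OF diameter_pos c(2)]])
  qed
  then show "x \<in> cell C" by (simp add: interior_eq)
qed

end

end

text \<open>One fixed bump is scaled into the ball of \<open>inner_ball\<close> and normalised to
  the volume of the cell. Up to the diameter nothing depends on the simplex, so one \<open>B\<close>
  serves all simplices with parameter \<kappa>.\<close>

lemma bubble_exists:
  "\<exists>B\<ge>0. \<forall>C::'a::euclidean_space set. nsimplex C \<and> shape_regular \<kappa> C \<longrightarrow>
     (\<exists>b. test_fun (cell C) b \<and> (\<integral>x. b x \<partial>lborel) = vol C \<and> (\<forall>x. norm (grad b x) \<le> B / diam C))"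
proof (cases "2 * 4 ^ DIM('a) * \<kappa> \<ge> 1")
  case False
  \<comment> \<open>For so small a \<kappa> there are no shape-regular simplices at all.\<close>
  then show ?thesis using nsimplex.shape_const_ge_1 by (intro exI[of _ 0]) blast
next
  case True
  let ?n = "DIM('a)"
  obtain \<psi> :: "'a \<Rightarrow> real" where \<psi>: "smooth_fun \<psi>" "\<And>x. 0 \<le> \<psi> x"
    "\<And>x. norm x < 1 \<Longrightarrow> 0 < \<psi> x" "\<And>x. 1 \<le> norm x \<Longrightarrow> \<psi> x = 0"
    using bump_exists by blast
  have c\<psi>: "continuous_on UNIV \<psi>" by (rule smooth_fun_continuous[OF \<psi>(1)])
  have m\<psi>: "\<psi> \<in> borel_measurable borel" by (rule borel_measurable_continuous_onI[OF c\<psi>])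
  define I where "I = (\<integral>x. \<psi> x \<partial>lborel)"
  have int\<psi>: "integrable lborel \<psi>"
    by (rule integrable_continuous_compact_support[where C="cball 0 1"]) (use \<psi>(4) c\<psi> in auto)
  have I: "I > 0"
  proof -
    have "I \<noteq> 0"
    proof
      assume "I = 0"
      then have "AE x in lborel. \<psi> x = 0"
        using integral_nonneg_eq_0_iff_AE[OF int\<psi>] \<psi>(2) by (simp add: I_def)
      then have "AE x in lborel. x \<notin> ball (0::'a) 1"
      proof eventually_elim
        case (elim x)
        then show ?case using \<psi>(3)[of x] by auto
      qed
      then have "emeasure lborel (ball (0::'a) 1) = 0"
        by (subst (asm) AE_iff_measurable[where N="ball 0 1"]) auto
      then have "measure lborel (ball (0::'a) 1) = 0" by (simp add: measure_def)
      then show False using content_ball_pos[of 1 "0::'a"] by simp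
    qed
    moreover have "I \<ge> 0" unfolding I_def by (rule Bochner_Integration.integral_nonneg) (rule \<psi>)
    ultimately show ?thesis by simp
  qed
  obtain G where G: "\<And>x. norm (grad \<psi> x) \<le> G" "G \<ge> 0"
  proof -
    have "bounded (grad \<psi> ` cball 0 1)"
      by (intro compact_imp_bounded compact_continuous_image smooth_fun_grad_continuous \<psi>) simp
    then obtain G0 where G0: "\<forall>x\<in>cball 0 1. norm (grad \<psi> x) \<le> G0" by (auto simp: bounded_iff)
    have "grad \<psi> x = 0" if "x \<notin> cball 0 1" for x
      by (rule grad_zero_outside[OF smooth_fun_has_derivative[OF \<psi>(1)] closed_cball _ that]) (use \<psi>(4) in auto)
    then have "norm (grad \<psi> x) \<le> max G0 0" for x
      using bspec[OF G0, of x] by (cases "x \<in> cball 0 1") (auto simp: le_max_iff_disj)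
    then show ?thesis using that[of "max G0 0"] by auto
  qed
  \<comment> \<open>Half the relative radius of \<open>inner_ball\<close>, so that a closed ball
    lies in the open cell.\<close>
  define \<rho> where "\<rho> = 1 / (2 * (2 * 4 ^ ?n * \<kappa> * real (?n + 1)))"
  have "0 < 2 * 4 ^ ?n * \<kappa>" using True by linarith
  then have \<rho>: "\<rho> > 0" unfolding \<rho>_def by (intro divide_pos_pos mult_pos_pos) (simp_all add: zero_less_mult_iff)
  define B where "B = 2 ^ ?n / (\<rho> ^ ?n * I) * (G / \<rho>)"
  have B: "B \<ge> 0" unfolding B_def using I \<rho> G by simp
  have "\<exists>b. test_fun (cell C) b \<and> (\<integral>x. b x \<partial>lborel) = vol C \<and> (\<forall>x. norm (grad b x) \<le> B / diam C)"
    if C: "nsimplex C" "shape_regular \<kappa> C" for C :: "'a set"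
  proof -
    interpret nsimplex C by (rule C(1))
    define r where "r = \<rho> * diam C"
    have r: "r > 0" using \<rho> diameter_pos by (simp add: r_def)
    have sub: "cball center r \<subseteq> cell C"
    proof -
      have "diam C / (2 * 4 ^ ?n * \<kappa> * real (?n + 1)) = 2 * r" by (simp add: r_def \<rho>_def)
      then have "ball center (2 * r) \<subseteq> cell C" using inner_ball[OF C(2)] by simp
      moreover have "cball center r \<subseteq> ball center (2 * r)" using r by auto
      ultimately show ?thesis by blast
    qed
    \<comment> \<open>\<open>r ^ n * I\<close> is the integral of the scaled bump, so
      \<open>A\<close> turns it into the volume; \<open>measure_hull_le\<close> bounds
      \<open>A\<close> independently of the diameter.\<close>
    define A where "A = vol C / (r ^ ?n * I)"
    have A: "0 \<le> A" "A \<le> 2 ^ ?n / (\<rho> ^ ?n * I)"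
    proof -
      show "0 \<le> A" using r I by (simp add: A_def)
      have "A \<le> (2 * diam C) ^ ?n / (r ^ ?n * I)"
        unfolding A_def by (rule divide_right_mono[OF measure_hull_le]) (use r I in simp)
      also have "\<dots> = 2 ^ ?n / (\<rho> ^ ?n * I)"
        using diameter_pos by (simp add: r_def power_mult_distrib)
      finally show "A \<le> 2 ^ ?n / (\<rho> ^ ?n * I)" .
    qed
    define t where "t = - (1 / r) *\<^sub>R center"
    define b where "b x = A * \<psi> ((1 / r) *\<^sub>R x + t)" for x
    have arg: "(1 / r) *\<^sub>R x + t = (1 / r) *\<^sub>R (x - center)" for x
      by (simp add: t_def algebra_simps)
    have sm: "smooth_fun b" unfolding b_def by (rule smooth_fun_affine[OF \<psi>(1)])
    have b0: "b x = 0" if "x \<notin> cball center r" for x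
    proof -
      have "1 \<le> norm ((1 / r) *\<^sub>R (x - center))" using that r by (simp add: dist_norm norm_minus_commute)
      then show ?thesis by (simp add: b_def arg \<psi>(4))
    qed
    have cl: "closure {x. b x \<noteq> 0} \<subseteq> cball center r"
    proof (rule closure_minimal[OF subsetI closed_cball])
      show "x \<in> cball center r" if "x \<in> {x. b x \<noteq> 0}" for x
        using b0[of x] that by blast
    qed
    have "bounded (closure {x. b x \<noteq> 0})" by (rule bounded_subset[OF bounded_cball cl])
    then have "compact (closure {x. b x \<noteq> 0})" by (simp only: compact_eq_bounded_closed closed_closure)
    then have test: "test_fun (cell C) b" using sm cl sub by (auto simp: test_fun_def)
    have "(\<integral>x. \<psi> x \<partial>lborel) = \<bar>1 / r\<bar> ^ ?n * (\<integral>x. \<psi> (t + (1 / r) *\<^sub>R x) \<partial>lborel)"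
      by (rule lborel_integral_affine[OF m\<psi>]) (use r in simp)
    then have "(\<integral>x. \<psi> ((1 / r) *\<^sub>R x + t) \<partial>lborel) = r ^ ?n * I"
      using r by (simp add: I_def add.commute power_one_over field_simps)
    then have int: "(\<integral>x. b x \<partial>lborel) = vol C"
      using r I by (simp add: b_def A_def)
    have grb: "norm (grad b x) \<le> B / diam C" for x
    proof -
      have "(b has_derivative (\<lambda>h. ((A / r) *\<^sub>R grad \<psi> ((1 / r) *\<^sub>R x + t)) \<bullet> h)) (at x)"
      proof (rule has_gradient_of_linear)
        show "(b has_derivative (\<lambda>h. A * (grad \<psi> ((1 / r) *\<^sub>R x + t) \<bullet> ((1 / r) *\<^sub>R h)))) (at x)"
          unfolding b_def
          by (rule has_derivative_mult_right, rule has_derivative_compose[OF _ smooth_fun_has_derivative[OF \<psi>(1)]])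
            (auto intro!: derivative_eq_intros)
      qed simp
      then have "grad b x = (A / r) *\<^sub>R grad \<psi> ((1 / r) *\<^sub>R x + t)" by (rule grad_eqI)
      then have "norm (grad b x) = A / r * norm (grad \<psi> ((1 / r) *\<^sub>R x + t))" using A r by simp
      also have "\<dots> \<le> A / r * G" using A r by (intro mult_left_mono G) simp
      also have "\<dots> = A * (G / r)" by simp
      also have "\<dots> \<le> 2 ^ ?n / (\<rho> ^ ?n * I) * (G / r)" using A G r by (intro mult_right_mono) auto
      also have "\<dots> = B / diam C" by (simp add: B_def r_def)
      finally show ?thesis .
    qed
    show ?thesis using test int grb by blast
  qed
  then show ?thesis using B by blast
qed

text \<open>\<kappa> and \<open>B\<close> are parameters, and the constants defined in this locale
  do not mention the mesh; once exported they depend only on the dimension, \<kappa> and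
  \<open>B\<close>.\<close>

locale regular_mesh = mesh \<Omega> \<V> for \<Omega> :: "'a::euclidean_space set" and \<V> +
  fixes \<kappa> B :: real
  assumes shape: "C \<in> \<V> \<Longrightarrow> shape_regular \<kappa> C"
    and bubbles: "C \<in> \<V> \<Longrightarrow> \<exists>b. test_fun (cell C) b \<and> (\<integral>x. b x \<partial>lborel) = vol C \<and> (\<forall>x. norm (grad b x) \<le> B / diam C)"
    and dim: "2 \<le> DIM('a)" and mesh_nonempty: "\<V> \<noteq> {}" and B_nonneg: "0 \<le> B"
begin

definition "c\<^sub>g = 2 * 4 ^ DIM('a) * \<kappa>"

lemma c\<^sub>g_ge_1: "1 \<le> c\<^sub>g"
proof -
  obtain C where C: "C \<in> \<V>" using mesh_nonempty by blast
  show ?thesis unfolding c\<^sub>g_def by (rule nsimplex.shape_const_ge_1[OF simplices[OF C] shape[OF C]])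
qed

lemma \<kappa>_pos: "0 < \<kappa>"
proof -
  have "0 < 2 * 4 ^ DIM('a) * \<kappa>" using c\<^sub>g_ge_1 unfolding c\<^sub>g_def by linarith
  then show ?thesis by (simp add: zero_less_mult_iff)
qed

definition "N\<^sub>v = nat \<lfloor>2 ^ DIM('a) * \<kappa>\<rfloor>"

text \<open>Shrink every simplex at \<open>z\<close> towards \<open>z\<close> until its diameter is
  the smallest one, \<open>r\<close>. The copies overlap only in null sets, have volume at least
  \<open>r ^ n / \<kappa>\<close> and lie in a cube of side \<open>2 * r\<close>, so there are at
  most \<open>2 ^ n * \<kappa>\<close> of them.\<close>

lemma card_vertex_patch: "card {C \<in> \<V>. z \<in> C} \<le> N\<^sub>v"
proof (cases "{C \<in> \<V>. z \<in> C} = {}")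
  case False
  let ?P = "{C \<in> \<V>. z \<in> C}" and ?n = "DIM('a)"
  have fP: "finite ?P" using finite_mesh by simp
  define r where "r = Min (diam ` ?P)"
  have dpos: "0 < diam C" if "C \<in> ?P" for C
    using that nsimplex.diameter_pos[OF simplices] by blast
  have r: "r > 0" unfolding r_def using fP False dpos by (subst Min_gr_iff) auto
  have rle: "r \<le> diam C" if "C \<in> ?P" for C unfolding r_def using fP that by simp
  define T where "T C = (\<lambda>x. (z - (r / diam C) *\<^sub>R z) + (r / diam C) *\<^sub>R x) ` (convex hull C)" for C
  have Tsub: "T C \<subseteq> convex hull C" and Tball: "T C \<subseteq> cball z r"
    and Tlm: "T C \<in> lmeasurable" and Tm: "r ^ ?n / \<kappa> \<le> measure lebesgue (T C)" if C: "C \<in> ?P" for C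
  proof -
    interpret nsimplex C using simplices C by blast
    define s where "s = r / diam C"
    have s: "0 < s" "s \<le> 1" using r rle[OF C] diameter_pos by (auto simp: s_def)
    have zK: "z \<in> convex hull C" using C vertex_in_hull by blast
    show "T C \<subseteq> convex hull C"
    proof
      fix y assume "y \<in> T C"
      then obtain x where x: "x \<in> convex hull C" "y = (1 - s) *\<^sub>R z + s *\<^sub>R x"
        by (auto simp: T_def s_def[symmetric] algebra_simps)
      then show "y \<in> convex hull C" using convex_convex_hull[of C] zK s by (simp add: convex_alt)
    qed
    show "T C \<subseteq> cball z r"
    proof
      fix y assume "y \<in> T C"
      then obtain x where x: "x \<in> convex hull C" "y = (z - s *\<^sub>R z) + s *\<^sub>R x"
        by (auto simp: T_def s_def[symmetric])
      have "z - y = s *\<^sub>R (z - x)" by (simp add: x(2) algebra_simps)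
      then have "norm (z - y) \<le> s * diam C"
        using s dist_le_diameter[OF zK x(1)] by (simp add: mult_left_mono)
      then show "y \<in> cball z r" using diameter_pos by (simp add: dist_norm s_def)
    qed
    have comp: "compact (T C)"
      unfolding T_def by (intro compact_continuous_image compact_hull continuous_intros)
    then show "T C \<in> lmeasurable" by (rule lmeasurable_compact)
    define m where "m = measure lborel (T C)"
    have bT: "T C \<in> sets borel" by (rule borel_closed[OF compact_imp_closed[OF comp]])
    have "(\<integral>x. indicator (T C) x \<partial>lborel) = \<bar>s\<bar> ^ ?n * (\<integral>x. indicator (T C) ((z - s *\<^sub>R z) + s *\<^sub>R x) \<partial>lborel)"
      by (rule lborel_integral_affine) (use bT s in auto)
    also have "(\<lambda>x. indicator (T C) ((z - s *\<^sub>R z) + s *\<^sub>R x) :: real) = indicator (convex hull C)"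
    proof
      fix x
      have "(z - s *\<^sub>R z) + s *\<^sub>R x \<in> T C \<longleftrightarrow> x \<in> convex hull C"
      proof
        assume "(z - s *\<^sub>R z) + s *\<^sub>R x \<in> T C"
        then obtain y where "y \<in> convex hull C" "(z - s *\<^sub>R z) + s *\<^sub>R x = (z - s *\<^sub>R z) + s *\<^sub>R y"
          by (auto simp: T_def s_def)
        then show "x \<in> convex hull C" using s by simp
      qed (auto simp: T_def s_def)
      then show "(indicator (T C) ((z - s *\<^sub>R z) + s *\<^sub>R x) :: real) = indicator (convex hull C) x"
        by (simp add: indicator_def)
    qed
    finally have "measure lborel (T C) = s ^ ?n * measure lborel (convex hull C)"
      using s bT hull_borel by simp
    then have "measure lebesgue (T C) = s ^ ?n * vol C" using bT measure_lborel_hull by simp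
    moreover have "diam C ^ ?n / \<kappa> \<le> vol C"
      using shape C \<kappa>_pos by (simp add: shape_regular_def divide_le_eq mult.commute)
    then have "s ^ ?n * (diam C ^ ?n / \<kappa>) \<le> s ^ ?n * vol C" using s by (intro mult_left_mono) auto
    moreover have "r ^ ?n / \<kappa> = s ^ ?n * (diam C ^ ?n / \<kappa>)"
      using diameter_pos by (simp add: s_def power_divide)
    ultimately show "r ^ ?n / \<kappa> \<le> measure lebesgue (T C)" by (simp only:)
  qed
  have neg: "negligible (T C \<inter> T C')" if "C \<in> ?P" "C' \<in> ?P" "C \<noteq> C'" for C C'
  proof -
    interpret C: nsimplex C using simplices that by blast
    interpret C': nsimplex C' using simplices that by blast
    have "C \<inter> C' \<noteq> C"
    proof
      assume "C \<inter> C' = C"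
      then have "C \<subseteq> C'" by blast
      then have "C = C'" using card_subset_eq[OF C'.finite_C] C.card_C C'.card_C by simp
      with that show False by blast
    qed
    then have "negligible (convex hull (C \<inter> C'))" by (intro C.sub_hull_negligible) auto
    moreover have "T C \<inter> T C' \<subseteq> convex hull (C \<inter> C')"
      using Tsub[OF that(1)] Tsub[OF that(2)] conforming[of C C'] that by blast
    ultimately show ?thesis by (rule negligible_subset)
  qed
  have "real (card ?P) * (r ^ ?n / \<kappa>) \<le> (\<Sum>C\<in>?P. measure lebesgue (T C))"
    using sum_bounded_below[of ?P "r ^ ?n / \<kappa>" "\<lambda>C. measure lebesgue (T C)"] Tm by simp
  also have "\<dots> = measure lebesgue (\<Union>(T ` ?P))"
    by (rule measure_negligible_finite_Union_image[symmetric])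
      (use fP Tlm neg in \<open>auto simp: pairwise_def\<close>)
  also have "\<dots> \<le> measure lebesgue (cbox (z - r *\<^sub>R One) (z + r *\<^sub>R One))"
  proof (rule measure_mono_fmeasurable)
    show "\<Union>(T ` ?P) \<subseteq> cbox (z - r *\<^sub>R One) (z + r *\<^sub>R One)"
    proof
      fix x assume "x \<in> \<Union>(T ` ?P)"
      then have "x \<in> cball z r" using Tball by blast
      then have "norm (x - z) \<le> r" by (simp add: dist_norm norm_minus_commute)
      then have "\<bar>(x - z) \<bullet> i\<bar> \<le> r" if "i \<in> Basis" for i using Basis_le_norm[OF that, of "x - z"] by linarith
      then show "x \<in> cbox (z - r *\<^sub>R One) (z + r *\<^sub>R One)"
        by (fastforce simp: mem_box inner_diff_left inner_add_left abs_le_iff)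
    qed
    show "\<Union>(T ` ?P) \<in> sets lebesgue" using fP Tlm by (auto intro!: sets.finite_UN simp: fmeasurableD)
  qed simp
  also have "\<dots> = (2 * r) ^ ?n"
    using r by (simp add: content_cbox_if inner_diff_left inner_add_left box_eq_empty not_less)
  finally have "real (card ?P) * (r ^ ?n / \<kappa>) \<le> 2 ^ ?n * r ^ ?n" by (simp add: power_mult_distrib)
  then have "real (card ?P) * r ^ ?n \<le> (2 ^ ?n * \<kappa>) * r ^ ?n"
    using \<kappa>_pos by (simp add: divide_le_eq algebra_simps)
  then have "real (card ?P) \<le> 2 ^ ?n * \<kappa>" using r by (simp add: mult_le_cancel_right)
  then show ?thesis unfolding N\<^sub>v_def by (simp add: le_nat_floor)
next
  case True
  show ?thesis unfolding True by simp
qed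

text \<open>In dimension at least 2 the common facet contains an edge from \<open>z\<close>, whose
  length is comparable to both diameters by \<open>vertex_distance\<close>.\<close>

lemma adj_diam:
  assumes "(C, C') \<in> vertex_adj z"
  shows "diam C \<le> c\<^sub>g * diam C'" "diam C' \<le> c\<^sub>g * diam C"
proof -
  obtain w where w: "C \<in> \<V>" "C' \<in> \<V>" "z \<in> C" "z \<in> C'" "w \<in> C" "w \<noteq> z" "C - {w} \<subseteq> C'"
    using assms by (auto simp: vertex_adj_def)
  interpret C: nsimplex C using simplices w by blast
  interpret C': nsimplex C' using simplices w by blast
  have "card (C - {w} - {z}) \<noteq> 0"
    using C.facet_card[OF w(5)] w dim by (simp add: card_Diff_singleton)
  then have "C - {w} - {z} \<noteq> {}" by (metis card.empty)
  then obtain v where "v \<in> C - {w} - {z}" by blast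
  then have v: "v \<in> C" "v \<in> C'" "z \<noteq> v" using w(7) by auto
  have "diam C \<le> c\<^sub>g * norm (z - v)" unfolding c\<^sub>g_def
    by (rule C.vertex_distance[OF shape[OF w(1)] w(3) v(1,3)])
  also have "\<dots> \<le> c\<^sub>g * diam C'"
    using c\<^sub>g_ge_1 w v by (intro mult_left_mono C'.dist_le_diameter C'.vertex_in_hull) auto
  finally show "diam C \<le> c\<^sub>g * diam C'" .
  have "diam C' \<le> c\<^sub>g * norm (z - v)" unfolding c\<^sub>g_def
    by (rule C'.vertex_distance[OF shape[OF w(2)] w(4) v(2,3)])
  also have "\<dots> \<le> c\<^sub>g * diam C"
    using c\<^sub>g_ge_1 w v by (intro mult_left_mono C.dist_le_diameter C.vertex_in_hull) auto
  finally show "diam C' \<le> c\<^sub>g * diam C" .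
qed

lemma relpow_diam:
  "(C, C') \<in> vertex_adj z ^^ k \<Longrightarrow> diam C \<le> c\<^sub>g ^ k * diam C' \<and> diam C' \<le> c\<^sub>g ^ k * diam C"
proof (induction k arbitrary: C')
  case (Suc k)
  then obtain D where D: "(C, D) \<in> vertex_adj z ^^ k" "(D, C') \<in> vertex_adj z" by auto
  have c: "0 \<le> c\<^sub>g ^ k" "0 \<le> c\<^sub>g" using c\<^sub>g_ge_1 by auto
  have "diam C \<le> c\<^sub>g ^ k * diam D" using Suc.IH[OF D(1)] by simp
  also have "\<dots> \<le> c\<^sub>g ^ k * (c\<^sub>g * diam C')" by (intro mult_left_mono adj_diam[OF D(2)] c)
  finally have 1: "diam C \<le> c\<^sub>g ^ Suc k * diam C'" by (simp add: ac_simps)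
  have "diam C' \<le> c\<^sub>g * diam D" by (rule adj_diam[OF D(2)])
  also have "\<dots> \<le> c\<^sub>g * (c\<^sub>g ^ k * diam C)" using Suc.IH[OF D(1)] by (intro mult_left_mono c) simp
  finally have 2: "diam C' \<le> c\<^sub>g ^ Suc k * diam C" by (simp add: ac_simps)
  show ?case using 1 2 by blast
qed simp

text \<open>A path need not be longer than the number of pairs in the relation, and on a patch of at
  most \<open>N\<^sub>v\<close> simplices there are at most \<open>N\<^sub>v * N\<^sub>v\<close>
  pairs.\<close>

definition "path_len = N\<^sub>v * N\<^sub>v"

lemma vertex_adj_path:
  assumes "(C, C') \<in> (vertex_adj z)\<^sup>*"
  obtains k where "k \<le> path_len" "(C, C') \<in> vertex_adj z ^^ k"
proof -
  let ?P = "{C \<in> \<V>. z \<in> C}"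
  have sub: "vertex_adj z \<subseteq> ?P \<times> ?P" by (auto simp: vertex_adj_def)
  have fP: "finite (?P \<times> ?P)" using finite_mesh by simp
  then have fin: "finite (vertex_adj z)" using sub finite_subset by blast
  have "card (vertex_adj z) \<le> card (?P \<times> ?P)" by (rule card_mono[OF fP sub])
  also have "\<dots> = card ?P * card ?P" by (rule card_cartesian_product)
  also have "\<dots> \<le> path_len" unfolding path_len_def by (intro mult_mono card_vertex_patch) auto
  finally have le: "card (vertex_adj z) \<le> path_len" .
  have "(C, C') \<in> (\<Union>n\<in>{n. n \<le> card (vertex_adj z)}. vertex_adj z ^^ n)"
    using assms rtrancl_finite_eq_relpow[OF fin] by simp
  then obtain n where "n \<le> card (vertex_adj z)" "(C, C') \<in> vertex_adj z ^^ n" by blast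
  then show ?thesis using that[of n] le by simp
qed

end

section \<open>Piecewise fields on a mesh and nodal interpolation\<close>

lemma smooth_fun_sum: "(\<And>i. i \<in> I \<Longrightarrow> smooth_fun (f i)) \<Longrightarrow> smooth_fun (\<lambda>x. \<Sum>i\<in>I. f i x)"
  by (induction I rule: infinite_finite_induct) (simp_all add: smooth_fun_zero smooth_fun_add)

lemma test_fun_sum: "(\<And>i. i \<in> I \<Longrightarrow> test_fun \<Omega> (f i)) \<Longrightarrow> test_fun \<Omega> (\<lambda>x. \<Sum>i\<in>I. f i x)"
  by (induction I rule: infinite_finite_induct) (simp_all add: test_fun_zero test_fun_add)

lemma grad_zero: "grad (\<lambda>x::'a::euclidean_space. 0) x = 0"
  by (rule grad_eqI) simp

lemma grad_sum: "(\<And>i. i \<in> I \<Longrightarrow> smooth_fun (f i)) \<Longrightarrow> grad (\<lambda>x. \<Sum>i\<in>I. f i x) x = (\<Sum>i\<in>I. grad (f i) x)"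
  by (induction I rule: infinite_finite_induct) (simp_all add: grad_zero grad_add smooth_fun_sum)

lemma sum_power2_le_card: "(\<Sum>i\<in>I. a i)\<^sup>2 \<le> real (card I) * (\<Sum>i\<in>I. (a i)\<^sup>2)" for a :: "'i \<Rightarrow> real"
  using Cauchy_Schwarz_ineq_sum[of a "\<lambda>_. 1" I] by (simp add: mult.commute)

lemma (in mesh) integral_cells:
  fixes f :: "'a \<Rightarrow> real"
  assumes f: "integrable (lebesgue_on \<Omega>) f"
  shows "integral\<^sup>L (lebesgue_on \<Omega>) f = (\<Sum>C\<in>\<V>. integral\<^sup>L (lebesgue_on (cell C)) f)"
    and "C \<in> \<V> \<Longrightarrow> integrable (lebesgue_on (cell C)) f"
proof -
  have Os: "\<Omega> \<in> sets lebesgue" using open_domain by auto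
  have cs: "cell C \<in> sets lebesgue" for C by simp
  have fi: "integrable lebesgue (\<lambda>x. indicator \<Omega> x *\<^sub>R f x)"
    using f Os by (simp add: integrable_restrict_space)
  have ind: "(\<lambda>x. indicator (cell C) x *\<^sub>R (indicator \<Omega> x *\<^sub>R f x)) = (\<lambda>x. indicator (cell C) x *\<^sub>R f x)" if "C \<in> \<V>" for C
    using interior_subset_domain[OF that] by (auto simp: indicator_def fun_eq_iff)
  have ci: "integrable lebesgue (\<lambda>x. indicator (cell C) x *\<^sub>R f x)" if "C \<in> \<V>" for C
    using integrable_mult_indicator[OF cs fi, of C] unfolding ind[OF that] .
  then show "integrable (lebesgue_on (cell C)) f" if "C \<in> \<V>"
    using that cs by (simp add: integrable_restrict_space)
  have "(\<integral>x. indicator \<Omega> x *\<^sub>R f x \<partial>lebesgue) = (\<integral>x. (\<Sum>C\<in>\<V>. indicator (cell C) x *\<^sub>R f x) \<partial>lebesgue)"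
  proof (rule integral_cong_AE)
    have "AE x in lebesgue. x \<notin> \<Omega> - (\<Union>C\<in>\<V>. cell C)"
      by (rule AE_not_in) (use negligible_skeleton in \<open>simp add: negligible_iff_null_sets\<close>)
    then show "AE x in lebesgue. indicator \<Omega> x *\<^sub>R f x = (\<Sum>C\<in>\<V>. indicator (cell C) x *\<^sub>R f x)"
    proof eventually_elim
      case (elim x)
      show ?case
      proof (cases "x \<in> \<Omega>")
        case True
        then obtain C where C: "C \<in> \<V>" "x \<in> cell C" using elim by blast
        have o: "x \<notin> cell D" if "D \<in> \<V> - {C}" for D
          using interior_point_unique[OF C(1) _ C(2), of D] that interior_subset by blast
        have "(\<Sum>D\<in>\<V>. indicator (cell D) x *\<^sub>R f x) = indicator (cell C) x *\<^sub>R f x + (\<Sum>D\<in>\<V> - {C}. indicator (cell D) x *\<^sub>R f x)"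
          by (rule sum.remove[OF finite_mesh C(1)])
        also have "(\<Sum>D\<in>\<V> - {C}. indicator (cell D) x *\<^sub>R f x) = 0"
          by (rule sum.neutral) (use o in simp)
        finally show ?thesis using True C by simp
      next
        case False
        then have "x \<notin> cell C" if "C \<in> \<V>" for C using interior_subset_domain[OF that] by blast
        then show ?thesis using False by simp
      qed
    qed
  qed (use fi ci in auto)
  also have "\<dots> = (\<Sum>C\<in>\<V>. \<integral>x. indicator (cell C) x *\<^sub>R f x \<partial>lebesgue)"
    by (rule Bochner_Integration.integral_sum) (rule ci)
  finally show "integral\<^sup>L (lebesgue_on \<Omega>) f = (\<Sum>C\<in>\<V>. integral\<^sup>L (lebesgue_on (cell C)) f)"
    using Os cs by (simp add: integral_restrict_space)
qed

context mesh
begin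

abbreviation "M \<equiv> lebesgue_on \<Omega>"

lemma domain_measurable: "\<Omega> \<in> sets lebesgue" "\<Omega> \<in> lmeasurable"
  using domain_sets[OF domain] domain_lmeasurable[OF domain] by blast+

lemma AE_cells: "AE x in M. \<exists>C\<in>\<V>. x \<in> cell C"
proof -
  have "AE x in lebesgue. x \<notin> \<Omega> - (\<Union>C\<in>\<V>. cell C)"
    by (rule AE_not_in) (use negligible_skeleton in \<open>simp add: negligible_iff_null_sets\<close>)
  then show ?thesis
    using domain_measurable(1) by (simp add: AE_restrict_space_iff)
qed

lemma nrm_le_cells:
  fixes f :: "'a \<Rightarrow> 'b::euclidean_space"
  assumes f: "sqi M f" and b: "\<And>C x. C \<in> \<V> \<Longrightarrow> x \<in> cell C \<Longrightarrow> norm (f x) \<le> m C"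
  shows "(nrm M f)\<^sup>2 \<le> (\<Sum>C\<in>\<V>. vol C * (m C)\<^sup>2)"
proof -
  have i: "integrable M (\<lambda>x. (norm (f x))\<^sup>2)" using f by (simp add: sqi_def)
  have "(nrm M f)\<^sup>2 = (\<integral>x. (norm (f x))\<^sup>2 \<partial>M)" by (simp add: nrm_def)
  also have "\<dots> = (\<Sum>C\<in>\<V>. \<integral>x. (norm (f x))\<^sup>2 \<partial>lebesgue_on (cell C))" by (rule integral_cells(1)[OF i])
  also have "\<dots> \<le> (\<Sum>C\<in>\<V>. vol C * (m C)\<^sup>2)"
  proof (rule sum_mono)
    fix C assume C: "C \<in> \<V>"
    interpret nsimplex C using simplices C by blast
    interpret finite_measure "lebesgue_on (cell C)" by (rule finite_measure_lebesgue_on[OF cell_lmeasurable])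
    have "(\<integral>x. (norm (f x))\<^sup>2 \<partial>lebesgue_on (cell C)) \<le> (\<integral>x. (m C)\<^sup>2 \<partial>lebesgue_on (cell C))"
    proof (rule integral_mono)
      show "integrable (lebesgue_on (cell C)) (\<lambda>x. (norm (f x))\<^sup>2)" by (rule integral_cells(2)[OF i C])
      show "(norm (f x))\<^sup>2 \<le> (m C)\<^sup>2" if "x \<in> space (lebesgue_on (cell C))" for x
        using b[OF C, of x] that by (intro power_mono) auto
    qed simp
    also have "\<dots> = vol C * (m C)\<^sup>2"
      using cell_sets by (simp add: measure_restrict_space measure_cell)
    finally show "(\<integral>x. (norm (f x))\<^sup>2 \<partial>lebesgue_on (cell C)) \<le> vol C * (m C)\<^sup>2" .
  qed
  finally show ?thesis .
qed

text \<open>The field with the given values on the cells, and zero elsewhere.\<close>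

definition on_cells :: "('a set \<Rightarrow> 'a \<Rightarrow> 'b::real_vector) \<Rightarrow> 'a \<Rightarrow> 'b" where
  "on_cells f x = (\<Sum>C\<in>\<V>. indicator (cell C) x *\<^sub>R f C x)"

lemma on_cells_eq:
  assumes "C \<in> \<V>" "x \<in> cell C" shows "on_cells f x = f C x"
proof -
  have o: "x \<notin> cell D" if "D \<in> \<V> - {C}" for D
    using interior_point_unique[OF assms(1) _ assms(2), of D] that interior_subset by blast
  have "on_cells f x = indicator (cell C) x *\<^sub>R f C x + (\<Sum>D\<in>\<V> - {C}. indicator (cell D) x *\<^sub>R f D x)"
    unfolding on_cells_def by (rule sum.remove[OF finite_mesh assms(1)])
  also have "(\<Sum>D\<in>\<V> - {C}. indicator (cell D) x *\<^sub>R f D x) = 0"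
    by (rule sum.neutral) (use o in simp)
  finally show ?thesis using assms by simp
qed

lemma on_cells_sqi:
  fixes f :: "'a set \<Rightarrow> 'a \<Rightarrow> 'b::euclidean_space"
  assumes f: "\<And>C. C \<in> \<V> \<Longrightarrow> continuous_on UNIV (f C)"
  shows "sqi M (on_cells f)"
proof -
  have "sqi M (\<lambda>x. indicator (cell C) x *\<^sub>R f C x)" if C: "C \<in> \<V>" for C
  proof -
    interpret nsimplex C using simplices C by blast
    have "bounded (f C ` (convex hull C))"
      by (intro compact_imp_bounded compact_continuous_image compact_hull continuous_on_subset[OF f[OF C]]) simp
    then obtain K where K: "\<forall>x\<in>convex hull C. norm (f C x) \<le> K" by (auto simp: bounded_iff)
    show ?thesis
    proof (rule sqi_bounded[OF domain_measurable(2), where B="max K 0"])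
      have "f C \<in> borel_measurable M"
        by (rule continuous_imp_measurable_on_sets_lebesgue[OF continuous_on_subset[OF f[OF C]] domain_measurable(1)]) simp
      moreover have "cell C \<in> sets M"
        using cell_sets interior_subset_domain[OF C] domain_measurable(1) by (simp add: sets_restrict_space_iff)
      ultimately show "(\<lambda>x. indicator (cell C) x *\<^sub>R f C x) \<in> borel_measurable M" by measurable
      show "norm (indicator (cell C) x *\<^sub>R f C x) \<le> max K 0" for x
        using K interior_subset[of "convex hull C"] by (auto simp: indicator_def le_max_iff_disj)
    qed
  qed
  then show ?thesis unfolding on_cells_def[abs_def] by (rule sqi_sum)
qed

lemma on_cells_AE_unique:
  assumes "\<And>C x. C \<in> \<V> \<Longrightarrow> x \<in> cell C \<Longrightarrow> g x = f C x"
  shows "AE x in M. on_cells f x = g x"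
  using AE_cells by (rule eventually_mono) (use assms on_cells_eq in auto)

text \<open>A point of two simplices lies in their common face, where both sets of coordinates are
  those of the face. Hence the choice of a simplex in \<open>nodal_interpolant\<close> does not
  matter.\<close>

lemma bary_agree:
  assumes C: "C \<in> \<V>" "C' \<in> \<V>" and x: "x \<in> convex hull C" "x \<in> convex hull C'"
  shows "(\<Sum>z\<in>C. a z * bary C z x) = (\<Sum>z\<in>C'. a z * bary C' z x)"
proof -
  interpret C: nsimplex C using simplices C by blast
  interpret C': nsimplex C' using simplices C by blast
  let ?S = "C \<inter> C'"
  have fS: "finite ?S" using C.finite_C by simp
  have "x \<in> convex hull ?S" using conforming[OF C] x by blast
  then obtain u where u: "sum u ?S = 1" "(\<Sum>v\<in>?S. u v *\<^sub>R v) = x" by (auto simp: convex_hull_finite[OF fS])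
  have s: "(\<Sum>z\<in>D. a z * bary D z x) = (\<Sum>z\<in>?S. a z * u z)" if D: "nsimplex D" "?S \<subseteq> D" for D
  proof -
    interpret D: nsimplex D by (rule D(1))
    have "(\<Sum>z\<in>D. a z * bary D z x) = (\<Sum>z\<in>D. if z \<in> ?S then a z * u z else 0)"
      by (rule sum.cong) (use D.bary_sub[OF D(2) u(1)] u(2) in auto)
    also have "\<dots> = (\<Sum>z\<in>D \<inter> ?S. a z * u z)" by (rule sum.inter_restrict[OF D.finite_C, symmetric])
    also have "D \<inter> ?S = ?S" using D(2) by blast
    finally show ?thesis .
  qed
  show ?thesis using s[OF C.nsimplex_axioms] s[OF C'.nsimplex_axioms] by simp
qed

definition nodal_interpolant :: "('a \<Rightarrow> real) \<Rightarrow> 'a \<Rightarrow> real" where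
  "nodal_interpolant a x = (if x \<in> closure \<Omega> then
     (let C = SOME C. C \<in> \<V> \<and> x \<in> convex hull C in \<Sum>z\<in>C. a z * bary C z x) else 0)"

lemma nodal_interpolant_eq:
  assumes C: "C \<in> \<V>" "x \<in> convex hull C"
  shows "nodal_interpolant a x = (\<Sum>z\<in>C. a z * bary C z x)"
proof -
  define D where "D = (SOME C. C \<in> \<V> \<and> x \<in> convex hull C)"
  have D: "D \<in> \<V> \<and> x \<in> convex hull D"
    unfolding D_def by (rule someI[of "\<lambda>C. C \<in> \<V> \<and> x \<in> convex hull C" C]) (use C in simp)
  have "x \<in> closure \<Omega>" using C cover by blast
  then have "nodal_interpolant a x = (\<Sum>z\<in>D. a z * bary D z x)"
    by (simp add: nodal_interpolant_def D_def Let_def)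
  also have "\<dots> = (\<Sum>z\<in>C. a z * bary C z x)" by (rule bary_agree) (use D C in auto)
  finally show ?thesis .
qed

definition nodal_grad :: "('a \<Rightarrow> real) \<Rightarrow> 'a set \<Rightarrow> 'a" where
  "nodal_grad a C = (\<Sum>z\<in>C. a z *\<^sub>R bgrad C z)"

lemma nodal_interpolant_diff:
  assumes C: "C \<in> \<V>" "x \<in> convex hull C" "y \<in> convex hull C"
  shows "nodal_interpolant a x - nodal_interpolant a y = nodal_grad a C \<bullet> (x - y)"
proof -
  interpret nsimplex C using simplices C by blast
  have "nodal_interpolant a x - nodal_interpolant a y = (\<Sum>z\<in>C. a z * (bary C z x - bary C z y))"
    by (simp add: nodal_interpolant_eq[OF C(1,2)] nodal_interpolant_eq[OF C(1,3)] sum_subtractf right_diff_distrib)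
  then show ?thesis by (simp add: bary_diff nodal_grad_def inner_sum_left)
qed

text \<open>Every frontier point lies in a boundary facet, where all nodal values vanish, so the
  extension by 0 is consistent. A global Lipschitz bound follows by restricting to a segment and
  gluing finitely many closed pieces; \<open>lipschitz_H10g\<close> does the rest.\<close>

lemma nodal_interpolant_H10g:
  assumes a: "\<And>C z w. C \<in> \<V> \<Longrightarrow> w \<in> C \<Longrightarrow> boundary_facet (C - {w}) \<Longrightarrow> z \<in> C \<Longrightarrow> z \<noteq> w \<Longrightarrow> a z = 0"
  shows "H10g \<Omega> (nodal_interpolant a) (on_cells (\<lambda>C x. nodal_grad a C))"
proof -
  let ?V = "nodal_interpolant a"
  define L where "L = (\<Sum>C\<in>\<V>. norm (nodal_grad a C)) + 1"
  have L: "L > 0" "norm (nodal_grad a C) \<le> L" if "C \<in> \<V>" for C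
  proof -
    show "L > 0" unfolding L_def by (intro add_nonneg_pos sum_nonneg) auto
    have "norm (nodal_grad a C) \<le> (\<Sum>C\<in>\<V>. norm (nodal_grad a C))"
      by (rule member_le_sum) (use that finite_mesh in auto)
    then show "norm (nodal_grad a C) \<le> L" by (simp add: L_def)
  qed
  have L0: "L > 0" unfolding L_def by (intro add_nonneg_pos sum_nonneg) auto
  have out: "?V x = 0" if x: "x \<notin> \<Omega>" for x
  proof (cases "x \<in> closure \<Omega>")
    case True
    then have "x \<in> frontier \<Omega>" using x open_domain by (simp add: frontier_def interior_open)
    then obtain C w where C: "C \<in> \<V>" "w \<in> C" "x \<in> convex hull (C - {w})" "boundary_facet (C - {w})"
      by (rule frontier_in_boundary_facet)
    interpret nsimplex C using simplices C by blast
    have "x \<in> convex hull C" using C(3) hull_mono[of "C - {w}" C convex] by blast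
    have "bary C w x = 0" using C(2,3) sub_hull_eq[of "C - {w}"] by auto
    then have "a z * bary C z x = 0" if "z \<in> C" for z
      using a[OF C(1,2,4) that] by (cases "z = w") auto
    then have "(\<Sum>z\<in>C. a z * bary C z x) = 0" by (intro sum.neutral ballI)
    then show ?thesis using nodal_interpolant_eq[OF C(1) \<open>x \<in> convex hull C\<close>] by simp
  qed (simp add: nodal_interpolant_def)
  have lip: "L-lipschitz_on UNIV ?V"
  proof (rule lipschitz_onI)
    fix x y :: 'a
    define p where "p t = x + t *\<^sub>R (y - x)" for t :: real
    have cp: "continuous_on S p" for S unfolding p_def by (intro continuous_intros)
    have pd: "dist (p s) (p t) = \<bar>s - t\<bar> * dist x y" for s t
    proof -
      have "p s - p t = (s - t) *\<^sub>R (y - x)" by (simp add: p_def algebra_simps)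
      then show ?thesis by (simp add: dist_norm norm_minus_commute)
    qed
    \<comment> \<open>The closed pieces of the parameter interval: index \<open>None\<close> is the
      complement of \<Omega>, where the interpolant is 0, and \<open>Some C\<close> a
      simplex.\<close>
    define U where "U = case_option (p -` (- \<Omega>)) (\<lambda>C. p -` (convex hull C))"
    have "(L * dist x y)-lipschitz_on {0..1} (\<lambda>t. ?V (p t))"
    proof (rule lipschitz_on_closed_Union[where I="insert None (Some ` \<V>)" and U=U])
      show "(L * dist x y)-lipschitz_on (U i) (\<lambda>t. ?V (p t))" if i: "i \<in> insert None (Some ` \<V>)" for i
      proof (rule lipschitz_onI)
        fix s t assume st: "s \<in> U i" "t \<in> U i"
        show "dist (?V (p s)) (?V (p t)) \<le> L * dist x y * dist s t"
        proof (cases i)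
          case None
          then have "p s \<notin> \<Omega>" "p t \<notin> \<Omega>" using st by (auto simp: U_def)
          then show ?thesis using out L0 by simp
        next
          case (Some C)
          then have C: "C \<in> \<V>" "p s \<in> convex hull C" "p t \<in> convex hull C" using st i by (auto simp: U_def)
          have "\<bar>?V (p s) - ?V (p t)\<bar> \<le> norm (nodal_grad a C) * norm (p s - p t)"
            unfolding nodal_interpolant_diff[OF C] by (rule Cauchy_Schwarz_ineq2)
          also have "\<dots> \<le> L * norm (p s - p t)" by (intro mult_right_mono L C) simp
          also have "\<dots> = L * (\<bar>s - t\<bar> * dist x y)" using pd[of s t] by (simp add: dist_norm)
          finally show ?thesis by (simp add: dist_real_def mult.commute mult.left_commute)
        qed
      qed (use L0 in simp)
      show "closed (U i)" if i: "i \<in> insert None (Some ` \<V>)" for i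
      proof (cases i)
        case None
        have "closed (- \<Omega>)" using open_domain by (simp add: closed_Compl)
        then have "closed (p -` (- \<Omega>))" by (rule closed_vimage[OF _ cp])
        then show ?thesis using None by (simp add: U_def)
      next
        case (Some C)
        then have "C \<in> \<V>" using i by auto
        then have "closed (convex hull C)"
          using nsimplex.compact_hull[OF simplices] compact_imp_closed by auto
        then have "closed (p -` (convex hull C))" by (rule closed_vimage[OF _ cp])
        then show ?thesis using Some by (simp add: U_def)
      qed
      show "{0..1} \<subseteq> (\<Union>i\<in>insert None (Some ` \<V>). U i)"
      proof
        fix t :: real assume "t \<in> {0..1}"
        show "t \<in> (\<Union>i\<in>insert None (Some ` \<V>). U i)"
        proof (cases "p t \<in> \<Omega>")
          case True
          then have "p t \<in> closure \<Omega>" using closure_subset by blast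
          then obtain C where "C \<in> \<V>" "p t \<in> convex hull C" using cover by blast
          then have "Some C \<in> insert None (Some ` \<V>)" "t \<in> U (Some C)" by (auto simp: U_def)
          then show ?thesis by blast
        next
          case False
          then have "t \<in> U None" by (simp add: U_def)
          then show ?thesis by blast
        qed
      qed
    qed (use finite_mesh L0 in auto)
    from lipschitz_onD[OF this, of 0 1] show "dist (?V x) (?V y) \<le> L * dist x y"
      by (simp add: p_def)
  qed (use L0 in simp)
  show ?thesis
  proof (rule lipschitz_H10g[OF domain lip L0 out negligible_skeleton])
    have "sqi M (on_cells (\<lambda>C x. nodal_grad a C))" by (rule on_cells_sqi) simp
    then show "on_cells (\<lambda>C x. nodal_grad a C) \<in> borel_measurable M" by (simp add: sqi_def)
    fix x assume "x \<in> \<Omega> - (\<Omega> - (\<Union>C\<in>\<V>. cell C))"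
    then obtain C where C: "C \<in> \<V>" "x \<in> cell C" by blast
    obtain r where r: "r > 0" "ball x r \<subseteq> cell C" using C(2) open_contains_ball[of "cell C"] by auto
    have "?V y = ?V x + on_cells (\<lambda>C x. nodal_grad a C) x \<bullet> (y - x)" if "y \<in> ball x r" for y
    proof -
      have "y \<in> convex hull C" "x \<in> convex hull C" using that r(2) C(2) interior_subset by blast+
      from nodal_interpolant_diff[OF C(1) this, of a] show ?thesis unfolding on_cells_eq[OF C] by simp
    qed
    then show "\<exists>r>0. \<forall>y\<in>ball x r. ?V y = ?V x + on_cells (\<lambda>C x. nodal_grad a C) x \<bullet> (y - x)"
      using r(1) by blast
  qed
qed

end

section \<open>The conforming companion\<close>

context regular_mesh
begin

lemma reach_patch:
  assumes "(C, C') \<in> (vertex_adj z)\<^sup>*" "C \<in> \<V>" "z \<in> C"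
  shows "C' \<in> \<V>" "z \<in> C'"
  using assms by (induction rule: rtrancl_induct) (auto simp: vertex_adj_def)

text \<open>Only simplices reachable from \<open>C\<close> through facets at \<open>z\<close> are
  counted: it is along such chains that jumps at \<open>z\<close> are controlled by
  gradients.\<close>

definition patch_sum :: "('a set \<Rightarrow> real) \<Rightarrow> 'a set \<Rightarrow> 'a \<Rightarrow> real" where
  "patch_sum d C z = (\<Sum>C'\<in>{C' \<in> \<V>. (C, C') \<in> (vertex_adj z)\<^sup>*}. diam C' * norm (cr_grad d C'))"

lemma diam_nonneg: "C \<in> \<V> \<Longrightarrow> 0 \<le> diam C"
  using nsimplex.diameter_pos[OF simplices] less_imp_le by blast

lemma patch_sum_member:
  assumes "C' \<in> \<V>" "(C, C') \<in> (vertex_adj z)\<^sup>*"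
  shows "diam C' * norm (cr_grad d C') \<le> patch_sum d C z"
  unfolding patch_sum_def
  by (rule member_le_sum) (use assms finite_mesh diam_nonneg in auto)

lemma patch_sum_nonneg: "0 \<le> patch_sum d C z"
  unfolding patch_sum_def by (rule sum_nonneg) (simp add: diam_nonneg)

text \<open>Both functions take the value belonging to the common facet at its midpoint, so at
  \<open>z\<close> they differ by at most their two oscillations.\<close>

lemma adj_val:
  assumes "(C, C') \<in> vertex_adj z"
  shows "\<bar>cr_val d C z - cr_val d C' z\<bar> \<le> diam C * norm (cr_grad d C) + diam C' * norm (cr_grad d C')"
proof (cases "C' = C")
  case True
  have "C \<in> \<V>" using assms by (auto simp: vertex_adj_def)
  then show ?thesis using True diam_nonneg by simp
next
  case False
  obtain w where w: "C \<in> \<V>" "C' \<in> \<V>" "z \<in> C" "z \<in> C'" "w \<in> C" "w \<noteq> z" "C - {w} \<subseteq> C'"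
    using assms by (auto simp: vertex_adj_def)
  obtain z' where z': "z' \<in> C'" "C' - {z'} = C - {w}" "z' \<notin> C"
    by (rule neighbour_eq[OF w(1,2,5,7) False])
  have "z' \<noteq> z" using z'(3) w(3) by blast
  have "\<bar>cr_val d C z - d (C - {w})\<bar> \<le> norm (cr_grad d C) * diam C"
    by (rule nsimplex.cr_val_facet[OF simplices[OF w(1)] w(3,5,6)])
  moreover have "\<bar>cr_val d C' z - d (C' - {z'})\<bar> \<le> norm (cr_grad d C') * diam C'"
    by (rule nsimplex.cr_val_facet[OF simplices[OF w(2)] w(4) z'(1) \<open>z' \<noteq> z\<close>])
  ultimately show ?thesis unfolding z'(2) by (simp add: mult.commute)
qed

lemma path_val:
  assumes C: "C \<in> \<V>" "z \<in> C" and "(C, C') \<in> vertex_adj z ^^ k"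
  shows "\<bar>cr_val d C z - cr_val d C' z\<bar> \<le> 2 * real k * patch_sum d C z"
  using assms(3)
proof (induction k arbitrary: C')
  case (Suc k)
  then obtain D where D: "(C, D) \<in> vertex_adj z ^^ k" "(D, C') \<in> vertex_adj z" by auto
  have r: "(C, D) \<in> (vertex_adj z)\<^sup>*" "(C, C') \<in> (vertex_adj z)\<^sup>*"
    using relpow_imp_rtrancl[OF D(1)] relpow_imp_rtrancl[OF Suc.prems] by blast+
  have "\<bar>cr_val d D z - cr_val d C' z\<bar> \<le> diam D * norm (cr_grad d D) + diam C' * norm (cr_grad d C')"
    by (rule adj_val[OF D(2)])
  also have "\<dots> \<le> patch_sum d C z + patch_sum d C z"
    by (intro add_mono patch_sum_member reach_patch[OF _ C] r)
  finally have "\<bar>cr_val d D z - cr_val d C' z\<bar> \<le> 2 * patch_sum d C z" by simp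
  then show ?case using Suc.IH[OF D(1)] by (simp add: algebra_simps)
qed simp

text \<open>Zero at the vertices of boundary facets, as \<open>H10\<close> demands. Elsewhere the
  patch is facet-connected, and any of its simplices may supply the value.\<close>

definition nodal_value :: "('a set \<Rightarrow> real) \<Rightarrow> 'a \<Rightarrow> real" where
  "nodal_value d z = (if \<exists>C\<in>\<V>. \<exists>w\<in>C. z \<in> C \<and> z \<noteq> w \<and> boundary_facet (C - {w}) then 0
     else cr_val d (SOME C. C \<in> \<V> \<and> z \<in> C) z)"

text \<open>If the facet component of \<open>C\<close> at \<open>z\<close> reaches a boundary facet
  through \<open>z\<close>, the value on that facet is 0, and the chain from \<open>C\<close> to it
  bounds \<open>cr_val d C z\<close> itself; the summand 1 pays for the last oscillation. Otherwise
  the component is the whole patch and contains the simplex chosen in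
  \<open>nodal_value\<close>.\<close>

lemma nodal_value_diff:
  assumes d: "\<And>S. boundary_facet S \<Longrightarrow> d S = 0" and C: "C \<in> \<V>" "z \<in> C"
  shows "\<bar>cr_val d C z - nodal_value d z\<bar> \<le> (2 * real path_len + 1) * patch_sum d C z"
proof -
  have path: "\<bar>cr_val d C z - cr_val d C' z\<bar> \<le> 2 * real path_len * patch_sum d C z"
    if r: "(C, C') \<in> (vertex_adj z)\<^sup>*" for C'
  proof -
    obtain k where k: "k \<le> path_len" "(C, C') \<in> vertex_adj z ^^ k" by (rule vertex_adj_path[OF r])
    have "\<bar>cr_val d C z - cr_val d C' z\<bar> \<le> 2 * real k * patch_sum d C z" by (rule path_val[OF C k(2)])
    also have "\<dots> \<le> 2 * real path_len * patch_sum d C z"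
      using k(1) patch_sum_nonneg by (intro mult_right_mono) auto
    finally show ?thesis .
  qed
  show ?thesis
  proof (cases "\<exists>C' w. (C, C') \<in> (vertex_adj z)\<^sup>* \<and> w \<in> C' \<and> w \<noteq> z \<and> boundary_facet (C' - {w})")
    case True
    then obtain C' w where C': "(C, C') \<in> (vertex_adj z)\<^sup>*" "w \<in> C'" "w \<noteq> z" "boundary_facet (C' - {w})" by blast
    note C'V = reach_patch[OF C'(1) C]
    have "nodal_value d z = 0" unfolding nodal_value_def using C' C'V by auto
    moreover have "\<bar>cr_val d C' z - d (C' - {w})\<bar> \<le> norm (cr_grad d C') * diam C'"
      by (rule nsimplex.cr_val_facet[OF simplices[OF C'V(1)] C'V(2) C'(2,3)])
    then have "\<bar>cr_val d C' z\<bar> \<le> patch_sum d C z"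
      using d[OF C'(4)] patch_sum_member[OF C'V(1) C'(1), of d] by (simp add: mult.commute)
    ultimately show ?thesis using path[OF C'(1)] by (simp add: algebra_simps)
  next
    case False
    then have nb: "\<not> boundary_facet (C' - {w})" if "(C, C') \<in> (vertex_adj z)\<^sup>*" "w \<in> C'" "w \<noteq> z" for C' w
      using that by blast
    have all: "(C, C') \<in> (vertex_adj z)\<^sup>*" if "C' \<in> \<V>" "z \<in> C'" for C'
      by (rule vertex_patch_connected[OF C nb that])
    have "\<not> (\<exists>C\<in>\<V>. \<exists>w\<in>C. z \<in> C \<and> z \<noteq> w \<and> boundary_facet (C - {w}))"
      using all nb by blast
    then have v: "nodal_value d z = cr_val d (SOME C. C \<in> \<V> \<and> z \<in> C) z" unfolding nodal_value_def by (rule if_not_P)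
    have "(SOME C. C \<in> \<V> \<and> z \<in> C) \<in> \<V> \<and> z \<in> (SOME C. C \<in> \<V> \<and> z \<in> C)"
      by (rule someI[of "\<lambda>C. C \<in> \<V> \<and> z \<in> C" C]) (use C in simp)
    then have "\<bar>cr_val d C z - nodal_value d z\<bar> \<le> 2 * real path_len * patch_sum d C z"
      unfolding v by (intro path all) auto
    then show ?thesis using patch_sum_nonneg[of d C z] by (simp add: algebra_simps)
  qed
qed

text \<open>With \<open>P = 2 * path_len + 1\<close> this is
  \<open>1 + P * c\<^sub>g + (P + 1) * B\<close>: the nodal interpolant contributes
  \<open>1 + P * c\<^sub>g\<close>, the bubbles the rest. \<open>K\<^sub>2\<close> compares the
  weights of two cells of a patch, and \<open>K\<^sub>3\<close> bounds the squared gradient norm of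
  the companion.\<close>

definition "K\<^sub>1 = 1 + (2 * real path_len + 1) * c\<^sub>g + (2 * real path_len + 2) * B"
definition "K\<^sub>2 = 2 ^ DIM('a) * c\<^sub>g ^ (path_len * DIM('a)) * \<kappa>"
definition "K\<^sub>3 = K\<^sub>1\<^sup>2 * (real (DIM('a) + 1) * real N\<^sub>v)\<^sup>2 * K\<^sub>2"

text \<open>Cauchy--Schwarz over the at most \<open>(n + 1) * N\<^sub>v\<close> summands at a cell
  gives one factor of that size. Exchanging the sums gives the other: each cell is counted at its
  \<open>n + 1\<close> vertices, from at most \<open>N\<^sub>v\<close> cells each time.\<close>

lemma patch_sums_estimate:
  "(\<Sum>C\<in>\<V>. vol C * ((\<Sum>z\<in>C. patch_sum d C z) / diam C)\<^sup>2) \<le>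
     (real (DIM('a) + 1) * real N\<^sub>v)\<^sup>2 * K\<^sub>2 * (\<Sum>C\<in>\<V>. vol C * (norm (cr_grad d C))\<^sup>2)"
proof -
  let ?n = "DIM('a)" and ?m = "real (DIM('a) + 1)"
  define s where "s C = vol C * (norm (cr_grad d C))\<^sup>2" for C
  have s0: "0 \<le> s C" for C by (simp add: s_def)
  note fC = finite_vertices
  have cC: "card C = ?n + 1" if "C \<in> \<V>" for C using nsimplex.card_C[OF simplices[OF that]] .
  define R where "R C z = {C' \<in> \<V>. (C, C') \<in> (vertex_adj z)\<^sup>*}" for C z
  define P where "P z = {C \<in> \<V>. z \<in> C}" for z
  have RP: "R C z \<subseteq> P z" if "C \<in> \<V>" "z \<in> C" for C z
    using reach_patch[OF _ that] by (auto simp: R_def P_def)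
  have fP: "finite (P z)" for z using finite_mesh by (simp add: P_def)
  have cP: "card (P z) \<le> N\<^sub>v" for z using card_vertex_patch by (simp add: P_def)
  have K2: "0 \<le> K\<^sub>2" using c\<^sub>g_ge_1 \<kappa>_pos by (simp add: K\<^sub>2_def)
  have size: "vol C * (diam C' / diam C)\<^sup>2 \<le> K\<^sub>2 * vol C'" if C: "C \<in> \<V>" "z \<in> C" and C': "C' \<in> R C z" for C C' z
  proof -
    interpret C: nsimplex C using simplices C by blast
    have C'V: "C' \<in> \<V>" using C' by (simp add: R_def)
    interpret C': nsimplex C' using simplices C'V by blast
    obtain k where k: "k \<le> path_len" "(C, C') \<in> vertex_adj z ^^ k"
      using vertex_adj_path[of C C' z] C' by (auto simp: R_def)
    have "diam C \<le> c\<^sub>g ^ k * diam C'" using relpow_diam[OF k(2)] by simp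
    also have "\<dots> \<le> c\<^sub>g ^ path_len * diam C'"
      using c\<^sub>g_ge_1 k(1) C'.diameter_pos by (intro mult_right_mono power_increasing) auto
    finally have h: "diam C \<le> c\<^sub>g ^ path_len * diam C'" .
    have c: "1 \<le> c\<^sub>g ^ path_len" using c\<^sub>g_ge_1 by (rule one_le_power)
    have "vol C * (diam C' / diam C)\<^sup>2 \<le> (2 * diam C) ^ ?n * (diam C' / diam C)\<^sup>2"
      by (rule mult_right_mono[OF C.measure_hull_le]) simp
    \<comment> \<open>Dimension at least 2 lets two powers of \<open>diam C\<close> cancel against
      the squared quotient without a negative exponent.\<close>
    also have "\<dots> = 2 ^ ?n * (diam C ^ (?n - 2) * (diam C')\<^sup>2)"
    proof -
      have "?n - 2 + 2 = ?n" using dim by simp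
      from power_add[of "diam C" "?n - 2" 2, unfolded this]
      have "diam C ^ ?n = diam C ^ (?n - 2) * (diam C)\<^sup>2" .
      then show ?thesis using C.diameter_pos by (simp add: power_mult_distrib power_divide)
    qed
    also have "\<dots> \<le> 2 ^ ?n * ((c\<^sub>g ^ path_len * diam C') ^ (?n - 2) * (c\<^sub>g ^ path_len * diam C')\<^sup>2)"
    proof (intro mult_left_mono mult_mono power_mono)
      show "diam C' \<le> c\<^sub>g ^ path_len * diam C'" using c C'.diameter_pos by simp
    qed (use h C.diameter_pos C'.diameter_pos c in auto)
    also have "\<dots> = 2 ^ ?n * (c\<^sub>g ^ path_len * diam C') ^ ?n"
    proof -
      have "?n - 2 + 2 = ?n" using dim by simp
      from power_add[of "c\<^sub>g ^ path_len * diam C'" "?n - 2" 2, unfolded this] show ?thesis by simp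
    qed
    also have "\<dots> = 2 ^ ?n * c\<^sub>g ^ (path_len * ?n) * diam C' ^ ?n"
      by (simp add: power_mult_distrib power_mult)
    also have "\<dots> \<le> 2 ^ ?n * c\<^sub>g ^ (path_len * ?n) * (\<kappa> * vol C')"
      using shape[OF C'V] c\<^sub>g_ge_1 by (intro mult_left_mono) (auto simp: shape_regular_def)
    also have "\<dots> = K\<^sub>2 * vol C'" by (simp add: K\<^sub>2_def)
    finally show ?thesis .
  qed
  have cell_est: "vol C * ((\<Sum>z\<in>C. patch_sum d C z) / diam C)\<^sup>2 \<le> ?m * real N\<^sub>v * K\<^sub>2 * (\<Sum>z\<in>C. \<Sum>C'\<in>P z. s C')"
    if C: "C \<in> \<V>" for C
  proof -
    interpret C: nsimplex C using simplices C by blast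
    define I where "I = Sigma C (R C)"
    have fR: "finite (R C z)" for z using finite_mesh by (simp add: R_def)
    have "card I = (\<Sum>z\<in>C. card (R C z))" unfolding I_def by (rule card_SigmaI) (use fC[OF C] fR in auto)
    also have "\<dots> \<le> (\<Sum>z\<in>C. N\<^sub>v)"
      by (rule sum_mono) (use card_mono[OF fP RP[OF C]] cP in \<open>blast intro: order_trans\<close>)
    also have "\<dots> = (?n + 1) * N\<^sub>v" using cC[OF C] by simp
    finally have "real (card I) \<le> real ((?n + 1) * N\<^sub>v)" by (rule of_nat_mono)
    then have cI: "real (card I) \<le> ?m * real N\<^sub>v" by (simp only: of_nat_mult)
    define t where "t zC = diam (snd zC) / diam C * norm (cr_grad d (snd zC))" for zC :: "'a \<times> 'a set"
    have "(\<Sum>z\<in>C. patch_sum d C z) / diam C = (\<Sum>z\<in>C. \<Sum>C'\<in>R C z. t (z, C'))"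
      by (simp add: patch_sum_def R_def t_def sum_divide_distrib)
    also have "\<dots> = (\<Sum>i\<in>I. t i)" unfolding I_def by (subst sum.Sigma) (use fC[OF C] fR in \<open>auto simp: split_def\<close>)
    finally have "vol C * ((\<Sum>z\<in>C. patch_sum d C z) / diam C)\<^sup>2 = vol C * (\<Sum>i\<in>I. t i)\<^sup>2" by simp
    also have "\<dots> \<le> vol C * (real (card I) * (\<Sum>i\<in>I. (t i)\<^sup>2))"
      by (rule mult_left_mono[OF sum_power2_le_card]) simp
    also have "\<dots> = real (card I) * (\<Sum>i\<in>I. vol C * (t i)\<^sup>2)" by (simp add: sum_distrib_left mult.left_commute)
    also have "\<dots> \<le> real (card I) * (\<Sum>i\<in>I. K\<^sub>2 * s (snd i))"
    proof (intro mult_left_mono sum_mono)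
      fix i assume "i \<in> I"
      then obtain z C' where i: "i = (z, C')" "z \<in> C" "C' \<in> R C z" by (auto simp: I_def)
      have "vol C * (t i)\<^sup>2 = vol C * (diam C' / diam C)\<^sup>2 * (norm (cr_grad d C'))\<^sup>2"
        by (simp add: t_def i(1) power_mult_distrib power_divide)
      also have "\<dots> \<le> K\<^sub>2 * vol C' * (norm (cr_grad d C'))\<^sup>2"
        by (rule mult_right_mono[OF size[OF C i(2,3)]]) simp
      finally show "vol C * (t i)\<^sup>2 \<le> K\<^sub>2 * s (snd i)" by (simp add: s_def i(1))
    qed simp
    also have "\<dots> \<le> (?m * real N\<^sub>v) * (\<Sum>i\<in>I. K\<^sub>2 * s (snd i))"
      by (rule mult_right_mono[OF cI]) (use K2 s0 in \<open>auto intro!: sum_nonneg\<close>)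
    also have "(\<Sum>i\<in>I. K\<^sub>2 * s (snd i)) = K\<^sub>2 * (\<Sum>z\<in>C. \<Sum>C'\<in>R C z. s C')"
      unfolding I_def sum_distrib_left[symmetric] by (subst sum.Sigma) (use fC[OF C] fR in \<open>auto simp: split_def\<close>)
    also have "(?m * real N\<^sub>v) * (K\<^sub>2 * (\<Sum>z\<in>C. \<Sum>C'\<in>R C z. s C')) \<le> (?m * real N\<^sub>v) * (K\<^sub>2 * (\<Sum>z\<in>C. \<Sum>C'\<in>P z. s C'))"
      by (intro mult_left_mono sum_mono sum_mono2 fP RP[OF C]) (use K2 s0 in auto)
    finally show ?thesis by (simp only: mult.assoc)
  qed
  define W where "W = \<Union>\<V>"
  have fW: "finite W" unfolding W_def using finite_mesh fC by blast
  have CW: "C = {z \<in> W. z \<in> C}" if "C \<in> \<V>" for C using that by (auto simp: W_def)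
  have "(\<Sum>C\<in>\<V>. \<Sum>z\<in>C. \<Sum>C'\<in>P z. s C') = (\<Sum>C\<in>\<V>. \<Sum>z\<in>{z \<in> W. z \<in> C}. \<Sum>C'\<in>P z. s C')"
    by (rule sum.cong[OF refl]) (use CW in simp)
  also have "\<dots> = (\<Sum>z\<in>W. \<Sum>C\<in>P z. \<Sum>C'\<in>P z. s C')"
    unfolding P_def by (rule sum.swap_restrict[OF finite_mesh fW])
  also have "\<dots> \<le> (\<Sum>z\<in>W. real N\<^sub>v * (\<Sum>C'\<in>P z. s C'))"
  proof (rule sum_mono)
    fix z
    have "0 \<le> (\<Sum>C'\<in>P z. s C')" by (rule sum_nonneg) (rule s0)
    then show "(\<Sum>C\<in>P z. \<Sum>C'\<in>P z. s C') \<le> real N\<^sub>v * (\<Sum>C'\<in>P z. s C')"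
      using cP[of z] by (simp add: mult_right_mono)
  qed
  also have "\<dots> = real N\<^sub>v * (\<Sum>z\<in>W. \<Sum>C'\<in>P z. s C')" by (simp add: sum_distrib_left)
  also have "(\<Sum>z\<in>W. \<Sum>C'\<in>P z. s C') = (\<Sum>C'\<in>\<V>. \<Sum>z\<in>{z \<in> W. z \<in> C'}. s C')"
    unfolding P_def by (rule sum.swap_restrict[OF fW finite_mesh])
  also have "\<dots> = (\<Sum>C'\<in>\<V>. ?m * s C')"
  proof (rule sum.cong[OF refl])
    fix C' assume C': "C' \<in> \<V>"
    show "(\<Sum>z\<in>{z \<in> W. z \<in> C'}. s C') = ?m * s C'" unfolding CW[OF C', symmetric] using cC[OF C'] by simp
  qed
  also have "\<dots> = ?m * (\<Sum>C\<in>\<V>. s C)" by (simp only: sum_distrib_left)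
  finally have count: "(\<Sum>C\<in>\<V>. \<Sum>z\<in>C. \<Sum>C'\<in>P z. s C') \<le> real N\<^sub>v * (?m * (\<Sum>C\<in>\<V>. s C))" .
  have "(\<Sum>C\<in>\<V>. vol C * ((\<Sum>z\<in>C. patch_sum d C z) / diam C)\<^sup>2) \<le> (\<Sum>C\<in>\<V>. ?m * real N\<^sub>v * K\<^sub>2 * (\<Sum>z\<in>C. \<Sum>C'\<in>P z. s C'))"
    by (rule sum_mono) (rule cell_est)
  also have "\<dots> = ?m * real N\<^sub>v * K\<^sub>2 * (\<Sum>C\<in>\<V>. \<Sum>z\<in>C. \<Sum>C'\<in>P z. s C')" by (simp only: sum_distrib_left)
  also have "\<dots> \<le> ?m * real N\<^sub>v * K\<^sub>2 * (real N\<^sub>v * (?m * (\<Sum>C\<in>\<V>. s C)))"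
    by (rule mult_left_mono[OF count]) (use K2 in simp)
  also have "\<dots> = (?m * real N\<^sub>v)\<^sup>2 * K\<^sub>2 * (\<Sum>C\<in>\<V>. s C)" by (simp add: power2_eq_square del: of_nat_add)
  finally show ?thesis by (simp only: s_def)
qed

text \<open>Bubbles of different cells have disjoint supports, so on each cell only one term
  survives.\<close>

lemma bubble_combination:
  fixes b :: "'a set \<Rightarrow> 'a \<Rightarrow> real" and \<beta> :: "'a set \<Rightarrow> real"
  assumes b: "\<forall>C\<in>\<V>. test_fun (cell C) (b C)"
  defines "t \<equiv> \<lambda>x. \<Sum>C\<in>\<V>. \<beta> C * b C x"
  shows "test_fun \<Omega> t"
    and "C \<in> \<V> \<Longrightarrow> x \<in> cell C \<Longrightarrow> t x = \<beta> C * b C x"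
    and "C \<in> \<V> \<Longrightarrow> x \<in> cell C \<Longrightarrow> grad t x = \<beta> C *\<^sub>R grad (b C) x"
proof -
  have tf: "test_fun \<Omega> (\<lambda>x. \<beta> C * b C x)" if "C \<in> \<V>" for C
    by (rule test_fun_cmult[OF test_fun_mono[OF b[rule_format, OF that] interior_subset_domain[OF that]]])
  show "test_fun \<Omega> t" unfolding t_def by (rule test_fun_sum[OF tf])
  assume C: "C \<in> \<V>" "x \<in> cell C"
  have z: "b D x = 0 \<and> grad (b D) x = 0" if D: "D \<in> \<V> - {C}" for D
  proof -
    have "x \<notin> cell D"
      using interior_point_unique[OF C(1) _ C(2), of D] D interior_subset by blast
    moreover obtain S where "S \<subseteq> cell D" "\<And>x. x \<notin> S \<Longrightarrow> b D x = 0" "\<And>x. x \<notin> S \<Longrightarrow> grad (b D) x = 0"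
      by (rule test_fun_support[OF b[rule_format, of D]]) (use D in auto)
    ultimately show ?thesis by blast
  qed
  have "t x = \<beta> C * b C x + (\<Sum>D\<in>\<V> - {C}. \<beta> D * b D x)"
    unfolding t_def by (rule sum.remove[OF finite_mesh C(1)])
  also have "(\<Sum>D\<in>\<V> - {C}. \<beta> D * b D x) = 0" by (rule sum.neutral) (use z in simp)
  finally show "t x = \<beta> C * b C x" by simp
  have "grad t x = (\<Sum>D\<in>\<V>. grad (\<lambda>x. \<beta> D * b D x) x)"
    unfolding t_def by (rule grad_sum) (rule test_fun_smooth[OF tf])
  also have "\<dots> = (\<Sum>D\<in>\<V>. \<beta> D *\<^sub>R grad (b D) x)"
    by (rule sum.cong[OF refl], rule grad_cmult, rule test_fun_smooth[OF b[rule_format]])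
  also have "\<dots> = \<beta> C *\<^sub>R grad (b C) x + (\<Sum>D\<in>\<V> - {C}. \<beta> D *\<^sub>R grad (b D) x)"
    by (rule sum.remove[OF finite_mesh C(1)])
  also have "(\<Sum>D\<in>\<V> - {C}. \<beta> D *\<^sub>R grad (b D) x) = 0" by (rule sum.neutral) (use z in simp)
  finally show "grad t x = \<beta> C *\<^sub>R grad (b C) x" by simp
qed

lemma obtain_bubbles:
  obtains b where "\<forall>C\<in>\<V>. test_fun (cell C) (b C)" "\<forall>C\<in>\<V>. integral\<^sup>L (lebesgue_on (cell C)) (b C) = vol C"
    "\<forall>C\<in>\<V>. \<forall>x. norm (grad (b C) x) \<le> B / diam C"
proof -
  have "\<forall>C\<in>\<V>. \<exists>b. test_fun (cell C) b \<and> (\<integral>x. b x \<partial>lborel) = vol C \<and> (\<forall>x. norm (grad b x) \<le> B / diam C)"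
    using bubbles by blast
  then obtain b where b: "\<forall>C\<in>\<V>. test_fun (cell C) (b C) \<and> (\<integral>x. b C x \<partial>lborel) = vol C \<and> (\<forall>x. norm (grad (b C) x) \<le> B / diam C)"
    by (rule bchoice[THEN exE])
  have "integral\<^sup>L (lebesgue_on (cell C)) (b C) = vol C" if C: "C \<in> \<V>" for C
  proof -
    interpret nsimplex C using simplices C by blast
    have t: "test_fun (cell C) (b C)" using b C by blast
    obtain S where S: "compact S" "S \<subseteq> cell C" "\<And>x. x \<notin> S \<Longrightarrow> b C x = 0"
      using test_fun_support[OF t] by metis
    have "integral\<^sup>L (lebesgue_on (cell C)) (b C) = (\<integral>x. b C x \<partial>lborel)"
      by (rule integrable_continuous_compact_support_on(2)[OF cell_sets smooth_fun_continuous[OF test_fun_smooth[OF t]] S(1) S(3) S(2)])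
    then show ?thesis using b C by simp
  qed
  then show ?thesis using that[of b] b by blast
qed

text \<open>The conforming companion of a Crouzeix--Raviart function: nodal averaging followed by a bubble
  correction that restores the cell means.\<close>

lemma companion:
  assumes d: "\<And>S. boundary_facet S \<Longrightarrow> d S = 0"
  obtains w g where "H10g \<Omega> w g" "\<forall>C\<in>\<V>. integral\<^sup>L (lebesgue_on (cell C)) w = vol C * cr_mean d C"
    "(nrm M g)\<^sup>2 \<le> K\<^sub>3 * (\<Sum>C\<in>\<V>. vol C * (norm (cr_grad d C))\<^sup>2)"
proof -
  define a where "a = nodal_value d"
  define V where "V = nodal_interpolant a"
  define P where "P = 2 * real path_len + 1"
  define E where "E C = (\<Sum>z\<in>C. patch_sum d C z)" for C
  have E0: "0 \<le> E C" for C unfolding E_def by (rule sum_nonneg) (rule patch_sum_nonneg)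
  have P1: "1 \<le> P" by (simp add: P_def)
  note fC = finite_vertices
  have psE: "patch_sum d C z \<le> E C" if "C \<in> \<V>" "z \<in> C" for C z
    unfolding E_def by (rule member_le_sum) (use that fC patch_sum_nonneg in auto)
  have GE: "norm (cr_grad d C) * diam C \<le> E C" if C: "C \<in> \<V>" for C
  proof -
    obtain z where z: "z \<in> C" using nsimplex.C_nonempty[OF simplices[OF C]] by blast
    have "diam C * norm (cr_grad d C) \<le> patch_sum d C z" by (rule patch_sum_member[OF C]) simp
    then show ?thesis using psE[OF C z] by (simp add: mult.commute)
  qed
  have nd: "\<bar>cr_val d C z - a z\<bar> \<le> P * patch_sum d C z" if "C \<in> \<V>" "z \<in> C" for C z
    unfolding a_def P_def by (rule nodal_value_diff[OF d that])
  have V: "H10g \<Omega> V (on_cells (\<lambda>C x. nodal_grad a C))"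
    unfolding V_def
  proof (rule nodal_interpolant_H10g)
    fix C z w assume "C \<in> \<V>" "w \<in> C" "boundary_facet (C - {w})" "z \<in> C" "z \<noteq> w"
    then have "\<exists>C\<in>\<V>. \<exists>w\<in>C. z \<in> C \<and> z \<noteq> w \<and> boundary_facet (C - {w})" by blast
    then show "a z = 0" unfolding a_def nodal_value_def by (rule if_P)
  qed
  \<comment> \<open>Written with vertex values, the two gradients differ only by nodal errors;
    \<open>bgrad_bound\<close> supplies the division by the diameter.\<close>
  have ngrad: "norm (nodal_grad a C) \<le> (1 + P * c\<^sub>g) * (E C / diam C)" if C: "C \<in> \<V>" for C
  proof -
    interpret nsimplex C using simplices C by blast
    have "norm (nodal_grad a C - cr_grad d C) = norm (\<Sum>z\<in>C. (a z - cr_val d C z) *\<^sub>R bgrad C z)"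
      by (simp add: nodal_grad_def cr_grad_vertex_values scaleR_diff_left sum_subtractf)
    also have "\<dots> \<le> (\<Sum>z\<in>C. P * patch_sum d C z * (c\<^sub>g / diam C))"
    proof (rule sum_norm_le)
      fix z assume z: "z \<in> C"
      have "norm (bgrad C z) \<le> c\<^sub>g / diam C"
        using bgrad_bound[OF shape[OF C] z] diameter_pos by (simp add: c\<^sub>g_def pos_le_divide_eq)
      then have "\<bar>a z - cr_val d C z\<bar> * norm (bgrad C z) \<le> P * patch_sum d C z * (c\<^sub>g / diam C)"
        using nd[OF C z] P1 patch_sum_nonneg by (intro mult_mono) (auto simp: abs_minus_commute)
      then show "norm ((a z - cr_val d C z) *\<^sub>R bgrad C z) \<le> P * patch_sum d C z * (c\<^sub>g / diam C)" by simp
    qed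
    also have "\<dots> = P * c\<^sub>g * (E C / diam C)"
      by (simp add: E_def sum_distrib_left sum_distrib_right sum_divide_distrib mult_ac)
    finally have 1: "norm (nodal_grad a C - cr_grad d C) \<le> P * c\<^sub>g * (E C / diam C)" .
    have 2: "norm (cr_grad d C) \<le> E C / diam C" using GE[OF C] diameter_pos by (simp add: pos_le_divide_eq)
    have "norm (nodal_grad a C) \<le> norm (cr_grad d C) + norm (nodal_grad a C - cr_grad d C)"
      using norm_triangle_ineq[of "cr_grad d C" "nodal_grad a C - cr_grad d C"] by simp
    also have "\<dots> \<le> E C / diam C + P * c\<^sub>g * (E C / diam C)" by (intro add_mono 1 2)
    finally show ?thesis by (simp only: distrib_right mult_1)
  qed
  have Vi: "integrable M V"
  proof -
    have one: "sqi M (\<lambda>x. 1::real)" by (rule sqi_bounded[OF domain_measurable(2), where B=1]) auto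
    show ?thesis using sqi_integrable_ip[OF H10g_sqi(1)[OF domain V] one] by simp
  qed
  note Vc = integral_cells(2)[OF Vi]
  \<comment> \<open>The defect in the mean of the interpolant. A bubble has mean 1 on its cell, so
    \<open>\<beta> C\<close> times the bubble repairs it.\<close>
  define \<beta> where "\<beta> C = cr_mean d C - integral\<^sup>L (lebesgue_on (cell C)) V / vol C" for C
  have \<beta>: "\<bar>\<beta> C\<bar> \<le> (P + 1) * E C" if C: "C \<in> \<V>" for C
  proof -
    interpret nsimplex C using simplices C by blast
    interpret finite_measure "lebesgue_on (cell C)" by (rule finite_measure_lebesgue_on[OF cell_lmeasurable])
    \<comment> \<open>The mean is the value at the barycentre; it is compared with the value at x,
      and that one with the interpolant through the vertex values.\<close>
    have pt: "\<bar>cr_mean d C - V x\<bar> \<le> (P + 1) * E C" if x: "x \<in> cell C" for x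
    proof -
      have xK: "x \<in> convex hull C" using x interior_subset by blast
      have "\<bar>cr_val d C center - cr_val d C x\<bar> \<le> norm (cr_grad d C) * norm (center - x)"
        by (rule cr_val_lipschitz)
      also have "\<dots> \<le> norm (cr_grad d C) * diam C"
        using center_interior interior_subset by (intro mult_left_mono dist_le_diameter xK) auto
      also have "\<dots> \<le> E C" by (rule GE[OF C])
      finally have 1: "\<bar>cr_val d C center - cr_val d C x\<bar> \<le> E C" .
      have "cr_val d C x - V x = (\<Sum>z\<in>C. bary C z x * (cr_val d C z - a z))"
        unfolding V_def nodal_interpolant_eq[OF C xK] by (subst cr_val_repr) (simp add: sum_subtractf algebra_simps)
      also have "\<bar>\<dots>\<bar> \<le> (\<Sum>z\<in>C. P * patch_sum d C z)"
      proof (rule order_trans[OF sum_abs], rule sum_mono)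
        fix z assume z: "z \<in> C"
        have "\<bar>bary C z x\<bar> \<le> 1" using bary_le_1[OF xK z] xK z by (simp add: hull_eq)
        then have "\<bar>bary C z x\<bar> * \<bar>cr_val d C z - a z\<bar> \<le> 1 * (P * patch_sum d C z)"
          by (intro mult_mono nd[OF C z]) auto
        then show "\<bar>bary C z x * (cr_val d C z - a z)\<bar> \<le> P * patch_sum d C z" by (simp add: abs_mult)
      qed
      also have "\<dots> = P * E C" by (simp add: E_def sum_distrib_left)
      finally have 2: "\<bar>cr_val d C x - V x\<bar> \<le> P * E C" .
      show ?thesis using 1 2 cr_val_center[of d] by (simp add: algebra_simps)
    qed
    have "\<beta> C * vol C = (\<integral>x. cr_mean d C - V x \<partial>lebesgue_on (cell C))"
    proof -
      have "(\<integral>x. cr_mean d C - V x \<partial>lebesgue_on (cell C)) = cr_mean d C * vol C - integral\<^sup>L (lebesgue_on (cell C)) V"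
        using Vc[OF C] cell_sets by (simp add: measure_restrict_space measure_cell)
      then show ?thesis using measure_hull_pos by (simp add: \<beta>_def left_diff_distrib)
    qed
    also have "\<bar>\<dots>\<bar> \<le> (\<integral>x. (P + 1) * E C \<partial>lebesgue_on (cell C))"
      unfolding real_norm_def[symmetric]
      by (rule Bochner_Integration.integral_norm_bound_integral) (use Vc[OF C] pt in auto)
    also have "\<dots> = (P + 1) * E C * vol C"
      using cell_sets by (simp add: measure_restrict_space measure_cell)
    finally have "\<bar>\<beta> C\<bar> * vol C \<le> (P + 1) * E C * vol C" by (simp add: abs_mult)
    then show ?thesis using measure_hull_pos by (rule mult_right_le_imp_le)
  qed
  obtain b where b: "\<forall>C\<in>\<V>. test_fun (cell C) (b C)" "\<forall>C\<in>\<V>. integral\<^sup>L (lebesgue_on (cell C)) (b C) = vol C"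
    "\<forall>C\<in>\<V>. \<forall>x. norm (grad (b C) x) \<le> B / diam C"
    by (rule obtain_bubbles)
  define t where "t x = (\<Sum>C\<in>\<V>. \<beta> C * b C x)" for x
  have bt: "test_fun (cell C) (b C)" if "C \<in> \<V>" for C using b(1) that by blast
  note tt0 = bubble_combination[where b=b and \<beta>=\<beta>, OF b(1)]
  have tt1: "test_fun \<Omega> t" using tt0(1) by (simp add: t_def[abs_def])
  have tt2: "t x = \<beta> C * b C x" if "C \<in> \<V>" "x \<in> cell C" for C x
    using tt0(2)[OF that] by (simp add: t_def)
  have tt3: "grad t x = \<beta> C *\<^sub>R grad (b C) x" if "C \<in> \<V>" "x \<in> cell C" for C x
    using tt0(3)[OF that] by (simp add: t_def[abs_def])
  define w where "w x = 1 * V x + 1 * t x" for x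
  define g where "g x = 1 *\<^sub>R on_cells (\<lambda>C x. nodal_grad a C) x + 1 *\<^sub>R grad t x" for x
  have wg: "H10g \<Omega> w g"
    unfolding w_def[abs_def] g_def[abs_def]
    by (rule H10g_lincomb[OF domain V test_fun_H10g[OF domain tt1]])
  have mean: "integral\<^sup>L (lebesgue_on (cell C)) w = vol C * cr_mean d C" if C: "C \<in> \<V>" for C
  proof -
    interpret nsimplex C using simplices C by blast
    have bi: "integrable (lebesgue_on (cell C)) (b C)"
      by (rule integral_cell(2)[OF smooth_fun_continuous[OF test_fun_smooth[OF bt[OF C]]]])
    have "integral\<^sup>L (lebesgue_on (cell C)) w = (\<integral>x. V x + \<beta> C * b C x \<partial>lebesgue_on (cell C))"
      by (rule Bochner_Integration.integral_cong) (use tt2[OF C] in \<open>auto simp: w_def\<close>)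
    also have "\<dots> = integral\<^sup>L (lebesgue_on (cell C)) V + \<beta> C * vol C"
      using Vc[OF C] bi b(2) C by simp
    finally show ?thesis using measure_hull_pos by (simp add: \<beta>_def algebra_simps)
  qed
  have gb: "norm (g x) \<le> K\<^sub>1 * (E C / diam C)" if C: "C \<in> \<V>" "x \<in> cell C" for C x
  proof -
    interpret nsimplex C using simplices C by blast
    have "norm (g x) = norm (nodal_grad a C + \<beta> C *\<^sub>R grad (b C) x)"
      by (simp add: g_def on_cells_eq[OF C] tt3[OF C])
    also have "\<dots> \<le> norm (nodal_grad a C) + \<bar>\<beta> C\<bar> * norm (grad (b C) x)"
      using norm_triangle_ineq[of "nodal_grad a C" "\<beta> C *\<^sub>R grad (b C) x"] by simp
    also have "\<dots> \<le> (1 + P * c\<^sub>g) * (E C / diam C) + ((P + 1) * E C) * (B / diam C)"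
      using b(3) C E0 P1 by (intro add_mono mult_mono ngrad \<beta>) auto
    also have "\<dots> = K\<^sub>1 * (E C / diam C)"
    proof -
      have "K\<^sub>1 = 1 + P * c\<^sub>g + (P + 1) * B" by (simp add: K\<^sub>1_def P_def)
      moreover have "((P + 1) * E C) * (B / diam C) = (P + 1) * B * (E C / diam C)" by simp
      ultimately show ?thesis by (simp only: distrib_right)
    qed
    finally show ?thesis .
  qed
  have "(nrm M g)\<^sup>2 \<le> (\<Sum>C\<in>\<V>. vol C * (K\<^sub>1 * (E C / diam C))\<^sup>2)"
    by (rule nrm_le_cells[OF H10g_sqi(2)[OF domain wg] gb])
  also have "\<dots> = K\<^sub>1\<^sup>2 * (\<Sum>C\<in>\<V>. vol C * (E C / diam C)\<^sup>2)"
    by (simp only: sum_distrib_left power_mult_distrib mult.left_commute)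
  also have "\<dots> \<le> K\<^sub>1\<^sup>2 * ((real (DIM('a) + 1) * real N\<^sub>v)\<^sup>2 * K\<^sub>2 * (\<Sum>C\<in>\<V>. vol C * (norm (cr_grad d C))\<^sup>2))"
    unfolding E_def by (rule mult_left_mono[OF patch_sums_estimate]) simp
  also have "\<dots> = K\<^sub>3 * (\<Sum>C\<in>\<V>. vol C * (norm (cr_grad d C))\<^sup>2)" by (simp add: K\<^sub>3_def mult.assoc del: of_nat_add)
  finally show ?thesis using that[OF wg] mean by blast
qed

end

section \<open>The Raviart--Thomas lifting\<close>

lemma quadratic_form_insert:
  fixes A :: "'i \<Rightarrow> 'i \<Rightarrow> real"
  assumes "finite I" "k \<notin> I" "\<And>i j. A i j = A j i"
  shows "(\<Sum>i\<in>insert k I. \<Sum>j\<in>insert k I. d i * d j * A i j) =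
    (\<Sum>i\<in>I. \<Sum>j\<in>I. d i * d j * A i j) + 2 * d k * (\<Sum>i\<in>I. d i * A i k) + (d k)\<^sup>2 * A k k"
proof -
  have "(\<Sum>i\<in>insert k I. \<Sum>j\<in>insert k I. d i * d j * A i j) =
     d k * d k * A k k + (\<Sum>j\<in>I. d k * d j * A k j) + ((\<Sum>i\<in>I. d i * d k * A i k) + (\<Sum>i\<in>I. \<Sum>j\<in>I. d i * d j * A i j))"
    using assms(1,2) by (simp add: sum.distrib)
  also have "(\<Sum>j\<in>I. d k * d j * A k j) = d k * (\<Sum>i\<in>I. d i * A i k)"
    by (simp add: sum_distrib_left mult.assoc assms(3)[of k])
  also have "(\<Sum>i\<in>I. d i * d k * A i k) = d k * (\<Sum>i\<in>I. d i * A i k)"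
    by (simp add: sum_distrib_left ac_simps)
  finally show ?thesis by (simp add: power2_eq_square)
qed

text \<open>Schur complement induction.\<close>

lemma psd_system_solvable:
  fixes A :: "'i \<Rightarrow> 'i \<Rightarrow> real"
  assumes "finite I" and sym: "\<And>i j. A i j = A j i"
    and "\<And>d. 0 \<le> (\<Sum>i\<in>I. \<Sum>j\<in>I. d i * d j * A i j)"
    and "\<And>d. (\<Sum>i\<in>I. \<Sum>j\<in>I. d i * d j * A i j) = 0 \<Longrightarrow> (\<Sum>i\<in>I. d i * l i) = 0"
  shows "\<exists>c. \<forall>i\<in>I. (\<Sum>j\<in>I. A i j * c j) = l i"
  using assms(1,3,4)
proof (induction I arbitrary: l rule: finite_induct)
  case (insert k I)
  note Q = quadratic_form_insert[OF insert.hyps sym]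
  have eqI: "(\<Sum>i\<in>I. (d(k := t)) i * f i) = (\<Sum>i\<in>I. d i * f i)" for d t and f :: "'i \<Rightarrow> real"
    by (rule sum.cong) (use insert.hyps in auto)
  have eqQ: "(\<Sum>i\<in>I. \<Sum>j\<in>I. (d(k := t)) i * (d(k := t)) j * A i j) = (\<Sum>i\<in>I. \<Sum>j\<in>I. d i * d j * A i j)" for d t
    by (intro sum.cong refl) (use insert.hyps in auto)
  have QI: "(\<Sum>i\<in>insert k I. \<Sum>j\<in>insert k I. (d(k := t)) i * (d(k := t)) j * A i j) =
      (\<Sum>i\<in>I. \<Sum>j\<in>I. d i * d j * A i j) + 2 * t * (\<Sum>i\<in>I. d i * A i k) + t\<^sup>2 * A k k" for d t
    unfolding Q eqQ eqI by simp
  have psd: "0 \<le> (\<Sum>i\<in>I. \<Sum>j\<in>I. d i * d j * A i j)" for d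
    using insert.prems(1)[of "d(k := 0)"] unfolding QI by simp
  have ker: "(\<Sum>i\<in>I. d i * l i) = 0" if "(\<Sum>i\<in>I. \<Sum>j\<in>I. d i * d j * A i j) = 0" for d
  proof -
    have "(\<Sum>i\<in>insert k I. (d(k := 0)) i * l i) = 0"
      by (rule insert.prems(2)) (unfold QI, simp add: that)
    then show ?thesis using insert.hyps eqI[of d 0 l] by simp
  qed
  obtain c0 where c0: "\<forall>i\<in>I. (\<Sum>j\<in>I. A i j * c0 j) = l i" using insert.IH[OF psd ker] by blast
  \<comment> \<open>Column \<open>k\<close> is itself an admissible right-hand side: where the
    smaller form vanishes, a nonzero linear term would make the full form negative.\<close>
  have ker': "(\<Sum>i\<in>I. d i * A i k) = 0" if "(\<Sum>i\<in>I. \<Sum>j\<in>I. d i * d j * A i j) = 0" for d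
  proof (rule ccontr)
    define b where "b = (\<Sum>i\<in>I. d i * A i k)"
    assume "(\<Sum>i\<in>I. d i * A i k) \<noteq> 0"
    then have b: "b \<noteq> 0" by (simp add: b_def)
    have pos: "0 \<le> 2 * t * b + t\<^sup>2 * A k k" for t
      using insert.prems(1)[of "d(k := t)"] unfolding QI that b_def by simp
    define m where "m = \<bar>A k k\<bar> + 1"
    have m: "m > 0" "A k k \<le> m" by (simp_all add: m_def)
    have "0 \<le> 2 * (- b / m) * b + (- b / m)\<^sup>2 * A k k" by (rule pos)
    also have "\<dots> \<le> 2 * (- b / m) * b + (- b / m)\<^sup>2 * m" by (intro add_left_mono mult_left_mono m) simp
    also have "\<dots> = - (b\<^sup>2 / m)" using m by (simp add: field_simps power2_eq_square)
    also have "\<dots> < 0" using b m by simp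
    finally show False by simp
  qed
  obtain e where e: "\<forall>i\<in>I. (\<Sum>j\<in>I. A i j * e j) = A i k" using insert.IH[OF psd ker'] by blast
  \<comment> \<open>The Schur complement of the block indexed by \<open>I\<close>.\<close>
  define s where "s = A k k - (\<Sum>j\<in>I. A k j * e j)"
  have ce: "(\<Sum>j\<in>I. A k j * c0 j) = (\<Sum>i\<in>I. e i * l i)"
  proof -
    have "(\<Sum>j\<in>I. A k j * c0 j) = (\<Sum>j\<in>I. (\<Sum>i\<in>I. A j i * e i) * c0 j)"
      by (rule sum.cong) (use e sym[of k] in auto)
    also have "\<dots> = (\<Sum>j\<in>I. \<Sum>i\<in>I. e i * (A i j * c0 j))"
      by (intro sum.cong refl) (simp add: sum_distrib_left sym ac_simps)
    also have "\<dots> = (\<Sum>i\<in>I. \<Sum>j\<in>I. e i * (A i j * c0 j))" by (rule sum.swap)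
    also have "\<dots> = (\<Sum>i\<in>I. e i * l i)"
      by (rule sum.cong) (use c0 in \<open>auto simp: sum_distrib_left[symmetric]\<close>)
    finally show ?thesis .
  qed
  show ?case
  proof (cases "s = 0")
    case True
    \<comment> \<open>For s = 0 the form vanishes on this vector, so compatibility of
      \<open>l\<close> yields the last equation.\<close>
    have "(\<Sum>i\<in>insert k I. ((\<lambda>i. - e i)(k := 1)) i * l i) = 0"
    proof (rule insert.prems(2), unfold QI)
      have "(\<Sum>i\<in>I. \<Sum>j\<in>I. - e i * - e j * A i j) = (\<Sum>i\<in>I. e i * A i k)"
        by (rule sum.cong) (use e in \<open>auto simp: sum_distrib_left[symmetric] mult.assoc mult.commute[of "e _" "A _ _"]\<close>)
      moreover have "(\<Sum>j\<in>I. A k j * e j) = (\<Sum>i\<in>I. e i * A i k)"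
        by (rule sum.cong) (simp_all add: sym[of k] mult.commute)
      ultimately show "(\<Sum>i\<in>I. \<Sum>j\<in>I. - e i * - e j * A i j) + 2 * 1 * (\<Sum>i\<in>I. - e i * A i k) + 1\<^sup>2 * A k k = 0"
        using True by (simp add: s_def sum_negf)
    qed
    then have lk: "l k = (\<Sum>i\<in>I. e i * l i)"
      using insert.hyps eqI[of "\<lambda>i. - e i" 1 l] by (simp add: sum_negf)
    have "(\<Sum>j\<in>insert k I. A i j * (c0(k := 0)) j) = l i" if "i \<in> insert k I" for i
    proof -
      have "(\<Sum>j\<in>insert k I. A i j * (c0(k := 0)) j) = (\<Sum>j\<in>I. A i j * c0 j)"
        using insert.hyps eqI[of c0 0 "A i"] by (simp add: mult.commute)
      then show ?thesis using that c0 ce lk by auto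
    qed
    then show ?thesis by blast
  next
    case False
    define t where "t = (l k - (\<Sum>j\<in>I. A k j * c0 j)) / s"
    have "(\<Sum>j\<in>insert k I. A i j * ((\<lambda>j. c0 j - t * e j)(k := t)) j) = l i" if i: "i \<in> insert k I" for i
    proof -
      have "(\<Sum>j\<in>insert k I. A i j * ((\<lambda>j. c0 j - t * e j)(k := t)) j) = A i k * t + (\<Sum>j\<in>I. (c0 j - t * e j) * A i j)"
        using insert.hyps eqI[of "\<lambda>j. c0 j - t * e j" t "A i"] by (simp add: mult.commute)
      also have "(\<Sum>j\<in>I. (c0 j - t * e j) * A i j) = (\<Sum>j\<in>I. A i j * c0 j) - t * (\<Sum>j\<in>I. A i j * e j)"
        by (simp add: algebra_simps sum_subtractf sum_distrib_left)
      finally have *: "(\<Sum>j\<in>insert k I. A i j * ((\<lambda>j. c0 j - t * e j)(k := t)) j) =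
          A i k * t + ((\<Sum>j\<in>I. A i j * c0 j) - t * (\<Sum>j\<in>I. A i j * e j))" .
      show ?thesis
      proof (cases "i = k")
        case True
        have "A k k * t + ((\<Sum>j\<in>I. A k j * c0 j) - t * (\<Sum>j\<in>I. A k j * e j)) = (\<Sum>j\<in>I. A k j * c0 j) + t * s"
          by (simp add: s_def algebra_simps)
        then show ?thesis using * True False by (simp add: t_def)
      next
        case False
        then show ?thesis using * i c0 e by simp
      qed
    qed
    then show ?thesis by blast
  qed
qed simp

text \<open>Elimination of one coordinate at a time: if some \<open>z0\<close> in \<open>Z\<close>
  has a nonzero k-th coordinate, subtracting a multiple of it leads into the subspace where that
  coordinate vanishes. It will provide finitely many generators of the divergence-free
  fields.\<close>

lemma subspace_finite_span:
  fixes Z :: "('i \<Rightarrow> real) set"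
  assumes "finite I" and "\<And>f g a b. f \<in> Z \<Longrightarrow> g \<in> Z \<Longrightarrow> (\<lambda>i. a * f i + b * g i) \<in> Z"
  shows "\<exists>S. finite S \<and> S \<subseteq> Z \<and> (\<forall>z\<in>Z. \<exists>c. \<forall>i\<in>I. z i = (\<Sum>s\<in>S. c s * s i))"
  using assms
proof (induction I arbitrary: Z rule: finite_induct)
  case empty
  show ?case by (rule exI[of _ "{}"]) simp
next
  case (insert k I)
  define Z' where "Z' = {z \<in> Z. z k = 0}"
  have "\<exists>S. finite S \<and> S \<subseteq> Z' \<and> (\<forall>z\<in>Z'. \<exists>c. \<forall>i\<in>I. z i = (\<Sum>s\<in>S. c s * s i))"
    by (rule insert.IH) (auto simp: Z'_def insert.prems)
  then obtain S where S: "finite S" "S \<subseteq> Z'" "\<forall>z\<in>Z'. \<exists>c. \<forall>i\<in>I. z i = (\<Sum>s\<in>S. c s * s i)" by blast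
  have Sk: "s k = 0" if "s \<in> S" for s using S(2) that by (auto simp: Z'_def)
  have S': "\<exists>c. \<forall>i\<in>insert k I. z i = (\<Sum>s\<in>S. c s * s i)" if "z \<in> Z'" for z
  proof -
    obtain c where c: "\<forall>i\<in>I. z i = (\<Sum>s\<in>S. c s * s i)" using S(3) \<open>z \<in> Z'\<close> by blast
    have "(\<Sum>s\<in>S. c s * s k) = 0" by (rule sum.neutral) (use Sk in simp)
    moreover have "z k = 0" using that by (simp add: Z'_def)
    ultimately show ?thesis using c by (intro exI[of _ c]) simp
  qed
  show ?case
  proof (cases "\<exists>z0\<in>Z. z0 k \<noteq> 0")
    case False
    then have "Z' = Z" by (auto simp: Z'_def)
    then show ?thesis using S S' by (intro exI[of _ S]) simp
  next
    case True
    then obtain z0 where z0: "z0 \<in> Z" "z0 k \<noteq> 0" by blast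
    have nz: "z0 \<notin> S" using Sk z0(2) by blast
    have "\<exists>c. \<forall>i\<in>insert k I. z i = (\<Sum>s\<in>insert z0 S. c s * s i)" if z: "z \<in> Z" for z
    proof -
      define a where "a = z k / z0 k"
      have "(\<lambda>i. 1 * z i + (- a) * z0 i) \<in> Z'"
        unfolding Z'_def using insert.prems[OF z z0(1), of 1 "- a"] z0(2) by (simp add: a_def)
      then obtain c where c: "\<forall>i\<in>insert k I. 1 * z i + (- a) * z0 i = (\<Sum>s\<in>S. c s * s i)"
        using S' by blast
      have "z i = (\<Sum>s\<in>insert z0 S. (c(z0 := a)) s * s i)" if i: "i \<in> insert k I" for i
      proof -
        have "(\<Sum>s\<in>insert z0 S. (c(z0 := a)) s * s i) = a * z0 i + (\<Sum>s\<in>S. (c(z0 := a)) s * s i)"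
          using S(1) nz by simp
        also have "(\<Sum>s\<in>S. (c(z0 := a)) s * s i) = (\<Sum>s\<in>S. c s * s i)"
          by (rule sum.cong) (use nz in auto)
        finally show ?thesis using bspec[OF c i] by simp
      qed
      then show ?thesis by blast
    qed
    then show ?thesis using S(1,2) z0(1) by (intro exI[of _ "insert z0 S"]) (auto simp: Z'_def)
  qed
qed

lemma cr_grad_sum:
  assumes "finite F" "\<And>z. z \<in> C \<Longrightarrow> C - {z} \<notin> F \<Longrightarrow> d (C - {z}) = 0"
  shows "cr_grad d C = (\<Sum>S\<in>F. d S *\<^sub>R cr_grad (\<lambda>T. of_bool (T = S)) C)"
    and "cr_mean d C = (\<Sum>S\<in>F. d S * cr_mean (\<lambda>T. of_bool (T = S)) C)"
proof -
  have e: "d (C - {z}) = (\<Sum>S\<in>F. d S * of_bool (C - {z} = S))" if "z \<in> C" for z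
  proof -
    have "(\<Sum>S\<in>F. d S * of_bool (C - {z} = S)) = (\<Sum>S\<in>F. if S = C - {z} then d S else 0)"
      by (rule sum.cong) auto
    then show ?thesis using assms(1) assms(2)[OF that] by simp
  qed
  have "cr_grad d C = (\<Sum>z\<in>C. \<Sum>S\<in>F. d S *\<^sub>R ((- real DIM('a) * of_bool (C - {z} = S)) *\<^sub>R bgrad C z))"
    unfolding cr_grad_def
    by (rule sum.cong[OF refl], subst e, assumption) (simp only: sum_distrib_left scaleR_sum_left, rule sum.cong, simp_all add: mult_ac)
  also have "\<dots> = (\<Sum>S\<in>F. d S *\<^sub>R cr_grad (\<lambda>T. of_bool (T = S)) C)"
    by (subst sum.swap) (simp only: scaleR_sum_right[symmetric] cr_grad_def)
  finally show "cr_grad d C = (\<Sum>S\<in>F. d S *\<^sub>R cr_grad (\<lambda>T. of_bool (T = S)) C)" .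
  have "(\<Sum>z\<in>C. d (C - {z})) = (\<Sum>z\<in>C. \<Sum>S\<in>F. d S * of_bool (C - {z} = S))"
    by (rule sum.cong[OF refl], erule e)
  also have "\<dots> = (\<Sum>S\<in>F. d S * (\<Sum>z\<in>C. of_bool (C - {z} = S)))"
    by (subst sum.swap) (simp only: sum_distrib_left)
  finally have e2: "(\<Sum>z\<in>C. d (C - {z})) = (\<Sum>S\<in>F. d S * (\<Sum>z\<in>C. of_bool (C - {z} = S)))" .
  show "cr_mean d C = (\<Sum>S\<in>F. d S * cr_mean (\<lambda>T. of_bool (T = S)) C)"
    by (simp only: cr_mean_def e2 times_divide_eq_right sum_divide_distrib[symmetric])
qed

section \<open>The Crouzeix--Raviart problem and the lifting of piecewise constants\<close>

context regular_mesh
begin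

definition facets :: "'a set set" where
  "facets = {S. \<not> boundary_facet S \<and> (\<exists>C\<in>\<V>. \<exists>z\<in>C. S = C - {z})}"

lemma finite_facets: "finite facets"
proof (rule finite_subset)
  show "facets \<subseteq> (\<Union>C\<in>\<V>. (\<lambda>z. C - {z}) ` C)" by (auto simp: facets_def)
  show "finite (\<Union>C\<in>\<V>. (\<lambda>z. C - {z}) ` C)"
    using finite_mesh nsimplex.finite_C[OF simplices] by auto
qed

lemma integral_piecewise:
  assumes p: "\<And>C x. C \<in> \<V> \<Longrightarrow> x \<in> cell C \<Longrightarrow> p x = q C" and v: "sqi M v"
  shows "sqi M p" and "ip M p v = (\<Sum>C\<in>\<V>. q C * integral\<^sup>L (lebesgue_on (cell C)) v)"
proof -
  have "sqi M (on_cells (\<lambda>C x. q C))" by (rule on_cells_sqi) simp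
  then show sp: "sqi M p"
    by (rule sqi_AE_eq[OF domain_measurable(1) _ on_cells_AE_unique]) (rule p)
  have "ip M p v = (\<Sum>C\<in>\<V>. \<integral>x. p x \<bullet> v x \<partial>lebesgue_on (cell C))"
    unfolding ip_def by (rule integral_cells(1)[OF sqi_integrable_ip[OF sp v]])
  also have "\<dots> = (\<Sum>C\<in>\<V>. q C * integral\<^sup>L (lebesgue_on (cell C)) v)"
  proof (rule sum.cong[OF refl])
    fix C assume C: "C \<in> \<V>"
    have "(\<integral>x. p x \<bullet> v x \<partial>lebesgue_on (cell C)) = (\<integral>x. q C * v x \<partial>lebesgue_on (cell C))"
      by (rule Bochner_Integration.integral_cong) (use p[OF C] in auto)
    then show "(\<integral>x. p x \<bullet> v x \<partial>lebesgue_on (cell C)) = q C * integral\<^sup>L (lebesgue_on (cell C)) v" by simp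
  qed
  finally show "ip M p v = (\<Sum>C\<in>\<V>. q C * integral\<^sup>L (lebesgue_on (cell C)) v)" .
qed

context
  fixes p :: "'a \<Rightarrow> real" and q :: "'a set \<Rightarrow> real"
  assumes p: "\<And>C x. C \<in> \<V> \<Longrightarrow> x \<in> cell C \<Longrightarrow> p x = q C"
begin

lemma piecewise_sqi: "sqi M p"
  by (rule integral_piecewise(1)[OF p sqi_zero])

lemma piecewise_dual_bound:
  assumes "H10g \<Omega> w g"
  shows "(\<Sum>C\<in>\<V>. q C * integral\<^sup>L (lebesgue_on (cell C)) w)\<^sup>2 \<le> (dual_norm \<Omega> (emb \<Omega> p))\<^sup>2 * (nrm M g)\<^sup>2"
proof -
  have "\<bar>emb \<Omega> p w\<bar> \<le> dual_norm \<Omega> (emb \<Omega> p) * nrm M g"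
    by (rule dual_norm_bound[OF domain emb_Hm1[OF domain piecewise_sqi] assms])
  then have "\<bar>emb \<Omega> p w\<bar>\<^sup>2 \<le> (dual_norm \<Omega> (emb \<Omega> p) * nrm M g)\<^sup>2" by (rule power_mono) simp
  moreover have "emb \<Omega> p w = (\<Sum>C\<in>\<V>. q C * integral\<^sup>L (lebesgue_on (cell C)) w)"
    unfolding emb_eq[OF domain_measurable(1)]
    by (rule integral_piecewise(2)[OF p H10g_sqi(1)[OF domain assms]])
  ultimately show ?thesis by (simp add: power_mult_distrib)
qed

text \<open>The load sees only cell means, and the companion has the same ones. A nonconforming test
  function is thus exchanged for a conforming one, to which the dual norm applies.\<close>

lemma cr_dual_bound:
  assumes d: "\<And>S. boundary_facet S \<Longrightarrow> d S = 0"
  shows "(\<Sum>C\<in>\<V>. q C * (vol C * cr_mean d C))\<^sup>2 \<le>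
     (dual_norm \<Omega> (emb \<Omega> p))\<^sup>2 * (K\<^sub>3 * (\<Sum>C\<in>\<V>. vol C * (norm (cr_grad d C))\<^sup>2))"
proof -
  obtain w g where w: "H10g \<Omega> w g" "\<forall>C\<in>\<V>. integral\<^sup>L (lebesgue_on (cell C)) w = vol C * cr_mean d C"
    "(nrm M g)\<^sup>2 \<le> K\<^sub>3 * (\<Sum>C\<in>\<V>. vol C * (norm (cr_grad d C))\<^sup>2)"
    by (rule companion[OF d])
  have "(\<Sum>C\<in>\<V>. q C * (vol C * cr_mean d C))\<^sup>2 = (\<Sum>C\<in>\<V>. q C * integral\<^sup>L (lebesgue_on (cell C)) w)\<^sup>2"
    using w(2) by (simp cong: sum.cong)
  also have "\<dots> \<le> (dual_norm \<Omega> (emb \<Omega> p))\<^sup>2 * (nrm M g)\<^sup>2" by (rule piecewise_dual_bound[OF w(1)])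
  also have "\<dots> \<le> (dual_norm \<Omega> (emb \<Omega> p))\<^sup>2 * (K\<^sub>3 * (\<Sum>C\<in>\<V>. vol C * (norm (cr_grad d C))\<^sup>2))"
    by (rule mult_left_mono[OF w(3)]) simp
  finally show ?thesis .
qed

text \<open>Solvability comes from compatibility: a test function of energy 0 has load 0 by
  \<open>cr_dual_bound\<close>. The same bound applied to the solution reads
  \<open>X^2 \<le> K\<^sub>3 * D^2 * X\<close> for its energy \<open>X\<close> and the dual norm
  \<open>D\<close> of the data, and one factor \<open>X\<close> cancels.\<close>

lemma cr_solution:
  obtains c where "\<forall>d. (\<forall>S. boundary_facet S \<longrightarrow> d S = 0) \<longrightarrow>
      (\<Sum>C\<in>\<V>. vol C * (cr_grad c C \<bullet> cr_grad d C)) = - (\<Sum>C\<in>\<V>. q C * (vol C * cr_mean d C))"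
    "(\<Sum>C\<in>\<V>. vol C * (norm (cr_grad c C))\<^sup>2) \<le> K\<^sub>3 * (dual_norm \<Omega> (emb \<Omega> p))\<^sup>2"
proof -
  define G where "G C S = cr_grad (\<lambda>T. of_bool (T = S)) C" for C S :: "'a set"
  define m where "m C S = cr_mean (\<lambda>T. of_bool (T = S)) C" for C S :: "'a set"
  define A where "A S S' = (\<Sum>C\<in>\<V>. vol C * (G C S \<bullet> G C S'))" for S S'
  define l where "l S = - (\<Sum>C\<in>\<V>. q C * (vol C * m C S))" for S
  have expand: "cr_grad d C = (\<Sum>S\<in>facets. d S *\<^sub>R G C S)" "cr_mean d C = (\<Sum>S\<in>facets. d S * m C S)"
    if "\<forall>S. boundary_facet S \<longrightarrow> d S = 0" "C \<in> \<V>" for d C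
    unfolding G_def m_def
    by (rule cr_grad_sum[OF finite_facets]; use that in \<open>auto simp: facets_def\<close>)+
  have bil: "(\<Sum>C\<in>\<V>. vol C * (cr_grad e C \<bullet> cr_grad d C)) = (\<Sum>S\<in>facets. d S * (\<Sum>S'\<in>facets. A S S' * e S'))"
    if "\<forall>S. boundary_facet S \<longrightarrow> d S = 0" "\<forall>S. boundary_facet S \<longrightarrow> e S = 0" for d e
  proof -
    have "(\<Sum>C\<in>\<V>. vol C * (cr_grad e C \<bullet> cr_grad d C)) =
       (\<Sum>C\<in>\<V>. \<Sum>S\<in>facets. \<Sum>S'\<in>facets. d S * (e S' * (vol C * (G C S \<bullet> G C S'))))"
    proof (rule sum.cong[OF refl])
      fix C assume C: "C \<in> \<V>"
      show "vol C * (cr_grad e C \<bullet> cr_grad d C) = (\<Sum>S\<in>facets. \<Sum>S'\<in>facets. d S * (e S' * (vol C * (G C S \<bullet> G C S'))))"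
      proof -
        have "vol C * (cr_grad e C \<bullet> cr_grad d C) = vol C * (cr_grad d C \<bullet> cr_grad e C)" by (simp only: inner_commute)
        also have "\<dots> = vol C * (\<Sum>S\<in>facets. \<Sum>S'\<in>facets. d S * (e S' * (G C S \<bullet> G C S')))"
          unfolding expand(1)[OF that(1) C] expand(1)[OF that(2) C]
          by (simp only: inner_sum_left inner_sum_right inner_scaleR_left inner_scaleR_right sum_distrib_left)
            (subst sum.swap, simp only: mult.left_commute)
        also have "\<dots> = (\<Sum>S\<in>facets. \<Sum>S'\<in>facets. d S * (e S' * (vol C * (G C S \<bullet> G C S'))))"
          unfolding sum_distrib_left by (intro sum.cong refl) (simp only: mult.left_commute)
        finally show ?thesis .
      qed
    qed
    also have "\<dots> = (\<Sum>S\<in>facets. \<Sum>C\<in>\<V>. \<Sum>S'\<in>facets. d S * (e S' * (vol C * (G C S \<bullet> G C S'))))"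
      by (rule sum.swap)
    also have "\<dots> = (\<Sum>S\<in>facets. \<Sum>S'\<in>facets. \<Sum>C\<in>\<V>. d S * (e S' * (vol C * (G C S \<bullet> G C S'))))"
      by (rule sum.cong[OF refl]) (rule sum.swap)
    also have "\<dots> = (\<Sum>S\<in>facets. d S * (\<Sum>S'\<in>facets. A S S' * e S'))"
      by (intro sum.cong refl) (simp add: A_def sum_distrib_left sum_distrib_right mult_ac)
    finally show ?thesis .
  qed
  have lin: "- (\<Sum>C\<in>\<V>. q C * (vol C * cr_mean d C)) = (\<Sum>S\<in>facets. d S * l S)"
    if "\<forall>S. boundary_facet S \<longrightarrow> d S = 0" for d
  proof -
    have "(\<Sum>C\<in>\<V>. q C * (vol C * cr_mean d C)) = (\<Sum>C\<in>\<V>. \<Sum>S\<in>facets. d S * (q C * (vol C * m C S)))"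
      by (rule sum.cong) (use expand(2)[OF that] in \<open>auto simp: sum_distrib_left mult_ac\<close>)
    also have "\<dots> = (\<Sum>S\<in>facets. \<Sum>C\<in>\<V>. d S * (q C * (vol C * m C S)))" by (rule sum.swap)
    finally show ?thesis by (simp add: l_def sum_distrib_left sum_negf[symmetric])
  qed
  \<comment> \<open>Extension by 0, because \<open>cr_dual_bound\<close> speaks about functions on
    all vertex sets that vanish on boundary facets.\<close>
  define ext where "ext d S = (if S \<in> facets then d S else 0)" for d :: "'a set \<Rightarrow> real" and S
  have ext0: "\<forall>S. boundary_facet S \<longrightarrow> ext d S = 0" for d by (auto simp: ext_def facets_def)
  have extQ: "(\<Sum>S\<in>facets. \<Sum>S'\<in>facets. d S * d S' * A S S') = (\<Sum>C\<in>\<V>. vol C * (norm (cr_grad (ext d) C))\<^sup>2)" for d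
  proof -
    have "(\<Sum>S\<in>facets. \<Sum>S'\<in>facets. d S * d S' * A S S') = (\<Sum>S\<in>facets. ext d S * (\<Sum>S'\<in>facets. A S S' * ext d S'))"
      by (rule sum.cong) (auto simp: ext_def sum_distrib_left mult_ac intro!: sum.cong)
    also have "\<dots> = (\<Sum>C\<in>\<V>. vol C * (norm (cr_grad (ext d) C))\<^sup>2)"
      using bil[OF ext0 ext0, of d d] by (simp add: power2_norm_eq_inner)
    finally show ?thesis .
  qed
  have sumext: "(\<Sum>S\<in>facets. ext d S * l S) = (\<Sum>S\<in>facets. d S * l S)" for d
    by (rule sum.cong) (auto simp: ext_def)
  have "\<exists>c. \<forall>S\<in>facets. (\<Sum>S'\<in>facets. A S S' * c S') = l S"
  proof (rule psd_system_solvable[OF finite_facets])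
    show "A S S' = A S' S" for S S' by (simp add: A_def inner_commute)
    show "0 \<le> (\<Sum>S\<in>facets. \<Sum>S'\<in>facets. d S * d S' * A S S')" for d
      unfolding extQ by (rule sum_nonneg) simp
    show "(\<Sum>S\<in>facets. d S * l S) = 0" if "(\<Sum>S\<in>facets. \<Sum>S'\<in>facets. d S * d S' * A S S') = 0" for d
    proof -
      have "(\<Sum>C\<in>\<V>. q C * (vol C * cr_mean (ext d) C))\<^sup>2 \<le> (dual_norm \<Omega> (emb \<Omega> p))\<^sup>2 * (K\<^sub>3 * 0)"
        using cr_dual_bound[of "ext d"] ext0[of d] that unfolding extQ by simp
      then have "(\<Sum>C\<in>\<V>. q C * (vol C * cr_mean (ext d) C)) = 0" by simp
      then show ?thesis using lin[OF ext0, of d] by (simp add: sumext)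
    qed
  qed
  then obtain c0 where c0: "\<forall>S\<in>facets. (\<Sum>S'\<in>facets. A S S' * c0 S') = l S" by blast
  define c where "c = ext c0"
  have c: "\<forall>S. boundary_facet S \<longrightarrow> c S = 0" unfolding c_def by (rule ext0)
  have sol: "(\<Sum>C\<in>\<V>. vol C * (cr_grad c C \<bullet> cr_grad d C)) = - (\<Sum>C\<in>\<V>. q C * (vol C * cr_mean d C))"
    if d: "\<forall>S. boundary_facet S \<longrightarrow> d S = 0" for d
  proof -
    have "(\<Sum>S'\<in>facets. A S S' * c S') = (\<Sum>S'\<in>facets. A S S' * c0 S')" for S
      by (rule sum.cong) (auto simp: c_def ext_def)
    then have "(\<Sum>S\<in>facets. d S * (\<Sum>S'\<in>facets. A S S' * c S')) = (\<Sum>S\<in>facets. d S * l S)"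
      using c0 by (simp cong: sum.cong)
    then show ?thesis using bil[OF d c] lin[OF d] by simp
  qed
  define X where "X = (\<Sum>C\<in>\<V>. vol C * (norm (cr_grad c C))\<^sup>2)"
  have X0: "0 \<le> X" unfolding X_def by (rule sum_nonneg) simp
  have "X = - (\<Sum>C\<in>\<V>. q C * (vol C * cr_mean c C))"
    using sol[OF c] by (simp add: X_def power2_norm_eq_inner)
  then have "X\<^sup>2 = (\<Sum>C\<in>\<V>. q C * (vol C * cr_mean c C))\<^sup>2" by simp
  also have "\<dots> \<le> (dual_norm \<Omega> (emb \<Omega> p))\<^sup>2 * (K\<^sub>3 * X)"
    unfolding X_def by (rule cr_dual_bound) (use c in blast)
  finally have "X * X \<le> K\<^sub>3 * (dual_norm \<Omega> (emb \<Omega> p))\<^sup>2 * X" by (simp add: power2_eq_square mult_ac)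
  moreover have "0 \<le> K\<^sub>3 * (dual_norm \<Omega> (emb \<Omega> p))\<^sup>2"
    using c\<^sub>g_ge_1 \<kappa>_pos by (simp add: K\<^sub>3_def K\<^sub>2_def)
  ultimately have "X \<le> K\<^sub>3 * (dual_norm \<Omega> (emb \<Omega> p))\<^sup>2"
    using X0 by (cases "X = 0") (auto simp: mult_le_cancel_right)
  then show ?thesis using that[of c] sol by (simp add: X_def)
qed

text \<open>Bubbles weighted by \<open>(diam C)^2 * q C\<close> make the pairing with
  \<open>p\<close> equal to the left-hand side \<open>Y\<close>, while their gradient has squared
  norm at most \<open>B^2 * Y\<close>.\<close>

lemma data_estimate:
  "(\<Sum>C\<in>\<V>. vol C * (diam C * \<bar>q C\<bar>)\<^sup>2) \<le> B\<^sup>2 * (dual_norm \<Omega> (emb \<Omega> p))\<^sup>2"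
proof -
  obtain b where b: "\<forall>C\<in>\<V>. test_fun (cell C) (b C)" "\<forall>C\<in>\<V>. integral\<^sup>L (lebesgue_on (cell C)) (b C) = vol C"
    "\<forall>C\<in>\<V>. \<forall>x. norm (grad (b C) x) \<le> B / diam C"
    by (rule obtain_bubbles)
  define \<beta> where "\<beta> C = (diam C)\<^sup>2 * q C" for C
  define t where "t = (\<lambda>x. \<Sum>C\<in>\<V>. \<beta> C * b C x)"
  note tt = bubble_combination[where b=b and \<beta>=\<beta>, OF b(1)]
  have t1: "test_fun \<Omega> t" using tt(1) by (simp add: t_def)
  define Y where "Y = (\<Sum>C\<in>\<V>. vol C * (diam C * \<bar>q C\<bar>)\<^sup>2)"
  have Y0: "0 \<le> Y" unfolding Y_def by (rule sum_nonneg) simp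
  have g: "norm (grad t x) \<le> B * (diam C * \<bar>q C\<bar>)" if C: "C \<in> \<V>" "x \<in> cell C" for C x
  proof -
    have dp: "0 < diam C" using nsimplex.diameter_pos[OF simplices[OF C(1)]] .
    have "norm (grad t x) = \<bar>\<beta> C\<bar> * norm (grad (b C) x)" using tt(3)[OF C] by (simp add: t_def)
    also have "\<dots> \<le> \<bar>\<beta> C\<bar> * (B / diam C)" using b(3) C(1) by (intro mult_left_mono) auto
    also have "\<dots> = B * (diam C * \<bar>q C\<bar>)" using dp by (simp add: \<beta>_def abs_mult power2_eq_square)
    finally show ?thesis .
  qed
  have "(nrm M (grad t))\<^sup>2 \<le> (\<Sum>C\<in>\<V>. vol C * (B * (diam C * \<bar>q C\<bar>))\<^sup>2)"
    by (rule nrm_le_cells[OF test_sqi(2)[OF domain t1] g])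
  also have "\<dots> = B\<^sup>2 * Y" by (simp add: Y_def sum_distrib_left power_mult_distrib mult_ac)
  finally have gn: "(nrm M (grad t))\<^sup>2 \<le> B\<^sup>2 * Y" .
  have "(\<Sum>C\<in>\<V>. q C * integral\<^sup>L (lebesgue_on (cell C)) t) = Y"
    unfolding Y_def
  proof (rule sum.cong[OF refl])
    fix C assume C: "C \<in> \<V>"
    have "integral\<^sup>L (lebesgue_on (cell C)) t = (\<integral>x. \<beta> C * b C x \<partial>lebesgue_on (cell C))"
      by (rule Bochner_Integration.integral_cong) (use tt(2)[OF C] in \<open>auto simp: t_def\<close>)
    also have "\<dots> = \<beta> C * vol C" using b(2) C by simp
    finally show "q C * integral\<^sup>L (lebesgue_on (cell C)) t = vol C * (diam C * \<bar>q C\<bar>)\<^sup>2"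
      by (simp add: \<beta>_def power2_eq_square abs_mult_self_eq mult_ac)
  qed
  then have "Y\<^sup>2 \<le> (dual_norm \<Omega> (emb \<Omega> p))\<^sup>2 * (nrm M (grad t))\<^sup>2"
    using piecewise_dual_bound[OF test_fun_H10g[OF domain t1]] by simp
  also have "\<dots> \<le> (dual_norm \<Omega> (emb \<Omega> p))\<^sup>2 * (B\<^sup>2 * Y)" by (rule mult_left_mono[OF gn]) simp
  finally have "Y * Y \<le> B\<^sup>2 * (dual_norm \<Omega> (emb \<Omega> p))\<^sup>2 * Y" by (simp add: power2_eq_square mult_ac)
  then have "Y \<le> B\<^sup>2 * (dual_norm \<Omega> (emb \<Omega> p))\<^sup>2"
    using Y0 by (cases "Y = 0") (auto simp: mult_le_cancel_right)
  then show ?thesis by (simp add: Y_def)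
qed

text \<open>Marini's identity: the lowest-order mixed solution is the Crouzeix--Raviart gradient plus an
  explicit linear correction.\<close>

lemma lifting:
  obtains \<rho> where "\<forall>C\<in>\<V>. \<exists>a b. \<forall>x\<in>cell C. \<rho> x = a + b *\<^sub>R x" "has_weak_div \<Omega> \<rho> p"
    "(nrm M \<rho>)\<^sup>2 \<le> 2 * (K\<^sub>3 + B\<^sup>2) * (dual_norm \<Omega> (emb \<Omega> p))\<^sup>2"
proof -
  let ?n = "real DIM('a)"
  have n1: "1 \<le> ?n" using dim by simp
  obtain c where c: "\<forall>d. (\<forall>S. boundary_facet S \<longrightarrow> d S = 0) \<longrightarrow>
      (\<Sum>C\<in>\<V>. vol C * (cr_grad c C \<bullet> cr_grad d C)) = - (\<Sum>C\<in>\<V>. q C * (vol C * cr_mean d C))"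
    and cb: "(\<Sum>C\<in>\<V>. vol C * (norm (cr_grad c C))\<^sup>2) \<le> K\<^sub>3 * (dual_norm \<Omega> (emb \<Omega> p))\<^sup>2"
    by (rule cr_solution)
  \<comment> \<open>The factor \<open>q C / n\<close> makes the cellwise divergence
    \<open>q C\<close>; with the barycentre as origin \<open>facet_mean_center\<close>
    applies.\<close>
  define r where "r C x = cr_grad c C + (q C / ?n) *\<^sub>R (x - nsimplex.center C)" for C x
  define \<rho> where "\<rho> = on_cells r"
  have \<rho>: "\<rho> x = r C x" if "C \<in> \<V>" "x \<in> cell C" for C x unfolding \<rho>_def by (rule on_cells_eq[OF that])
  have cr: "continuous_on S (r C)" for S C unfolding r_def by (intro continuous_intros)
  have s\<rho>: "sqi M \<rho>" unfolding \<rho>_def by (rule on_cells_sqi) (rule cr)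
  have "\<forall>C\<in>\<V>. \<exists>a b. \<forall>x\<in>cell C. \<rho> x = a + b *\<^sub>R x"
  proof
    fix C assume C: "C \<in> \<V>"
    show "\<exists>a b. \<forall>x\<in>cell C. \<rho> x = a + b *\<^sub>R x"
      by (intro exI[of _ "cr_grad c C - (q C / ?n) *\<^sub>R nsimplex.center C"] exI[of _ "q C / ?n"] ballI)
        (simp add: \<rho>[OF C] r_def scaleR_diff_right)
  qed
  moreover have "ip M \<rho> (grad \<phi>) = - ip M p \<phi>" if \<phi>: "test_fun \<Omega> \<phi>" for \<phi>
  proof -
    note sm = test_fun_smooth[OF \<phi>]
    define isf where "isf S Cz \<longleftrightarrow> fst Cz \<in> \<V> \<and> snd Cz \<in> fst Cz \<and> S = fst Cz - {snd Cz}" for S :: "'a set" and Cz :: "'a set \<times> 'a"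
    \<comment> \<open>The Crouzeix--Raviart interpolant of \<phi> by facet means. A facet shared by
      two simplices has two descriptions; \<open>d_eq\<close> shows that the choice between them
      does not matter.\<close>
    define d where "d S = (if \<exists>Cz. isf S Cz then facet_mean (fst (SOME Cz. isf S Cz)) (snd (SOME Cz. isf S Cz)) \<phi> else 0)" for S
    have d_eq: "d (C - {z}) = facet_mean C z \<phi>" if C: "C \<in> \<V>" "z \<in> C" for C z
    proof -
      define Cz where "Cz = (SOME Cz. isf (C - {z}) Cz)"
      have "isf (C - {z}) (C, z)" using C by (simp add: isf_def)
      then have ex: "\<exists>Cz. isf (C - {z}) Cz" by blast
      have "isf (C - {z}) Cz" unfolding Cz_def by (rule someI_ex[OF ex])
      then have Cz: "fst Cz \<in> \<V>" "snd Cz \<in> fst Cz" "C - {z} = fst Cz - {snd Cz}" by (auto simp: isf_def)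
      have "d (C - {z}) = facet_mean (fst Cz) (snd Cz) \<phi>" unfolding d_def Cz_def[symmetric] using ex by (rule if_P)
      also have "\<dots> = facet_mean C z \<phi>"
        by (rule nsimplex.facet_mean_opposite[OF simplices[OF C(1)] C(2) simplices[OF Cz(1)] Cz(2) Cz(3)[symmetric] sm])
      finally show ?thesis .
    qed
    have d0: "d S = 0" if S: "boundary_facet S" for S
    proof (cases "\<exists>Cz. isf S Cz")
      case True
      then obtain Cz where "isf S Cz" by blast
      then have Cz: "fst Cz \<in> \<V>" "snd Cz \<in> fst Cz" "S = fst Cz - {snd Cz}" by (auto simp: isf_def)
      have "\<phi> x = 0" if x: "x \<in> convex hull (fst Cz - {snd Cz})" for x
      proof -
        have "x \<notin> \<Omega>" by (rule boundary_facet_outside[OF Cz(1,2) _ x]) (use S Cz(3) in simp)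
        then show ?thesis using \<phi> closure_subset[of "{x. \<phi> x \<noteq> 0}"] by (auto simp: test_fun_def)
      qed
      then have "facet_mean (fst Cz) (snd Cz) \<phi> = 0"
        by (rule nsimplex.facet_mean_zero[OF simplices[OF Cz(1)] Cz(2) sm])
      then show ?thesis using d_eq[OF Cz(1,2)] Cz(3) by simp
    next
      case False
      then show ?thesis unfolding d_def by (rule if_not_P)
    qed
    \<comment> \<open>Summed over the cells, the first two terms cancel by the equation for
      \<open>c\<close>, which leaves the pairing of \<open>p\<close> with \<phi>.\<close>
    have celleq: "(\<integral>x. \<rho> x \<bullet> grad \<phi> x \<partial>lebesgue_on (cell C)) =
       vol C * (cr_grad c C \<bullet> cr_grad d C) + q C * (vol C * cr_mean d C) - q C * integral\<^sup>L (lebesgue_on (cell C)) \<phi>"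
      if C: "C \<in> \<V>" for C
    proof -
      interpret nsimplex C using simplices C by blast
      have cg: "continuous_on UNIV (grad \<phi>)" by (rule smooth_fun_grad_continuous[OF sm])
      have c1: "continuous_on UNIV (\<lambda>x. grad \<phi> x \<bullet> cr_grad c C)" "continuous_on UNIV (\<lambda>x. grad \<phi> x \<bullet> (x - center))"
        by (intro continuous_intros cg)+
      note i1 = integral_cell[OF c1(1)] and i2 = integral_cell[OF c1(2)] and i3 = integral_cell[OF smooth_fun_continuous[OF sm]]
      have gd: "(\<Sum>z\<in>C. (- ?n * facet_mean C z \<phi>) *\<^sub>R bgrad C z) = cr_grad d C"
        unfolding cr_grad_def by (rule sum.cong) (simp_all add: d_eq[OF C])
      have md: "(\<Sum>z\<in>C. facet_mean C z \<phi>) / real (DIM('a) + 1) = cr_mean d C"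
        unfolding cr_mean_def by (simp add: d_eq[OF C] cong: sum.cong)
      have "(\<integral>x. \<rho> x \<bullet> grad \<phi> x \<partial>lebesgue_on (cell C)) =
          (\<integral>x. grad \<phi> x \<bullet> cr_grad c C + (q C / ?n) * (grad \<phi> x \<bullet> (x - center)) \<partial>lebesgue_on (cell C))"
      proof (rule Bochner_Integration.integral_cong[OF refl])
        fix x assume "x \<in> space (lebesgue_on (cell C))"
        then have "\<rho> x = r C x" using \<rho>[OF C] by simp
        then show "\<rho> x \<bullet> grad \<phi> x = grad \<phi> x \<bullet> cr_grad c C + (q C / ?n) * (grad \<phi> x \<bullet> (x - center))"
          by (simp add: r_def inner_add_left inner_add_right inner_commute)
      qed
      also have "\<dots> = (\<integral>x. grad \<phi> x \<bullet> cr_grad c C \<partial>lebesgue_on (cell C)) +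
          (q C / ?n) * (\<integral>x. grad \<phi> x \<bullet> (x - center) \<partial>lebesgue_on (cell C))"
        using i1(2) i2(2) by simp
      also have "(\<integral>x. grad \<phi> x \<bullet> cr_grad c C \<partial>lebesgue_on (cell C)) = vol C * (cr_grad d C \<bullet> cr_grad c C)"
        unfolding i1(1)[symmetric] facet_mean_gradient[OF sm] gd measure_lborel_hull ..
      also have "(\<integral>x. grad \<phi> x \<bullet> (x - center) \<partial>lebesgue_on (cell C)) =
          ?n * (vol C * cr_mean d C - integral\<^sup>L (lebesgue_on (cell C)) \<phi>)"
        unfolding i2(1)[symmetric] facet_mean_center[OF sm] md measure_lborel_hull i3(1) ..
      finally show ?thesis using n1 by (simp add: inner_commute right_diff_distrib)
    qed
    have "ip M \<rho> (grad \<phi>) = (\<Sum>C\<in>\<V>. \<integral>x. \<rho> x \<bullet> grad \<phi> x \<partial>lebesgue_on (cell C))"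
      unfolding ip_def
      by (rule integral_cells(1)[OF sqi_integrable_ip[OF s\<rho> test_sqi(2)[OF domain \<phi>]]])
    also have "\<dots> = (\<Sum>C\<in>\<V>. vol C * (cr_grad c C \<bullet> cr_grad d C)) + (\<Sum>C\<in>\<V>. q C * (vol C * cr_mean d C))
        - (\<Sum>C\<in>\<V>. q C * integral\<^sup>L (lebesgue_on (cell C)) \<phi>)"
      by (simp add: celleq sum.distrib sum_subtractf cong: sum.cong)
    also have "(\<Sum>C\<in>\<V>. vol C * (cr_grad c C \<bullet> cr_grad d C)) = - (\<Sum>C\<in>\<V>. q C * (vol C * cr_mean d C))"
      using c d0 by blast
    also have "(\<Sum>C\<in>\<V>. q C * integral\<^sup>L (lebesgue_on (cell C)) \<phi>) = ip M p \<phi>"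
      by (rule integral_piecewise(2)[OF p test_sqi(1)[OF domain \<phi>], symmetric])
    finally show ?thesis by simp
  qed
  then have "has_weak_div \<Omega> \<rho> p"
    using s\<rho> piecewise_sqi by (simp add: has_weak_div_iff[OF domain])
  moreover have "(nrm M \<rho>)\<^sup>2 \<le> 2 * (K\<^sub>3 + B\<^sup>2) * (dual_norm \<Omega> (emb \<Omega> p))\<^sup>2"
  proof -
    have b: "norm (\<rho> x) \<le> norm (cr_grad c C) + diam C * \<bar>q C\<bar>" if C: "C \<in> \<V>" "x \<in> cell C" for C x
    proof -
      interpret nsimplex C using simplices C by blast
      have "norm (x - center) \<le> diam C"
        using C(2) center_interior interior_subset by (intro dist_le_diameter) auto
      then have "\<bar>q C\<bar> / ?n * norm (x - center) \<le> \<bar>q C\<bar> / 1 * diam C"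
        using n1 by (intro mult_mono divide_left_mono) auto
      moreover have "norm (\<rho> x) \<le> norm (cr_grad c C) + norm ((q C / ?n) *\<^sub>R (x - center))"
        unfolding \<rho>[OF C] r_def by (rule norm_triangle_ineq)
      ultimately show ?thesis using n1 by (simp add: mult.commute)
    qed
    have "(nrm M \<rho>)\<^sup>2 \<le> (\<Sum>C\<in>\<V>. vol C * (norm (cr_grad c C) + diam C * \<bar>q C\<bar>)\<^sup>2)"
      by (rule nrm_le_cells[OF s\<rho> b])
    also have "\<dots> \<le> (\<Sum>C\<in>\<V>. 2 * (vol C * (norm (cr_grad c C))\<^sup>2) + 2 * (vol C * (diam C * \<bar>q C\<bar>)\<^sup>2))"
    proof (rule sum_mono)
      fix C
      have "(x + y)\<^sup>2 \<le> 2 * x\<^sup>2 + 2 * y\<^sup>2" for x y :: real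
        using sum_squares_bound[of x y] by (simp add: power2_sum)
      then have "vol C * (norm (cr_grad c C) + diam C * \<bar>q C\<bar>)\<^sup>2 \<le> vol C * (2 * (norm (cr_grad c C))\<^sup>2 + 2 * (diam C * \<bar>q C\<bar>)\<^sup>2)"
        by (rule mult_left_mono) simp
      then show "vol C * (norm (cr_grad c C) + diam C * \<bar>q C\<bar>)\<^sup>2 \<le> 2 * (vol C * (norm (cr_grad c C))\<^sup>2) + 2 * (vol C * (diam C * \<bar>q C\<bar>)\<^sup>2)"
        by (simp only: distrib_left mult.left_commute)
    qed
    also have "\<dots> = 2 * (\<Sum>C\<in>\<V>. vol C * (norm (cr_grad c C))\<^sup>2) + 2 * (\<Sum>C\<in>\<V>. vol C * (diam C * \<bar>q C\<bar>)\<^sup>2)"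
      by (simp only: sum.distrib sum_distrib_left)
    also have "\<dots> \<le> 2 * (K\<^sub>3 * (dual_norm \<Omega> (emb \<Omega> p))\<^sup>2) + 2 * (B\<^sup>2 * (dual_norm \<Omega> (emb \<Omega> p))\<^sup>2)"
      using cb data_estimate by (intro add_mono mult_left_mono) auto
    finally show ?thesis by (simp only: distrib_left distrib_right mult.assoc)
  qed
  ultimately show ?thesis by (rule that)
qed

end

end

section \<open>The mixed method\<close>

context regular_mesh
begin

abbreviation \<T> :: "'a set set" where "\<T> \<equiv> (\<lambda>C. convex hull C) ` \<V>"

lemmas weak_div_iff = has_weak_div_iff[OF domain]

lemma P0_iff: "v \<in> P0 \<T> \<longleftrightarrow> (\<exists>q. \<forall>C\<in>\<V>. \<forall>x\<in>cell C. v x = q C)"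
proof -
  have "v \<in> P0 \<T> \<longleftrightarrow> (\<forall>C\<in>\<V>. \<exists>c. \<forall>x\<in>cell C. v x = c)" by (simp add: P0_def)
  also have "\<dots> \<longleftrightarrow> (\<exists>q. \<forall>C\<in>\<V>. \<forall>x\<in>cell C. v x = q C)" by (rule bchoice_iff)
  finally show ?thesis .
qed

lemma P0_sqi: "v \<in> P0 \<T> \<Longrightarrow> sqi M v"
  unfolding P0_iff using piecewise_sqi by metis

lemma P0_lincomb:
  assumes "v \<in> P0 \<T>" "w \<in> P0 \<T>"
  shows "(\<lambda>x. a * v x + b * w x) \<in> P0 \<T>"
proof -
  obtain q r where "\<forall>C\<in>\<V>. \<forall>x\<in>cell C. v x = q C" "\<forall>C\<in>\<V>. \<forall>x\<in>cell C. w x = r C"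
    using assms unfolding P0_iff by metis
  then show ?thesis unfolding P0_iff by (intro exI[of _ "\<lambda>C. a * q C + b * r C"]) simp
qed

lemma RT0_iff: "\<tau> \<in> RT0 \<Omega> \<T> \<longleftrightarrow>
    (\<exists>a b. \<forall>C\<in>\<V>. \<forall>x\<in>cell C. \<tau> x = a C + b C *\<^sub>R x) \<and> (\<exists>d. has_weak_div \<Omega> \<tau> d)"
proof -
  have "(\<forall>C\<in>\<V>. \<exists>a b. \<forall>x\<in>cell C. \<tau> x = a + b *\<^sub>R x) \<longleftrightarrow> (\<exists>a b. \<forall>C\<in>\<V>. \<forall>x\<in>cell C. \<tau> x = a C + b C *\<^sub>R x)"
    by (simp only: bchoice_iff)
  then show ?thesis by (simp add: RT0_def)
qed

lemma weak_div_sqi: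
  assumes "has_weak_div \<Omega> \<tau> d" shows "sqi M \<tau>" "sqi M d"
  using assms by (simp_all add: weak_div_iff)

lemma RT0_sqi: "\<tau> \<in> RT0 \<Omega> \<T> \<Longrightarrow> sqi M \<tau>"
  using weak_div_sqi by (auto simp: RT0_iff)

lemma weak_div_lincomb:
  assumes "has_weak_div \<Omega> \<sigma> d" "has_weak_div \<Omega> \<tau> e"
  shows "has_weak_div \<Omega> (\<lambda>x. a *\<^sub>R \<sigma> x + b *\<^sub>R \<tau> x) (\<lambda>x. a * d x + b * e x)"
proof -
  note s = weak_div_sqi[OF assms(1)] weak_div_sqi[OF assms(2)]
  note c = s[THEN sqi_scaleR]
  have d: "sqi M (\<lambda>x. a * d x)" "sqi M (\<lambda>x. b * e x)" using c(2,4) by simp_all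
  have "ip M (\<lambda>x. a *\<^sub>R \<sigma> x + b *\<^sub>R \<tau> x) (grad \<phi>) = - ip M (\<lambda>x. a * d x + b * e x) \<phi>" if \<phi>: "test_fun \<Omega> \<phi>" for \<phi>
  proof -
    note t = test_sqi[OF domain \<phi>]
    have h: "ip M \<sigma> (grad \<phi>) = - ip M d \<phi>" "ip M \<tau> (grad \<phi>) = - ip M e \<phi>"
      using assms \<phi> by (simp_all add: weak_div_iff)
    have m: "ip M (\<lambda>x. a * d x) \<phi> = a * ip M d \<phi>" "ip M (\<lambda>x. b * e x) \<phi> = b * ip M e \<phi>"
      using ip_scaleR_left[of M a d \<phi>] ip_scaleR_left[of M b e \<phi>] by simp_all
    show ?thesis
      unfolding ip_add_left[OF c(1) c(3) t(2)] ip_add_left[OF d t(1)] ip_scaleR_left m h by simp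
  qed
  then show ?thesis unfolding weak_div_iff using sqi_add[OF c(1) c(3)] sqi_add[OF d] by blast
qed

lemma weak_div_AE:
  assumes "has_weak_div \<Omega> \<tau> d" "AE x in M. d x = e x"
  shows "has_weak_div \<Omega> \<tau> e"
proof -
  note s = weak_div_sqi[OF assms(1)]
  have e: "sqi M e" by (rule sqi_AE_eq[OF domain_measurable(1) s(2) assms(2)])
  have "ip M d \<phi> = ip M e \<phi>" if "test_fun \<Omega> \<phi>" for \<phi>
    by (rule ip_cong_AE)
      (use s(2) e assms(2) test_sqi(1)[OF domain that] in \<open>auto simp: sqi_def\<close>)
  then show ?thesis using assms(1) e by (simp add: weak_div_iff)
qed

lemma RT0_lincomb:
  assumes "\<sigma> \<in> RT0 \<Omega> \<T>" "\<tau> \<in> RT0 \<Omega> \<T>"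
  shows "(\<lambda>x. a *\<^sub>R \<sigma> x + b *\<^sub>R \<tau> x) \<in> RT0 \<Omega> \<T>"
proof -
  obtain p q p' q' d e where *: "\<forall>C\<in>\<V>. \<forall>x\<in>cell C. \<sigma> x = p C + q C *\<^sub>R x"
    "\<forall>C\<in>\<V>. \<forall>x\<in>cell C. \<tau> x = p' C + q' C *\<^sub>R x" "has_weak_div \<Omega> \<sigma> d" "has_weak_div \<Omega> \<tau> e"
    using assms unfolding RT0_iff by metis
  have "\<forall>C\<in>\<V>. \<forall>x\<in>cell C. a *\<^sub>R \<sigma> x + b *\<^sub>R \<tau> x = (a *\<^sub>R p C + b *\<^sub>R p' C) + (a * q C + b * q' C) *\<^sub>R x"
    using * by (simp add: algebra_simps)
  then have "\<exists>p q. \<forall>C\<in>\<V>. \<forall>x\<in>cell C. a *\<^sub>R \<sigma> x + b *\<^sub>R \<tau> x = p C + q C *\<^sub>R x"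
    by (intro exI[of _ "\<lambda>C. a *\<^sub>R p C + b *\<^sub>R p' C"] exI[of _ "\<lambda>C. a * q C + b * q' C"])
  then show ?thesis unfolding RT0_iff using weak_div_lincomb[OF *(3,4)] by fast
qed

lemma integral_single_cell:
  fixes f :: "'a \<Rightarrow> real"
  assumes f: "integrable M f" and C: "C \<in> \<V>" and z: "\<And>x. x \<notin> cell C \<Longrightarrow> f x = 0"
  shows "integral\<^sup>L M f = integral\<^sup>L (lebesgue_on (cell C)) f"
proof -
  have "integral\<^sup>L (lebesgue_on (cell D)) f = (if D = C then integral\<^sup>L (lebesgue_on (cell C)) f else 0)"
    if D: "D \<in> \<V>" for D
  proof (cases "D = C")
    case False
    have "f x = 0" if x: "x \<in> cell D" for x
      using z[of x] x interior_subset[of "convex hull D"] interior_point_unique[OF C D] False by blast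
    then have "integral\<^sup>L (lebesgue_on (cell D)) f = integral\<^sup>L (lebesgue_on (cell D)) (\<lambda>x. 0)"
      by (intro Bochner_Integration.integral_cong) auto
    then show ?thesis using False by simp
  qed simp
  then have "integral\<^sup>L M f = (\<Sum>D\<in>\<V>. if D = C then integral\<^sup>L (lebesgue_on (cell C)) f else 0)"
    unfolding integral_cells(1)[OF f] by (rule sum.cong[OF refl])
  also have "\<dots> = integral\<^sup>L (lebesgue_on (cell C)) f"
    unfolding sum.delta[OF finite_mesh] using C by (rule if_P)
  finally show ?thesis .
qed

lemma sqi_cell:
  fixes f :: "'a \<Rightarrow> real"
  assumes f: "sqi M f" and C: "C \<in> \<V>"
  shows "sqi (lebesgue_on (cell C)) f"
proof -
  have "f \<in> borel_measurable M" "integrable M (\<lambda>x. (norm (f x))\<^sup>2)" using f by (simp_all add: sqi_def)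
  note measurable_restrict_mono[OF this(1) interior_subset_domain[OF C]] integral_cells(2)[OF this(2) C]
  then show ?thesis by (simp add: sqi_def)
qed

text \<open>The divergence of \<open>a + b *\<^sub>R x\<close> is \<open>n * b\<close>: each of the
  n coordinates contributes b.\<close>

lemma RT0_cell_parts:
  assumes C: "C \<in> \<V>" and \<phi>: "test_fun (cell C) \<phi>"
  shows "(\<integral>x. (a + b *\<^sub>R x) \<bullet> grad \<phi> x \<partial>lebesgue_on (cell C)) = - (\<integral>x. (real DIM('a) * b) * \<phi> x \<partial>lebesgue_on (cell C))"
proof -
  note cs = nsimplex.cell_sets[OF simplices[OF C]]
  note sm = test_fun_smooth[OF \<phi>]
  obtain S where S: "compact S" "S \<subseteq> cell C" "\<And>x. x \<notin> S \<Longrightarrow> \<phi> x = 0" "\<And>x. x \<notin> S \<Longrightarrow> grad \<phi> x = 0"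
    using test_fun_support[OF \<phi>] by metis
  have i: "integrable (lebesgue_on (cell C)) (\<lambda>x. ((a + b *\<^sub>R x) \<bullet> i) * (grad \<phi> x \<bullet> i))" for i
    by (rule integrable_continuous_compact_support_on[OF cs _ S(1)])
      (intro continuous_intros smooth_fun_grad_continuous[OF sm], simp add: S(4))
  have "(\<integral>x. (a + b *\<^sub>R x) \<bullet> grad \<phi> x \<partial>lebesgue_on (cell C)) =
      (\<integral>x. (\<Sum>i\<in>Basis. ((a + b *\<^sub>R x) \<bullet> i) * (grad \<phi> x \<bullet> i)) \<partial>lebesgue_on (cell C))"
    by (simp only: euclidean_inner[symmetric])
  also have "\<dots> = (\<Sum>i\<in>Basis. \<integral>x. ((a + b *\<^sub>R x) \<bullet> i) * (grad \<phi> x \<bullet> i) \<partial>lebesgue_on (cell C))"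
    by (rule Bochner_Integration.integral_sum) (rule i)
  also have "\<dots> = (\<Sum>i\<in>(Basis::'a set). - (b * integral\<^sup>L (lebesgue_on (cell C)) \<phi>))"
  proof (rule sum.cong[OF refl])
    fix i :: 'a assume iB: "i \<in> Basis"
    have "(\<integral>x. ((a + b *\<^sub>R x) \<bullet> i) * (grad \<phi> x \<bullet> i) \<partial>lebesgue_on (cell C))
        = - (\<integral>x. ((b *\<^sub>R i) \<bullet> i) * \<phi> x \<partial>lebesgue_on (cell C))"
      by (rule integration_by_parts_test[OF cs \<phi>])
        (auto intro!: derivative_eq_intros continuous_intros simp: inner_commute)
    then show "(\<integral>x. ((a + b *\<^sub>R x) \<bullet> i) * (grad \<phi> x \<bullet> i) \<partial>lebesgue_on (cell C)) = - (b * integral\<^sup>L (lebesgue_on (cell C)) \<phi>)"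
      using iB by simp
  qed
  finally show ?thesis by simp
qed

text \<open>The weak divergence is at first just some L2 function. Testing with functions supported
  in one cell identifies it there with \<open>n * b\<close>, and the skeleton is null.\<close>

lemma RT0_div_P0:
  assumes "\<tau> \<in> RT0 \<Omega> \<T>"
  obtains p where "p \<in> P0 \<T>" "has_weak_div \<Omega> \<tau> p"
proof -
  obtain a b d where \<tau>: "\<forall>C\<in>\<V>. \<forall>x\<in>cell C. \<tau> x = a C + b C *\<^sub>R x" and d: "has_weak_div \<Omega> \<tau> d"
    using assms unfolding RT0_iff by metis
  note s = weak_div_sqi[OF d]
  let ?c = "\<lambda>C. real DIM('a) * b C"
  define p where "p = on_cells (\<lambda>C x. ?c C)"
  have p: "p x = ?c C" if "C \<in> \<V>" "x \<in> cell C" for C x unfolding p_def by (rule on_cells_eq[OF that])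
  have AEC: "AE x in lebesgue_on (cell C). d x - ?c C = 0" if C: "C \<in> \<V>" for C
  proof (rule fundamental_lemma)
    interpret nsimplex C using simplices C by blast
    show "open (cell C)" "bounded (cell C)" by (simp_all add: bounded_cell)
    have cq: "sqi (lebesgue_on (cell C)) (\<lambda>x. ?c C)"
      by (rule sqi_bounded[OF cell_lmeasurable, where B = "\<bar>?c C\<bar>"]) auto
    note ds = sqi_cell[OF s(2) C]
    show "sqi (lebesgue_on (cell C)) (\<lambda>x. d x - ?c C)" by (rule sqi_diff[OF ds cq])
    fix \<phi> assume \<phi>: "test_fun (cell C) \<phi>"
    obtain S where S: "compact S" "S \<subseteq> cell C" "\<And>x. x \<notin> S \<Longrightarrow> \<phi> x = 0" "\<And>x. x \<notin> S \<Longrightarrow> grad \<phi> x = 0"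
      using test_fun_support[OF \<phi>] by metis
    have z: "\<phi> x = 0" "grad \<phi> x = 0" if "x \<notin> cell C" for x using S(2-4) that by blast+
    have \<phi>\<Omega>: "test_fun \<Omega> \<phi>" by (rule test_fun_mono[OF \<phi> interior_subset_domain[OF C]])
    note t = test_sqi[OF domain \<phi>\<Omega>]
    have "ip (lebesgue_on (cell C)) d \<phi> = ip M d \<phi>"
      unfolding ip_def by (rule integral_single_cell[symmetric, OF sqi_integrable_ip[OF s(2) t(1)] C]) (simp add: z)
    also have "\<dots> = - ip M \<tau> (grad \<phi>)" using d \<phi>\<Omega> by (simp add: weak_div_iff)
    also have "ip M \<tau> (grad \<phi>) = ip (lebesgue_on (cell C)) \<tau> (grad \<phi>)"
      unfolding ip_def by (rule integral_single_cell[OF sqi_integrable_ip[OF s(1) t(2)] C]) (simp add: z)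
    also have "\<dots> = (\<integral>x. (a C + b C *\<^sub>R x) \<bullet> grad \<phi> x \<partial>lebesgue_on (cell C))"
      unfolding ip_def by (rule Bochner_Integration.integral_cong) (use \<tau> C in auto)
    also have "\<dots> = - ip (lebesgue_on (cell C)) (\<lambda>x. ?c C) \<phi>"
      unfolding RT0_cell_parts[OF C \<phi>] ip_def by simp
    finally show "ip (lebesgue_on (cell C)) (\<lambda>x. d x - ?c C) \<phi> = 0"
      using ip_diff_left[OF ds cq test_fun_sqi(1)[OF cell_sets \<phi>]] by simp
  qed
  have "AE x in lebesgue. \<forall>C\<in>\<V>. x \<in> cell C \<longrightarrow> d x = p x"
  proof (rule AE_finite_allI[OF finite_mesh])
    fix C assume C: "C \<in> \<V>"
    have "AE x in lebesgue. x \<in> cell C \<longrightarrow> d x - ?c C = 0"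
      using AEC[OF C] nsimplex.cell_sets[OF simplices[OF C]] by (simp add: AE_restrict_space_iff)
    then show "AE x in lebesgue. x \<in> cell C \<longrightarrow> d x = p x" by (rule AE_mp) (use p[OF C] in auto)
  qed
  then have "AE x in M. \<forall>C\<in>\<V>. x \<in> cell C \<longrightarrow> d x = p x"
    using domain_measurable(1) by (auto simp: AE_restrict_space_iff elim: AE_mp)
  then have "AE x in M. d x = p x" using AE_cells by eventually_elim blast
  then have "has_weak_div \<Omega> \<tau> p" by (rule weak_div_AE[OF d])
  moreover have "p \<in> P0 \<T>" unfolding P0_iff using p by (intro exI[of _ ?c]) simp
  ultimately show ?thesis by (intro that)
qed

end

section \<open>Divergence-free fields; existence and uniqueness of the discrete solution\<close>

context regular_mesh
begin

definition div_free :: "('a \<Rightarrow> 'a) set" where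
  "div_free = {\<tau> \<in> RT0 \<Omega> \<T>. has_weak_div \<Omega> \<tau> (\<lambda>x. 0)}"

lemma div_free_sqi: "z \<in> div_free \<Longrightarrow> sqi M z"
  by (simp add: div_free_def RT0_sqi)

lemma div_free_lincomb:
  assumes "\<sigma> \<in> div_free" "\<tau> \<in> div_free"
  shows "(\<lambda>x. a *\<^sub>R \<sigma> x + b *\<^sub>R \<tau> x) \<in> div_free"
proof -
  have "has_weak_div \<Omega> \<sigma> (\<lambda>x. 0)" "has_weak_div \<Omega> \<tau> (\<lambda>x. 0)" using assms by (simp_all add: div_free_def)
  from weak_div_lincomb[OF this, of a b] have "has_weak_div \<Omega> (\<lambda>x. a *\<^sub>R \<sigma> x + b *\<^sub>R \<tau> x) (\<lambda>x. 0)" by simp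
  then show ?thesis using RT0_lincomb[of \<sigma> \<tau> a b] assms by (simp add: div_free_def)
qed

lemma RT0_div_sum:
  assumes "finite I" "\<And>i. i \<in> I \<Longrightarrow> t i \<in> RT0 \<Omega> \<T> \<and> has_weak_div \<Omega> (t i) (d i)"
  shows "(\<lambda>x. \<Sum>i\<in>I. c i *\<^sub>R t i x) \<in> RT0 \<Omega> \<T> \<and> has_weak_div \<Omega> (\<lambda>x. \<Sum>i\<in>I. c i *\<^sub>R t i x) (\<lambda>x. \<Sum>i\<in>I. c i * d i x)"
  using assms
proof (induction I rule: finite_induct)
  case empty
  have "sqi M (\<lambda>x. 0 :: 'a)" "sqi M (\<lambda>x. 0 :: real)" by (rule sqi_zero)+
  then have "has_weak_div \<Omega> (\<lambda>x. 0) (\<lambda>x. 0)" by (simp add: weak_div_iff ip_def)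
  moreover have "\<exists>a b. \<forall>C\<in>\<V>. \<forall>x\<in>cell C. (0 :: 'a) = a C + b C *\<^sub>R x"
    by (intro exI[of _ "\<lambda>C. 0"]) simp
  ultimately show ?case unfolding RT0_iff by (simp only: sum.empty) blast
next
  case (insert i I)
  have i: "t i \<in> RT0 \<Omega> \<T>" "has_weak_div \<Omega> (t i) (d i)" using insert.prems by blast+
  have I: "(\<lambda>x. \<Sum>i\<in>I. c i *\<^sub>R t i x) \<in> RT0 \<Omega> \<T>"
    "has_weak_div \<Omega> (\<lambda>x. \<Sum>i\<in>I. c i *\<^sub>R t i x) (\<lambda>x. \<Sum>i\<in>I. c i * d i x)"
    using insert.IH insert.prems by blast+
  from RT0_lincomb[OF i(1) I(1), of "c i" 1] weak_div_lincomb[OF i(2) I(2), of "c i" 1]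
  show ?case by (simp add: insert.hyps)
qed

lemma div_free_sum:
  assumes "finite I" "\<And>i. i \<in> I \<Longrightarrow> t i \<in> div_free"
  shows "(\<lambda>x. \<Sum>i\<in>I. c i *\<^sub>R t i x) \<in> div_free"
  using RT0_div_sum[of I t "\<lambda>i x. 0" c] assms by (simp add: div_free_def)

text \<open>A field is encoded by finitely many coefficients: index \<open>(C, i)\<close> holds a
  component of the constant part and \<open>(C, 0)\<close> the factor of x, as 0 is no basis vector.
  Coefficients determine the field on the cells, hence almost everywhere.\<close>

lemma div_free_span:
  obtains S :: "('a set \<times> 'a \<Rightarrow> real) set" and t where "finite S" "\<forall>s\<in>S. t s \<in> div_free"
    "\<forall>z\<in>div_free. \<exists>c. AE x in M. z x = (\<Sum>s\<in>S. c s *\<^sub>R t s x)"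
proof -
  define I where "I = \<V> \<times> insert 0 (Basis :: 'a set)"
  define rep where "rep f C x = (\<Sum>i\<in>Basis. f (C, i) *\<^sub>R i) + f (C, 0) *\<^sub>R x" for f :: "'a set \<times> 'a \<Rightarrow> real" and C x
  define Z where "Z = {f. \<exists>\<tau>\<in>div_free. \<forall>C\<in>\<V>. \<forall>x\<in>cell C. \<tau> x = rep f C x}"
  have fI: "finite I" using finite_mesh by (simp add: I_def)
  have Z: "(\<lambda>i. a * f i + b * g i) \<in> Z" if fg: "f \<in> Z" "g \<in> Z" for f g a b
  proof -
    obtain \<sigma> \<tau> where s: "\<sigma> \<in> div_free" "\<forall>C\<in>\<V>. \<forall>x\<in>cell C. \<sigma> x = rep f C x"
      and t: "\<tau> \<in> div_free" "\<forall>C\<in>\<V>. \<forall>x\<in>cell C. \<tau> x = rep g C x"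
      using fg unfolding Z_def by fast
    have "rep (\<lambda>i. a * f i + b * g i) C x = a *\<^sub>R rep f C x + b *\<^sub>R rep g C x" for C x
      by (simp add: rep_def scaleR_add_left scaleR_add_right sum.distrib scaleR_sum_right)
    then have "\<forall>C\<in>\<V>. \<forall>x\<in>cell C. a *\<^sub>R \<sigma> x + b *\<^sub>R \<tau> x = rep (\<lambda>i. a * f i + b * g i) C x"
      using s(2) t(2) by simp
    then show ?thesis unfolding Z_def by (intro CollectI bexI[OF _ div_free_lincomb[OF s(1) t(1)]])
  qed
  have "\<exists>S. finite S \<and> S \<subseteq> Z \<and> (\<forall>z\<in>Z. \<exists>c. \<forall>i\<in>I. z i = (\<Sum>s\<in>S. c s * s i))"
    by (rule subspace_finite_span[OF fI Z])
  then obtain S where S: "finite S" "S \<subseteq> Z" "\<forall>z\<in>Z. \<exists>c. \<forall>i\<in>I. z i = (\<Sum>s\<in>S. c s * s i)"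
    by (elim exE conjE) (rule that)
  have "\<forall>s\<in>S. \<exists>\<tau>. \<tau> \<in> div_free \<and> (\<forall>C\<in>\<V>. \<forall>x\<in>cell C. \<tau> x = rep s C x)"
    using S(2) unfolding Z_def by fast
  then have "\<exists>t. \<forall>s\<in>S. t s \<in> div_free \<and> (\<forall>C\<in>\<V>. \<forall>x\<in>cell C. t s x = rep s C x)" by (rule bchoice)
  then obtain t where t: "\<forall>s\<in>S. t s \<in> div_free \<and> (\<forall>C\<in>\<V>. \<forall>x\<in>cell C. t s x = rep s C x)" ..
  have "\<exists>c. AE x in M. z x = (\<Sum>s\<in>S. c s *\<^sub>R t s x)" if z: "z \<in> div_free" for z
  proof -
    obtain a b where ab: "\<forall>C\<in>\<V>. \<forall>x\<in>cell C. z x = a C + b C *\<^sub>R x"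
      using z unfolding div_free_def RT0_iff by fast
    define f where "f Ci = (if snd Ci = 0 then b (fst Ci) else a (fst Ci) \<bullet> snd Ci)" for Ci :: "'a set \<times> 'a"
    have nz: "i \<noteq> 0" if "i \<in> Basis" for i :: 'a using that by auto
    have "(\<Sum>i\<in>Basis. f (C, i) *\<^sub>R i) = (\<Sum>i\<in>Basis. (a C \<bullet> i) *\<^sub>R i)" for C
      by (rule sum.cong[OF refl]) (simp add: f_def nz)
    then have rf: "rep f C x = a C + b C *\<^sub>R x" for C x
      by (simp add: rep_def euclidean_representation) (simp add: f_def)
    then have "f \<in> Z" unfolding Z_def using z ab by (intro CollectI bexI[of _ z]) auto
    then obtain c where c: "\<forall>i\<in>I. f i = (\<Sum>s\<in>S. c s * s i)" using S(3) by fast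
    have "z x = (\<Sum>s\<in>S. c s *\<^sub>R t s x)" if C: "C \<in> \<V>" "x \<in> cell C" for C x
    proof -
      have fi: "f (C, i) = (\<Sum>s\<in>S. c s * s (C, i))" if "i \<in> insert 0 Basis" for i
        by (rule bspec[OF c]) (use C that in \<open>simp only: I_def mem_Sigma_iff\<close>)
      have "z x = rep f C x" using ab C rf by simp
      also have "\<dots> = (\<Sum>i\<in>Basis. (\<Sum>s\<in>S. c s * s (C, i)) *\<^sub>R i) + (\<Sum>s\<in>S. c s * s (C, 0)) *\<^sub>R x"
        unfolding rep_def by (simp only: fi insertI1 insertI2 cong: sum.cong)
      also have "(\<Sum>i\<in>Basis. (\<Sum>s\<in>S. c s * s (C, i)) *\<^sub>R i) = (\<Sum>s\<in>S. \<Sum>i\<in>Basis. (c s * s (C, i)) *\<^sub>R i)"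
        unfolding scaleR_sum_left by (rule sum.swap)
      also have "\<dots> + (\<Sum>s\<in>S. c s * s (C, 0)) *\<^sub>R x = (\<Sum>s\<in>S. c s *\<^sub>R rep s C x)"
        by (simp add: rep_def scaleR_add_right sum.distrib scaleR_sum_right scaleR_sum_left)
      also have "\<dots> = (\<Sum>s\<in>S. c s *\<^sub>R t s x)" by (rule sum.cong[OF refl]) (use t C in simp)
      finally show ?thesis .
    qed
    then have "AE x in M. z x = (\<Sum>s\<in>S. c s *\<^sub>R t s x)" using AE_cells by (auto elim: AE_mp)
    then show ?thesis by (rule exI[of _ c])
  qed
  moreover have "t s \<in> div_free" if "s \<in> S" for s using t that by blast
  ultimately show ?thesis using S(1) by (intro that[of S t]) blast+
qed

text \<open>The normal equations for a generating system. Their Gram matrix may be singular; the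
  compatibility condition of \<open>psd_system_solvable\<close> follows from
  Cauchy--Schwarz.\<close>

lemma div_free_projection:
  fixes \<sigma> :: "'a \<Rightarrow> 'a"
  assumes \<sigma>: "sqi M \<sigma>"
  obtains \<zeta> where "\<zeta> \<in> div_free" "\<And>z. z \<in> div_free \<Longrightarrow> ip M \<zeta> z = ip M \<sigma> z"
proof -
  obtain S :: "('a set \<times> 'a \<Rightarrow> real) set" and t where S: "finite S" "\<forall>s\<in>S. t s \<in> div_free"
    "\<forall>z\<in>div_free. \<exists>c. AE x in M. z x = (\<Sum>s\<in>S. c s *\<^sub>R t s x)" by (rule div_free_span)
  define w where "w d x = (\<Sum>s\<in>S. d s *\<^sub>R t s x)" for d x
  have ts: "sqi M (t s)" if "s \<in> S" for s by (rule div_free_sqi[OF bspec[OF S(2) that]])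
  have ws: "sqi M (w d)" for d unfolding w_def by (intro sqi_sum sqi_scaleR ts)
  have ipw: "ip M (w d) h = (\<Sum>s\<in>S. d s * ip M (t s) h)" if "sqi M h" for d h
    unfolding w_def by (subst ip_sum_left) (simp_all add: that sqi_scaleR ts ip_scaleR_left)
  have quad: "(\<Sum>i\<in>S. \<Sum>j\<in>S. d i * d j * ip M (t i) (t j)) = ip M (w d) (w d)" for d
    unfolding ipw[OF ws]
  proof (rule sum.cong[OF refl])
    fix i assume i: "i \<in> S"
    have "ip M (t i) (w d) = (\<Sum>j\<in>S. d j * ip M (t i) (t j))"
      unfolding ip_commute[of M "t i"] by (rule ipw[OF ts[OF i]])
    then show "(\<Sum>j\<in>S. d i * d j * ip M (t i) (t j)) = d i * ip M (t i) (w d)"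
      by (simp only: sum_distrib_left mult.assoc)
  qed
  have "\<exists>c. \<forall>i\<in>S. (\<Sum>j\<in>S. ip M (t i) (t j) * c j) = ip M (t i) \<sigma>"
  proof (rule psd_system_solvable[OF S(1) ip_commute])
    fix d
    show "0 \<le> (\<Sum>i\<in>S. \<Sum>j\<in>S. d i * d j * ip M (t i) (t j))" unfolding quad nrm_power2[symmetric] by simp
    assume "(\<Sum>i\<in>S. \<Sum>j\<in>S. d i * d j * ip M (t i) (t j)) = 0"
    then have "nrm M (w d) = 0" unfolding quad nrm_power2[symmetric] by simp
    then have "ip M (w d) \<sigma> = 0" using ip_cauchy_schwarz[OF ws[of d] \<sigma>] by simp
    then show "(\<Sum>i\<in>S. d i * ip M (t i) \<sigma>) = 0" unfolding ipw[OF \<sigma>] .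
  qed
  then obtain c where c: "\<forall>i\<in>S. (\<Sum>j\<in>S. ip M (t i) (t j) * c j) = ip M (t i) \<sigma>" by metis
  have "w c \<in> div_free" unfolding w_def by (rule div_free_sum[OF S(1) bspec[OF S(2)]])
  moreover have "ip M (w c) z = ip M \<sigma> z" if z: "z \<in> div_free" for z
  proof -
    obtain d where d: "AE x in M. z x = w d x" using bspec[OF S(3) z] unfolding w_def[symmetric] ..
    note zs = div_free_sqi[OF z]
    have eq: "ip M h z = ip M h (w d)" if "sqi M h" for h
      by (rule ip_cong_AE) (use that zs ws d in \<open>auto simp: sqi_def\<close>)
    have "ip M (w d) (w c) = (\<Sum>s\<in>S. d s * ip M (t s) \<sigma>)"
      unfolding ipw[OF ws]
    proof (rule sum.cong[OF refl])
      fix s assume s: "s \<in> S"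
      have "ip M (t s) (w c) = (\<Sum>j\<in>S. ip M (t s) (t j) * c j)"
        unfolding ip_commute[of M "t s"] ipw[OF ts[OF s]] by (simp add: mult.commute)
      then show "d s * ip M (t s) (w c) = d s * ip M (t s) \<sigma>" using c s by simp
    qed
    also have "\<dots> = ip M (w d) \<sigma>" by (simp only: ipw[OF \<sigma>])
    finally show ?thesis unfolding eq[OF ws] eq[OF \<sigma>] by (simp only: ip_commute)
  qed
  ultimately show ?thesis by (rule that)
qed

definition K\<^sub>4 :: real where "K\<^sub>4 = sqrt (2 * (K\<^sub>3 + B\<^sup>2))"

lemma K\<^sub>3_nonneg: "0 \<le> K\<^sub>3"
  using c\<^sub>g_ge_1 \<kappa>_pos by (simp add: K\<^sub>3_def K\<^sub>2_def)

lemma K\<^sub>4_nonneg: "0 \<le> K\<^sub>4"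
  by (simp add: K\<^sub>4_def K\<^sub>3_nonneg)

lemma P0_lifting:
  assumes p: "p \<in> P0 \<T>"
  obtains \<rho> where "\<rho> \<in> RT0 \<Omega> \<T>" "has_weak_div \<Omega> \<rho> p" "nrm M \<rho> \<le> K\<^sub>4 * dual_norm \<Omega> (emb \<Omega> p)"
proof -
  obtain q where q: "\<forall>C\<in>\<V>. \<forall>x\<in>cell C. p x = q C" using p unfolding P0_iff by metis
  have q': "p x = q C" if "C \<in> \<V>" "x \<in> cell C" for C x using q that by simp
  obtain \<rho> where \<rho>: "\<forall>C\<in>\<V>. \<exists>a b. \<forall>x\<in>cell C. \<rho> x = a + b *\<^sub>R x" "has_weak_div \<Omega> \<rho> p"
    "(nrm M \<rho>)\<^sup>2 \<le> 2 * (K\<^sub>3 + B\<^sup>2) * (dual_norm \<Omega> (emb \<Omega> p))\<^sup>2" by (rule lifting[OF q'])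
  have "\<rho> \<in> RT0 \<Omega> \<T>" using \<rho>(1,2) by (auto simp: RT0_def)
  moreover have "nrm M \<rho> \<le> K\<^sub>4 * dual_norm \<Omega> (emb \<Omega> p)"
  proof (rule power2_le_imp_le)
    show "(nrm M \<rho>)\<^sup>2 \<le> (K\<^sub>4 * dual_norm \<Omega> (emb \<Omega> p))\<^sup>2" using \<rho>(3) K\<^sub>3_nonneg by (simp add: K\<^sub>4_def power_mult_distrib)
    show "0 \<le> K\<^sub>4 * dual_norm \<Omega> (emb \<Omega> p)"
      using K\<^sub>4_nonneg dual_norm_nonneg[OF domain emb_Hm1[OF domain P0_sqi[OF p]]] by simp
  qed
  ultimately show ?thesis using \<rho>(2) that by blast
qed

text \<open>The discrete system with its second equation resolved: the divergence of \<sigma> is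
  prescribed instead of tested, and the choice in \<open>wdiv\<close> gives way to a quantifier over
  all weak divergences.\<close>

definition mixed_pair :: "('a \<Rightarrow> real) \<Rightarrow> ('a \<Rightarrow> real) \<Rightarrow> ('a \<Rightarrow> 'a) \<Rightarrow> bool" where
  "mixed_pair g u \<sigma> \<longleftrightarrow> u \<in> P0 \<T> \<and> \<sigma> \<in> RT0 \<Omega> \<T> \<and> has_weak_div \<Omega> \<sigma> g \<and>
     (\<forall>\<tau>\<in>RT0 \<Omega> \<T>. \<forall>p. has_weak_div \<Omega> \<tau> p \<longrightarrow> ip M \<sigma> \<tau> + ip M u p = 0)"

lemma mixed_pairD:
  assumes "mixed_pair g u \<sigma>"
  shows "u \<in> P0 \<T>" "\<sigma> \<in> RT0 \<Omega> \<T>" "has_weak_div \<Omega> \<sigma> g"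
    and "\<tau> \<in> RT0 \<Omega> \<T> \<Longrightarrow> has_weak_div \<Omega> \<tau> p \<Longrightarrow> ip M \<sigma> \<tau> + ip M u p = 0"
  using assms by (simp_all add: mixed_pair_def)

text \<open>The difference of the fluxes is divergence-free and orthogonal to itself; a lifting of
  the difference of the potentials then tests that difference with itself.\<close>

lemma mixed_pair_unique:
  assumes 1: "mixed_pair g u \<sigma>" and 2: "mixed_pair g u' \<sigma>'"
  shows "AE x in M. u x = u' x" "AE x in M. \<sigma> x = \<sigma>' x"
proof -
  note D1 = mixed_pairD[OF 1] and D2 = mixed_pairD[OF 2]
  note s = RT0_sqi[OF D1(2)] RT0_sqi[OF D2(2)] P0_sqi[OF D1(1)] P0_sqi[OF D2(1)]
  define \<delta> where "\<delta> x = \<sigma> x - \<sigma>' x" for x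
  define e where "e x = u x - u' x" for x
  have \<delta>: "\<delta> \<in> RT0 \<Omega> \<T>" "has_weak_div \<Omega> \<delta> (\<lambda>x. 0)"
    using RT0_lincomb[OF D1(2) D2(2), of 1 "-1"] weak_div_lincomb[OF D1(3) D2(3), of 1 "-1"]
    by (simp_all add: \<delta>_def[abs_def])
  have e: "e \<in> P0 \<T>" using P0_lincomb[OF D1(1) D2(1), of 1 "-1"] by (simp add: e_def[abs_def])
  have \<delta>s: "sqi M \<delta>" by (rule RT0_sqi[OF \<delta>(1)])
  have es: "sqi M e" by (rule P0_sqi[OF e])
  have ip\<delta>: "ip M \<delta> h = ip M \<sigma> h - ip M \<sigma>' h" if "sqi M h" for h
    using ip_diff_left[OF s(1,2) that] by (simp add: \<delta>_def[abs_def])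
  have ipe: "ip M e h = ip M u h - ip M u' h" if "sqi M h" for h
    using ip_diff_left[OF s(3,4) that] by (simp add: e_def[abs_def])
  have "ip M \<delta> \<delta> = 0" using D1(4)[OF \<delta>] D2(4)[OF \<delta>] ip\<delta>[OF \<delta>s] by (simp add: ip_def)
  then have n\<delta>: "nrm M \<delta> = 0" using nrm_power2[of M \<delta>] by simp
  show "AE x in M. \<sigma> x = \<sigma>' x" using nrm_eq_0_AE[OF \<delta>s n\<delta>] by (simp add: \<delta>_def)
  obtain \<rho> where \<rho>: "\<rho> \<in> RT0 \<Omega> \<T>" "has_weak_div \<Omega> \<rho> e" using P0_lifting[OF e] by metis
  note \<rho>s = RT0_sqi[OF \<rho>(1)]
  have "ip M \<delta> \<rho> = 0" using ip_cauchy_schwarz[OF \<delta>s \<rho>s] n\<delta> by simp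
  then have "ip M e e = 0" using D1(4)[OF \<rho>] D2(4)[OF \<rho>] ip\<delta>[OF \<rho>s] ipe[OF es] by simp
  then have "nrm M e = 0" using nrm_power2[of M e] by simp
  then show "AE x in M. u x = u' x" using nrm_eq_0_AE[OF es] by (simp add: e_def)
qed

text \<open>The flux is a lifting of \<open>g\<close> minus its projection onto the divergence-free
  fields. Being orthogonal to these, it pairs with \<tau> in a way that depends only on the
  divergence of \<tau>, so the potential can be read off from liftings of the cell
  indicators.\<close>

lemma mixed_pair_exists:
  assumes g: "g \<in> P0 \<T>"
  obtains u \<sigma> where "mixed_pair g u \<sigma>"
proof -
  obtain \<rho> where \<rho>: "\<rho> \<in> RT0 \<Omega> \<T>" "has_weak_div \<Omega> \<rho> g" using P0_lifting[OF g] by metis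
  obtain \<zeta> where \<zeta>: "\<zeta> \<in> div_free" "\<And>z. z \<in> div_free \<Longrightarrow> ip M \<zeta> z = ip M \<rho> z"
    using div_free_projection[OF RT0_sqi[OF \<rho>(1)]] by metis
  have \<zeta>': "\<zeta> \<in> RT0 \<Omega> \<T>" "has_weak_div \<Omega> \<zeta> (\<lambda>x. 0)" using \<zeta>(1) by (simp_all add: div_free_def)
  define \<sigma> where "\<sigma> x = \<rho> x - \<zeta> x" for x
  have \<sigma>: "\<sigma> \<in> RT0 \<Omega> \<T>" "has_weak_div \<Omega> \<sigma> g"
    using RT0_lincomb[OF \<rho>(1) \<zeta>'(1), of 1 "-1"] weak_div_lincomb[OF \<rho>(2) \<zeta>'(2), of 1 "-1"]
    by (simp_all add: \<sigma>_def[abs_def])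
  note \<sigma>s = RT0_sqi[OF \<sigma>(1)]
  have orth: "ip M \<sigma> z = 0" if "z \<in> div_free" for z
    using ip_diff_left[OF RT0_sqi[OF \<rho>(1)] RT0_sqi[OF \<zeta>'(1)] div_free_sqi[OF that]] \<zeta>(2)[OF that]
    by (simp add: \<sigma>_def[abs_def])
  define \<eta> where "\<eta> C = on_cells (\<lambda>D x. of_bool (D = C) :: real)" for C
  have \<eta>: "\<eta> C x = of_bool (D = C)" if "D \<in> \<V>" "x \<in> cell D" for C D x
    unfolding \<eta>_def by (rule on_cells_eq[OF that])
  have "\<eta> C \<in> P0 \<T>" for C unfolding P0_iff by (rule exI[of _ "\<lambda>D. of_bool (D = C)"]) (simp add: \<eta>)
  then have "\<exists>t. t \<in> RT0 \<Omega> \<T> \<and> has_weak_div \<Omega> t (\<eta> C)" for C using P0_lifting[of "\<eta> C"] by metis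
  then obtain t where t': "\<forall>C. t C \<in> RT0 \<Omega> \<T> \<and> has_weak_div \<Omega> (t C) (\<eta> C)"
    using choice[of "\<lambda>C t. t \<in> RT0 \<Omega> \<T> \<and> has_weak_div \<Omega> t (\<eta> C)"] by auto
  then have t: "t C \<in> RT0 \<Omega> \<T>" "has_weak_div \<Omega> (t C) (\<eta> C)" for C by simp_all
  \<comment> \<open>The value for which the first equation holds with the lifting \<open>t C\<close>
    of the indicator of \<open>C\<close>.\<close>
  define m where "m C = - ip M \<sigma> (t C) / vol C" for C
  define u where "u = on_cells (\<lambda>C x. m C)"
  have u: "u x = m C" if "C \<in> \<V>" "x \<in> cell C" for C x unfolding u_def by (rule on_cells_eq[OF that])
  have uP: "u \<in> P0 \<T>" unfolding P0_iff using u by (intro exI[of _ m]) simp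
  have iu: "integral\<^sup>L (lebesgue_on (cell C)) u = - ip M \<sigma> (t C)" if C: "C \<in> \<V>" for C
  proof -
    interpret nsimplex C using simplices C by blast
    have "integral\<^sup>L (lebesgue_on (cell C)) u = integral\<^sup>L (lebesgue_on (cell C)) (\<lambda>x. m C)"
      by (rule Bochner_Integration.integral_cong) (use u C in auto)
    also have "\<dots> = vol C * m C"
      using measure_cell cell_sets by (simp add: measure_restrict_space)
    finally show ?thesis using measure_hull_pos by (simp add: m_def)
  qed
  have "ip M \<sigma> \<tau> + ip M u p = 0" if \<tau>: "\<tau> \<in> RT0 \<Omega> \<T>" "has_weak_div \<Omega> \<tau> p" for \<tau> p
  proof -
    note \<tau>s = RT0_sqi[OF \<tau>(1)]
    obtain p' where p': "p' \<in> P0 \<T>" "has_weak_div \<Omega> \<tau> p'" using RT0_div_P0[OF \<tau>(1)] by metis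
    obtain q where q: "\<forall>C\<in>\<V>. \<forall>x\<in>cell C. p' x = q C" using p'(1) unfolding P0_iff by metis
    have q': "p' x = q C" if "C \<in> \<V>" "x \<in> cell C" for C x using q that by simp
    define w where "w x = (\<Sum>C\<in>\<V>. q C *\<^sub>R t C x)" for x
    have w: "w \<in> RT0 \<Omega> \<T>" "has_weak_div \<Omega> w (\<lambda>x. \<Sum>C\<in>\<V>. q C * \<eta> C x)"
      using RT0_div_sum[of \<V> t \<eta> q] t finite_mesh by (simp_all add: w_def[abs_def])
    note ws = RT0_sqi[OF w(1)]
    have "(\<Sum>C\<in>\<V>. q C * \<eta> C x) = p' x" if D: "D \<in> \<V>" "x \<in> cell D" for D x
    proof -
      have "(\<Sum>C\<in>\<V>. q C * \<eta> C x) = (\<Sum>C\<in>\<V>. if D = C then q C else 0)"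
        by (rule sum.cong[OF refl]) (simp add: \<eta>[OF D])
      then show ?thesis using q'[OF D] D(1) finite_mesh by simp
    qed
    then have "AE x in M. (\<Sum>C\<in>\<V>. q C * \<eta> C x) = p' x" using AE_cells by (auto elim: AE_mp)
    note w' = weak_div_AE[OF w(2) this]
    have "(\<lambda>x. \<tau> x - w x) \<in> div_free"
      using RT0_lincomb[OF \<tau>(1) w(1), of 1 "-1"] weak_div_lincomb[OF p'(2) w', of 1 "-1"]
      by (simp add: div_free_def)
    from orth[OF this] have "ip M \<sigma> \<tau> = ip M \<sigma> w" using ip_diff_right[OF \<tau>s ws \<sigma>s] by simp
    also have "\<dots> = (\<Sum>C\<in>\<V>. q C * ip M (t C) \<sigma>)"
      unfolding ip_commute[of M \<sigma> w] w_def
      by (subst ip_sum_left) (simp_all add: \<sigma>s sqi_scaleR RT0_sqi t(1) ip_scaleR_left)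
    also have "\<dots> = - (\<Sum>C\<in>\<V>. q C * integral\<^sup>L (lebesgue_on (cell C)) u)"
      unfolding sum_negf[symmetric] by (rule sum.cong[OF refl]) (simp add: iu ip_commute)
    also have "\<dots> = - ip M p' u" by (simp only: integral_piecewise(2)[where p = p' and q = q, OF q' P0_sqi[OF uP]])
    also have "ip M p' u = ip M u p"
      unfolding ip_commute[of M p' u]
      by (rule ip_cong_AE)
        (use weak_div_unique[OF domain p'(2) \<tau>(2)] P0_sqi[OF uP] weak_div_sqi(2)[OF p'(2)] weak_div_sqi(2)[OF \<tau>(2)] in \<open>auto simp: sqi_def\<close>)
    finally show ?thesis by simp
  qed
  then have "mixed_pair g u \<sigma>" using uP \<sigma> by (simp add: mixed_pair_def)
  then show ?thesis by (rule that)
qed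

end

section \<open>Error estimates and quasi-optimality\<close>

lemma weak_solution_H10g:
  assumes op: "open \<Omega>" and bd: "bounded \<Omega>" and u: "weak_solution \<Omega> f u" "has_weak_grad \<Omega> u \<sigma>"
  shows "H10g \<Omega> u \<sigma>"
    and "H10g \<Omega> v g \<Longrightarrow> ip (lebesgue_on \<Omega>) \<sigma> g = f v"
proof -
  note S = domain_sets[OF op bd]
  have meas: "h \<in> borel_measurable (lebesgue_on \<Omega>)" if "has_weak_grad \<Omega> w h" for w and h :: "'a \<Rightarrow> 'a"
    using that by (auto simp: has_weak_grad_iff[OF op bd] sqi_def)
  have "u \<in> H10 \<Omega>" using u(1) by (simp add: weak_solution_def)
  then obtain h where h: "H10g \<Omega> u h" unfolding H10_iff ..
  note hg = H10g_weak_grad[OF op bd h]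
  obtain \<phi> :: "nat \<Rightarrow> 'a \<Rightarrow> real" where \<phi>: "\<forall>k. test_fun \<Omega> (\<phi> k)"
    "(\<lambda>k. nrm (lebesgue_on \<Omega>) (\<lambda>x. \<phi> k x - u x)) \<longlonglongrightarrow> 0"
    "(\<lambda>k. nrm (lebesgue_on \<Omega>) (\<lambda>x. grad (\<phi> k) x - h x)) \<longlonglongrightarrow> 0"
    by (rule H10g_approx[OF op bd h])
  have \<phi>t: "test_fun \<Omega> (\<phi> k)" for k using \<phi>(1) ..
  have "nrm (lebesgue_on \<Omega>) (\<lambda>x. grad (\<phi> k) x - h x) = nrm (lebesgue_on \<Omega>) (\<lambda>x. grad (\<phi> k) x - \<sigma> x)" for k
  proof (rule nrm_cong_AE)
    have [measurable]: "grad (\<phi> k) \<in> borel_measurable (lebesgue_on \<Omega>)"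
      using test_sqi(2)[OF op bd \<phi>t] by (rule sqi_measurable)
    show "(\<lambda>x. grad (\<phi> k) x - h x) \<in> borel_measurable (lebesgue_on \<Omega>)"
      "(\<lambda>x. grad (\<phi> k) x - \<sigma> x) \<in> borel_measurable (lebesgue_on \<Omega>)"
      using meas[OF hg] meas[OF u(2)] by measurable
    show "AE x in lebesgue_on \<Omega>. grad (\<phi> k) x - h x = grad (\<phi> k) x - \<sigma> x"
      using weak_grad_unique[OF op bd hg u(2)] by eventually_elim simp
  qed
  then have "(\<lambda>k. nrm (lebesgue_on \<Omega>) (\<lambda>x. grad (\<phi> k) x - \<sigma> x)) \<longlonglongrightarrow> 0" using \<phi>(3) by simp
  moreover have "sqi (lebesgue_on \<Omega>) u" "sqi (lebesgue_on \<Omega>) \<sigma>"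
    using u(2) by (simp_all add: has_weak_grad_iff[OF op bd])
  ultimately show "H10g \<Omega> u \<sigma>" using H10gI[OF op bd _ _ \<phi>t \<phi>(2)] by simp
  show "ip (lebesgue_on \<Omega>) \<sigma> g = f v" if v: "H10g \<Omega> v g"
  proof -
    note vg = H10g_weak_grad[OF op bd v]
    have "v \<in> H10 \<Omega>" using v by (auto simp: H10_iff)
    then have "f v = L2innerv \<Omega> (wgrad \<Omega> u) (wgrad \<Omega> v)" using u(1) by (simp add: weak_solution_def)
    also have "\<dots> = ip (lebesgue_on \<Omega>) (wgrad \<Omega> u) (wgrad \<Omega> v)" by (rule L2innerv_eq[OF S])
    also have "\<dots> = ip (lebesgue_on \<Omega>) \<sigma> g"
      by (rule ip_cong_AE[OF meas[OF wgrad_eq(1)[OF op bd u(2)]] meas[OF wgrad_eq(1)[OF op bd vg]] meas[OF u(2)] meas[OF vg]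
        wgrad_eq(2)[OF op bd u(2)] wgrad_eq(2)[OF op bd vg]])
    finally show ?thesis by simp
  qed
qed

context regular_mesh
begin

text \<open>The divergence of \<sigma> has a piecewise constant representative \<open>p\<close>, so
  \<open>p + Q f\<close> is an admissible test function; tested with itself it vanishes almost
  everywhere.\<close>

lemma mixed_fem_solution_iff:
  assumes Qf: "Q f \<in> P0 \<T>"
  shows "mixed_fem_solution \<Omega> \<T> Q f u \<sigma> \<longleftrightarrow> mixed_pair (\<lambda>x. - Q f x) u \<sigma>"
proof -
  note S = domain_measurable(1)
  note bm = sqi_measurable[of M]
  have div: "ip M v (wdiv \<Omega> \<tau>) = ip M v p" "ip M (wdiv \<Omega> \<tau>) v = ip M p v"
    if "has_weak_div \<Omega> \<tau> p" "sqi M v" for \<tau> p and v :: "'a \<Rightarrow> real"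
  proof -
    note w = wdiv_eq[OF domain that(1)]
    show "ip M v (wdiv \<Omega> \<tau>) = ip M v p"
      by (rule ip_cong_AE[OF bm[OF that(2)] bm[OF weak_div_sqi(2)[OF w(1)]] bm[OF that(2)] bm[OF weak_div_sqi(2)[OF that(1)]] _ w(2)]) simp
    then show "ip M (wdiv \<Omega> \<tau>) v = ip M p v" by (simp only: ip_commute[of M _ v])
  qed
  show ?thesis
  proof
    assume L: "mixed_fem_solution \<Omega> \<T> Q f u \<sigma>"
    then have u: "u \<in> P0 \<T>" and \<sigma>: "\<sigma> \<in> RT0 \<Omega> \<T>" by (simp_all add: mixed_fem_solution_def)
    obtain p where p: "p \<in> P0 \<T>" "has_weak_div \<Omega> \<sigma> p" using RT0_div_P0[OF \<sigma>] by metis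
    define e where "e x = 1 * p x + 1 * Q f x" for x
    have eP: "e \<in> P0 \<T>" unfolding e_def by (rule P0_lincomb[OF p(1) Qf])
    note es = P0_sqi[OF eP]
    have "ip M (wdiv \<Omega> \<sigma>) e = - ip M (Q f) e"
      using L eP by (simp add: mixed_fem_solution_def L2inner_eq[OF S])
    then have "ip M p e + ip M (Q f) e = 0" unfolding div(2)[OF p(2) es] by simp
    then have "ip M e e = 0" using ip_add_left[OF P0_sqi[OF p(1)] P0_sqi[OF Qf] es] by (simp add: e_def[abs_def])
    then have "nrm M e = 0" using nrm_power2[of M e] by simp
    from nrm_eq_0_AE[OF es this] have "AE x in M. p x = - Q f x"
      by eventually_elim (simp add: e_def)
    then have hd: "has_weak_div \<Omega> \<sigma> (\<lambda>x. - Q f x)" by (rule weak_div_AE[OF p(2)])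
    have "ip M \<sigma> \<tau> + ip M u q = 0" if \<tau>: "\<tau> \<in> RT0 \<Omega> \<T>" "has_weak_div \<Omega> \<tau> q" for \<tau> q
    proof -
      have "ip M \<sigma> \<tau> + ip M u (wdiv \<Omega> \<tau>) = 0"
        using L \<tau>(1) by (simp add: mixed_fem_solution_def L2inner_eq[OF S] L2innerv_eq[OF S])
      then show ?thesis unfolding div(1)[OF \<tau>(2) P0_sqi[OF u]] .
    qed
    then show "mixed_pair (\<lambda>x. - Q f x) u \<sigma>" using u \<sigma> hd by (simp add: mixed_pair_def)
  next
    assume R: "mixed_pair (\<lambda>x. - Q f x) u \<sigma>"
    note D = mixed_pairD[OF R]
    have "ip M \<sigma> \<tau> + ip M u (wdiv \<Omega> \<tau>) = 0" if \<tau>: "\<tau> \<in> RT0 \<Omega> \<T>" for \<tau>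
    proof -
      obtain d where "has_weak_div \<Omega> \<tau> d" using \<tau> by (auto simp: RT0_iff)
      from wdiv_eq(1)[OF domain this] show ?thesis by (rule D(4)[OF \<tau>])
    qed
    moreover have "ip M (wdiv \<Omega> \<sigma>) v = - ip M (Q f) v" if "v \<in> P0 \<T>" for v
      unfolding div(2)[OF D(3) P0_sqi[OF that]] by (simp add: ip_def)
    ultimately show "mixed_fem_solution \<Omega> \<T> Q f u \<sigma>"
      using D(1,2) by (simp add: mixed_fem_solution_def L2inner_eq[OF S] L2innerv_eq[OF S])
  qed
qed

lemma data_perturbation:
  assumes Q: "bounded_projection \<Omega> \<T> CQ Q" and f: "f \<in> Hm1 \<Omega>" and p: "p \<in> P0 \<T>"
    and \<sigma>: "sqi M \<sigma>" "\<And>v g. H10g \<Omega> v g \<Longrightarrow> ip M \<sigma> g = f v" and \<tau>: "has_weak_div \<Omega> \<tau> p"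
  shows "dual_norm \<Omega> (emb \<Omega> (\<lambda>x. - Q f x - p x)) \<le> \<bar>CQ\<bar> * nrm M (\<lambda>x. \<sigma> x - \<tau> x)"
proof -
  note ob = domain
  note ps = P0_sqi[OF p] and \<tau>s = weak_div_sqi(1)[OF \<tau>]
  let ?a = "nrm M (\<lambda>x. \<sigma> x - \<tau> x)"
  \<comment> \<open>Since \<open>p\<close> is the divergence of \<tau>, \<open>F v\<close> is the
    pairing of \<open>\<sigma> - \<tau>\<close> with the gradient of \<open>v\<close>. The factors 1
    match the form of linearity in \<open>bounded_projection\<close>.\<close>
  define F where "F v = 1 * f v + 1 * emb \<Omega> p v" for v
  have ep: "emb \<Omega> p \<in> Hm1 \<Omega>" by (rule emb_Hm1[OF ob ps])
  have Fb: "\<bar>F v\<bar> \<le> ?a * H1norm \<Omega> v" if v: "v \<in> H10 \<Omega>" for v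
  proof -
    obtain g where g: "H10g \<Omega> v g" using v unfolding H10_iff ..
    note gs = H10g_sqi[OF ob g]
    have "F v = ip M \<sigma> g - ip M \<tau> g"
      using \<sigma>(2)[OF g] H10g_weak_div[OF ob g \<tau>] by (simp add: F_def emb_eq[OF domain_measurable(1)])
    also have "\<dots> = ip M (\<lambda>x. \<sigma> x - \<tau> x) g" by (rule ip_diff_left[OF \<sigma>(1) \<tau>s gs(2), symmetric])
    finally show ?thesis
      using ip_cauchy_schwarz[OF sqi_diff[OF \<sigma>(1) \<tau>s] gs(2)]
      unfolding H1norm_eq[OF ob H10g_weak_grad[OF ob g]] by simp
  qed
  have F: "F \<in> Hm1 \<Omega>"
    unfolding Hm1_def
  proof (intro CollectI conjI exI ballI allI)
    fix v w a b assume vw: "v \<in> H10 \<Omega>" "w \<in> H10 \<Omega>"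
    then have "f (\<lambda>x. a * v x + b * w x) = a * f v + b * f w"
      "emb \<Omega> p (\<lambda>x. a * v x + b * w x) = a * emb \<Omega> p v + b * emb \<Omega> p w"
      using f ep by (simp_all add: Hm1_def)
    then show "F (\<lambda>x. a * v x + b * w x) = a * F v + b * F w" by (simp add: F_def algebra_simps)
  next
    fix v assume "v \<in> H10 \<Omega>" then show "\<bar>F v\<bar> \<le> ?a * H1norm \<Omega> v" by (rule Fb)
  qed
  have QF: "Q F \<in> P0 \<T>" "Q f \<in> P0 \<T>" "Q (emb \<Omega> p) \<in> P0 \<T>"
    using Q F f ep by (simp_all add: bounded_projection_def)
  have eq1: "AE x in M. Q F x = 1 * Q f x + 1 * Q (emb \<Omega> p) x"
    using Q f ep unfolding bounded_projection_def ae_eq_iff[OF domain_measurable(1)] F_def[abs_def] by blast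
  have eq2: "AE x in M. Q (emb \<Omega> p) x = p x"
    using Q p by (simp add: bounded_projection_def ae_eq_iff[OF domain_measurable(1)])
  have eq: "AE x in M. - Q f x - p x = - Q F x" using eq1 eq2 by eventually_elim simp
  have QFs: "sqi M (Q F)" by (rule P0_sqi[OF QF(1)])
  have eQ: "emb \<Omega> (Q F) \<in> Hm1 \<Omega>" by (rule emb_Hm1[OF ob QFs])
  have rs: "sqi M (\<lambda>x. - Q f x - p x)" "sqi M (\<lambda>x. - Q F x)"
    using P0_sqi[OF P0_lincomb[OF QF(2) p, of "-1" "-1"]] P0_sqi[OF P0_lincomb[OF QF(1) QF(1), of "-1" 0]] by simp_all
  have "dual_norm \<Omega> (emb \<Omega> (\<lambda>x. - Q f x - p x)) \<le> dual_norm \<Omega> (emb \<Omega> (Q F))"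
  proof (rule dual_norm_le[OF ob _ dual_norm_nonneg[OF ob eQ]])
    fix v assume v: "v \<in> H10 \<Omega>"
    then obtain g where g: "H10g \<Omega> v g" unfolding H10_iff ..
    note vs = sqi_measurable[OF H10g_sqi(1)[OF ob g]]
    have "ip M (\<lambda>x. - Q f x - p x) v = ip M (\<lambda>x. - Q F x) v"
      by (rule ip_cong_AE[OF sqi_measurable[OF rs(1)] vs sqi_measurable[OF rs(2)] vs eq]) simp
    also have "\<dots> = - ip M (Q F) v" by (simp add: ip_def)
    finally have "\<bar>emb \<Omega> (\<lambda>x. - Q f x - p x) v\<bar> = \<bar>emb \<Omega> (Q F) v\<bar>" by (simp add: emb_eq[OF domain_measurable(1)])
    then show "\<bar>emb \<Omega> (\<lambda>x. - Q f x - p x) v\<bar> \<le> dual_norm \<Omega> (emb \<Omega> (Q F)) * H1norm \<Omega> v"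
      using dual_norm_bound[OF ob eQ g] unfolding H1norm_eq[OF ob H10g_weak_grad[OF ob g]] by simp
  qed
  also have "\<dots> \<le> CQ * dual_norm \<Omega> F" using Q F by (simp add: bounded_projection_def)
  \<comment> \<open>\<open>CQ\<close> is an arbitrary real; with its absolute value the final factor
    is nonnegative.\<close>
  also have "\<dots> \<le> \<bar>CQ\<bar> * dual_norm \<Omega> F"
    by (rule mult_right_mono[OF abs_ge_self dual_norm_nonneg[OF ob F]])
  also have "\<dots> \<le> \<bar>CQ\<bar> * ?a"
    by (intro mult_left_mono dual_norm_le[OF ob Fb]) simp_all
  finally show ?thesis .
qed

text \<open>The discrete error splits as \<open>\<sigma>\<^sub>h - \<tau> = z + \<rho>\<close> with
  a divergence-free \<open>z\<close>. Orthogonality bounds the norm of \<open>z\<close> by those of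
  \<open>\<sigma> - \<tau>\<close> and \<rho> together; the triangle inequality adds each of the two
  once more, whence the factors 2.\<close>

lemma flux_estimate:
  assumes Q: "bounded_projection \<Omega> \<T> CQ Q" and f: "f \<in> Hm1 \<Omega>"
    and u: "H10g \<Omega> u \<sigma>" "\<And>v g. H10g \<Omega> v g \<Longrightarrow> ip M \<sigma> g = f v"
    and s: "mixed_pair (\<lambda>x. - Q f x) u\<^sub>h \<sigma>\<^sub>h" and \<tau>: "\<tau> \<in> RT0 \<Omega> \<T>"
  shows "nrm M (\<lambda>x. \<sigma> x - \<sigma>\<^sub>h x) \<le> (2 + 2 * K\<^sub>4 * \<bar>CQ\<bar>) * nrm M (\<lambda>x. \<sigma> x - \<tau> x)"
proof -
  note ob = domain
  note D = mixed_pairD[OF s]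
  obtain p where p: "p \<in> P0 \<T>" "has_weak_div \<Omega> \<tau> p" using RT0_div_P0[OF \<tau>] by metis
  have Qf: "Q f \<in> P0 \<T>" using Q f by (simp add: bounded_projection_def)
  define r where "r x = - Q f x - p x" for x
  have r: "r \<in> P0 \<T>" using P0_lincomb[OF Qf p(1), of "-1" "-1"] by (simp add: r_def[abs_def])
  note \<sigma>s = H10g_sqi(2)[OF ob u(1)]
  obtain \<rho> where \<rho>: "\<rho> \<in> RT0 \<Omega> \<T>" "has_weak_div \<Omega> \<rho> r" "nrm M \<rho> \<le> K\<^sub>4 * dual_norm \<Omega> (emb \<Omega> r)"
    by (rule P0_lifting[OF r])
  let ?a = "nrm M (\<lambda>x. \<sigma> x - \<tau> x)"
  have "dual_norm \<Omega> (emb \<Omega> r) \<le> \<bar>CQ\<bar> * ?a"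
    unfolding r_def[abs_def] by (rule data_perturbation[OF Q f, OF p(1) \<sigma>s _ p(2)]) (rule u(2))
  from mult_left_mono[OF this K\<^sub>4_nonneg] have n\<rho>: "nrm M \<rho> \<le> K\<^sub>4 * \<bar>CQ\<bar> * ?a" using \<rho>(3) by (simp add: mult.assoc)
  note \<tau>s = RT0_sqi[OF \<tau>] and \<rho>s = RT0_sqi[OF \<rho>(1)] and \<sigma>hs = RT0_sqi[OF D(2)]
  define w where "w x = \<sigma>\<^sub>h x - \<tau> x" for x
  have w: "w \<in> RT0 \<Omega> \<T>" "has_weak_div \<Omega> w (\<lambda>x. - Q f x - p x)"
    using RT0_lincomb[OF D(2) \<tau>, of 1 "-1"] weak_div_lincomb[OF D(3) p(2), of 1 "-1"] by (simp_all add: w_def[abs_def])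
  define z where "z x = w x - \<rho> x" for x
  have z: "z \<in> RT0 \<Omega> \<T>" "has_weak_div \<Omega> z (\<lambda>x. 0)"
    using RT0_lincomb[OF w(1) \<rho>(1), of 1 "-1"] weak_div_lincomb[OF w(2) \<rho>(2), of 1 "-1"]
    by (simp_all add: z_def[abs_def] r_def)
  note zs = RT0_sqi[OF z(1)] and ws = RT0_sqi[OF w(1)]
  have h0: "ip M \<sigma>\<^sub>h z = 0" using D(4)[OF z] by (simp add: ip_def)
  have s0: "ip M \<sigma> z = 0" using H10g_weak_div[OF ob u(1) z(2)] unfolding ip_commute[of M \<sigma>] by (simp add: ip_def)
  have ds: "sqi M (\<lambda>x. \<sigma> x - \<tau> x)" by (rule sqi_diff[OF \<sigma>s \<tau>s])
  have "ip M z z = ip M w z - ip M \<rho> z" using ip_diff_left[OF ws \<rho>s zs] by (simp add: z_def[abs_def])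
  also have "ip M w z = ip M \<sigma>\<^sub>h z - ip M \<tau> z" using ip_diff_left[OF \<sigma>hs \<tau>s zs] by (simp add: w_def[abs_def])
  also have "\<dots> = ip M (\<lambda>x. \<sigma> x - \<tau> x) z" using ip_diff_left[OF \<sigma>s \<tau>s zs] h0 s0 by simp
  finally have "ip M z z \<le> \<bar>ip M (\<lambda>x. \<sigma> x - \<tau> x) z\<bar> + \<bar>ip M \<rho> z\<bar>" by linarith
  also have "\<dots> \<le> ?a * nrm M z + nrm M \<rho> * nrm M z" by (intro add_mono ip_cauchy_schwarz ds zs \<rho>s)
  finally have "nrm M z * nrm M z \<le> (?a + nrm M \<rho>) * nrm M z"
    using nrm_power2[of M z] by (simp add: power2_eq_square distrib_right)
  then have nz: "nrm M z \<le> ?a + nrm M \<rho>"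
    using nrm_nonneg[of M z] by (cases "nrm M z = 0") (auto simp: mult_le_cancel_right)
  have "nrm M (\<lambda>x. \<sigma> x - \<sigma>\<^sub>h x) \<le> ?a + nrm M (\<lambda>x. \<tau> x - \<sigma>\<^sub>h x)" by (rule nrm_triangle_diff[OF \<sigma>s \<tau>s \<sigma>hs])
  also have "nrm M (\<lambda>x. \<tau> x - \<sigma>\<^sub>h x) = nrm M (\<lambda>x. z x + \<rho> x)"
    unfolding nrm_minus[of M \<tau>] by (simp add: z_def w_def)
  also have "\<dots> \<le> nrm M z + nrm M \<rho>" by (rule nrm_triangle[OF zs \<rho>s])
  finally show ?thesis using nz n\<rho> by (simp add: algebra_simps)
qed

text \<open>For \<open>e = v - u\<^sub>h\<close> and its lifting \<rho>, testing the continuous and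
  the discrete relation with \<rho> gives \<open>ip M e e\<close> as minus the pairings of
  \<open>u - v\<close> with \<open>e\<close> and of \<open>\<sigma> - \<sigma>\<^sub>h\<close> with
  \<rho>. As \<rho> is bounded by a multiple of \<open>nrm M e\<close>, one factor
  \<open>nrm M e\<close> cancels.\<close>

lemma potential_estimate:
  assumes u: "H10g \<Omega> u \<sigma>" and R: "\<Omega> \<subseteq> cball 0 R"
    and s: "mixed_pair g u\<^sub>h \<sigma>\<^sub>h" and v: "v \<in> P0 \<T>"
  shows "nrm M (\<lambda>x. u x - u\<^sub>h x) \<le> 2 * nrm M (\<lambda>x. u x - v x) + 2 * R * K\<^sub>4 * nrm M (\<lambda>x. \<sigma> x - \<sigma>\<^sub>h x)"
proof -
  note ob = domain
  note D = mixed_pairD[OF s]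
  define e where "e x = v x - u\<^sub>h x" for x
  have e: "e \<in> P0 \<T>" using P0_lincomb[OF v D(1), of 1 "-1"] by (simp add: e_def[abs_def])
  note us = H10g_sqi(1)[OF ob u] and \<sigma>s = H10g_sqi(2)[OF ob u]
    and uhs = P0_sqi[OF D(1)] and \<sigma>hs = RT0_sqi[OF D(2)] and vs = P0_sqi[OF v] and es = P0_sqi[OF e]
  obtain \<rho> where \<rho>: "\<rho> \<in> RT0 \<Omega> \<T>" "has_weak_div \<Omega> \<rho> e" "nrm M \<rho> \<le> K\<^sub>4 * dual_norm \<Omega> (emb \<Omega> e)"
    by (rule P0_lifting[OF e])
  note \<rho>s = RT0_sqi[OF \<rho>(1)]
  let ?b = "nrm M (\<lambda>x. u x - v x)" and ?s = "nrm M (\<lambda>x. \<sigma> x - \<sigma>\<^sub>h x)"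
  have R0: "0 \<le> R" 
  proof -
    obtain C where C: "C \<in> \<V>" using mesh_nonempty by blast
    have "cell C \<noteq> {}" using nsimplex.center_interior[OF simplices[OF C]] by blast
    then obtain x where "x \<in> \<Omega>" using interior_subset_domain[OF C] by blast
    then have "norm x \<le> R" using R by auto
    then show ?thesis using norm_ge_zero[of x] by linarith
  qed
  have "dual_norm \<Omega> (emb \<Omega> e) \<le> 2 * R * nrm M e"
  proof (rule dual_norm_le[OF ob])
    fix w assume "w \<in> H10 \<Omega>"
    then obtain g' where g': "H10g \<Omega> w g'" unfolding H10_iff ..
    have "\<bar>emb \<Omega> e w\<bar> \<le> nrm M e * nrm M w"
      unfolding emb_eq[OF domain_measurable(1)] by (rule ip_cauchy_schwarz[OF es H10g_sqi(1)[OF ob g']])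
    also have "\<dots> \<le> nrm M e * (2 * R * nrm M g')" by (intro mult_left_mono H10g_friedrichs[OF ob g' R]) simp
    finally show "\<bar>emb \<Omega> e w\<bar> \<le> 2 * R * nrm M e * H1norm \<Omega> w"
      unfolding H1norm_eq[OF ob H10g_weak_grad[OF ob g']] by (simp only: mult_ac)
  qed (simp add: R0)
  from mult_left_mono[OF this K\<^sub>4_nonneg] have n\<rho>: "nrm M \<rho> \<le> 2 * R * K\<^sub>4 * nrm M e" using \<rho>(3) by (simp add: mult_ac)
  have 1: "ip M \<sigma>\<^sub>h \<rho> + ip M u\<^sub>h e = 0" by (rule D(4)[OF \<rho>(1,2)])
  have 2: "ip M \<sigma> \<rho> = - ip M u e"
    using H10g_weak_div[OF ob u \<rho>(2)] unfolding ip_commute[of M \<sigma>] ip_commute[of M u] .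
  have "ip M e e = ip M v e - ip M u\<^sub>h e" using ip_diff_left[OF vs uhs es] by (simp add: e_def[abs_def])
  also have "\<dots> = - ip M (\<lambda>x. u x - v x) e - ip M (\<lambda>x. \<sigma> x - \<sigma>\<^sub>h x) \<rho>"
    unfolding ip_diff_left[OF us vs es] ip_diff_left[OF \<sigma>s \<sigma>hs \<rho>s] using 1 2 by simp
  finally have "ip M e e \<le> \<bar>ip M (\<lambda>x. u x - v x) e\<bar> + \<bar>ip M (\<lambda>x. \<sigma> x - \<sigma>\<^sub>h x) \<rho>\<bar>" by linarith
  also have "\<dots> \<le> ?b * nrm M e + ?s * nrm M \<rho>"
    by (intro add_mono ip_cauchy_schwarz sqi_diff us vs es \<sigma>s \<sigma>hs \<rho>s)
  also have "\<dots> \<le> ?b * nrm M e + ?s * (2 * R * K\<^sub>4 * nrm M e)"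
    by (intro add_left_mono mult_left_mono n\<rho>) simp
  finally have "nrm M e * nrm M e \<le> (?b + 2 * R * K\<^sub>4 * ?s) * nrm M e"
    using nrm_power2[of M e] by (simp add: power2_eq_square algebra_simps)
  moreover have "0 \<le> ?b + 2 * R * K\<^sub>4 * ?s" using R0 K\<^sub>4_nonneg by simp
  ultimately have ne: "nrm M e \<le> ?b + 2 * R * K\<^sub>4 * ?s"
    using nrm_nonneg[of M e] by (cases "nrm M e = 0") (auto simp: mult_le_cancel_right)
  have "nrm M (\<lambda>x. u x - u\<^sub>h x) \<le> ?b + nrm M e"
    using nrm_triangle_diff[OF us vs uhs] by (simp add: e_def[abs_def])
  then show ?thesis using ne by simp
qed

lemma quasi_optimality:
  assumes Q: "bounded_projection \<Omega> \<T> CQ Q" and f: "f \<in> Hm1 \<Omega>"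
    and u: "weak_solution \<Omega> f u" "has_weak_grad \<Omega> u \<sigma>" and R: "\<Omega> \<subseteq> cball 0 R" "0 \<le> R"
  shows "\<exists>u\<^sub>h \<sigma>\<^sub>h. mixed_fem_solution \<Omega> \<T> Q f u\<^sub>h \<sigma>\<^sub>h \<and>
     (\<forall>u' \<sigma>'. mixed_fem_solution \<Omega> \<T> Q f u' \<sigma>' \<longrightarrow> ae_eq \<Omega> u' u\<^sub>h \<and> ae_eq \<Omega> \<sigma>' \<sigma>\<^sub>h) \<and>
     (\<forall>v\<in>P0 \<T>. \<forall>\<tau>\<in>RT0 \<Omega> \<T>.
        L2norm \<Omega> (\<lambda>x. u x - u\<^sub>h x) + L2normv \<Omega> (\<lambda>x. \<sigma> x - \<sigma>\<^sub>h x)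
          \<le> (2 + (1 + 2 * R * K\<^sub>4) * (2 + 2 * K\<^sub>4 * \<bar>CQ\<bar>)) * (L2norm \<Omega> (\<lambda>x. u x - v x) + L2normv \<Omega> (\<lambda>x. \<sigma> x - \<tau> x)))"
proof -
  note S = domain_measurable(1) and H = weak_solution_H10g[OF domain u]
  have Qf: "Q f \<in> P0 \<T>" using Q f by (simp add: bounded_projection_def)
  note iff = mixed_fem_solution_iff[of Q f, OF Qf]
  have "(\<lambda>x. - Q f x) \<in> P0 \<T>" using P0_lincomb[OF Qf Qf, of "-1" 0] by simp
  then obtain u\<^sub>h \<sigma>\<^sub>h where s: "mixed_pair (\<lambda>x. - Q f x) u\<^sub>h \<sigma>\<^sub>h" by (rule mixed_pair_exists)
  have "L2norm \<Omega> (\<lambda>x. u x - u\<^sub>h x) + L2normv \<Omega> (\<lambda>x. \<sigma> x - \<sigma>\<^sub>h x)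
          \<le> (2 + (1 + 2 * R * K\<^sub>4) * (2 + 2 * K\<^sub>4 * \<bar>CQ\<bar>)) * (L2norm \<Omega> (\<lambda>x. u x - v x) + L2normv \<Omega> (\<lambda>x. \<sigma> x - \<tau> x))"
    if v: "v \<in> P0 \<T>" and \<tau>: "\<tau> \<in> RT0 \<Omega> \<T>" for v \<tau>
  proof -
    let ?a = "nrm M (\<lambda>x. \<sigma> x - \<tau> x)" and ?b = "nrm M (\<lambda>x. u x - v x)" and ?s = "nrm M (\<lambda>x. \<sigma> x - \<sigma>\<^sub>h x)"
    let ?c = "2 + 2 * K\<^sub>4 * \<bar>CQ\<bar>" and ?d = "1 + 2 * R * K\<^sub>4"
    have sa: "?s \<le> ?c * ?a" by (rule flux_estimate[OF Q f, OF H(1), OF _ s \<tau>]) (rule H(2))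
    have d0: "0 \<le> ?d" "0 \<le> ?c" using R(2) K\<^sub>4_nonneg by simp_all
    have "nrm M (\<lambda>x. u x - u\<^sub>h x) + ?s \<le> 2 * ?b + ?d * ?s"
      using potential_estimate[OF H(1) R(1) s v] by (simp add: algebra_simps)
    also have "\<dots> \<le> 2 * ?b + ?d * (?c * ?a)" by (intro add_left_mono mult_left_mono sa d0)
    \<comment> \<open>Both coefficients are enlarged to the common value
      \<open>2 + ?d * ?c\<close>.\<close>
    also have "\<dots> \<le> (2 + ?d * ?c) * ?b + (2 + ?d * ?c) * ?a"
      using d0 by (intro add_mono) (simp_all add: mult_right_mono mult.assoc[symmetric])
    finally show ?thesis unfolding L2norm_eq[OF S] L2normv_eq[OF S] by (simp only: distrib_left)
  qed
  moreover have "ae_eq \<Omega> u' u\<^sub>h \<and> ae_eq \<Omega> \<sigma>' \<sigma>\<^sub>h" if "mixed_pair (\<lambda>x. - Q f x) u' \<sigma>'" for u' \<sigma>'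
    unfolding ae_eq_iff[OF S] using mixed_pair_unique[OF that s] by blast
  ultimately show ?thesis unfolding iff using s by blast
qed

end

text \<open>Around a frontier point interior to the closure there would be points of the closure
  strictly above the graph; but the points above the graph form an open set disjoint from
  \<Omega>.\<close>

lemma lipschitz_domain_regular:
  assumes "lipschitz_domain \<Omega>"
  shows "interior (closure \<Omega>) = \<Omega>"
proof
  have op: "open \<Omega>" using assms by (simp add: lipschitz_domain_def)
  show "\<Omega> \<subseteq> interior (closure \<Omega>)" by (rule interior_maximal[OF closure_subset op])
  show "interior (closure \<Omega>) \<subseteq> \<Omega>"
  proof
    fix x assume x: "x \<in> interior (closure \<Omega>)"
    show "x \<in> \<Omega>"
    proof (rule ccontr)
      assume nx: "x \<notin> \<Omega>"
      have "x \<in> frontier \<Omega>" using x nx interior_subset by (auto simp: frontier_def interior_open[OF op])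
      then obtain r e h L where r: "r > 0" and e: "norm e = 1" and h: "L-lipschitz_on UNIV h"
        and \<Omega>: "\<forall>y\<in>ball x r. y \<in> \<Omega> \<longleftrightarrow> y \<bullet> e < h (y - (y \<bullet> e) *\<^sub>R e)"
        using assms unfolding lipschitz_domain_def by blast
      have ee: "e \<bullet> e = 1" using e by (simp add: norm_eq_1)
      have "h (x - (x \<bullet> e) *\<^sub>R e) \<le> x \<bullet> e" using \<Omega> nx r by force
      define U where "U = ball x r \<inter> {y. h (y - (y \<bullet> e) *\<^sub>R e) < y \<bullet> e}"
      have "continuous_on UNIV (\<lambda>y. h (y - (y \<bullet> e) *\<^sub>R e))"
        by (rule continuous_on_compose2[OF lipschitz_on_continuous_on[OF h]]) (auto intro!: continuous_intros)
      then have "open U" unfolding U_def by (intro open_Int open_ball open_Collect_less continuous_intros)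
      moreover have "U \<inter> \<Omega> = {}" using \<Omega> by (force simp: U_def)
      ultimately have dj: "U \<inter> closure \<Omega> = {}" by (simp add: open_Int_closure_eq_empty)
      obtain s where s: "s > 0" "ball x s \<subseteq> closure \<Omega>"
        using x by (meson mem_interior)
      define t where "t = min r s / 2"
      have t: "0 < t" "t < r" "t < s" using r s(1) by (auto simp: t_def)
      define y where "y = x + t *\<^sub>R e"
      have d: "dist x y = t" using e t(1) by (simp add: y_def dist_norm)
      have "y \<bullet> e = x \<bullet> e + t" by (simp add: y_def inner_add_left ee)
      moreover from this have "y - (y \<bullet> e) *\<^sub>R e = x - (x \<bullet> e) *\<^sub>R e" by (simp add: y_def scaleR_add_left)
      ultimately have "y \<in> U" using \<open>h (x - (x \<bullet> e) *\<^sub>R e) \<le> x \<bullet> e\<close> d t by (simp add: U_def)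
      moreover have "y \<in> closure \<Omega>" using s(2) d t by auto
      ultimately show False using dj by blast
    qed
  qed
qed

section \<open>From simplicial meshes to vertex sets, and the theorem\<close>

lemma affine_independent_hull_inj:
  fixes C C' :: "'a::euclidean_space set"
  assumes "\<not> affine_dependent C" "\<not> affine_dependent C'" "convex hull C = convex hull C'"
  shows "C = C'"
proof (rule set_eqI)
  fix x
  show "x \<in> C \<longleftrightarrow> x \<in> C'"
    unfolding extreme_point_of_convex_hull_affine_independent[OF assms(1), symmetric]
      extreme_point_of_convex_hull_affine_independent[OF assms(2), symmetric] assms(3) ..
qed

text \<open>Vertices are the extreme points, so a simplex determines its vertex set. The
  intersection of two simplices is a face of each, spanned by a subset of either vertex set; the two
  subsets coincide and hence lie in the common vertices.\<close>

lemma simplicial_mesh_vertices: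
  fixes \<Omega> :: "'a::euclidean_space set"
  assumes m: "simplicial_mesh \<Omega> \<T>" and \<Omega>: "lipschitz_domain \<Omega>"
  obtains \<V> where "mesh \<Omega> \<V>" "\<T> = (\<lambda>C. convex hull C) ` \<V>"
proof -
  define \<V> where "\<V> = {C. \<not> affine_dependent C \<and> card C = DIM('a) + 1 \<and> convex hull C \<in> \<T>}"
  have \<T>: "\<T> = (\<lambda>C. convex hull C) ` \<V>"
  proof
    show "(\<lambda>C. convex hull C) ` \<V> \<subseteq> \<T>" by (auto simp: \<V>_def)
    show "\<T> \<subseteq> (\<lambda>C. convex hull C) ` \<V>"
    proof
      fix K assume K: "K \<in> \<T>"
      then have "int DIM('a) simplex K" using m by (simp add: simplicial_mesh_def)
      then obtain C where "\<not> affine_dependent C" "int (card C) = int DIM('a) + 1" "K = convex hull C"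
        unfolding simplex_def by blast
      then show "K \<in> (\<lambda>C. convex hull C) ` \<V>" using K by (auto simp: \<V>_def image_iff)
    qed
  qed
  have "inj_on (\<lambda>C. convex hull C) \<V>"
    by (rule inj_onI, rule affine_independent_hull_inj) (simp_all add: \<V>_def)
  moreover have "finite \<T>" using m by (simp add: simplicial_mesh_def)
  ultimately have fin: "finite \<V>" unfolding \<T> by (simp add: finite_image_iff)
  have "mesh \<Omega> \<V>"
  proof (rule mesh.intro)
    show "finite \<V>" by (rule fin)
    show "nsimplex C" if "C \<in> \<V>" for C
      by (rule nsimplex.intro) (use that in \<open>simp_all add: \<V>_def\<close>)
    show "convex hull C \<inter> convex hull C' = convex hull (C \<inter> C')" if C: "C \<in> \<V>" "C' \<in> \<V>" for C C'
    proof
      have ind: "\<not> affine_dependent C" "\<not> affine_dependent C'" using C by (auto simp: \<V>_def)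
      have "(convex hull C \<inter> convex hull C') face_of convex hull C" "(convex hull C \<inter> convex hull C') face_of convex hull C'"
        using m C by (auto simp: simplicial_mesh_def \<V>_def)
      then obtain c c' where c: "c \<subseteq> C" "convex hull C \<inter> convex hull C' = convex hull c"
        and c': "c' \<subseteq> C'" "convex hull C \<inter> convex hull C' = convex hull c'"
        unfolding face_of_convex_hull_affine_independent[OF ind(1)] face_of_convex_hull_affine_independent[OF ind(2)]
        by blast
      have "c = c'"
        by (rule affine_independent_hull_inj)
          (use c c' affine_independent_subset[OF ind(1) c(1)] affine_independent_subset[OF ind(2) c'(1)] in simp_all)
      then show "convex hull C \<inter> convex hull C' \<subseteq> convex hull (C \<inter> C')"
        unfolding c(2) using c(1) c'(1) by (intro hull_mono) blast
      show "convex hull (C \<inter> C') \<subseteq> convex hull C \<inter> convex hull C'"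
        using hull_mono[of "C \<inter> C'" C convex] hull_mono[of "C \<inter> C'" C' convex] by blast
    qed
    show "(\<Union>C\<in>\<V>. convex hull C) = closure \<Omega>" using m \<T> by (simp add: simplicial_mesh_def)
    show "open \<Omega>" "bounded \<Omega>" using \<Omega> by (simp_all add: lipschitz_domain_def)
    show "interior (closure \<Omega>) = \<Omega>" by (rule lipschitz_domain_regular[OF \<Omega>])
  qed
  then show ?thesis using \<T> by (rule that)
qed

lemma shape_const_shape_regular:
  assumes "mesh \<Omega> \<V>" "C \<in> \<V>" "shape_const ((\<lambda>C. convex hull C) ` \<V>) \<le> \<kappa>"
  shows "shape_regular \<kappa> C"
proof -
  interpret mesh \<Omega> \<V> by (rule assms(1))
  interpret nsimplex C by (rule simplices[OF assms(2)])
  have "diam C ^ DIM('a) / vol C \<le> shape_const ((\<lambda>C. convex hull C) ` \<V>)"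
    unfolding shape_const_def by (rule Max_ge) (use assms(2) finite_mesh in auto)
  then have "diam C ^ DIM('a) / vol C \<le> \<kappa>" using assms(3) by linarith
  then show ?thesis using measure_hull_pos by (simp add: shape_regular_def divide_le_eq)
qed

theorem mainTheorem2:
  fixes \<Omega> :: "'a::euclidean_space set" and CQ \<kappa> :: real
  assumes "DIM('a) = 2 \<or> DIM('a) = 3"
    and "lipschitz_domain \<Omega>" and "polytopal \<Omega>"
  shows "\<exists>C. \<forall>(\<T>::'a set set) Q f u \<sigma>.
     simplicial_mesh \<Omega> \<T> \<and> shape_const \<T> \<le> \<kappa> \<and> bounded_projection \<Omega> \<T> CQ Q \<and>
     f \<in> Hm1 \<Omega> \<and> weak_solution \<Omega> f u \<and> has_weak_grad \<Omega> u \<sigma> \<longrightarrow>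
     (\<exists>uT \<sigma>T. mixed_fem_solution \<Omega> \<T> Q f uT \<sigma>T \<and>
        (\<forall>uT' \<sigma>T'. mixed_fem_solution \<Omega> \<T> Q f uT' \<sigma>T' \<longrightarrow> ae_eq \<Omega> uT' uT \<and> ae_eq \<Omega> \<sigma>T' \<sigma>T) \<and>
        (\<forall>v\<in>P0 \<T>. \<forall>\<tau>\<in>RT0 \<Omega> \<T>.
           L2norm \<Omega> (\<lambda>x. u x - uT x) + L2normv \<Omega> (\<lambda>x. \<sigma> x - \<sigma>T x)
             \<le> C * (L2norm \<Omega> (\<lambda>x. u x - v x) + L2normv \<Omega> (\<lambda>x. \<sigma> x - \<tau> x))))"
proof -
  have "bounded \<Omega>" "\<Omega> \<noteq> {}" using assms(2) by (simp_all add: lipschitz_domain_def)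
  obtain R where R: "0 < R" "\<forall>x\<in>\<Omega>. norm x \<le> R" using \<open>bounded \<Omega>\<close> unfolding bounded_pos by blast
  then have R': "\<Omega> \<subseteq> cball 0 R" "0 \<le> R" by auto
  obtain B where B: "0 \<le> B" "\<forall>C::'a set. nsimplex C \<and> shape_regular \<kappa> C \<longrightarrow>
     (\<exists>b. test_fun (cell C) b \<and> (\<integral>x. b x \<partial>lborel) = vol C \<and> (\<forall>x. norm (grad b x) \<le> B / diam C))"
    using bubble_exists[of \<kappa>] by (elim exE conjE) (rule that)
  \<comment> \<open>Depends only on the dimension, \<kappa> and \<open>B\<close>, and
    \<open>B\<close> only on \<kappa> and the dimension, while \<open>R\<close> depends on \<Omega>;
    so the factor is fixed before the mesh.\<close>
  let ?K = "regular_mesh.K\<^sub>4 TYPE('a) \<kappa> B"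
  have reg: "regular_mesh \<Omega> \<V> \<kappa> B"
    if \<V>: "mesh \<Omega> \<V>" and \<kappa>: "shape_const ((\<lambda>C. convex hull C) ` \<V>) \<le> \<kappa>" for \<V>
  proof -
    interpret mesh \<Omega> \<V> by (rule \<V>)
    have sr: "shape_regular \<kappa> C" if "C \<in> \<V>" for C by (rule shape_const_shape_regular[OF \<V> that \<kappa>])
    show ?thesis
    proof
      show "2 \<le> DIM('a)" using assms(1) by auto
      show "\<V> \<noteq> {}" using cover \<open>\<Omega> \<noteq> {}\<close> closure_subset[of \<Omega>] by auto
      show "\<exists>b. test_fun (cell C) b \<and> (\<integral>x. b x \<partial>lborel) = vol C \<and> (\<forall>x. norm (grad b x) \<le> B / diam C)"
        if C: "C \<in> \<V>" for C
        using B(2) simplices[OF C] sr[OF C] by blast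
    qed (rule sr B(1), assumption?)+
  qed
  show ?thesis
  proof (intro exI[of _ "2 + (1 + 2 * R * ?K) * (2 + 2 * ?K * \<bar>CQ\<bar>)"] allI impI, elim conjE)
    fix \<T> :: "'a set set" and Q f u \<sigma>
    assume \<T>: "simplicial_mesh \<Omega> \<T>" "shape_const \<T> \<le> \<kappa>" and Q: "bounded_projection \<Omega> \<T> CQ Q"
      and f: "f \<in> Hm1 \<Omega>" and u: "weak_solution \<Omega> f u" "has_weak_grad \<Omega> u \<sigma>"
    obtain \<V> where \<V>: "mesh \<Omega> \<V>" "\<T> = (\<lambda>C. convex hull C) ` \<V>" by (rule simplicial_mesh_vertices[OF \<T>(1) assms(2)])
    note rm = reg[OF \<V>(1) \<T>(2)[unfolded \<V>(2)]]
    from regular_mesh.quasi_optimality[OF rm, OF Q[unfolded \<V>(2)] f u R']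
    show "\<exists>uT \<sigma>T. mixed_fem_solution \<Omega> \<T> Q f uT \<sigma>T \<and>
        (\<forall>uT' \<sigma>T'. mixed_fem_solution \<Omega> \<T> Q f uT' \<sigma>T' \<longrightarrow> ae_eq \<Omega> uT' uT \<and> ae_eq \<Omega> \<sigma>T' \<sigma>T) \<and>
        (\<forall>v\<in>P0 \<T>. \<forall>\<tau>\<in>RT0 \<Omega> \<T>.
           L2norm \<Omega> (\<lambda>x. u x - uT x) + L2normv \<Omega> (\<lambda>x. \<sigma> x - \<sigma>T x)
             \<le> (2 + (1 + 2 * R * ?K) * (2 + 2 * ?K * \<bar>CQ\<bar>)) *
               (L2norm \<Omega> (\<lambda>x. u x - v x) + L2normv \<Omega> (\<lambda>x. \<sigma> x - \<tau> x)))"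
      unfolding \<V>(2)[symmetric] .
  qed
qed

end
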